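(* Let $A$ be a nonnegative partially fundamentally reducible operator in a Kreĭn space $(\mathcal K,[\cdot,\cdot])$ with associated symmetric operators $S_+$ and $S_-$. Let $(\mathbb C,\Gamma_0^+,\Gamma_1^+)$ be a boundary triple for $S_+^*$, let $(\mathbb C,\Gamma_0^-,\Gamma_1^-)$ be the boundary triple for $S_-^*$ induced by $A$, and let $m_\pm$ be the Weyl function of $S_\pm$ relative to $(\mathbb C,\Gamma_0^\pm,\Gamma_1^\pm)$. Assume that $m_+$ and $m_-$ both have $B_0$-property. Then $0\notin c_s(A)$ if and only if $\ker(A)=\ker(A^2)$ and the pair $(m_+,m_-)$ has $D_0$-property.
   Context: **Kreĭn spaces.** A Kreĭn space $(\mathcal K,[\cdot,\cdot])$ is a complex vector space with a sesquilinear form for which there is a fundamental decomposition: a direct sum $\mathcal K=\mathcal K_+\dot+\mathcal K_-$ with $[\mathcal K_+,\mathcal K_-]=\{0\}$ such that $(\mathcal K_+,[\cdot,\cdot])$ and $(\mathcal K_-,-[\cdot,\cdot])$ are Hilbert spaces. $P_\pm$ are the corresponding projections, $J=P_+-P_-$ is the fundamental symmetry, and $\langle x,y\rangle=[Jx,y]$ is a Hilbert space inner product; topological notions refer to it (different decompositions give equivalent norms). A densely defined $A$ is self-adjoint in $(\mathcal K,[\cdot,\cdot])$ if $A=A^{[*]}$, the adjoint with respect to $[\cdot,\cdot]$, and nonnegative if $[Af,f]\ge0$ for all $f\in\operatorname{dom}(A)$. All operators are closed and densely defined. **Partially fundamentally reducible.** A self-adjoint operator $A$ in a Kreĭn space is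 partially fundamentally reducible if there is a fundamental decomposition $\mathcal K=\mathcal K_+\dot+\mathcal K_-$ such that $\mathcal D_\pm=\{f\in\mathcal K_\pm\cap\operatorname{dom}A:\ Af\in\mathcal K_\pm\}$ is dense in $\mathcal K_\pm$ and $S_+=A|_{\mathcal D_+}$, $S_-=-A|_{\mathcal D_-}$ are symmetric operators with defect numbers $(1,1)$ in the Hilbert spaces $(\mathcal K_+,[\cdot,\cdot])$, $(\mathcal K_-,-[\cdot,\cdot])$. This decomposition is fixed; $S_\pm^*$ is the adjoint in the Hilbert space $(\mathcal K_\pm,\pm[\cdot,\cdot])$. **Boundary triples, Weyl functions.** For a closed densely defined symmetric operator $S$ with defect numbers $(1,1)$ in a Hilbert space, a boundary triple $(\mathbb C,\Gamma_0,\Gamma_1)$ for $S^*$ consists of nonzero linear functionals $\Gamma_0,\Gamma_1:\operatorname{dom}(S^* )\to\mathbb C$ with $\ker\Gamma_0\cap\ker\Gamma_1=\operatorname{dom}(S)$ and $\langle S^*f,g\rangle-\langle f,S^*g\rangle=\Gamma_0(g)^*\Gamma_1(f)-\Gamma_1(g)^*\Gamma_0(f)$ for all $f,g\in\operatorname{dom}(S^* )$ ($z^*$ is the complex conjugate of $z$). For $z\in\mathbb C\setminus\mathbb R$ the Weyl solution $\psi(z)$ is the unique element of $\ker(S^*-z)$ with $\Gamma_0\psi(z)=1$, and the Weyl function is $m(z)=\Gamma_1\psi(z)$; it is a Nevanlinna function. **Triple induced by $A$.** Given a boundary triple $(\mathbb C,\Gamma_0^+,\Gamma_1^+)$ for $S_+^*$,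 one has $\operatorname{dom}(S_\pm^* )=P_\pm\operatorname{dom}(A)$, and the equalities $\Gamma_0^-P_-f=\Gamma_0^+P_+f$, $\Gamma_1^-P_-f=-\Gamma_1^+P_+f$ $(f\in\operatorname{dom}A)$ define a boundary triple $(\mathbb C,\Gamma_0^-,\Gamma_1^-)$ for $S_-^*$. **Singular critical points.** A nonnegative partially fundamentally reducible $A$ has nonempty resolvent set. A nonnegative self-adjoint $A$ in a Kreĭn space with $\rho(A)\ne\emptyset$ has real spectrum and a spectral function $E$ defined on the ring $\mathcal I$ of finite unions of bounded intervals with nonzero real endpoints and their complements in $\overline{\mathbb R}=\mathbb R\cup\{\infty\}$, with values bounded operators such that: $E(\emptyset)=0$, $E(\overline{\mathbb R})=I$; $E(\Delta)=E(\Delta)^{[*]}$; $E(\Delta_1\cap\Delta_2)=E(\Delta_1)E(\Delta_2)$; $E(\Delta_1\cup\Delta_2)=E(\Delta_1)+E(\Delta_2)$ for disjoint sets; $(E(\Delta)\mathcal K,\pm[\cdot,\cdot])$ is a Hilbert space if $\Delta\subset\mathbb R_\pm$; $E(\Delta)$ is in the double commutant of the resolvent of $A$; for bounded $\Delta$, $E(\Delta)\mathcal K\subseteq\operatorname{dom}A$ and $A|_{E(\Delta)\mathcal K}$ is bounded with spectrum in $\overline\Delta$. The point $0$ (respectively $\infty$) is a critical point of $A$ if $[\cdot,\cdot]$ is indefinite on $E(\Delta)\mathcal K$ for every $\Delta\in\mathcal I$ containing it. The critical point $0$ is regular if $\lim_{t\uparrow0}E([\lambda_1,t])$ and $\lim_{t\downarrow0}E([t,\lambda_2])$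 (with $\lambda_1<0<\lambda_2$) exist strongly; $\infty$ is regular if $\lim_{t\uparrow+\infty}E([\lambda_1,t])$ and $\lim_{t\downarrow-\infty}E([t,\lambda_2])$ exist strongly for some $\lambda_1,\lambda_2\in\mathbb R\setminus\{0\}$. A critical point that is not regular is singular; $c_s(A)\subseteq\{0,\infty\}$ is the set of singular critical points. **Nevanlinna functions, $B_0$-property.** A Nevanlinna function $m$ is holomorphic at least on $\mathbb C\setminus\mathbb R$, with $m(z^* )=m(z)^*$ and $\operatorname{Im}m(z)\ge0$ for $\operatorname{Im}z>0$. $\mathcal H(m)$ is the reproducing kernel Hilbert space of holomorphic functions on $\mathbb C\setminus\mathbb R$ with kernel $K_m(z,w)=\frac{m(z)-m(w)^*}{z-w^*}$ ($z\ne w^*$; extended by continuity). With $w_m(y)=1/\operatorname{Im}m(iy)$, $y>0$, $m$ has $B_0$-property if $h\mapsto\big(y\mapsto h(iy)\big)$ is a bounded operator from $\mathcal H(m)$ into the weighted space $L^2_{w_m}(0,1)$. **$D_0$-property.** A pair $(m_+,m_-)$ of Nevanlinna functions has $D_0$-property if the function $y\mapsto\dfrac{\operatorname{Im}m_+(iy)+\operatorname{Im}m_-(iy)}{|m_+(iy)+m_-(-iy)|}$ is (defined and) bounded on $(0,1)$. *)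

theory Defs
  imports "HOL-Analysis.Analysis" "HOL-Library.Function_Algebras"
begin

section \<open>Complex vector spaces\<close>

class complex_vector = ab_group_add +
  fixes scaleC :: "complex \<Rightarrow> 'a \<Rightarrow> 'a"  (infixr \<open>*\<^sub>C\<close> 75)
  assumes scaleC_add_right: "a *\<^sub>C (x + y) = a *\<^sub>C x + a *\<^sub>C y"
    and scaleC_add_left: "(a + b) *\<^sub>C x = a *\<^sub>C x + b *\<^sub>C x"
    and scaleC_scaleC: "a *\<^sub>C b *\<^sub>C x = (a * b) *\<^sub>C x"
    and scaleC_one: "1 *\<^sub>C x = x"

global_interpretation complex_vector: vector_space "scaleC :: complex \<Rightarrow> 'a \<Rightarrow> 'a::complex_vector"
  defines cspan_raw_def: cspan = complex_vector.span
    and csubspace_raw_def: csubspace = complex_vector.subspace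
    and cdependent_raw_def: cdependent = complex_vector.dependent
    and cdim_raw_def: cdim = complex_vector.dim
  by unfold_locales (simp_all add: scaleC_add_right scaleC_add_left scaleC_scaleC scaleC_one)

instantiation complex :: complex_vector
begin
definition scaleC_complex_def: "a *\<^sub>C (x::complex) = a * x"
instance by standard (simp_all add: scaleC_complex_def algebra_simps)
end

instantiation "fun" :: (type, complex_vector) complex_vector
begin
definition scaleC_fun_def: "a *\<^sub>C f = (\<lambda>x. a *\<^sub>C f x)"
instance
  by standard
    (simp_all add: scaleC_fun_def fun_eq_iff scaleC_add_right scaleC_add_left scaleC_scaleC scaleC_one)
end

definition clinear_on :: "'a::complex_vector set \<Rightarrow> ('a \<Rightarrow> 'b::complex_vector) \<Rightarrow> bool" where
  "clinear_on H T \<longleftrightarrow>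
     (\<forall>x\<in>H. \<forall>y\<in>H. T (x + y) = T x + T y) \<and> (\<forall>c. \<forall>x\<in>H. T (c *\<^sub>C x) = c *\<^sub>C T x)"


section \<open>Hilbert and Krein spaces\<close>

text \<open>Sesquilinear forms are linear in the first argument. A Hilbert space is a subspace H of
  the ambient type together with a form on it; the values of the form off H do not matter.\<close>

definition hermitian_form_on :: "'a::complex_vector set \<Rightarrow> ('a \<Rightarrow> 'a \<Rightarrow> complex) \<Rightarrow> bool" where
  "hermitian_form_on H form \<longleftrightarrow>
     (\<forall>x\<in>H. \<forall>y\<in>H. \<forall>z\<in>H. form (x + y) z = form x z + form y z) \<and>
     (\<forall>c. \<forall>x\<in>H. \<forall>y\<in>H. form (c *\<^sub>C x) y = c * form x y) \<and>
     (\<forall>x\<in>H. \<forall>y\<in>H. form y x = cnj (form x y))"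

definition ip_norm :: "('a \<Rightarrow> 'a \<Rightarrow> complex) \<Rightarrow> 'a \<Rightarrow> real" where
  "ip_norm ip x = sqrt (Re (ip x x))"

definition hilbert_on :: "'a::complex_vector set \<Rightarrow> ('a \<Rightarrow> 'a \<Rightarrow> complex) \<Rightarrow> bool" where
  "hilbert_on H ip \<longleftrightarrow>
     csubspace H \<and> hermitian_form_on H ip \<and>
     (\<forall>x\<in>H. x \<noteq> 0 \<longrightarrow> 0 < Re (ip x x)) \<and>
     (\<forall>X::nat \<Rightarrow> 'a. range X \<subseteq> H \<longrightarrow>
        (\<forall>\<epsilon>>0. \<exists>N. \<forall>m\<ge>N. \<forall>n\<ge>N. ip_norm ip (X m - X n) < \<epsilon>) \<longrightarrow>
        (\<exists>l\<in>H. (\<lambda>n. ip_norm ip (X n - l)) \<longlonglongrightarrow> 0))"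

definition dense_in :: "('a::complex_vector \<Rightarrow> 'a \<Rightarrow> complex) \<Rightarrow> 'a set \<Rightarrow> 'a set \<Rightarrow> bool" where
  "dense_in ip D H \<longleftrightarrow> D \<subseteq> H \<and> (\<forall>x\<in>H. \<forall>\<epsilon>>0. \<exists>y\<in>D. ip_norm ip (x - y) < \<epsilon>)"

definition fundamental_decomposition ::
    "('a::complex_vector \<Rightarrow> 'a \<Rightarrow> complex) \<Rightarrow> 'a set \<Rightarrow> 'a set \<Rightarrow> bool" where
  "fundamental_decomposition form Kp Km \<longleftrightarrow>
     Kp \<inter> Km = {0} \<and> (\<forall>x. \<exists>p\<in>Kp. \<exists>q\<in>Km. x = p + q) \<and>
     (\<forall>x\<in>Kp. \<forall>y\<in>Km. form x y = 0) \<and>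
     hilbert_on Kp form \<and> hilbert_on Km (\<lambda>x y. - form x y)"

definition krein_space :: "('a::complex_vector \<Rightarrow> 'a \<Rightarrow> complex) \<Rightarrow> bool" where
  "krein_space form \<longleftrightarrow>
     hermitian_form_on UNIV form \<and> (\<exists>Kp Km. fundamental_decomposition form Kp Km)"

text \<open>The projection onto the first summand along the second one: P_+ is
  \<open>proj_along Kp Km\<close> and P_- is \<open>proj_along Km Kp\<close>.\<close>

definition proj_along :: "'a::complex_vector set \<Rightarrow> 'a set \<Rightarrow> 'a \<Rightarrow> 'a" where
  "proj_along M N x = (THE p. p \<in> M \<and> x - p \<in> N)"

definition fundamental_symmetry :: "'a::complex_vector set \<Rightarrow> 'a set \<Rightarrow> 'a \<Rightarrow> 'a" where
  "fundamental_symmetry Kp Km x = proj_along Kp Km x - proj_along Km Kp x"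

definition fundamental_ip ::
    "('a::complex_vector \<Rightarrow> 'a \<Rightarrow> complex) \<Rightarrow> 'a set \<Rightarrow> 'a set \<Rightarrow> 'a \<Rightarrow> 'a \<Rightarrow> complex" where
  "fundamental_ip form Kp Km x y = form (fundamental_symmetry Kp Km x) y"


section \<open>Unbounded operators\<close>

text \<open>An operator T in H is represented by its graph, so that dom(T) is \<open>Domain T\<close> and
  T^2 is \<open>T O T\<close>. In a Krein space, the parameter \<open>ip\<close> below is the Hilbert space inner product of
  a fundamental decomposition. It serves only to express topological notions,
  and all fundamental decompositions give equivalent norms.\<close>

definition operator_in :: "'a::complex_vector set \<Rightarrow> ('a \<times> 'a) set \<Rightarrow> bool" where
  "operator_in H T \<longleftrightarrow>
     T \<subseteq> H \<times> H \<and> single_valued T \<and> (0, 0) \<in> T \<and>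
     (\<forall>f f' g g'. (f, f') \<in> T \<longrightarrow> (g, g') \<in> T \<longrightarrow> (f + g, f' + g') \<in> T) \<and>
     (\<forall>c f f'. (f, f') \<in> T \<longrightarrow> (c *\<^sub>C f, c *\<^sub>C f') \<in> T)"

definition op_ker :: "('a::zero \<times> 'a) set \<Rightarrow> 'a set" where
  "op_ker T = {f. (f, 0) \<in> T}"

definition adjoint_in ::
    "'a set \<Rightarrow> ('a \<Rightarrow> 'a \<Rightarrow> complex) \<Rightarrow> ('a \<times> 'a) set \<Rightarrow> ('a \<times> 'a) set" where
  "adjoint_in H form T =
     {(g, g'). g \<in> H \<and> g' \<in> H \<and> (\<forall>(f, f') \<in> T. form f' g = form f g')}"

definition krein_selfadjoint ::
    "('a::complex_vector \<Rightarrow> 'a \<Rightarrow> complex) \<Rightarrow> ('a \<Rightarrow> 'a \<Rightarrow> complex) \<Rightarrow> ('a \<times> 'a) set \<Rightarrow> bool" where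
  "krein_selfadjoint form ip A \<longleftrightarrow>
     operator_in UNIV A \<and> dense_in ip (Domain A) UNIV \<and> A = adjoint_in UNIV form A"

definition krein_nonnegative ::
    "('a::complex_vector \<Rightarrow> 'a \<Rightarrow> complex) \<Rightarrow> ('a \<times> 'a) set \<Rightarrow> bool" where
  "krein_nonnegative form A \<longleftrightarrow> (\<forall>(f, f') \<in> A. form f' f \<in> \<real>\<^sub>\<ge>\<^sub>0)"

definition symmetric_in ::
    "'a::complex_vector set \<Rightarrow> ('a \<Rightarrow> 'a \<Rightarrow> complex) \<Rightarrow> ('a \<times> 'a) set \<Rightarrow> bool" where
  "symmetric_in H ip S \<longleftrightarrow>
     operator_in H S \<and> dense_in ip (Domain S) H \<and> S \<subseteq> adjoint_in H ip S"

definition eigenspace :: "('a::complex_vector \<times> 'a) set \<Rightarrow> complex \<Rightarrow> 'a set" where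
  "eigenspace T z = {f. (f, z *\<^sub>C f) \<in> T}"

text \<open>\<open>cdim\<close> is 0 on infinite-dimensional spaces, so \<open>cdim V = 1\<close> means exactly that
  V is one-dimensional.\<close>

definition defect_numbers_1_1 ::
    "'a::complex_vector set \<Rightarrow> ('a \<Rightarrow> 'a \<Rightarrow> complex) \<Rightarrow> ('a \<times> 'a) set \<Rightarrow> bool" where
  "defect_numbers_1_1 H ip S \<longleftrightarrow>
     cdim (eigenspace (adjoint_in H ip S) \<i>) = 1 \<and>
     cdim (eigenspace (adjoint_in H ip S) (- \<i>)) = 1"


section \<open>Partially fundamentally reducible operators\<close>

definition part_plus :: "'a set \<Rightarrow> ('a \<times> 'a) set \<Rightarrow> ('a \<times> 'a) set" where
  "part_plus Kp A = {(f, f'). (f, f') \<in> A \<and> f \<in> Kp \<and> f' \<in> Kp}"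

definition part_minus :: "'a::uminus set \<Rightarrow> ('a \<times> 'a) set \<Rightarrow> ('a \<times> 'a) set" where
  "part_minus Km A = {(f, - f') | f f'. (f, f') \<in> A \<and> f \<in> Km \<and> f' \<in> Km}"

definition partially_fundamentally_reducible ::
    "('a::complex_vector \<Rightarrow> 'a \<Rightarrow> complex) \<Rightarrow> 'a set \<Rightarrow> 'a set \<Rightarrow> ('a \<times> 'a) set \<Rightarrow> bool" where
  "partially_fundamentally_reducible form Kp Km A \<longleftrightarrow>
     fundamental_decomposition form Kp Km \<and>
     krein_selfadjoint form (fundamental_ip form Kp Km) A \<and>
     symmetric_in Kp form (part_plus Kp A) \<and>
     defect_numbers_1_1 Kp form (part_plus Kp A) \<and>
     symmetric_in Km (\<lambda>x y. - form x y) (part_minus Km A) \<and>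
     defect_numbers_1_1 Km (\<lambda>x y. - form x y) (part_minus Km A)"

definition adjoint_plus ::
    "('a \<Rightarrow> 'a \<Rightarrow> complex) \<Rightarrow> 'a set \<Rightarrow> ('a \<times> 'a) set \<Rightarrow> ('a \<times> 'a) set" where
  "adjoint_plus form Kp A = adjoint_in Kp form (part_plus Kp A)"

definition adjoint_minus ::
    "('a::uminus \<Rightarrow> 'a \<Rightarrow> complex) \<Rightarrow> 'a set \<Rightarrow> ('a \<times> 'a) set \<Rightarrow> ('a \<times> 'a) set" where
  "adjoint_minus form Km A = adjoint_in Km (\<lambda>x y. - form x y) (part_minus Km A)"


section \<open>Boundary triples and Weyl functions\<close>

definition boundary_triple ::
    "'a::complex_vector set \<Rightarrow> ('a \<Rightarrow> 'a \<Rightarrow> complex) \<Rightarrow> ('a \<times> 'a) set \<Rightarrow>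
     ('a \<Rightarrow> complex) \<Rightarrow> ('a \<Rightarrow> complex) \<Rightarrow> bool" where
  "boundary_triple H ip S \<Gamma>0 \<Gamma>1 \<longleftrightarrow>
     (let T = adjoint_in H ip S in
        clinear_on (Domain T) \<Gamma>0 \<and> (\<exists>f\<in>Domain T. \<Gamma>0 f \<noteq> 0) \<and>
        clinear_on (Domain T) \<Gamma>1 \<and> (\<exists>f\<in>Domain T. \<Gamma>1 f \<noteq> 0) \<and>
        {f \<in> Domain T. \<Gamma>0 f = 0 \<and> \<Gamma>1 f = 0} = Domain S \<and>
        (\<forall>(f, f') \<in> T. \<forall>(g, g') \<in> T.
           ip f' g - ip f g' = cnj (\<Gamma>0 g) * \<Gamma>1 f - cnj (\<Gamma>1 g) * \<Gamma>0 f))"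

text \<open>Since dom(S_-^*) = P_- dom(A), these equalities determine the induced functionals
  \<open>\<Gamma>0m\<close> and \<open>\<Gamma>1m\<close> on dom(S_-^*); no other values of them are ever used.\<close>

definition induced_triple ::
    "'a::complex_vector set \<Rightarrow> 'a set \<Rightarrow> ('a \<times> 'a) set \<Rightarrow> ('a \<Rightarrow> complex) \<Rightarrow> ('a \<Rightarrow> complex) \<Rightarrow>
     ('a \<Rightarrow> complex) \<Rightarrow> ('a \<Rightarrow> complex) \<Rightarrow> bool" where
  "induced_triple Kp Km A \<Gamma>0p \<Gamma>1p \<Gamma>0m \<Gamma>1m \<longleftrightarrow>
     (\<forall>f\<in>Domain A. \<Gamma>0m (proj_along Km Kp f) = \<Gamma>0p (proj_along Kp Km f) \<and>
                   \<Gamma>1m (proj_along Km Kp f) = - \<Gamma>1p (proj_along Kp Km f))"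

text \<open>Here T is the adjoint S^*. The Weyl function is meaningful at nonreal z only.\<close>

definition weyl_solution ::
    "('a::complex_vector \<times> 'a) set \<Rightarrow> ('a \<Rightarrow> complex) \<Rightarrow> complex \<Rightarrow> 'a" where
  "weyl_solution T \<Gamma>0 z = (THE \<psi>. \<psi> \<in> eigenspace T z \<and> \<Gamma>0 \<psi> = 1)"

definition weyl_function ::
    "('a::complex_vector \<times> 'a) set \<Rightarrow> ('a \<Rightarrow> complex) \<Rightarrow> ('a \<Rightarrow> complex) \<Rightarrow> complex \<Rightarrow> complex" where
  "weyl_function T \<Gamma>0 \<Gamma>1 z = \<Gamma>1 (weyl_solution T \<Gamma>0 z)"


section \<open>The spaces H(m) and the properties B_0 and D_0\<close>

definition nevanlinna_kernel :: "(complex \<Rightarrow> complex) \<Rightarrow> complex \<Rightarrow> complex \<Rightarrow> complex" where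
  "nevanlinna_kernel m z w =
     (if z = cnj w then Lim (at (cnj w)) (\<lambda>\<zeta>. (m \<zeta> - cnj (m w)) / (\<zeta> - cnj w))
      else (m z - cnj (m w)) / (z - cnj w))"

text \<open>Functions on the complement of the real line are extended by 0 to the real line.
  For a Nevanlinna function m there is exactly one such pair \<open>(H, ip)\<close>, up to the values of
  \<open>ip\<close> off H.\<close>

definition is_rkhs ::
    "(complex \<Rightarrow> complex) \<Rightarrow> (complex \<Rightarrow> complex) set \<Rightarrow>
     ((complex \<Rightarrow> complex) \<Rightarrow> (complex \<Rightarrow> complex) \<Rightarrow> complex) \<Rightarrow> bool" where
  "is_rkhs m H ip \<longleftrightarrow>
     hilbert_on H ip \<and>
     (\<forall>h\<in>H. h holomorphic_on - \<real> \<and> (\<forall>x\<in>\<real>. h x = 0)) \<and>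
     (\<forall>w\<in>- \<real>.
        (let k = (\<lambda>z. if z \<in> \<real> then 0 else nevanlinna_kernel m z w)
         in k \<in> H \<and> (\<forall>h\<in>H. ip h k = h w)))"

definition B0_weight :: "(complex \<Rightarrow> complex) \<Rightarrow> real \<Rightarrow> real" where
  "B0_weight m y = 1 / Im (m (\<i> * of_real y))"

definition B0_property :: "(complex \<Rightarrow> complex) \<Rightarrow> bool" where
  "B0_property m \<longleftrightarrow>
     (\<exists>H ip. is_rkhs m H ip \<and>
        (\<exists>C. \<forall>h\<in>H.
           set_integrable lborel {0<..<1} (\<lambda>y. (cmod (h (\<i> * of_real y)))\<^sup>2 * B0_weight m y) \<and>
           sqrt (LINT y:{0<..<1}|lborel. (cmod (h (\<i> * of_real y)))\<^sup>2 * B0_weight m y)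
             \<le> C * ip_norm ip h))"

definition D0_property :: "(complex \<Rightarrow> complex) \<Rightarrow> (complex \<Rightarrow> complex) \<Rightarrow> bool" where
  "D0_property mp mm \<longleftrightarrow>
     (\<forall>y\<in>{0<..<1::real}. mp (\<i> * of_real y) + mm (- \<i> * of_real y) \<noteq> 0) \<and>
     bounded ((\<lambda>y::real. (Im (mp (\<i> * of_real y)) + Im (mm (\<i> * of_real y)))
                / cmod (mp (\<i> * of_real y) + mm (- \<i> * of_real y))) ` {0<..<1})"


section \<open>Spectral functions and singular critical points\<close>

definition bounded_operator ::
    "('a::complex_vector \<Rightarrow> 'a \<Rightarrow> complex) \<Rightarrow> ('a \<Rightarrow> 'a) \<Rightarrow> bool" where
  "bounded_operator ip T \<longleftrightarrow> clinear_on UNIV T \<and> (\<exists>C. \<forall>x. ip_norm ip (T x) \<le> C * ip_norm ip x)"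

definition resolvent_set_in ::
    "('a::complex_vector \<Rightarrow> 'a \<Rightarrow> complex) \<Rightarrow> 'a set \<Rightarrow> ('a \<times> 'a) set \<Rightarrow> complex set" where
  "resolvent_set_in ip H T =
     {z. (\<forall>h\<in>H. \<exists>!f. (f, h + z *\<^sub>C f) \<in> T) \<and>
         (\<exists>C. \<forall>(f, f') \<in> T. ip_norm ip f \<le> C * ip_norm ip (f' - z *\<^sub>C f))}"

definition spectrum_in ::
    "('a::complex_vector \<Rightarrow> 'a \<Rightarrow> complex) \<Rightarrow> 'a set \<Rightarrow> ('a \<times> 'a) set \<Rightarrow> complex set" where
  "spectrum_in ip H T = - resolvent_set_in ip H T"

text \<open>The value at h of the inverse of A - z.\<close>

definition resolvent :: "('a::complex_vector \<times> 'a) set \<Rightarrow> complex \<Rightarrow> 'a \<Rightarrow> 'a" where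
  "resolvent A z h = (THE f. (f, h + z *\<^sub>C f) \<in> A)"

definition in_double_commutant ::
    "('a::complex_vector \<Rightarrow> 'a \<Rightarrow> complex) \<Rightarrow> ('a \<times> 'a) set \<Rightarrow> ('a \<Rightarrow> 'a) \<Rightarrow> bool" where
  "in_double_commutant ip A P \<longleftrightarrow>
     (\<forall>T. bounded_operator ip T \<longrightarrow>
        (\<forall>z\<in>resolvent_set_in ip UNIV A. T \<circ> resolvent A z = resolvent A z \<circ> T) \<longrightarrow>
        T \<circ> P = P \<circ> T)"

text \<open>The one-point compactification of the real line is \<open>real option\<close>, as in the library's
  \<open>Alexandroff_compactification\<close>: \<open>None\<close> is the point at infinity.\<close>

definition nonzero_bounded_interval :: "real set \<Rightarrow> bool" where
  "nonzero_bounded_interval I \<longleftrightarrow>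
     (\<exists>a b. a \<noteq> 0 \<and> b \<noteq> 0 \<and> (I = {a..b} \<or> I = {a..<b} \<or> I = {a<..b} \<or> I = {a<..<b}))"

definition interval_ring :: "real option set set" where
  "interval_ring =
     {\<Delta>. \<exists>F. finite F \<and> (\<forall>I\<in>F. nonzero_bounded_interval I) \<and>
           (\<Delta> = Some ` (\<Union>F) \<or> \<Delta> = - (Some ` (\<Union>F)))}"

text \<open>The inclusion of the spectrum of the restriction of A to the range of \<open>E \<Delta>\<close> in the closure of
  \<open>\<Delta>\<close> is required for all \<open>\<Delta>\<close>, not only for bounded ones, as in Langer's spectral theorem. If it
  were required for bounded \<open>\<Delta>\<close> only, the other conditions would also be met by the
  degenerate choice \<open>E \<Delta> = (if None \<in> \<Delta> then id else 0)\<close>. For a member of the ring,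
  boundedness means \<open>None \<notin> \<Delta>\<close>.\<close>

definition spectral_function ::
    "('a::complex_vector \<Rightarrow> 'a \<Rightarrow> complex) \<Rightarrow> ('a \<Rightarrow> 'a \<Rightarrow> complex) \<Rightarrow> ('a \<times> 'a) set \<Rightarrow>
     (real option set \<Rightarrow> 'a \<Rightarrow> 'a) \<Rightarrow> bool" where
  "spectral_function form ip A E \<longleftrightarrow>
     E {} = (\<lambda>x. 0) \<and> E UNIV = id \<and>
     (\<forall>\<Delta>\<in>interval_ring.
        bounded_operator ip (E \<Delta>) \<and>
        (\<forall>x y. form (E \<Delta> x) y = form x (E \<Delta> y)) \<and>
        (\<Delta> \<subseteq> Some ` {0<..} \<longrightarrow> hilbert_on (range (E \<Delta>)) form) \<and>
        (\<Delta> \<subseteq> Some ` {..<0} \<longrightarrow> hilbert_on (range (E \<Delta>)) (\<lambda>x y. - form x y)) \<and>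
        in_double_commutant ip A (E \<Delta>) \<and>
        (None \<notin> \<Delta> \<longrightarrow>
           range (E \<Delta>) \<subseteq> Domain A \<and>
           (\<exists>C. \<forall>(f, f') \<in> A. f \<in> range (E \<Delta>) \<longrightarrow> ip_norm ip f' \<le> C * ip_norm ip f)) \<and>
        spectrum_in ip (range (E \<Delta>)) (A \<inter> range (E \<Delta>) \<times> range (E \<Delta>))
          \<subseteq> of_real ` closure {t. Some t \<in> \<Delta>}) \<and>
     (\<forall>\<Delta>1\<in>interval_ring. \<forall>\<Delta>2\<in>interval_ring. E (\<Delta>1 \<inter> \<Delta>2) = E \<Delta>1 \<circ> E \<Delta>2) \<and>
     (\<forall>\<Delta>1\<in>interval_ring. \<forall>\<Delta>2\<in>interval_ring.
        \<Delta>1 \<inter> \<Delta>2 = {} \<longrightarrow> E (\<Delta>1 \<union> \<Delta>2) = (\<lambda>x. E \<Delta>1 x + E \<Delta>2 x))"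

definition indefinite_on :: "('a \<Rightarrow> 'a \<Rightarrow> complex) \<Rightarrow> 'a set \<Rightarrow> bool" where
  "indefinite_on form V \<longleftrightarrow> (\<exists>x\<in>V. 0 < Re (form x x)) \<and> (\<exists>x\<in>V. Re (form x x) < 0)"

definition critical_point ::
    "('a \<Rightarrow> 'a \<Rightarrow> complex) \<Rightarrow> (real option set \<Rightarrow> 'a \<Rightarrow> 'a) \<Rightarrow> real option \<Rightarrow> bool" where
  "critical_point form E p \<longleftrightarrow>
     (\<forall>\<Delta>\<in>interval_ring. p \<in> \<Delta> \<longrightarrow> indefinite_on form (range (E \<Delta>)))"

definition strong_limit_exists ::
    "('a::complex_vector \<Rightarrow> 'a \<Rightarrow> complex) \<Rightarrow> (real \<Rightarrow> 'a \<Rightarrow> 'a) \<Rightarrow> real filter \<Rightarrow> bool" where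
  "strong_limit_exists ip T F \<longleftrightarrow> (\<forall>x. \<exists>y. ((\<lambda>t. ip_norm ip (T t x - y)) \<longlongrightarrow> 0) F)"

definition regular_at_zero ::
    "('a::complex_vector \<Rightarrow> 'a \<Rightarrow> complex) \<Rightarrow> (real option set \<Rightarrow> 'a \<Rightarrow> 'a) \<Rightarrow> bool" where
  "regular_at_zero ip E \<longleftrightarrow>
     (\<exists>l1 l2. l1 < 0 \<and> 0 < l2 \<and>
        strong_limit_exists ip (\<lambda>t. E (Some ` {l1..t})) (at_left 0) \<and>
        strong_limit_exists ip (\<lambda>t. E (Some ` {t..l2})) (at_right 0))"

definition regular_at_infinity ::
    "('a::complex_vector \<Rightarrow> 'a \<Rightarrow> complex) \<Rightarrow> (real option set \<Rightarrow> 'a \<Rightarrow> 'a) \<Rightarrow> bool" where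
  "regular_at_infinity ip E \<longleftrightarrow>
     (\<exists>l1 l2. l1 \<noteq> 0 \<and> l2 \<noteq> 0 \<and>
        strong_limit_exists ip (\<lambda>t. E (Some ` {l1..t})) at_top \<and>
        strong_limit_exists ip (\<lambda>t. E (Some ` {t..l2})) at_bot)"

text \<open>A nonnegative self-adjoint operator with nonempty resolvent set has a spectral function, and
  the set below does not depend on which one is used: the values of any two of them at \<open>\<Delta>\<close>
  can differ only on the eigenspaces of A at the endpoints of \<open>\<Delta>\<close>.\<close>

definition singular_critical_points ::
    "('a::complex_vector \<Rightarrow> 'a \<Rightarrow> complex) \<Rightarrow> ('a \<Rightarrow> 'a \<Rightarrow> complex) \<Rightarrow> ('a \<times> 'a) set \<Rightarrow>
     real option set" where
  "singular_critical_points form ip A =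
     {p. \<exists>E. spectral_function form ip A E \<and> critical_point form E p \<and>
             (p = Some 0 \<and> \<not> regular_at_zero ip E \<or> p = None \<and> \<not> regular_at_infinity ip E)}"

end

(*
The critical point 0 is not singular exactly if the resolvent grows like 1/y along iy, y -> 0. The
compressions of the resolvent to K_+ and K_- are those of self-adjoint operators in Hilbert spaces plus the
rank-one term of Krein's formula, with denominator m_+(iy) + m_-(-iy). If 0 is not singular, evaluating the
growth bound at the defect vectors gives D_0. Conversely, D_0 and B_0 make the rank-one term integrable in
y, while the self-adjoint part telescopes over dyadic scales; this bounds the spectral projections of the
intervals [t, 1/2] and [-1/2, -t] as t -> 0. Property B_0 also excludes that 0 is an eigenvalue of an
adjoint S* but not of S, so that ker(A) is the orthogonal sum of its parts in K_+ and K_-.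

The spectral function needed for the first direction is built from the bounded operators
T = (R(i) + R(-i))/2 and Y = (R(i) - R(-i))/(2i), where R is the resolvent of A; negative spectral
projections of self-adjoint operators are obtained as strong limits of polynomials.
*)
theory Submission
  imports Defs
begin

section \<open>Semidefinite forms and Hilbert spaces on a carrier\<close>

text \<open>As functions of A, T is \<lambda> / (1 + \<lambda>^2) and Y is 1 / (1 + \<lambda>^2).
  Nonnegativity of A makes [T x, y] a semidefinite inner product, and with D the square root of J T
  the identity D T = (D J D) D carries T to a symmetric operator in a Hilbert space. Spectral
  projections are formed there and lifted back in the form a Y + J D h D. This model sees nothing of
  ker(A), on which the value of a function at 0 has to be recorded separately; lifts are unique
  because ker(A) is nondegenerate. Membership in c_s(A) asks for some spectral function with bad
  behaviour. One constructed spectral function therefore suffices to deduce D_0, whereas the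
  converse has to treat an arbitrary one through its axioms alone; there, bounds on forms are
  extracted from resolvent sets by a continuity argument. B_0 controls integrals over y, while
  telescoping needs values of y in geometric progression; averaging over the starting point of the
  progression reconciles the two.\<close>

locale psd_space =
 fixes V :: "'a::complex_vector set" and q :: "'a => 'a => complex"
 assumes subspace: "csubspace V"
  and herm_form: "hermitian_form_on V q"
  and semidef: "!!x. x \<in> V ==> 0 <= Re (q x x)"
begin

abbreviation nrm :: "'a => real" where "nrm \<equiv> ip_norm q"

lemma zero_mem [simp]: "0 \<in> V"
 using subspace complex_vector.subspace_0 by blast

lemma add_mem [simp]: "x \<in> V ==> y \<in> V ==> x + y \<in> V"
 using subspace complex_vector.subspace_add by blast

lemma scale_mem [simp]: "x \<in> V ==> c *\<^sub>C x \<in> V"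
 using subspace complex_vector.subspace_scale by blast

lemma minus_mem [simp]: "x \<in> V ==> - x \<in> V"
 using subspace complex_vector.subspace_neg by blast

lemma diff_mem [simp]: "x \<in> V ==> y \<in> V ==> x - y \<in> V"
 using subspace complex_vector.subspace_diff by blast

lemma sum_mem: "(!!i. i \<in> I ==> f i \<in> V) ==> sum f I \<in> V"
 using subspace complex_vector.subspace_sum by blast

lemma add_left [simp]: "x \<in> V ==> y \<in> V ==> z \<in> V ==> q (x + y) z = q x z + q y z"
 using herm_form unfolding hermitian_form_on_def by blast

lemma scale_left [simp]: "x \<in> V ==> y \<in> V ==> q (c *\<^sub>C x) y = c * q x y"
 using herm_form unfolding hermitian_form_on_def by blast

lemma herm: "x \<in> V ==> y \<in> V ==> q y x = cnj (q x y)"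
 using herm_form unfolding hermitian_form_on_def by blast

lemma add_right [simp]: "x \<in> V ==> y \<in> V ==> z \<in> V ==> q x (y + z) = q x y + q x z"
 using herm[of x "y + z"] herm[of x y] herm[of x z] by (metis add_left add_mem complex_cnj_add herm)

lemma scale_right [simp]: "x \<in> V ==> y \<in> V ==> q x (c *\<^sub>C y) = cnj c * q x y"
 by (metis scale_left scale_mem complex_cnj_mult herm)

lemma zero_left [simp]: "x \<in> V ==> q 0 x = 0"
 using scale_left[of 0 x 0] by simp

lemma zero_right [simp]: "x \<in> V ==> q x 0 = 0"
 using scale_right[of x 0 0] by simp

lemma minus_left [simp]: "x \<in> V ==> y \<in> V ==> q (- x) y = - q x y"
 using scale_left[of x y "-1"] by (simp del: scale_left)

lemma minus_right [simp]: "x \<in> V ==> y \<in> V ==> q x (- y) = - q x y"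
 using scale_right[of x y "-1"] by (simp del: scale_right)

lemma diff_left [simp]: "x \<in> V ==> y \<in> V ==> z \<in> V ==> q (x - y) z = q x z - q y z"
 using add_left[of x "- y" z] by (simp del: add_left)

lemma diff_right [simp]: "x \<in> V ==> y \<in> V ==> z \<in> V ==> q x (y - z) = q x y - q x z"
 using add_right[of x y "- z"] by (simp del: add_right)

lemma sum_left: "(!!i. i \<in> I ==> f i \<in> V) ==> y \<in> V ==> q (sum f I) y = (\<Sum>i\<in>I. q (f i) y)"
 by (induction I rule: infinite_finite_induct) (auto simp: sum_mem)

lemma self_Im [simp]: "x \<in> V ==> Im (q x x) = 0"
 using herm[of x x] by (metis cnj.simps(2) neg_equal_zero)

lemma Re_swap: "x \<in> V ==> y \<in> V ==> Re (q y x) = Re (q x y)"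
 using herm[of x y] by simp

lemma nrm_nonneg [simp]: "x \<in> V ==> 0 <= nrm x"
 by (simp add: ip_norm_def semidef)

lemma nrm_sq: "x \<in> V ==> (nrm x)\<^sup>2 = Re (q x x)"
 by (simp add: ip_norm_def semidef)

lemma self_eq: "x \<in> V ==> q x x = of_real ((nrm x)\<^sup>2)"
 by (simp add: nrm_sq complex_eq_iff)

lemma nrm_zero [simp]: "nrm 0 = 0"
 by (simp add: ip_norm_def)

lemma nrm_scale: "x \<in> V ==> nrm (c *\<^sub>C x) = cmod c * nrm x"
proof -
 assume x: "x \<in> V"
 have "(nrm (c *\<^sub>C x))\<^sup>2 = Re (c * cnj c * q x x)"
  using x by (simp add: nrm_sq mult.assoc)
 also have "c * cnj c = of_real ((cmod c)\<^sup>2)" by (rule complex_norm_square[symmetric])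
 finally have "(nrm (c *\<^sub>C x))\<^sup>2 = (cmod c * nrm x)\<^sup>2"
  using x by (simp add: nrm_sq power_mult_distrib)
 thus ?thesis using x by (simp add: power2_eq_iff_nonneg)
qed

lemma nrm_minus [simp]: "x \<in> V ==> nrm (- x) = nrm x"
 by (simp add: ip_norm_def)

lemma nrm_minus_commute: "x \<in> V ==> y \<in> V ==> nrm (x - y) = nrm (y - x)"
 using nrm_minus[of "x - y"] by simp

lemma nrm_sq_add: "x \<in> V ==> y \<in> V ==> (nrm (x + y))\<^sup>2 = (nrm x)\<^sup>2 + 2 * Re (q x y) + (nrm y)\<^sup>2"
 by (simp add: nrm_sq Re_swap[of x y])

lemma nrm_sq_diff: "x \<in> V ==> y \<in> V ==> (nrm (x - y))\<^sup>2 = (nrm x)\<^sup>2 - 2 * Re (q x y) + (nrm y)\<^sup>2"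
 by (simp add: nrm_sq Re_swap[of x y])

lemma cauchy_schwarz:
 assumes x: "x \<in> V" and y: "y \<in> V"
 shows "cmod (q x y) <= nrm x * nrm y"
proof -
 define c where "c = q x y"
 have *: "0 <= (nrm x)\<^sup>2 - 2 * t * (cmod c)\<^sup>2 + t\<^sup>2 * (cmod c)\<^sup>2 * (nrm y)\<^sup>2" for t :: real
 proof -
  have "(nrm (x - (of_real t * c) *\<^sub>C y))\<^sup>2 =
    (nrm x)\<^sup>2 - 2 * Re (cnj (of_real t * c) * c) + (t\<^sup>2 * (cmod c)\<^sup>2) * (nrm y)\<^sup>2"
   using x y by (simp add: nrm_sq_diff nrm_scale norm_mult power_mult_distrib c_def)
  also have "cnj (of_real t * c) * c = of_real (t * (cmod c)\<^sup>2)"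
   using complex_norm_square[of c] by (simp add: mult.commute mult.left_commute)
  finally have "(nrm (x - (of_real t * c) *\<^sub>C y))\<^sup>2 =
    (nrm x)\<^sup>2 - 2 * t * (cmod c)\<^sup>2 + t\<^sup>2 * (cmod c)\<^sup>2 * (nrm y)\<^sup>2" by simp
  thus ?thesis by (metis zero_le_power2)
 qed
 show ?thesis
 proof (cases "nrm y = 0")
  case True
  have "0 <= (nrm x)\<^sup>2 - 2 * t * (cmod c)\<^sup>2" for t using *[of t] True by simp
  \<comment> \<open>For y of norm 0 the quadratic in \<open>*\<close> is affine in t, so a large t
    refutes c \<noteq> 0.\<close>
  from this[of "((nrm x)\<^sup>2 + 1) / (2 * (cmod c)\<^sup>2)"] have "cmod c = 0"
   by (cases "cmod c = 0") (auto simp: field_simps)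
  thus ?thesis using True by (simp add: c_def)
 next
  case False
  hence b: "0 < (nrm y)\<^sup>2" by simp
  have "(1 / (nrm y)\<^sup>2)\<^sup>2 * (cmod c)\<^sup>2 * (nrm y)\<^sup>2 = (cmod c)\<^sup>2 / (nrm y)\<^sup>2"
   using b by (simp add: power2_eq_square)
  hence "0 <= (nrm x)\<^sup>2 - (cmod c)\<^sup>2 / (nrm y)\<^sup>2"
   using *[of "1 / (nrm y)\<^sup>2"] by simp
  hence "(cmod c)\<^sup>2 <= (nrm x)\<^sup>2 * (nrm y)\<^sup>2" using b by (simp add: field_simps)
  hence "(cmod c)\<^sup>2 <= (nrm x * nrm y)\<^sup>2" by (simp add: power_mult_distrib)
  thus ?thesis unfolding c_def by (rule power2_le_imp_le) (use x y in simp)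
 qed
qed

lemma Re_le: "x \<in> V ==> y \<in> V ==> Re (q x y) <= nrm x * nrm y"
 using cauchy_schwarz[of x y] complex_Re_le_cmod[of "q x y"] by linarith

lemma nrm_triangle: "x \<in> V ==> y \<in> V ==> nrm (x + y) <= nrm x + nrm y"
proof -
 assume a: "x \<in> V" "y \<in> V"
 have "(nrm (x + y))\<^sup>2 <= (nrm x + nrm y)\<^sup>2"
  unfolding nrm_sq_add[OF a] power2_sum using Re_le[OF a] by simp
 thus ?thesis by (rule power2_le_imp_le) (use a in simp)
qed

lemma nrm_triangle_diff: "x \<in> V ==> y \<in> V ==> nrm (x - y) <= nrm x + nrm y"
 using nrm_triangle[of x "- y"] by simp

lemma nrm_diff_triangle: "x \<in> V ==> y \<in> V ==> z \<in> V ==> nrm (x - z) <= nrm (x - y) + nrm (y - z)"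
 using nrm_triangle[of "x - y" "y - z"] by simp

end

locale hilbert_space =
 fixes H :: "'a::complex_vector set" and ip :: "'a => 'a => complex"
 assumes hilbert: "hilbert_on H ip"

sublocale hilbert_space \<subseteq> psd_space H ip
proof
 show "csubspace H" "hermitian_form_on H ip" using hilbert by (simp_all add: hilbert_on_def)
 fix x assume x: "x \<in> H"
 have *: "csubspace H" "hermitian_form_on H ip" and pos: "x ~= 0 ==> 0 < Re (ip x x)"
  using hilbert x by (simp_all add: hilbert_on_def)
 have "ip (0 *\<^sub>C x) x = 0 * ip x x" using *(2) x unfolding hermitian_form_on_def by blast
 thus "0 <= Re (ip x x)" using pos by (cases "x = 0") auto
qed

context hilbert_space
begin

lemma nrm_eq_0 [simp]: "x \<in> H ==> nrm x = 0 \<longleftrightarrow> x = 0"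
 using hilbert nrm_sq[of x] by (auto simp: hilbert_on_def)

lemma nrm_pos: "x \<in> H ==> x ~= 0 ==> 0 < nrm x"
 by (simp add: order_less_le)

lemma eq_zeroI: "x \<in> H ==> (!!y. y \<in> H ==> ip x y = 0) ==> x = 0"
 using nrm_sq[of x] nrm_eq_0[of x] by (metis zero_complex.simps(1) zero_eq_power2)

lemma eqI_left: "x \<in> H ==> z \<in> H ==> (!!y. y \<in> H ==> ip x y = ip z y) ==> x = z"
 using eq_zeroI[of "x - z"] by simp

lemma complete:
 assumes "range X \<subseteq> H" "!!\<epsilon>. \<epsilon> > 0 ==> \<exists>N. \<forall>m\<ge>N. \<forall>n\<ge>N. nrm (X m - X n) < \<epsilon>"
 obtains l where "l \<in> H" "(\<lambda>n. nrm (X n - l)) \<longlonglongrightarrow> 0"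
 using assms hilbert unfolding hilbert_on_def by blast

lemma limit_unique:
 assumes X: "range X \<subseteq> H" and l: "l \<in> H" "l' \<in> H"
  and lim: "(\<lambda>n. nrm (X n - l)) \<longlonglongrightarrow> 0" "(\<lambda>n. nrm (X n - l')) \<longlonglongrightarrow> 0"
 shows "l = l'"
proof -
 have "(\<lambda>n. nrm (X n - l) + nrm (X n - l')) \<longlonglongrightarrow> 0" using tendsto_add[OF lim] by simp
 moreover have "nrm (l - l') <= nrm (X n - l) + nrm (X n - l')" for n
  using nrm_diff_triangle[of l "X n" l'] nrm_minus_commute[of l "X n"] X l by auto
 ultimately have "nrm (l - l') <= 0" by (meson LIMSEQ_le_const)
 hence "nrm (l - l') = 0" using l nrm_nonneg[of "l - l'"] by (intro antisym) auto
 thus ?thesis using l by simp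
qed

lemma ip_tendsto:
 assumes X: "range X \<subseteq> H" and l: "l \<in> H" "y \<in> H" and lim: "(\<lambda>n. nrm (X n - l)) \<longlonglongrightarrow> 0"
 shows "(\<lambda>n. ip (X n) y) \<longlonglongrightarrow> ip l y"
proof -
 have "(\<lambda>n. nrm (X n - l) * nrm y) \<longlonglongrightarrow> 0" using tendsto_mult_left_zero[OF lim] by simp
 moreover have "norm (ip (X n) y - ip l y) <= nrm (X n - l) * nrm y" for n
 proof -
  have "X n \<in> H" using X by auto
  thus ?thesis using cauchy_schwarz[of "X n - l" y] l by simp
 qed
 ultimately have "(\<lambda>n. ip (X n) y - ip l y) \<longlonglongrightarrow> 0"
  using Lim_null_comparison[of "\<lambda>n. ip (X n) y - ip l y" "\<lambda>n. nrm (X n - l) * nrm y"] by simp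
 thus ?thesis by (simp add: LIM_zero_iff)
qed

lemma ip_tendsto_right:
 assumes X: "range X \<subseteq> H" and l: "l \<in> H" "y \<in> H" and lim: "(\<lambda>n. nrm (X n - l)) \<longlonglongrightarrow> 0"
 shows "(\<lambda>n. ip y (X n)) \<longlonglongrightarrow> ip y l"
proof -
 have "(\<lambda>n. cnj (ip (X n) y)) \<longlonglongrightarrow> cnj (ip l y)"
  by (intro tendsto_intros ip_tendsto assms)
 moreover have "cnj (ip (X n) y) = ip y (X n)" for n
 proof -
  have "X n \<in> H" using X by auto
  thus ?thesis using herm[of "X n" y] l by simp
 qed
 ultimately show ?thesis using l herm[of l y] by simp
qed

lemma nrm_tendsto:
 assumes X: "range X \<subseteq> H" and l: "l \<in> H" and lim: "(\<lambda>n. nrm (X n - l)) \<longlonglongrightarrow> 0"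
 shows "(\<lambda>n. nrm (X n)) \<longlonglongrightarrow> nrm l"
proof -
 have "norm (nrm (X n) - nrm l) <= nrm (X n - l)" for n
 proof -
  have "X n \<in> H" using X by auto
  thus ?thesis using nrm_triangle[of "X n - l" l] nrm_triangle[of "l - X n" "X n"]
    nrm_minus_commute[of l "X n"] l by (simp add: abs_le_iff)
 qed
 hence "(\<lambda>n. nrm (X n) - nrm l) \<longlonglongrightarrow> 0"
  by (intro Lim_null_comparison[OF _ lim]) auto
 thus ?thesis by (simp add: LIM_zero_iff)
qed

text \<open>The Riesz representation theorem for a functional given by its graph G: no closedness of the
 domain is needed, since a sequence minimising \<open>\<bar>v\<bar>\<^sup>2 - 2 Re s\<close> over the graph is a Cauchy sequence.\<close>

theorem riesz_graph:
 assumes GH: "!!v s. (v, s) \<in> G ==> v \<in> H" and ne: "(0, 0) \<in> G"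
  and add: "!!v s w r. (v, s) \<in> G ==> (w, r) \<in> G ==> (v + w, s + r) \<in> G"
  and scale: "!!c v s. (v, s) \<in> G ==> (c *\<^sub>C v, c * s) \<in> G"
  and bound: "!!v s. (v, s) \<in> G ==> cmod s <= M * nrm v" and M: "0 <= M"
 obtains u where "u \<in> H" "!!v s. (v, s) \<in> G ==> s = ip v u" "nrm u <= M"
  "!!\<epsilon>. \<epsilon> > 0 ==> \<exists>v s. (v, s) \<in> G \<and> nrm (v - u) < \<epsilon>"
proof -
 define J where "J = (\<lambda>(v, s). (nrm v)\<^sup>2 - 2 * Re s)"
 define d where "d = Inf (J ` G)"
 have low: "- M\<^sup>2 <= J g" if "g \<in> G" for g
 proof -
  obtain v s where g: "g = (v, s)" by force
  have "Re s <= M * nrm v" using bound[of v s] that g complex_Re_le_cmod[of s] by simp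
  moreover have "0 <= (nrm v - M)\<^sup>2" by simp
  ultimately show ?thesis by (simp add: J_def g power2_diff algebra_simps)
 qed
 have bdd: "bdd_below (J ` G)" using low by (intro bdd_belowI[of _ "- M\<^sup>2"]) auto
 have dle: "d <= J g" if "g \<in> G" for g
  unfolding d_def using that bdd by (intro cInf_lower) auto
 have "\<exists>g\<in>G. J g < d + 1 / real (Suc n)" for n
 proof -
  have "Inf (J ` G) < d + 1 / real (Suc n)" by (simp add: d_def)
  thus ?thesis using cInf_lessD[of "J ` G"] ne by blast
 qed
 then obtain g where g: "!!n. g n \<in> G" "!!n. J (g n) < d + 1 / real (Suc n)" by metis
 define v s where "v n = fst (g n)" and "s n = snd (g n)" for n
 have G: "(v n, s n) \<in> G" for n using g(1)[of n] by (simp add: v_def s_def)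
 have vH: "v n \<in> H" for n using GH[OF G] .
 have Jn: "(nrm (v n))\<^sup>2 - 2 * Re (s n) < d + 1 / real (Suc n)" for n
  using g(2)[of n] by (simp add: J_def v_def s_def case_prod_unfold)
 have dl: "d <= (nrm w)\<^sup>2 - 2 * Re r" if "(w, r) \<in> G" for w r using dle[OF that] by (simp add: J_def)
 have cau: "(nrm (v m - v n))\<^sup>2 <= 2 / real (Suc m) + 2 / real (Suc n)" for m n
 proof -
  \<comment> \<open>The midpoint competes with the infimum d; by the parallelogram law this bounds
    the distance between v m and v n.\<close>
  have "((1/2) *\<^sub>C (v m + v n), (1/2) * (s m + s n)) \<in> G" by (intro scale add G)
  hence "d <= (nrm ((1/2) *\<^sub>C (v m + v n)))\<^sup>2 - 2 * Re ((1/2) * (s m + s n))" by (rule dl)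
  moreover have "nrm ((1/2) *\<^sub>C (v m + v n)) = nrm (v m + v n) / 2"
   using nrm_scale[of "v m + v n" "1/2"] vH by simp
  moreover have "2 * Re ((1/2) * (s m + s n)) = Re (s m + s n)" by (simp add: field_simps)
  ultimately have "d <= (nrm (v m + v n) / 2)\<^sup>2 - Re (s m + s n)" by metis
  hence "4 * d <= (nrm (v m + v n))\<^sup>2 - 4 * Re (s m + s n)"
   by (simp add: power_divide field_simps)
  thus ?thesis using Jn[of m] Jn[of n] vH by (simp add: nrm_sq_add nrm_sq_diff)
 qed
 have "\<exists>N. \<forall>m\<ge>N. \<forall>n\<ge>N. nrm (v m - v n) < \<epsilon>" if e: "\<epsilon> > 0" for \<epsilon>
 proof -
  obtain N where N: "4 / \<epsilon>\<^sup>2 < real N" using reals_Archimedean2 by blast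
  have N0: "real N > 0" using N e by (smt (verit) divide_pos_pos zero_less_power)
  have "nrm (v m - v n) < \<epsilon>" if "m \<ge> N" "n \<ge> N" for m n
  proof -
   have "2 / real (Suc m) <= 2 / real N" "2 / real (Suc n) <= 2 / real N"
    using that N0 by (auto intro!: divide_left_mono)
   hence "(nrm (v m - v n))\<^sup>2 <= 4 / real N" using cau[of m n] by simp
   also have "... < \<epsilon>\<^sup>2" using N N0 e by (simp add: field_simps)
   finally show ?thesis using e by (simp add: power2_less_imp_less)
  qed
  thus ?thesis by blast
 qed
 then obtain u where u: "u \<in> H" and lim: "(\<lambda>n. nrm (v n - u)) \<longlonglongrightarrow> 0"
  using complete[of v] vH by blast
 have vr: "range v \<subseteq> H" using vH by auto
 have R: "Re (ip w u) = Re r" if wr: "(w, r) \<in> G" for w r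
 proof -
  have w: "w \<in> H" using GH[OF wr] .
  have ineq: "0 <= 2 * t * (Re (ip w u) - Re r) + t\<^sup>2 * (nrm w)\<^sup>2" for t :: real
  proof -
   have "0 <= 2 * t * (Re (ip w (v n)) - Re r) + t\<^sup>2 * (nrm w)\<^sup>2 + 1 / real (Suc n)" for n
   proof -
    have "(v n + of_real t *\<^sub>C w, s n + of_real t * r) \<in> G" by (intro add scale G wr)
    from dl[OF this] Jn[of n] show ?thesis
     using vH w Re_swap[of w "v n"] by (simp add: nrm_sq_add nrm_scale power_mult_distrib algebra_simps)
   qed
   moreover have "(\<lambda>n. 2 * t * (Re (ip w (v n)) - Re r) + t\<^sup>2 * (nrm w)\<^sup>2 + 1 / real (Suc n))
     \<longlonglongrightarrow> 2 * t * (Re (ip w u) - Re r) + t\<^sup>2 * (nrm w)\<^sup>2 + 0"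
    by (intro tendsto_intros ip_tendsto_right[OF vr u w lim] LIMSEQ_Suc lim_1_over_n)
   ultimately show ?thesis by (metis (no_types, lifting) LIMSEQ_le_const add.right_neutral)
  qed
  show ?thesis
  proof (rule ccontr)
   define a b where "a = Re (ip w u) - Re r" and "b = (nrm w)\<^sup>2"
   assume "Re (ip w u) ~= Re r"
   hence a: "a ~= 0" and b: "0 <= b" by (simp_all add: a_def b_def)
   \<comment> \<open>For small t of sign opposite to a the linear term of \<open>ineq\<close> wins;
     with this s the choice t = - s a gives s a^2 (1 + s) \<le> 0.\<close>
   define s where "s = 1 / (b + 1)"
   have s: "0 < s" "s * b = 1 - s" using b by (simp_all add: s_def field_simps)
   have "0 <= 2 * (- s * a) * a + (- s * a)\<^sup>2 * b" using ineq[of "- s * a"] by (simp add: a_def b_def)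
   also have "... = - 2 * s * a\<^sup>2 + s * a\<^sup>2 * (s * b)" by (simp add: power2_eq_square)
   also have "... = - (s * a\<^sup>2 * (1 + s))" unfolding s(2) by (simp add: algebra_simps)
   finally have "s * a\<^sup>2 * (1 + s) <= 0" by simp
   moreover have "0 < s * a\<^sup>2 * (1 + s)" using s a by simp
   ultimately show False by simp
  qed
 qed
 have rep: "r = ip w u" if wr: "(w, r) \<in> G" for w r
 proof (rule complex_eqI)
  show "Re r = Re (ip w u)" using R[OF wr] by simp
  have "(\<i> *\<^sub>C w, \<i> * r) \<in> G" by (rule scale[OF wr])
  from R[OF this] show "Im r = Im (ip w u)" using GH[OF wr] u by simp
 qed
 have "nrm u <= M"
 proof -
  have "(\<lambda>n. ip (v n) u) \<longlonglongrightarrow> ip u u" by (rule ip_tendsto[OF vr u u lim])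
  hence "(\<lambda>n. cmod (ip (v n) u)) \<longlonglongrightarrow> cmod (ip u u)" by (rule tendsto_norm)
  moreover have "(\<lambda>n. M * nrm (v n)) \<longlonglongrightarrow> M * nrm u"
   by (intro tendsto_intros nrm_tendsto[OF vr u lim])
  moreover have "cmod (ip (v n) u) <= M * nrm (v n)" for n
   using bound[OF G] rep[OF G] by simp
  ultimately have "cmod (ip u u) <= M * nrm u" by (intro LIMSEQ_le) auto
  moreover have "cmod (ip u u) = (nrm u)\<^sup>2" using u by (simp add: self_eq norm_power)
  ultimately have "nrm u * nrm u <= M * nrm u" by (simp add: power2_eq_square)
  thus ?thesis using u M by (cases "nrm u = 0") (auto simp: order_less_le)
 qed
 moreover have "\<exists>w r. (w, r) \<in> G \<and> nrm (w - u) < \<epsilon>" if "\<epsilon> > 0" for \<epsilon>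
  using LIMSEQ_D[OF lim that] G vH u by (metis abs_of_nonneg diff_mem diff_zero le_refl nrm_nonneg real_norm_def)
 ultimately show thesis using that u rep by blast
qed

end

section \<open>The algebra of linear operators\<close>

text \<open>As a type, the everywhere defined linear maps form a ring, and operator identities
  become ring identities. Boundedness stays a predicate, since it refers to the form
  \<open>ip\<close>.\<close>

typedef (overloaded) 'a lop = "{f :: 'a::complex_vector => 'a. clinear_on UNIV f}"
 morphisms lapp Lop
 by (rule exI[of _ "\<lambda>x. 0"]) (simp add: clinear_on_def)

setup_lifting type_definition_lop

declare [[coercion lapp]]

instantiation lop :: (complex_vector) "{ring, monoid_mult, complex_vector}"
begin

lift_definition zero_lop :: "'a lop" is "\<lambda>x. 0" by (simp add: clinear_on_def)
lift_definition one_lop :: "'a lop" is "\<lambda>x. x" by (simp add: clinear_on_def)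
lift_definition plus_lop :: "'a lop => 'a lop => 'a lop" is "\<lambda>f g x. f x + g x"
 by (simp add: clinear_on_def complex_vector.scale_right_distrib)
lift_definition minus_lop :: "'a lop => 'a lop => 'a lop" is "\<lambda>f g x. f x - g x"
 by (simp add: clinear_on_def complex_vector.scale_right_diff_distrib)
lift_definition uminus_lop :: "'a lop => 'a lop" is "\<lambda>f x. - f x"
 by (simp add: clinear_on_def)
lift_definition times_lop :: "'a lop => 'a lop => 'a lop" is "\<lambda>f g x. f (g x)"
 by (simp add: clinear_on_def)
lift_definition scaleC_lop :: "complex => 'a lop => 'a lop" is "\<lambda>c f x. c *\<^sub>C f x"
 by (simp add: clinear_on_def complex_vector.scale_right_distrib mult.commute)

instance
proof
 fix a b c :: "'a lop" and r s :: complex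
 show "a + b + c = a + (b + c)" "a + b = b + a" "0 + a = a" "- a + a = 0" "a - b = a + - b"
  by (transfer, simp add: fun_eq_iff algebra_simps)+
 show "a * b * c = a * (b * c)" "1 * a = a" "a * 1 = a" "(a + b) * c = a * c + b * c"
  by (transfer, simp add: fun_eq_iff algebra_simps)+
 show "a * (b + c) = a * b + a * c" by (transfer, simp add: fun_eq_iff clinear_on_def)
 show "r *\<^sub>C (a + b) = r *\<^sub>C a + r *\<^sub>C b" "(r + s) *\<^sub>C a = r *\<^sub>C a + s *\<^sub>C a"
  "r *\<^sub>C s *\<^sub>C a = (r * s) *\<^sub>C a" "1 *\<^sub>C a = a"
  by (transfer, simp add: fun_eq_iff complex_vector.scale_right_distrib complex_vector.scale_left_distrib)+
qed

end

lemma lop_eqI: "(!!x. lapp X x = lapp Y x) ==> X = Y"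
 by transfer auto

lemma lapp_zero [simp]: "lapp 0 x = 0" by transfer simp
lemma lapp_one [simp]: "lapp 1 x = x" by transfer simp
lemma lapp_add [simp]: "lapp (X + Y) x = X x + Y x" by transfer simp
lemma lapp_diff [simp]: "lapp (X - Y) x = X x - Y x" by transfer simp
lemma lapp_uminus [simp]: "lapp (- X) x = - X x" by transfer simp
lemma lapp_mult [simp]: "lapp (X * Y) x = X (Y x)" by transfer simp
lemma lapp_scale [simp]: "lapp (c *\<^sub>C X) x = c *\<^sub>C X x" by transfer simp

lemma lop_add [simp]: "lapp X (x + y) = X x + X y"
 by transfer (simp add: clinear_on_def)
lemma lop_scale [simp]: "lapp X (c *\<^sub>C x) = c *\<^sub>C X x"
 by transfer (simp add: clinear_on_def)
lemma lop_zero [simp]: "lapp X 0 = 0"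
 using lop_scale[of X 0 0] by simp
lemma lop_minus [simp]: "lapp X (- x) = - X x"
 using lop_scale[of X "-1" x] by simp
lemma lop_diff [simp]: "lapp X (x - y) = X x - X y"
 using lop_add[of X x "- y"] by simp

lemma lapp_Lop: "(!!x y. f (x + y) = f x + f y) ==> (!!c x. f (c *\<^sub>C x) = c *\<^sub>C f x) ==> lapp (Lop f) = f"
 by (simp add: Lop_inverse clinear_on_def)

lemma lop_mult_scale [simp]: "X * (c *\<^sub>C Y) = c *\<^sub>C (X * Y)" "(c *\<^sub>C X) * Y = c *\<^sub>C (X * (Y :: 'a::complex_vector lop))"
 by (rule lop_eqI; simp)+

text \<open>A polynomial is kept as a function of the operator so that the same one can be evaluated
  at two intertwined operators, one in the Krein space and one in the model.\<close>

inductive polyfun :: "('a::complex_vector lop => 'a lop) => bool" where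
 ident: "polyfun (\<lambda>B. B)"
| one: "polyfun (\<lambda>B. 1)"
| add: "polyfun F ==> polyfun G ==> polyfun (\<lambda>B. F B + G B)"
| mult: "polyfun F ==> polyfun G ==> polyfun (\<lambda>B. F B * G B)"
| scale: "polyfun F ==> polyfun (\<lambda>B. c *\<^sub>C F B)"

lemma polyfun_diff: "polyfun F ==> polyfun G ==> polyfun (\<lambda>B. F B - G B)"
 using polyfun.add[of F "\<lambda>B. (-1) *\<^sub>C G B"] polyfun.scale[of G "-1"] by simp

lemma polyfun_intertwine:
 assumes "polyfun F" "D * X = Y * D" shows "D * F X = F Y * D"
 using assms by (induction rule: polyfun.induct) (simp_all add: distrib_left distrib_right mult.assoc[symmetric], metis mult.assoc)

lemma polyfun_commute: "polyfun F ==> V * X = X * V ==> V * F X = F X * V"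
 by (rule polyfun_intertwine)

section \<open>Bounded operators on a Hilbert space\<close>

locale hilbert_ops = hilbert_space UNIV ip for ip :: "'a::complex_vector => 'a => complex"
begin

definition bnd :: "'a lop => bool" where "bnd X \<longleftrightarrow> (\<exists>C. \<forall>x. nrm (X x) <= C * nrm x)"

definition sym :: "'a lop => bool" where "sym X \<longleftrightarrow> (\<forall>x y. ip (X x) y = ip x (X y))"

definition pos :: "'a lop => bool" where "pos X \<longleftrightarrow> sym X \<and> (\<forall>x. 0 <= Re (ip (X x) x))"

definition slim :: "(nat => 'a lop) => 'a lop => bool" where
 "slim X Z \<longleftrightarrow> (\<forall>x. (\<lambda>n. nrm (X n x - Z x)) \<longlonglongrightarrow> 0)"

text \<open>Membership of \<open>u\<close> in the closure of the range of \<open>S\<close>. For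
  symmetric \<open>S\<close> this closure is the orthogonal complement of ker(S), see
  \<open>clr_ker\<close> and \<open>clr_split\<close>.\<close>

definition clr :: "'a lop => 'a => bool" where "clr S u \<longleftrightarrow> (\<forall>\<epsilon>>0. \<exists>z. nrm (S z - u) < \<epsilon>)"

lemma bndI: "(!!x. nrm (lapp X x) <= C * nrm x) ==> bnd X" by (auto simp: bnd_def)

lemma bndE:
 assumes "bnd X" obtains C where "C > 0" "!!x. nrm (X x) <= C * nrm x"
proof -
 obtain C where C: "nrm (X x) <= C * nrm x" for x using assms by (auto simp: bnd_def)
 have "nrm (X x) <= max C 1 * nrm x" for x
  using C[of x] mult_right_mono[of C "max C 1" "nrm x"] by simp
 thus thesis using that[of "max C 1"] by simp
qed

lemma bnd_0 [simp]: "bnd 0" by (rule bndI[of _ 0]) simp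

lemma bnd_1 [simp]: "bnd 1" by (rule bndI[of _ 1]) simp

lemma bnd_add [simp]: assumes "bnd X" "bnd Y" shows "bnd (X + Y)"
proof -
 obtain C D where "!!x. nrm (X x) <= C * nrm x" "!!x. nrm (Y x) <= D * nrm x"
  using assms by (meson bndE)
 hence "nrm ((X + Y) x) <= (C + D) * nrm x" for x
  using nrm_triangle[of "X x" "Y x"] by (simp add: distrib_right) (smt (verit))
 thus ?thesis by (rule bndI)
qed

lemma bnd_scale [simp]: assumes "bnd X" shows "bnd (c *\<^sub>C X)"
proof -
 obtain C where "C > 0" "!!x. nrm (X x) <= C * nrm x" using assms by (meson bndE)
 hence "nrm ((c *\<^sub>C X) x) <= (cmod c * C) * nrm x" for x
  by (simp add: nrm_scale mult.assoc mult_left_mono)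
 thus ?thesis by (rule bndI)
qed

lemma bnd_minus [simp]: "bnd X ==> bnd (- X)" using bnd_scale[of X "-1"] by simp

lemma bnd_diff [simp]: "bnd X ==> bnd Y ==> bnd (X - Y)" using bnd_add[of X "- Y"] by simp

lemma bnd_mult [simp]: assumes "bnd X" "bnd Y" shows "bnd (X * Y)"
proof -
 obtain C D where C: "C > 0" "!!x. nrm (X x) <= C * nrm x" and D: "!!x. nrm (Y x) <= D * nrm x"
  using assms by (meson bndE)
 have "nrm ((X * Y) x) <= (C * D) * nrm x" for x
 proof -
  have "C * nrm (Y x) <= C * (D * nrm x)" using C(1) D[of x] by (intro mult_left_mono) auto
  thus ?thesis using C(2)[of "Y x"] by (simp only: lapp_mult mult.assoc)
 qed
 thus ?thesis by (rule bndI)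
qed

lemma symD: "sym X ==> ip (X x) y = ip x (X y)" by (simp add: sym_def)

lemma sym_0 [simp]: "sym 0" and sym_1 [simp]: "sym 1" by (simp_all add: sym_def)

lemma sym_add [simp]: "sym X ==> sym Y ==> sym (X + Y)"
 and sym_diff [simp]: "sym X ==> sym Y ==> sym (X - Y)"
 and sym_minus [simp]: "sym X ==> sym (- X)"
 and sym_scale [simp]: "sym X ==> cnj c = c ==> sym (c *\<^sub>C X)"
 by (simp_all add: sym_def)

lemma sym_mult: "sym X ==> sym Y ==> X * Y = Y * X ==> sym (X * Y)"
 unfolding sym_def by (metis lapp_mult)

lemma sym_sq [simp]: "sym X ==> sym (X * X)" by (simp add: sym_def)

lemma sym_Im: "sym X ==> Im (ip (X x) x) = 0"
 using herm[of "X x" x] symD[of X x x] by (metis UNIV_I cnj.simps(2) neg_equal_zero)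

lemma sym_lopI: "(!!x y. ip (lapp X x) y = ip (lapp Y x) y) ==> X = Y"
 by (rule lop_eqI) (auto intro: eqI_left)

lemma symI_bnd: "sym X ==> bnd X ==> \<exists>C>0. \<forall>x. Re (ip (X x) x) <= C * Re (ip x x)"
proof -
 assume "bnd X"
 then obtain C where C: "C > 0" "!!x. nrm (X x) <= C * nrm x" by (meson bndE)
 have "Re (ip (X x) x) <= C * Re (ip x x)" for x
  using Re_le[of "X x" x] mult_right_mono[OF C(2)[of x], of "nrm x"] nrm_sq[of x]
  by (simp add: power2_eq_square mult.assoc)
 thus ?thesis using C by blast
qed

lemma posD: "pos X ==> 0 <= Re (ip (X x) x)" by (simp add: pos_def)
lemma pos_sym [simp]: "pos X ==> sym X" by (simp add: pos_def)
lemma pos_0 [simp]: "pos 0" and pos_1 [simp]: "pos 1" by (simp_all add: pos_def semidef)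
lemma pos_add [simp]: "pos X ==> pos Y ==> pos (X + Y)" by (simp add: pos_def)
lemma pos_scale [simp]: "pos X ==> 0 <= r ==> pos (of_real r *\<^sub>C X)" by (simp add: pos_def)
lemma pos_sq [simp]: "sym X ==> pos (X * X)"
proof -
 assume X: "sym X"
 have "ip (X (X x)) x = ip (X x) (X x)" for x using X symD by blast
 thus "pos (X * X)" using X by (simp add: pos_def semidef)
qed
lemma pos_conj: assumes "sym P" "pos X" shows "pos (P * X * P)"
proof -
 have "ip (P (X (P x))) y = ip (X (P x)) (P y)" "ip x (P (X (P y))) = ip (X (P x)) (P y)" for x y
  using assms by (metis pos_sym sym_def)+
 hence "sym (P * X * P)" "0 <= Re (ip (P (X (P x))) x)" for x
  using posD[OF assms(2), of "P x"] by (simp_all add: sym_def)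
 thus ?thesis by (simp add: pos_def)
qed

text \<open>This is why \<open>psd_space\<close> allows semidefinite forms: Cauchy-Schwarz becomes
  available for the form of every positive operator.\<close>

lemma pos_psd: "pos X ==> psd_space UNIV (\<lambda>x y. ip (X x) y)"
proof
 assume X: "pos X"
 show "csubspace (UNIV :: 'a set)" by simp
 show "hermitian_form_on UNIV (\<lambda>x y. ip (X x) y)"
  unfolding hermitian_form_on_def
 proof (intro conjI allI ballI)
  show "ip (X y) x = cnj (ip (X x) y)" for x y
   using X herm[of "X x" y] by (simp add: pos_def sym_def)
 qed simp_all
 show "0 <= Re (ip (X x) x)" for x using X by (rule posD)
qed

lemma pos_cs: "pos X ==> (cmod (ip (X x) y))\<^sup>2 <= Re (ip (X x) x) * Re (ip (X y) y)"
proof -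
 assume X: "pos X"
 interpret q: psd_space UNIV "\<lambda>x y. ip (X x) y" using X by (rule pos_psd)
 have "(cmod (ip (X x) y))\<^sup>2 <= (q.nrm x * q.nrm y)\<^sup>2"
  using q.cauchy_schwarz[of x y] by (intro power_mono) auto
 thus ?thesis by (simp add: power_mult_distrib q.nrm_sq)
qed

lemma pos_null: "pos X ==> Re (ip (X x) x) = 0 ==> X x = 0"
proof -
 assume X: "pos X" "Re (ip (X x) x) = 0"
 have "(cmod (ip (X x) (X x)))\<^sup>2 <= 0" using pos_cs[OF X(1), of x "X x"] X(2) by simp
 thus "X x = 0" by (simp add: self_eq)
qed

text \<open>Cauchy-Schwarz for the form of X at x and X x, divided by the square of the norm of X x.
  It serves throughout to turn estimates of forms into estimates of norms.\<close>

lemma pos_bound: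
 assumes X: "pos X" and b: "!!x. nrm (X x) <= C * nrm x"
 shows "(nrm (X x))\<^sup>2 <= C * Re (ip (X x) x)"
proof (cases "nrm (X x) = 0")
 case True
 show ?thesis
 proof (cases "nrm x = 0")
  case False
  hence "0 < nrm x" by (simp add: nrm_pos)
  hence "0 <= C" using b[of x] True by (simp add: zero_le_mult_iff)
  thus ?thesis using True posD[OF X, of x] by simp
 qed (use True in simp)
next
 case False
 define n where "n = nrm (X x)"
 have n: "n > 0" using False nrm_pos[of "X x"] by (auto simp: n_def)
 have "Re (ip (X (X x)) (X x)) <= nrm (X (X x)) * n" using Re_le[of "X (X x)" "X x"] by (simp add: n_def)
 also have "... <= C * n * n" using b[of "X x"] n by (intro mult_right_mono) (auto simp: n_def)
 finally have 1: "Re (ip (X (X x)) (X x)) <= C * n\<^sup>2" by (simp add: power2_eq_square)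
 have "(n\<^sup>2)\<^sup>2 <= Re (ip (X x) x) * Re (ip (X (X x)) (X x))"
  using pos_cs[OF X, of x "X x"] by (simp add: self_eq n_def norm_power)
 also have "... <= Re (ip (X x) x) * (C * n\<^sup>2)" using 1 posD[OF X, of x] by (rule mult_left_mono)
 finally have "n\<^sup>2 * n\<^sup>2 <= (C * Re (ip (X x) x)) * n\<^sup>2" by (simp add: power2_eq_square mult_ac)
 hence "n\<^sup>2 <= C * Re (ip (X x) x)" by (rule mult_right_le_imp_le) (use n in simp)
 thus ?thesis unfolding n_def .
qed

lemma pos_diff_sq:
 assumes "pos R" "pos (1 - R)" shows "pos (R - R * R)"
proof -
 have "R - R * R = R * (1 - R) * R + (1 - R) * R * (1 - R)" by (simp add: algebra_simps)
 thus ?thesis using assms pos_conj[of R "1 - R"] pos_conj[of "1 - R" R] by simp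
qed

lemma pos_contraction:
 assumes "pos R" "pos (1 - R)" shows "nrm (R x) <= nrm x"
proof -
 have "(nrm (R x))\<^sup>2 <= (nrm x)\<^sup>2"
  using posD[OF pos_diff_sq[OF assms], of x] posD[OF assms(2), of x] assms(1)
  by (simp add: nrm_sq symD)
 thus ?thesis by (rule power2_le_imp_le) simp
qed

lemma contraction_pos: "sym X ==> (!!x. nrm (X x) <= nrm x) ==> pos (1 - X)"
proof -
 assume X: "sym X" "!!x. nrm (X x) <= nrm x"
 have "Re (ip (X x) x) <= Re (ip x x)" for x
  using Re_le[of "X x" x] mult_right_mono[OF X(2)[of x], of "nrm x"] nrm_sq[of x]
  by (simp add: power2_eq_square)
 thus ?thesis using X by (simp add: pos_def)
qed

text \<open>Riesz's argument: with \<open>P\<^sub>0 = P\<close> and \<open>P\<^sub>n\<^sub>+\<^sub>1 = P\<^sub>n - P\<^sub>n\<^sup>2\<close> one has \<open>P = \<Sum> P\<^sub>n\<^sup>2\<close>.\<close>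

lemma pos_mult:
 assumes P: "pos P" "bnd P" and Q: "pos Q" "P * Q = Q * P"
 shows "pos (P * Q)"
proof -
 obtain C where C: "C > 0" "!!x. nrm (P x) <= C * nrm x" using P(2) by (meson bndE)
 define R where "R = rec_nat (of_real (1 / C) *\<^sub>C P) (\<lambda>_ R. R - R * R)"
 have R0: "R 0 = of_real (1 / C) *\<^sub>C P" and RS: "R (Suc n) = R n - R n * R n" for n
  by (simp_all add: R_def)
 have R0': "pos (R 0)" unfolding R0 using P C by (intro pos_scale) auto
 have "nrm (R 0 x) <= nrm x" for x
  using C(2)[of x] C(1) by (simp add: R0 nrm_scale norm_divide field_simps)
 hence R0'': "pos (1 - R 0)" using R0' by (intro contraction_pos) auto
 have RR: "pos (R n) \<and> pos (1 - R n)" for n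
 proof (induction n)
  case (Suc n)
  have "1 - R (Suc n) = (1 - R n) + R n * R n" by (simp add: RS)
  moreover have "pos ((1 - R n) + R n * R n)" using Suc by (intro pos_add pos_sq) auto
  ultimately have "pos (1 - R (Suc n))" by metis
  thus ?case using Suc pos_diff_sq[of "R n"] by (simp add: RS)
 qed (simp add: R0' R0'')
 have RQ: "Q * R n = R n * Q" for n
 proof (induction n)
  case (Suc n)
  have "Q * (R n * R n) = (R n * R n) * Q" using Suc by (metis mult.assoc)
  thus ?case using Suc by (simp add: RS algebra_simps)
 qed (simp add: R0 Q)
 have tel: "(\<Sum>k<n. (R k * R k)) = R 0 - R n" for n by (induction n) (simp_all add: RS)
 have tel': "(\<Sum>k<n. lapp (R k * R k) x) = R 0 x - R n x" for n x
  by (induction n) (simp_all add: RS)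
 \<comment> \<open>By \<open>tel'\<close> the squared norms of the R k x add up to at most the form
   of R 0 at x, so they tend to 0.\<close>
 have small: "(\<lambda>n. nrm (R n x)) \<longlonglongrightarrow> 0" for x
 proof -
  have "(\<Sum>k<n. (nrm (R k x))\<^sup>2) <= Re (ip (R 0 x) x)" for n
  proof -
   have "(\<Sum>k<n. (nrm (R k x))\<^sup>2) = Re (ip (\<Sum>k<n. lapp (R k * R k) x) x)"
    using RR by (simp add: sum_left nrm_sq symD)
   thus ?thesis using RR[of n] unfolding tel' by (simp add: posD)
  qed
  hence "summable (\<lambda>k. (nrm (R k x))\<^sup>2)"
   by (intro summableI_nonneg_bounded) auto
  hence "(\<lambda>n. (nrm (R n x))\<^sup>2) \<longlonglongrightarrow> 0" by (rule summable_LIMSEQ_zero)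
  hence "(\<lambda>n. sqrt ((nrm (R n x))\<^sup>2)) \<longlonglongrightarrow> sqrt 0" by (intro tendsto_intros)
  thus ?thesis by simp
 qed
 have "0 <= Re (ip ((R 0 * Q) x) x)" for x
 proof -
  have eq: "Re (ip ((R 0 * Q) x) x) = (\<Sum>k<n. Re (ip (Q (R k x)) (R k x))) + Re (ip (R n x) (Q x))" for n
  proof -
   have a: "ip ((R 0 * Q) x) x = ip (R 0 x) (Q x)"
    using RQ[of 0] Q(1) by (metis lapp_mult pos_sym symD)
   have b: "ip (lapp (R k * R k) x) (Q x) = ip (Q (R k x)) (R k x)" for k
    using RR[of k] RQ[of k] Q(1) by (metis lapp_mult pos_sym symD)
   have "R 0 x = (\<Sum>k<n. lapp (R k * R k) x) + R n x" unfolding tel' by simp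
   hence "ip (R 0 x) (Q x) = (\<Sum>k<n. ip (lapp (R k * R k) x) (Q x)) + ip (R n x) (Q x)"
    by (simp add: sum_left del: lapp_mult)
   thus ?thesis unfolding a b by simp
  qed
  have low: "Re (ip (R n x) (Q x)) <= Re (ip ((R 0 * Q) x) x)" for n
   unfolding eq[of n] using posD[OF Q(1)] by (simp add: sum_nonneg)
  have "(\<lambda>n. Re (ip (R n x) (Q x))) \<longlonglongrightarrow> Re (ip 0 (Q x))"
   by (intro tendsto_intros ip_tendsto) (use small in auto)
  thus ?thesis using low by (intro LIMSEQ_le_const2) auto
 qed
 moreover have "sym (R 0 * Q)" using RQ[of 0] RR[of 0] Q by (intro sym_mult) auto
 ultimately have p: "pos (R 0 * Q)" by (simp add: pos_def)
 have "P * Q = of_real C *\<^sub>C (R 0 * Q)" using C by (simp add: R0)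
 thus ?thesis using pos_scale[OF p, of C] C by simp
qed

subsection \<open>Strong limits\<close>

lemma slimD: "slim X Z ==> (\<lambda>n. nrm (X n x - Z x)) \<longlonglongrightarrow> 0" by (simp add: slim_def)

lemma slim_exists:
 assumes "!!x \<epsilon>. \<epsilon> > 0 ==> \<exists>N. \<forall>m\<ge>N. \<forall>n\<ge>N. nrm (lapp (X m) x - lapp (X n) x) < \<epsilon>"
 obtains Z where "slim X Z"
proof -
 have "\<exists>l. (\<lambda>n. nrm (X n x - l)) \<longlonglongrightarrow> 0" for x
  by (rule complete[of "\<lambda>n. X n x"]) (use assms[of _ x] in auto)
 then obtain f where f: "!!x. (\<lambda>n. nrm (X n x - f x)) \<longlonglongrightarrow> 0" by metis
 have "f (x + y) = f x + f y" for x y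
 proof (rule limit_unique[OF _ _ _ f])
  show "(\<lambda>n. nrm (X n (x + y) - (f x + f y))) \<longlonglongrightarrow> 0"
  proof (rule Lim_null_comparison)
   show "(\<lambda>n. nrm (X n x - f x) + nrm (X n y - f y)) \<longlonglongrightarrow> 0" using tendsto_add[OF f[of x] f[of y]] by simp
   have "nrm (X n (x + y) - (f x + f y)) <= nrm (X n x - f x) + nrm (X n y - f y)" for n
    using nrm_triangle[of "X n x - f x" "X n y - f y"] by (simp only: UNIV_I simp_thms lop_add add_diff_add)
   thus "\<forall>\<^sub>F n in sequentially. norm (nrm (X n (x + y) - (f x + f y))) <= nrm (X n x - f x) + nrm (X n y - f y)"
    by simp
  qed
 qed auto
 moreover have "f (c *\<^sub>C x) = c *\<^sub>C f x" for c x
 proof (rule limit_unique[OF _ _ _ f])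
  have "(\<lambda>n. cmod c * nrm (X n x - f x)) \<longlonglongrightarrow> 0" using tendsto_mult_right_zero[OF f[of x]] by simp
  moreover have "cmod c * nrm (X n x - f x) = nrm (X n (c *\<^sub>C x) - c *\<^sub>C f x)" for n
   using nrm_scale[of "X n x - f x" c] by (simp add: complex_vector.scale_right_diff_distrib)
  ultimately show "(\<lambda>n. nrm (X n (c *\<^sub>C x) - c *\<^sub>C f x)) \<longlonglongrightarrow> 0" by simp
 qed auto
 ultimately have "lapp (Lop f) = f" by (rule lapp_Lop)
 hence "slim X (Lop f)" using f by (simp add: slim_def)
 thus thesis by (rule that)
qed

lemma slim_ip: "slim X Z ==> (\<lambda>n. ip (X n x) y) \<longlonglongrightarrow> ip (Z x) y"
 by (rule ip_tendsto) (auto simp: slim_def)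

lemma slim_unique: "slim X Z ==> slim X Z' ==> Z = Z'"
 by (rule lop_eqI) (auto intro!: limit_unique[of "\<lambda>n. X n _"] simp: slim_def)

lemma slim_sym: assumes "slim X Z" "!!n. sym (X n)" shows "sym Z"
 unfolding sym_def
proof (intro allI)
 fix x y
 have "(\<lambda>n. ip x (X n y)) \<longlonglongrightarrow> ip x (Z y)"
  by (rule ip_tendsto_right) (use slimD[OF assms(1)] in auto)
 hence "(\<lambda>n. ip (X n x) y) \<longlonglongrightarrow> ip x (Z y)" using assms(2) by (simp add: symD)
 thus "ip (Z x) y = ip x (Z y)" using slim_ip[OF assms(1)] LIMSEQ_unique by blast
qed

lemma slim_pos: assumes "slim X Z" "!!n. pos (X n)" shows "pos Z"
proof -
 have "0 <= Re (ip (Z x) x)" for x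
 proof (rule LIMSEQ_le_const)
  show "(\<lambda>n. Re (ip (X n x) x)) \<longlonglongrightarrow> Re (ip (Z x) x)" by (intro tendsto_intros slim_ip assms)
 qed (use assms posD in auto)
 thus ?thesis using assms slim_sym by (simp add: pos_def)
qed

lemma slim_bound: assumes "slim X Z" "!!n x. nrm (X n x) <= C * nrm x" shows "nrm (Z x) <= C * nrm x"
proof (rule LIMSEQ_le_const2)
 show "(\<lambda>n. nrm (X n x)) \<longlonglongrightarrow> nrm (Z x)" by (rule nrm_tendsto) (use slimD[OF assms(1)] in auto)
qed (use assms(2) in auto)

lemma slim_const [simp]: "slim (\<lambda>n. Z) Z" by (simp add: slim_def)

lemma slim_add: assumes "slim X Z" "slim Y W" shows "slim (\<lambda>n. X n + Y n) (Z + W)"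
 unfolding slim_def
proof
 fix x
 show "(\<lambda>n. nrm ((X n + Y n) x - (Z + W) x)) \<longlonglongrightarrow> 0"
 proof (rule Lim_null_comparison)
  show "(\<lambda>n. nrm (X n x - Z x) + nrm (Y n x - W x)) \<longlonglongrightarrow> 0"
   using tendsto_add[OF slimD[OF assms(1), of x] slimD[OF assms(2), of x]] by simp
  have "nrm ((X n + Y n) x - (Z + W) x) <= nrm (X n x - Z x) + nrm (Y n x - W x)" for n
   using nrm_triangle[of "X n x - Z x" "Y n x - W x"] by (simp only: UNIV_I simp_thms lapp_add add_diff_add)
  thus "\<forall>\<^sub>F n in sequentially. norm (nrm ((X n + Y n) x - (Z + W) x)) <= nrm (X n x - Z x) + nrm (Y n x - W x)"
   by simp
 qed
qed

lemma slim_mult_left: assumes "slim X Z" "bnd V" shows "slim (\<lambda>n. V * X n) (V * Z)"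
 unfolding slim_def
proof
 fix x
 obtain C where C: "C > 0" "!!x. nrm (V x) <= C * nrm x" using assms by (meson bndE)
 show "(\<lambda>n. nrm ((V * X n) x - (V * Z) x)) \<longlonglongrightarrow> 0"
 proof (rule Lim_null_comparison)
  show "(\<lambda>n. C * nrm (X n x - Z x)) \<longlonglongrightarrow> 0" using tendsto_mult_right_zero[OF slimD[OF assms(1), of x]] by simp
  show "\<forall>\<^sub>F n in sequentially. norm (nrm ((V * X n) x - (V * Z) x)) <= C * nrm (X n x - Z x)"
  proof -
   have "nrm ((V * X n) x - (V * Z) x) <= C * nrm (X n x - Z x)" for n
    using C(2)[of "X n x - Z x"] by simp
   thus ?thesis by simp
  qed
 qed
qed

lemma slim_mult_right: "slim X Z ==> slim (\<lambda>n. X n * V) (Z * V)"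
 by (simp add: slim_def)

lemma slim_scale: "slim X Z ==> slim (\<lambda>n. c *\<^sub>C X n) (c *\<^sub>C Z)"
 using slim_mult_left[of X Z "c *\<^sub>C 1"] by simp

lemma slim_diff: "slim X Z ==> slim Y W ==> slim (\<lambda>n. X n - Y n) (Z - W)"
 using slim_add[of X Z "\<lambda>n. (-1) *\<^sub>C Y n" "(-1) *\<^sub>C W"] slim_scale[of Y W "-1"] by simp

lemma slim_mult:
 assumes X: "slim X Z" and Y: "slim Y W" and b: "!!n x. nrm (X n x) <= C * nrm x"
 shows "slim (\<lambda>n. X n * Y n) (Z * W)"
 unfolding slim_def
proof
 fix x
 show "(\<lambda>n. nrm ((X n * Y n) x - (Z * W) x)) \<longlonglongrightarrow> 0"
 proof (rule Lim_null_comparison)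
  show "(\<lambda>n. C * nrm (Y n x - W x) + nrm (X n (W x) - Z (W x))) \<longlonglongrightarrow> 0"
   using tendsto_add[OF tendsto_mult_right_zero[OF slimD[OF Y, of x], of C] slimD[OF X, of "W x"]] by simp
  have "nrm (X n (Y n x) - Z (W x)) <= C * nrm (Y n x - W x) + nrm (X n (W x) - Z (W x))" for n
   using nrm_diff_triangle[of "X n (Y n x)" "X n (W x)" "Z (W x)"] b[of n "Y n x - W x"] by simp
  thus "\<forall>\<^sub>F n in sequentially. norm (nrm ((X n * Y n) x - (Z * W) x))
    <= C * nrm (Y n x - W x) + nrm (X n (W x) - Z (W x))" by simp
 qed
qed

lemma slim_commute: "slim X Z ==> bnd V ==> (!!n. V * X n = X n * V) ==> V * Z = Z * V"
 using slim_mult_left[of X Z V] slim_mult_right[of X Z V] slim_unique by fastforce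

end

section \<open>Square roots, negative spectral projections and factorisation\<close>

context hilbert_ops
begin

text \<open>The mechanism behind the convergence of monotone sequences of operators: squared
  increments are dominated by increments of a bounded increasing real sequence. In the applications
  \<open>a x n\<close> is a multiple of a form or of a squared norm at x.\<close>

lemma slim_mono:
 assumes inc: "!!x m n. n <= m ==> (nrm (lapp (X m) x - lapp (X n) x))\<^sup>2 <= a x m - a x n"
  and le: "!!x n. a x n <= (b x :: real)"
 obtains Z where "slim X Z"
proof (rule slim_exists[of X])
 fix x and \<epsilon> :: real assume e: "\<epsilon> > 0"
 have "a x n <= a x m" if "n <= m" for m n
  using inc[OF that, of x] zero_le_power2[of "nrm (X m x - X n x)"] by linarith
 hence "incseq (a x)" by (simp add: incseq_def)
 then obtain L where L: "a x \<longlonglongrightarrow> L" "!!n. a x n <= L"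
  using incseq_convergent[of "a x" "b x"] le by blast
 obtain N where "\<forall>n\<ge>N. norm (a x n - L) < \<epsilon>\<^sup>2" using LIMSEQ_D[OF L(1), of "\<epsilon>\<^sup>2"] e by auto
 hence N: "L - a x n < \<epsilon>\<^sup>2" if "n \<ge> N" for n using that by (metis abs_less_iff minus_diff_eq real_norm_def)
 have *: "nrm (X m x - X n x) < \<epsilon>" if "N <= n" "n <= m" for m n
 proof -
  have "(nrm (X m x - X n x))\<^sup>2 < \<epsilon>\<^sup>2" using inc[OF that(2), of x] N[OF that(1)] L(2)[of m] by linarith
  thus ?thesis using e by (simp add: power2_less_imp_less)
 qed
 show "\<exists>N. \<forall>m\<ge>N. \<forall>n\<ge>N. nrm (X m x - X n x) < \<epsilon>"
 proof (intro exI allI impI)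
  fix m n assume "N <= m" "N <= n"
  thus "nrm (X m x - X n x) < \<epsilon>"
   using *[of n m] *[of m n] nrm_minus_commute[of "X m x" "X n x"] by (cases "n <= m") auto
 qed
qed (use that in blast)

lemma slim_Suc: "slim X Z ==> slim (\<lambda>n. X (Suc n)) Z"
 unfolding slim_def using LIMSEQ_Suc by fastforce

text \<open>After scaling C to a contraction 1 - R, the root is sought as 1 - Z, which leads to the
  fixed point equation Z = (R + Z^2) / 2. The iterates starting from 0 increase because W (n + 2) -
  W (n + 1) is half the product of W (n + 1) + W n and W (n + 1) - W n, and \<open>pos_mult\<close>
  applies to it.\<close>

theorem pos_sqrt:
 assumes C: "pos C" "bnd C"
 obtains D where "pos D" "bnd D" "D * D = C" "!!V. bnd V ==> V * C = C * V ==> V * D = D * V"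
proof -
 obtain c where c: "c > 0" "!!x. nrm (C x) <= c * nrm x" using C(2) by (meson bndE)
 define C' where "C' = of_real (1 / c) *\<^sub>C C"
 define R where "R = 1 - C'"
 have C'p: "pos C'" unfolding C'_def using C c by (intro pos_scale) auto
 have C'c: "nrm (C' x) <= nrm x" for x
  using c(2)[of x] c(1) by (simp add: C'_def nrm_scale norm_divide field_simps)
 have R: "pos R" unfolding R_def by (rule contraction_pos) (use C'p C'c in auto)
 have Rc: "nrm (R x) <= nrm x" for x
  by (rule pos_contraction[OF R]) (simp add: R_def C'p)
 have Rb: "bnd R" using Rc by (intro bndI[of _ 1]) simp
 define W where "W = rec_nat 0 (\<lambda>_ W. of_real (1/2) *\<^sub>C (R + W * W))"
 have W0: "W 0 = 0" and WS: "W (Suc n) = of_real (1/2) *\<^sub>C (R + W n * W n)" for n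
  by (simp_all add: W_def)
 have comm: "V * W n = W n * V" if "V * C = C * V" for V n
 proof (induction n)
  case (Suc n)
  have "V * (W n * W n) = W n * W n * V" using Suc by (metis mult.assoc)
  moreover have "V * R = R * V" using that by (simp add: R_def C'_def algebra_simps)
  ultimately show ?case by (simp add: WS distrib_left distrib_right)
 qed (simp add: W0)
 have Wp: "pos (W n)" for n
 proof (induction n)
  case (Suc n)
  have "pos (R + W n * W n)" using Suc R by (intro pos_add pos_sq) auto
  thus ?case unfolding WS by (intro pos_scale) auto
 qed (simp add: W0)
 have Wc: "nrm (W n x) <= nrm x" for n x
 proof (induction n arbitrary: x)
  case (Suc n)
  have "nrm (R x + W n (W n x)) <= nrm (R x) + nrm (W n (W n x))" by (rule nrm_triangle) auto
  also have "... <= 2 * nrm x" using Rc[of x] Suc[of x] Suc[of "W n x"] by simp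
  finally show ?case by (simp add: WS nrm_scale del: complex_vector.scale_right_distrib)
 qed (simp add: W0)
 have Wb: "bnd (W n)" for n using Wc by (intro bndI[of _ 1]) simp
 have WC: "W m * W n = W n * W m" for m n
  using comm[of "W m" n] comm[of C m] by simp
 have step: "pos (W (Suc n) - W n)" for n
 proof (induction n)
  case 0
  show ?case using R pos_scale[OF R, of "1/2"] by (simp add: W0 WS)
 next
  case (Suc n)
  have a: "(W (Suc n) + W n) * (W (Suc n) - W n) = W (Suc n) * W (Suc n) - W n * W n"
   using WC[of n "Suc n"] by (simp add: algebra_simps)
  have "W (Suc (Suc n)) - W (Suc n) = of_real (1/2) *\<^sub>C ((W (Suc n) + W n) * (W (Suc n) - W n))"
   unfolding a by (subst WS, subst (3) WS) (simp add: complex_vector.scale_right_diff_distrib[symmetric])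
  moreover have "pos ((W (Suc n) + W n) * (W (Suc n) - W n))"
   by (rule pos_mult) (use Wp Wb Suc WC[of n "Suc n"] in \<open>auto simp: algebra_simps\<close>)
  ultimately show ?case using pos_scale[of "(W (Suc n) + W n) * (W (Suc n) - W n)" "1/2"] by simp
 qed
 have mono: "pos (W m - W n)" if "n <= m" for m n
  using that
 proof (induction m rule: dec_induct)
  case (step m)
  thus ?case using pos_add[of "W m - W n" "W (Suc m) - W m"] \<open>!!n. pos (W (Suc n) - W n)\<close> by simp
 qed simp
 obtain Z where Z: "slim W Z"
 proof (rule slim_mono[of W "\<lambda>x n. 2 * Re (ip (W n x) x)" "\<lambda>x. 2 * (nrm x)\<^sup>2"])
  fix x m n assume nm: "n <= (m :: nat)"
  have "nrm ((W m - W n) x) <= 2 * nrm x" for x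
   using nrm_triangle_diff[of "W m x" "W n x"] Wc[of m x] Wc[of n x] by simp
  from pos_bound[OF mono[OF nm] this, of x]
  show "(nrm (W m x - W n x))\<^sup>2 <= 2 * Re (ip (W m x) x) - 2 * Re (ip (W n x) x)" by simp
 next
  fix x n
  have "Re (ip (W n x) x) <= nrm x * nrm x"
   using Re_le[of "W n x" x] mult_right_mono[OF Wc[of n x], of "nrm x"] by simp
  thus "2 * Re (ip (W n x) x) <= 2 * (nrm x)\<^sup>2" by (simp add: power2_eq_square)
 qed
 have Zp: "pos Z" using slim_pos[OF Z] Wp by blast
 have Zc: "nrm (Z x) <= 1 * nrm x" for x using slim_bound[OF Z, of 1] Wc by simp
 have Zb: "bnd Z" using Zc by (rule bndI)
 have "slim (\<lambda>n. W n * W n) (Z * Z)" by (rule slim_mult[OF Z Z, of 1]) (use Wc in simp)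
 hence "slim (\<lambda>n. W (Suc n)) (of_real (1/2) *\<^sub>C (R + Z * Z))"
  unfolding WS by (intro slim_scale slim_add slim_const)
 hence Zeq: "Z = of_real (1/2) *\<^sub>C (R + Z * Z)" using slim_unique[OF slim_Suc[OF Z]] by blast
 have "Z + Z = R + Z * Z"
 proof -
  have "Z + Z = (2::complex) *\<^sub>C Z"
   using complex_vector.scale_left_distrib[of 1 1 Z] by simp
  also have "... = R + Z * Z" by (subst Zeq) simp
  finally show ?thesis .
 qed
 hence D2: "(1 - Z) * (1 - Z) = C'" by (simp add: R_def algebra_simps)
 have D'p: "pos (1 - Z)" by (rule contraction_pos) (use Zp Zc in auto)
 show thesis
 proof (rule that[of "of_real (sqrt c) *\<^sub>C (1 - Z)"])
  show "pos (of_real (sqrt c) *\<^sub>C (1 - Z))" using D'p c by (intro pos_scale) auto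
  show "bnd (of_real (sqrt c) *\<^sub>C (1 - Z))" using Zb by simp
  have "complex_of_real (sqrt c) * complex_of_real (sqrt c) = of_real c"
   using c by (metis less_imp_le of_real_mult real_sqrt_mult_self abs_of_nonneg)
  hence "of_real (sqrt c) *\<^sub>C (1 - Z) * of_real (sqrt c) *\<^sub>C (1 - Z) = of_real c *\<^sub>C C'"
   by (simp only: lop_mult_scale complex_vector.scale_scale D2)
  thus "of_real (sqrt c) *\<^sub>C (1 - Z) * of_real (sqrt c) *\<^sub>C (1 - Z) = C"
   using c by (simp add: C'_def)
  fix V assume V: "bnd V" "V * C = C * V"
  have "V * Z = Z * V" using slim_commute[OF Z V(1)] comm[OF V(2)] by blast
  thus "V * of_real (sqrt c) *\<^sub>C (1 - Z) = of_real (sqrt c) *\<^sub>C (1 - Z) * V"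
   by (simp add: algebra_simps)
 qed
qed

lemma proj_contraction:
 assumes "sym N" "N * N = N" shows "nrm (N x) <= nrm x"
proof -
 have "ip (N x) (N x) = ip (N x) x" using assms by (metis lapp_mult symD)
 hence "nrm (N x) * nrm (N x) <= nrm (N x) * nrm x"
  using Re_le[of "N x" x] nrm_sq[of "N x"] by (simp add: power2_eq_square)
 thus ?thesis by (cases "nrm (N x) = 0") (auto simp: mult_le_cancel_left nrm_pos)
qed

lemma proj_bnd: "sym N ==> N * N = N ==> bnd N"
 using proj_contraction by (intro bndI[of _ 1]) simp

lemma four_scale: "(4::complex) *\<^sub>C (x::'b::complex_vector) = x + x + x + x"
proof -
 have "(4::complex) *\<^sub>C x = (1 + 1 + 1 + 1) *\<^sub>C x" by simp
 thus ?thesis by (simp only: complex_vector.scale_left_distrib complex_vector.scale_one)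
qed

text \<open>The sign of a contraction is the strong limit of the Newton iteration
 \<open>X \<mapsto> X (3 - X\<^sup>2) / 2\<close>, all of whose iterates are polynomials in it.\<close>

theorem negative_projection:
 assumes B: "sym B" "bnd B"
 obtains N F where "sym N" "N * N = N" "pos (- (B * N))" "pos (B * (1 - N))" "!!x. B x = 0 ==> N x = 0"
  "!!n. polyfun (F n)" "slim (\<lambda>n. F n B) N"
proof -
 obtain c where c: "c > 0" "!!x. nrm (B x) <= c * nrm x" using B(2) by (meson bndE)
 define F :: "nat => 'a lop => 'a lop" where
  "F = rec_nat (\<lambda>B. of_real (1 / c) *\<^sub>C B) (\<lambda>_ G B. G B + (1/2) *\<^sub>C (G B * (1 - G B * G B)))"
 have F0: "F 0 = (\<lambda>B. of_real (1 / c) *\<^sub>C B)"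
  and FS: "F (Suc n) = (\<lambda>B. F n B + (1/2) *\<^sub>C (F n B * (1 - F n B * F n B)))" for n
  by (simp_all add: F_def)
 have poly: "polyfun (F n)" for n
  by (induction n) (auto simp: F0 FS intro!: polyfun.intros polyfun_diff)
 define X P where "X n = F n B" and "P n = 1 - F n B * F n B" for n
 have X0: "X 0 = of_real (1 / c) *\<^sub>C B" by (simp add: X_def F0)
 have XS: "X (Suc n) = X n + (1/2) *\<^sub>C (X n * P n)" for n by (simp add: X_def FS P_def)
 have P: "P n = 1 - X n * X n" for n by (simp add: X_def P_def)
 have XX: "X m * X n = X n * X m" for m n
  unfolding X_def by (intro polyfun_commute[OF poly] polyfun_commute[OF poly, symmetric]) simp
 have XP: "X m * P n = P n * X m" for m n
  using XX[of m n] unfolding P by (simp add: algebra_simps) (metis mult.assoc)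
 have Xs: "sym (X n)" for n
 proof (induction n)
  case 0 show ?case using B by (simp add: X0)
 next
  case (Suc n)
  have "sym (X n * P n)" using Suc XP by (intro sym_mult) (simp_all add: P)
  thus ?case using Suc unfolding XS by (intro sym_add sym_scale) auto
 qed
 have X0c: "nrm (X 0 x) <= nrm x" for x
  using c(2)[of x] c(1) by (simp add: X0 nrm_scale norm_divide field_simps)
 \<comment> \<open>The iteration replaces P = 1 - X^2 by (P^3 + 3 P^2) / 4. This keeps P positive,
   that is, X a contraction.\<close>
 have P': "(4::complex) *\<^sub>C P (Suc n) = P n * P n * P n + (P n * P n + (P n * P n + P n * P n))" for n
 proof -
  define Y where "Y = X n"
  define Q where "Q = Y + Y + Y * (1 - Y * Y)"
  have two: "(2::complex) *\<^sub>C X (Suc n) = Q"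
   using complex_vector.scale_left_distrib[of 1 1 Y]
   by (simp add: XS P Y_def[symmetric] Q_def complex_vector.scale_right_distrib)
  have "(2 *\<^sub>C X (Suc n)) * (2 *\<^sub>C X (Suc n)) = (4::complex) *\<^sub>C (X (Suc n) * X (Suc n))" by simp
  hence "(4::complex) *\<^sub>C P (Suc n) = (4::complex) *\<^sub>C 1 - Q * Q"
   by (simp only: P two complex_vector.scale_right_diff_distrib)
  also have "... = 1 + 1 + 1 + 1 - Q * Q" by (simp only: four_scale)
  also have "... = (1 - Y * Y) * (1 - Y * Y) * (1 - Y * Y) + ((1 - Y * Y) * (1 - Y * Y)
    + ((1 - Y * Y) * (1 - Y * Y) + (1 - Y * Y) * (1 - Y * Y)))"
   unfolding Q_def by (simp add: algebra_simps)
  finally show ?thesis by (simp only: P Y_def)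
 qed
 have Pp: "pos (P n)" for n
 proof (induction n)
  case 0
  have "Re (ip (X 0 (X 0 x)) x) <= Re (ip x x)" for x
  proof -
   have "ip (X 0 (X 0 x)) x = ip (X 0 x) (X 0 x)" using Xs symD by blast
   thus ?thesis using X0c[of x] nrm_sq[of x] nrm_sq[of "X 0 x"] by (metis UNIV_I nrm_nonneg power_mono)
  qed
  thus ?case using Xs[of 0] by (simp add: P pos_def)
 next
  case (Suc n)
  have "pos (P n * P n * P n + (P n * P n + (P n * P n + P n * P n)))"
   using Suc by (intro pos_add pos_conj pos_sq) auto
  hence "pos (of_real (1/4) *\<^sub>C ((4::complex) *\<^sub>C P (Suc n)))" unfolding P' by (rule pos_scale) simp
  thus ?case by simp
 qed
 have Xn: "(nrm (X n x))\<^sup>2 = Re (ip (X n (X n x)) x)" for n x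
  using Xs[of n] by (metis nrm_sq UNIV_I symD)
 have Xc: "nrm (X n x) <= nrm x" for n x
 proof -
  have "(nrm (X n x))\<^sup>2 <= (nrm x)\<^sup>2" using posD[OF Pp[of n], of x] nrm_sq[of x] by (simp add: Xn P)
  thus ?thesis by (rule power2_le_imp_le) simp
 qed
 have Xb: "bnd (X n)" for n using Xc by (intro bndI[of _ 1]) simp
 have Pb: "bnd (P n)" for n using Xb by (simp add: P)
 have XPX: "X m * X n * P k = P k * (X m * X n)" for m n k using XP by (metis mult.assoc)
 \<comment> \<open>In the functional calculus all X n have the sign of X 0 and their moduli
   increase; stated through products it follows from \<open>pos_mult\<close> and gives the
   hypothesis of \<open>slim_mono\<close>.\<close>
 have mono: "pos (X j * X k - X j * X j)" if "j <= k" for j k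
  using that
 proof (induction k rule: dec_induct)
  case (step k)
  have "pos (X j * X k)" using pos_add[OF step.IH pos_sq[OF Xs[of j]]] by simp
  hence "pos (X j * X k * P k)" using Xb Pp XPX by (intro pos_mult[of "X j * X k"]) auto
  hence "pos (of_real (1/2) *\<^sub>C (X j * X k * P k))" by (rule pos_scale) simp
  from pos_add[OF step.IH this] show ?case by (simp add: XS distrib_left mult.assoc algebra_simps)
 qed simp
 obtain S where S: "slim X S"
 proof (rule slim_mono[of X "\<lambda>x n. (nrm (X n x))\<^sup>2" "\<lambda>x. (nrm x)\<^sup>2"])
  fix x m n assume nm: "n <= (m :: nat)"
  have "ip (X n (X m x)) x = ip (X m x) (X n x)" using Xs symD by blast
  hence "(nrm (X n x))\<^sup>2 <= Re (ip (X m x) (X n x))"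
   using posD[OF mono[OF nm], of x] by (simp add: Xn)
  thus "(nrm (X m x - X n x))\<^sup>2 <= (nrm (X m x))\<^sup>2 - (nrm (X n x))\<^sup>2" by (simp add: nrm_sq_diff)
 next
  show "(nrm (X n x))\<^sup>2 <= (nrm x)\<^sup>2" for x n using Xc by (intro power_mono) auto
 qed
 have Ss: "sym S" using slim_sym[OF S] Xs by blast
 have Sc: "nrm (S x) <= 1 * nrm x" for x using slim_bound[OF S, of 1] Xc by simp
 have Sb: "bnd S" using Sc by (rule bndI)
 have SX: "X n * S = S * X n" for n using slim_commute[OF S Xb] XX by blast
 have "slim (\<lambda>n. X n * X n) (S * S)" by (rule slim_mult[OF S S, of 1]) (use Xc in simp)
 hence "slim P (1 - S * S)" using slim_diff[OF slim_const[of 1]] by (simp add: P[abs_def])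
 hence "slim (\<lambda>n. X n * P n) (S * (1 - S * S))" by (rule slim_mult[OF S, of _ _ 1]) (use Xc in simp)
 hence "slim (\<lambda>n. X (Suc n)) (S + (1/2) *\<^sub>C (S * (1 - S * S)))" unfolding XS
  by (intro slim_add slim_scale S)
 hence "S = S + (1/2) *\<^sub>C (S * (1 - S * S))" using slim_unique[OF slim_Suc[OF S]] by blast
 hence S3: "S * (S * S) = S" by (simp add: algebra_simps)
 have BS: "pos (X 0 * S)" and BS': "pos (X 0 * S - X 0 * X 0)"
 proof -
  have l: "slim (\<lambda>n. X 0 * X n) (X 0 * S)" by (rule slim_mult_left[OF S Xb])
  have "pos (X 0 * X n)" for n using pos_add[OF mono[of 0 n] pos_sq[OF Xs[of 0]]] by simp
  thus "pos (X 0 * S)" by (rule slim_pos[OF l])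
  show "pos (X 0 * S - X 0 * X 0)"
   using slim_pos[OF slim_diff[OF l slim_const[of "X 0 * X 0"]]] mono by blast
 qed
 \<comment> \<open>Since S^3 = S, the range of 1 - S^2 lies in ker(S), where \<open>BS'\<close>
   forces X 0 to vanish.\<close>
 have XSS: "X 0 * (S * S) = X 0"
 proof -
  have "X 0 (x - S (S x)) = 0" for x
  proof -
   define y where "y = x - S (S x)"
   have "S (S (S x)) = S x" using S3 by (metis lapp_mult)
   hence Sy: "S y = 0" by (simp add: y_def)
   have "ip (X 0 (X 0 y)) y = ip (X 0 y) (X 0 y)" using Xs symD by blast
   hence "Re (ip (X 0 y) (X 0 y)) <= 0" using posD[OF BS', of y] Sy by simp
   hence "(nrm (X 0 y))\<^sup>2 <= 0" by (simp add: nrm_sq)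
   thus ?thesis by (simp add: y_def[symmetric])
  qed
  thus ?thesis by (intro lop_eqI) simp
 qed
 \<comment> \<open>S is a symmetric operator with S^3 = S, and (S^2 - S) / 2 projects onto its
   eigenspace for -1. Since S vanishes on ker(B), so does N.\<close>
 define N where "N = (1/2::complex) *\<^sub>C (S * S - S)"
 have Nlim: "slim (\<lambda>n. (1/2::complex) *\<^sub>C (X n * X n - X n)) N"
  unfolding N_def by (intro slim_scale slim_diff S slim_mult[OF S S, of 1]) (use Xc in simp)
 have SN: "S * N = - N" using S3 by (simp add: N_def algebra_simps complex_vector.scale_right_diff_distrib)
 have NS: "N * S = - N" using S3 by (simp add: N_def algebra_simps complex_vector.scale_right_diff_distrib)
 have N2: "N * N = N"
 proof -
  have "N * N = (1/2::complex) *\<^sub>C (N * S * S - N * S)"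
   by (subst (2) N_def) (simp add: right_diff_distrib mult.assoc)
  also have "... = (1/2::complex) *\<^sub>C (N + N)" by (simp add: NS)
  also have "... = N" using complex_vector.scale_left_distrib[of "1/2" "1/2" N]
   by (simp add: complex_vector.scale_right_distrib)
  finally show ?thesis .
 qed
 have Ns: "sym N" unfolding N_def using Ss by (intro sym_scale sym_diff sym_sq) auto
 have XN: "X 0 * N = N * X 0" using SX[of 0] by (simp add: N_def algebra_simps) (metis mult.assoc)
 define M where "M = 1 - N"
 have Ms: "sym M" and M2: "M * M = M" using Ns N2 by (simp_all add: M_def algebra_simps)
 have XSN: "X 0 * S * N = N * (X 0 * S)"
 proof -
  have "N * (X 0 * S) = X 0 * (N * S)" by (simp add: mult.assoc[symmetric] XN)
  thus ?thesis by (simp add: mult.assoc SN NS)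
 qed
 have "- (X 0 * N) = X 0 * S * N" by (simp add: SN mult.assoc)
 also have "... = N * (X 0 * S) * N" using XSN N2 by (metis mult.assoc)
 finally have n1: "pos (- (X 0 * N))" using pos_conj[OF Ns BS] by simp
 have SM: "S * S * M = S * M"
 proof -
  have "S * S * M = S * S - N" using SN by (simp add: M_def algebra_simps)
  moreover have "S * M = S + N" using SN by (simp add: M_def algebra_simps)
  moreover have "N + N = S * S - S"
   using complex_vector.scale_left_distrib[of "1/2" "1/2" "S * S - S"] unfolding N_def by simp
  hence "S * S = S + N + N" by (simp add: add.assoc)
  ultimately show ?thesis by simp
 qed
 have XSM: "X 0 * S * M = M * (X 0 * S)" using XSN by (simp add: M_def algebra_simps)
 have "X 0 * M = X 0 * S * M" using XSS SM by (metis mult.assoc)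
 also have "... = M * (X 0 * S) * M" using XSM M2 by (metis mult.assoc)
 finally have n2: "pos (X 0 * M)" using pos_conj[OF Ms BS] by simp
 have Bc: "B = of_real c *\<^sub>C X 0" using c by (simp add: X0)
 show thesis
 proof (rule that[of N "\<lambda>n B. (1/2::complex) *\<^sub>C (F n B * F n B - F n B)"])
  show "sym N" "N * N = N" by fact+
  have "- (B * N) = of_real c *\<^sub>C (- (X 0 * N))" by (simp add: Bc)
  thus "pos (- (B * N))" using pos_scale[OF n1, of c] c by simp
  have "B * (1 - N) = of_real c *\<^sub>C (X 0 * M)" by (simp add: Bc M_def)
  thus "pos (B * (1 - N))" using pos_scale[OF n2, of c] c by simp
  show "N x = 0" if "B x = 0" for x
  proof -
   have "X n x = 0" for n
   proof (induction n)
    case (Suc n)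
    thus ?case by (simp add: XS P)
   qed (simp add: X0 that)
   hence "(\<lambda>n. nrm (S x)) \<longlonglongrightarrow> 0" using slimD[OF S, of x] by (simp only: diff_0 nrm_minus UNIV_I)
   hence "nrm (S x) = 0" by (simp only: LIMSEQ_const_iff)
   hence "S x = 0" by simp
   thus ?thesis by (simp add: N_def)
  qed
  show "polyfun (\<lambda>B. (1/2::complex) *\<^sub>C (F n B * F n B - F n B))" for n
   using poly by (intro polyfun.intros polyfun_diff)
  show "slim (\<lambda>n. (1/2::complex) *\<^sub>C (F n B * F n B - F n B)) N" using Nlim by (simp add: X_def)
 qed
qed

subsection \<open>Closed ranges and Douglas factorisation\<close>

lemma clrI: "clr S (S z)" unfolding clr_def by (auto intro!: exI[of _ z])

lemma clr_ker:
 assumes S: "sym S" and u: "clr S u" and k: "S k = 0"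
 shows "ip u k = 0"
proof -
 have "cmod (ip u k) <= e * nrm k" if e: "e > 0" for e
 proof -
  obtain z where z: "nrm (S z - u) < e" using u e unfolding clr_def by blast
  have "ip (S z) k = 0" using S k by (simp add: symD)
  hence "ip u k = - ip (S z - u) k" by simp
  hence "cmod (ip u k) <= nrm (S z - u) * nrm k" using cauchy_schwarz[of "S z - u" k] by (metis UNIV_I norm_minus_cancel)
  thus ?thesis using z mult_right_mono[of "nrm (S z - u)" e "nrm k"] by simp
 qed
 from this[of "cmod (ip u k) / (2 * (nrm k + 1))"] show ?thesis
 proof (cases "ip u k = 0")
  case False
  have n: "0 <= nrm k" by simp
  have "0 < 2 * (nrm k + 1)" using n by (simp add: add_nonneg_pos)
  hence p: "0 < cmod (ip u k) / (2 * (nrm k + 1))" using False by (intro divide_pos_pos) auto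
  have "cmod (ip u k) <= cmod (ip u k) / (2 * (nrm k + 1)) * nrm k"
   by (rule \<open>!!e. e > 0 ==> cmod (ip u k) <= e * nrm k\<close>[OF p])
  hence "cmod (ip u k) * (2 * (nrm k + 1)) <= cmod (ip u k) * nrm k" using n by (simp add: field_simps)
  hence "2 * (nrm k + 1) <= nrm k" using False by simp
  hence False using n by (smt (verit))
  thus ?thesis ..
 qed
qed

lemma clr_ker_zero: "sym S ==> clr S u ==> S u = 0 ==> u = 0"
 using clr_ker[of S u u] self_eq[of u] by simp

lemma clr_op:
 assumes V: "bnd V" "V * S = S * V" and u: "clr S u"
 shows "clr S (V u)"
 unfolding clr_def
proof (intro allI impI)
 fix e :: real assume e: "e > 0"
 obtain C where C: "C > 0" "!!x. nrm (V x) <= C * nrm x" using V by (meson bndE)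
 obtain z where z: "nrm (S z - u) < e / C" using u e C unfolding clr_def by (meson divide_pos_pos)
 have "nrm (S (V z) - V u) = nrm (V (S z - u))" using V(2) by (metis lapp_mult lop_diff)
 also have "... <= C * nrm (S z - u)" by (rule C)
 also have "... < e" using z C by (simp add: field_simps)
 finally show "\<exists>z. nrm (S z - V u) < e" by blast
qed

lemma clr_zero:
 assumes Z: "bnd Z" "Z * S = 0" and u: "clr S u"
 shows "Z u = 0"
proof -
 obtain C where C: "C > 0" "!!x. nrm (Z x) <= C * nrm x" using Z by (meson bndE)
 have "nrm (Z u) < e" if e: "e > 0" for e
 proof -
  obtain z where z: "nrm (S z - u) < e / C" using u e C unfolding clr_def by (meson divide_pos_pos)
  have "Z (S z) = 0" using Z(2) by (metis lapp_mult lapp_zero)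
  hence "nrm (Z u) = nrm (Z (S z - u))" by simp
  also have "... <= C * nrm (S z - u)" by (rule C)
  also have "... < e" using z C by (simp add: field_simps)
  finally show ?thesis .
 qed
 from this[of "nrm (Z u)"] show ?thesis using nrm_pos[of "Z u"] by auto
qed

lemma clr_add: assumes "clr S u" "clr S v" shows "clr S (u + v)"
 unfolding clr_def
proof (intro allI impI)
 fix e :: real assume "e > 0"
 then obtain y z where "nrm (S y - u) < e / 2" "nrm (S z - v) < e / 2"
  using assms unfolding clr_def by (meson half_gt_zero)
 moreover have "nrm (S (y + z) - (u + v)) <= nrm (S y - u) + nrm (S z - v)"
  using nrm_triangle[of "S y - u" "S z - v"] by (simp only: UNIV_I simp_thms lop_add add_diff_add)
 ultimately have "nrm (S (y + z) - (u + v)) < e" by linarith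
 thus "\<exists>z. nrm (S z - (u + v)) < e" by blast
qed

lemma clr_scale: "clr S u ==> clr S (c *\<^sub>C u)"
 using clr_op[of "c *\<^sub>C 1" S u] by simp

lemma clr_diff: "clr S u ==> clr S v ==> clr S (u - v)"
 using clr_add[of S u "(-1) *\<^sub>C v"] clr_scale[of S v "-1"] by simp

text \<open>The vector that represents the functional S z \<mapsto> <S z, y> on ran(S) is a limit of
  vectors from ran(S), and its difference from y is orthogonal to ran(S).\<close>

lemma clr_split:
 assumes S: "sym S" obtains u where "clr S u" "S (y - u) = 0"
proof -
 define G where "G = {(S z, ip (S z) y) | z. True}"
 have 1: "(0, 0) \<in> G" unfolding G_def by (auto intro!: exI[of _ 0])
  have 2: "(v + w, s + r) \<in> G" if vw: "(v, s) \<in> G" "(w, r) \<in> G" for v s w r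
  proof -
   obtain a b where "v = S a" "s = ip (S a) y" "w = S b" "r = ip (S b) y" using vw by (auto simp: G_def)
   thus ?thesis unfolding G_def by (auto intro!: exI[of _ "a + b"])
  qed
  have 3: "(c *\<^sub>C v, c * s) \<in> G" if vw: "(v, s) \<in> G" for c v s
  proof -
   obtain a where "v = S a" "s = ip (S a) y" using vw by (auto simp: G_def)
   thus ?thesis unfolding G_def by (auto intro!: exI[of _ "c *\<^sub>C a"])
  qed
  have 4: "cmod s <= nrm y * nrm v" if vw: "(v, s) \<in> G" for v s
   using vw cauchy_schwarz[of v y] by (auto simp: G_def mult.commute)
 obtain u where u: "!!v s. (v, s) \<in> G ==> s = ip v u" "!!\<epsilon>. \<epsilon> > 0 ==> \<exists>v s. (v, s) \<in> G \<and> nrm (v - u) < \<epsilon>"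
  by (rule riesz_graph[of G "nrm y"]; (blast intro: 1 2 3 4 | simp | (rule that; blast)))
 have "S (y - u) = 0"
 proof (rule eq_zeroI)
  fix z
  have "ip (S z) y = ip (S z) u" by (rule u(1)) (auto simp: G_def)
  hence "ip (S z) (y - u) = 0" by simp
  hence "cnj (ip (S z) (y - u)) = 0" by simp
  thus "ip (S (y - u)) z = 0" using S herm[of "S z" "y - u"] by (metis UNIV_I symD)
 qed simp
 moreover have "clr S u" unfolding clr_def
 proof (intro allI impI)
  fix e :: real assume "e > 0"
  from u(2)[OF this] show "\<exists>z. nrm (S z - u) < e" by (auto simp: G_def)
 qed
 ultimately show thesis using that by blast
qed

text \<open>Domination gives ker(S) \<subseteq> ker(F); for symmetric operators, taking orthogonal
  complements reverses this to the ranges.\<close>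

lemma clr_dominated:
 assumes S: "sym S" and F: "sym F" "!!y. nrm (F y) <= M * nrm (S y)"
 shows "clr S (F x)"
proof -
 obtain u where u: "clr S u" "S (F x - u) = 0" using clr_split[OF S] by blast
 define k where "k = F x - u"
 have "nrm (F k) <= M * nrm (S k)" by (rule F(2))
 hence "F k = 0" using u(2) nrm_pos[of "F k"] by (force simp: k_def)
 hence "ip (F x) k = 0" using F(1) by (simp add: symD)
 moreover have "ip u k = 0" by (rule clr_ker[OF S u(1)]) (use u(2) in \<open>simp add: k_def\<close>)
 moreover have "ip k k = ip (F x) k - ip u k" by (subst (1) k_def) simp
 ultimately have "ip k k = 0" by simp
 hence "k = 0" using self_eq[of k] by simp
 thus ?thesis using u(1) by (simp add: k_def)
qed

text \<open>\<open>h x\<close> is the Riesz vector of the functional S y \<mapsto> <F y, x>, taken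
  in the closure of ran(S). \<open>Fsym\<close> makes h symmetric on ran(S), and continuity together
  with h = 0 on ker(S) extends this to the whole space. Uniqueness of h makes it commute with
  whatever commutes with S and F. F is not assumed symmetric: \<open>Yt\<close> arises below with S
  = D and F = D Y.\<close>

theorem douglas:
 assumes S: "sym S" and F: "!!y. nrm (lapp F y) <= M * nrm (lapp S y)" and M: "0 <= M"
  and Fsym: "!!x y. ip (F y) (S x) = ip (S y) (F x)" and Fclr: "!!x. clr S (F x)"
 obtains h where "sym h" "bnd h" "h * S = F" "!!x. S x = 0 ==> h x = 0" "!!x. clr S (h x)"
  "!!V. bnd V ==> V * S = S * V ==> V * F = F * V ==> V * h = h * V"
proof -
 define Q where "Q x u \<longleftrightarrow> clr S u \<and> (\<forall>y. ip (S y) u = ip (F y) x)" for x u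
 have ex: "\<exists>u. Q x u \<and> nrm u <= M * nrm x" for x
 proof -
  define G where "G = {(S z, ip (F z) x) | z. True}"
  have 1:  "(0, 0) \<in> G" unfolding G_def by (auto intro!: exI[of _ 0])
   have 2: "(v + w, s + r) \<in> G" if vw: "(v, s) \<in> G" "(w, r) \<in> G" for v s w r
   proof -
    obtain a b where "v = S a" "s = ip (F a) x" "w = S b" "r = ip (F b) x" using vw by (auto simp: G_def)
    thus ?thesis unfolding G_def by (auto intro!: exI[of _ "a + b"])
   qed
   have 3: "(c *\<^sub>C v, c * s) \<in> G" if vw: "(v, s) \<in> G" for c v s
   proof -
    obtain a where "v = S a" "s = ip (F a) x" using vw by (auto simp: G_def)
    thus ?thesis unfolding G_def by (auto intro!: exI[of _ "c *\<^sub>C a"])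
   qed
   have 4: "cmod s <= M * nrm x * nrm v" if vw: "(v, s) \<in> G" for v s
   proof -
    obtain a where a: "v = S a" "s = ip (F a) x" using vw by (auto simp: G_def)
    have "cmod s <= nrm (F a) * nrm x" using cauchy_schwarz[of "F a" x] a by simp
    also have "... <= M * nrm (S a) * nrm x" using F by (intro mult_right_mono) auto
    finally show ?thesis by (simp add: a mult_ac)
   qed
   have 5: "0 <= M * nrm x" using M by simp
  obtain u where u: "!!v s. (v, s) \<in> G ==> s = ip v u" "nrm u <= M * nrm x"
   "!!\<epsilon>. \<epsilon> > 0 ==> \<exists>v s. (v, s) \<in> G \<and> nrm (v - u) < \<epsilon>"
   by (rule riesz_graph[of G "M * nrm x"]; (blast intro: 1 2 3 4 5 | simp | (rule that; blast)))
  have "clr S u" unfolding clr_def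
  proof (intro allI impI)
   fix e :: real assume "e > 0"
   from u(3)[OF this] show "\<exists>z. nrm (S z - u) < e" by (auto simp: G_def)
  qed
  moreover have "ip (S y) u = ip (F y) x" for y     proof -
   have "(S y, ip (F y) x) \<in> G" by (auto simp: G_def)
   from u(1)[OF this] show ?thesis by simp
  qed
  ultimately show ?thesis using u(2) by (auto simp: Q_def)
 qed
 have uniq: "u = u'" if "Q x u" "Q x u'" for x u u'
 proof -
  have "ip (S (u - u')) y = 0" for y
  proof -
   have "ip (S y) (u - u') = 0" using that by (simp add: Q_def)
   thus ?thesis using S herm[of "S y" "u - u'"] by (metis UNIV_I complex_cnj_zero symD)
  qed
  hence "S (u - u') = 0" by (intro eq_zeroI) auto
  thus ?thesis using clr_ker_zero[OF S, of "u - u'"] clr_diff[of S u u'] that by (simp add: Q_def)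
 qed
 define f where "f x = (THE u. Q x u)" for x
 have f: "Q x (f x)" for x unfolding f_def using ex uniq by (metis theI)
 have fb: "nrm (f x) <= M * nrm x" for x using ex[of x] uniq[OF f, of x] by auto
 have "f (x + y) = f x + f y" for x y
  by (rule uniq[OF f]) (use f clr_add in \<open>auto simp: Q_def\<close>)
 moreover have "f (c *\<^sub>C x) = c *\<^sub>C f x" for c x
  by (rule uniq[OF f]) (use f clr_scale in \<open>auto simp: Q_def\<close>)
 ultimately have lf: "lapp (Lop f) = f" by (rule lapp_Lop)
 define h where "h = Lop f"
 have h: "lapp h x = f x" for x by (simp add: h_def lf)
 have hclr: "clr S (h x)" for x using f[of x] by (simp add: h Q_def)
 have hip: "ip (S y) (h x) = ip (F y) x" for x y using f[of x] by (simp add: h Q_def)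
 have hS: "h * S = F"
  by (rule lop_eqI) (use uniq[OF f, of "S _" "F _"] Fclr Fsym in \<open>auto simp: h Q_def\<close>)
 have hk: "h k = 0" if "S k = 0" for k
 proof -
  have "Q k 0" using clr_scale[OF Fclr[of k], of 0] clr_ker[OF S Fclr that] by (simp add: Q_def)
  thus ?thesis using uniq[OF f] by (simp add: h)
 qed
 have hbound: "nrm (h x) <= M * nrm x" for x using fb by (simp add: h)
 have hb: "bnd h" using hbound by (rule bndI)
 have hip': "ip (h x) (S b) = ip x (h (S b))" for x b
 proof -
  have "ip (h x) (S b) = cnj (ip (S b) (h x))" by (rule herm) auto
  also have "... = ip x (F b)" using herm[of "F b" x] by (simp add: hip)
  also have "F b = h (S b)" using hS by (metis lapp_mult)
  finally show ?thesis .
 qed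
 have hsym: "sym h" unfolding sym_def
 proof (intro allI)
  fix x y
  obtain u where u: "clr S u" "S (y - u) = 0" using clr_split[OF S] by blast
  define e where "e = ip (h x) u - ip x (h u)"
  define K where "K = nrm (h x) + nrm x * M + 1"
  have K: "K > 0" using M by (simp add: K_def add_nonneg_pos)
  \<comment> \<open>\<open>hip'\<close> is symmetry at vectors S b; e is the defect of symmetry at
    u, and approximating u by some S b makes it arbitrarily small.\<close>
  have "cmod e <= K * d" if d: "d > 0" for d
  proof -
   obtain b where b: "nrm (S b - u) < d" using u(1) d unfolding clr_def by blast
   have "e = ip x (h (S b - u)) - ip (h x) (S b - u)" using hip'[of x b] by (simp add: e_def)
   hence "cmod e <= cmod (ip x (h (S b - u))) + cmod (ip (h x) (S b - u))"
    by (simp add: norm_triangle_ineq4)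
   also have "... <= nrm x * (M * nrm (S b - u)) + nrm (h x) * nrm (S b - u)"
    using cauchy_schwarz[of x "h (S b - u)"] cauchy_schwarz[of "h x" "S b - u"]
     mult_left_mono[OF hbound[of "S b - u"], of "nrm x"] by simp
   also have "... <= K * nrm (S b - u)" by (simp add: K_def algebra_simps)
   also have "... <= K * d" using b K by (intro mult_left_mono) auto
   finally show ?thesis .
  qed
  from this[of "cmod e / (2 * K)"] have "e = 0" using K by (cases "e = 0") (auto simp: field_simps)
  moreover have "ip (h x) (y - u) = 0" by (rule clr_ker[OF S hclr u(2)])
  moreover have "h (y - u) = 0" by (rule hk[OF u(2)])
  ultimately show "ip (h x) y = ip x (h y)" by (simp add: e_def)
 qed
 have "V * h = h * V" if V: "bnd V" "V * S = S * V" "V * F = F * V" for V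
 proof (rule lop_eqI)
  fix y
  obtain u where u: "clr S u" "S (y - u) = 0" using clr_split[OF S] by blast
  have "(h * V - V * h) * S = 0" using V hS by (simp add: left_diff_distrib mult.assoc) (metis mult.assoc)
  hence 1: "(h * V - V * h) u = 0" using V hb u by (intro clr_zero[of _ S]) auto
  have "S (V (y - u)) = 0" using V(2) u(2) by (metis lapp_mult lop_zero)
  hence "h (V (y - u)) = 0" "h (y - u) = 0" using hk u(2) by blast+
  hence "(h * V - V * h) (y - u) = 0" by simp
  thus "(V * h) y = (h * V) y" using 1 by simp
 qed
 thus thesis using that hsym hb hS hk hclr by blast
qed

lemma douglas_commuting:
 assumes S: "sym S" and F: "sym F" "S * F = F * S" "!!y. nrm (lapp F y) <= M * nrm (lapp S y)" and M: "0 <= M"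
 obtains h where "sym h" "bnd h" "h * S = F" "!!x. S x = 0 ==> h x = 0"
  "!!V. bnd V ==> V * S = S * V ==> V * F = F * V ==> V * h = h * V"
proof -
 have "ip (F y) (S x) = ip (S y) (F x)" for x y
  using S F(1,2) by (metis lapp_mult symD)
 moreover have "clr S (F x)" for x using clr_dominated[OF S F(1,3)] .
 ultimately show thesis using douglas[OF S F(3) M] that by metis
qed

end

section \<open>The Hilbert space model of a nonnegative operator in a Krein space\<close>

context hilbert_ops
begin

lemma adjoint_exists:
 assumes V: "bnd V"
 obtains W where "bnd W" "!!x y. ip (V x) y = ip x (W y)"
proof -
 obtain C where C: "C > 0" "!!x. nrm (V x) <= C * nrm x" using V by (meson bndE)
 have ex: "\<exists>u. (\<forall>z. ip (V z) y = ip z u) \<and> nrm u <= C * nrm y" for y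
 proof -
  define G where "G = {(z, ip (V z) y) | z. True}"
  have 1: "(0, 0) \<in> G" by (auto simp: G_def intro!: exI[of _ 0])
  have 2: "(v + w, s + r) \<in> G" if vw: "(v, s) \<in> G" "(w, r) \<in> G" for v s w r
   using vw by (auto simp: G_def)
  have 3: "(c *\<^sub>C v, c * s) \<in> G" if vw: "(v, s) \<in> G" for c v s
   using vw by (auto simp: G_def)
  have 4: "cmod s <= C * nrm y * nrm v" if vw: "(v, s) \<in> G" for v s
  proof -
   have "cmod s <= nrm (V v) * nrm y" using vw cauchy_schwarz[of "V v" y] by (auto simp: G_def)
   also have "... <= C * nrm v * nrm y" using C by (intro mult_right_mono) auto
   finally show ?thesis by (simp add: mult_ac)
  qed
  have 5: "0 <= C * nrm y" using C by simp
  obtain u where u: "!!v s. (v, s) \<in> G ==> s = ip v u" "nrm u <= C * nrm y"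
   by (rule riesz_graph[of G "C * nrm y"]; (blast intro: 1 2 3 4 5 | simp | (rule that; blast)))
  have "ip (V z) y = ip z u" for z
  proof -
   have "(z, ip (V z) y) \<in> G" by (auto simp: G_def)
   from u(1)[OF this] show ?thesis .
  qed
  thus ?thesis using u(2) by blast
 qed
 then obtain f where f: "!!z y. ip (V z) y = ip z (f y)" "!!y. nrm (f y) <= C * nrm y" by metis
 have R: "u = v" if "!!z. ip z u = ip z v" for u v
 proof -
  have "ip (u - v) (u - v) = 0" using that[of "u - v"] by simp
  thus ?thesis using self_eq[of "u - v"] by simp
 qed
 have "f (x + y) = f x + f y" for x y by (rule R) (simp add: f(1)[symmetric])
 moreover have "f (c *\<^sub>C x) = c *\<^sub>C f x" for c x by (rule R) (simp add: f(1)[symmetric])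
 ultimately have "lapp (Lop f) = f" by (rule lapp_Lop)
 thus thesis using f by (intro that[of "Lop f"] bndI[of _ C]) auto
qed

text \<open>By \<open>clr_split\<close> the space is the sum of ker(S) and the closure of ran(S), so
  bounded operators may be compared on the two parts.\<close>

lemma lop_eq_clr:
 assumes S: "sym S" and b: "bnd P" "bnd Q" and eq: "P * S = Q * S" "!!k. S k = 0 ==> P k = Q k"
 shows "P = Q"
proof (rule lop_eqI)
 fix y
 obtain u where u: "clr S u" "S (y - u) = 0" using clr_split[OF S] by blast
 have "(P - Q) u = 0" by (rule clr_zero[of _ S]) (use b eq u in \<open>auto simp: left_diff_distrib\<close>)
 moreover have "P (y - u) = Q (y - u)" by (rule eq(2)[OF u(2)])
 ultimately show "P y = Q y" by simp
qed

text \<open>A substitute for the functional calculus on a spectral subspace: P p and Q p are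
  positive on the whole space, so \<open>pos_mult\<close> applies to them. Pointwise inequalities
  between functions on an interval can thus be multiplied.\<close>

lemma pos_mult_on:
 assumes p: "sym p" "p * p = p" and P: "sym P" "bnd P" "P * p = p * P" and Q: "sym Q" "bnd Q" "Q * p = p * Q"
  and PQ: "P * Q = Q * P"
  and pos: "!!z. p z = z ==> 0 <= Re (ip (P z) z)" "!!z. p z = z ==> 0 <= Re (ip (Q z) z)"
  and z: "p z = z"
 shows "0 <= Re (ip (P (Q z)) z)"
proof -
 have pp: "p (p x) = p x" for x using p(2) by (metis lapp_mult)
 have Pp: "pos (P * p)"
 proof -
  have "ip ((P * p) x) x = ip (P (p x)) (p x)" for x using P(3) p(1) pp by (metis lapp_mult symD)
  moreover have "sym (P * p)" using P p by (intro sym_mult) auto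
  ultimately show ?thesis using pos(1)[OF pp] by (simp add: pos_def)
 qed
 have Qp: "pos (Q * p)"
 proof -
  have "ip ((Q * p) x) x = ip (Q (p x)) (p x)" for x using Q(3) p(1) pp by (metis lapp_mult symD)
  moreover have "sym (Q * p)" using Q p by (intro sym_mult) auto
  ultimately show ?thesis using pos(2)[OF pp] by (simp add: pos_def)
 qed
 have "P * p * (Q * p) = Q * p * (P * p)" using P Q PQ p by (metis mult.assoc)
 hence "pos (P * p * (Q * p))" by (intro pos_mult[OF Pp _ Qp] bnd_mult P proj_bnd p)
 from posD[OF this, of z] have "0 <= Re (ip (P (p (Q z))) z)" using z by simp
 moreover have "p (Q z) = Q z" using Q(3) z by (metis lapp_mult)
 ultimately show ?thesis by simp
qed

lemma negative_projection_ex: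
 assumes B: "sym B" "bnd B"
 shows "\<exists>N F. sym N \<and> N * N = N \<and> pos (- (B * N)) \<and> pos (B * (1 - N)) \<and> (\<forall>x. B x = 0 --> N x = 0) \<and>
  (\<forall>n. polyfun (F n)) \<and> slim (\<lambda>n. F n B) N \<and> (\<forall>V. bnd V --> V * B = B * V --> V * N = N * V)"
proof -
 obtain N F where NF: "sym N" "N * N = N" "pos (- (B * N))" "pos (B * (1 - N))" "!!x. B x = 0 ==> N x = 0"
  "!!n. polyfun (F n)" "slim (\<lambda>n. F n B) N" using negative_projection[OF B] by blast
 have "V * N = N * V" if "bnd V" "V * B = B * V" for V
  by (rule slim_commute[OF NF(7) that(1) polyfun_commute[OF NF(6) that(2)]])
 thus ?thesis using NF by blast
qed

end

text \<open>J is a fundamental symmetry, and T and Y play the roles of \<lambda> / (1 + \<lambda>^2)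
  and 1 / (1 + \<lambda>^2), whence \<open>circle\<close>. \<open>Tpos\<close> expresses
  nonnegativity of the underlying operator, and \<open>nondeg\<close> says that its kernel, here
  ker(T), contains no nonzero vector that is orthogonal to all of it in the Krein space
  form.\<close>

locale krein_model = hilbert_ops ip for ip :: "'a::complex_vector => 'a => complex" +
 fixes J T Y :: "'a lop"
 assumes J2: "J * J = 1" and Jsym: "sym J"
  and Tb: "bnd T" and Yb: "bnd Y" and Tpos: "pos (J * T)" and Yk: "sym (J * Y)"
  and TY: "T * Y = Y * T" and circle: "T * T + Y * Y = Y"
  and Yinj: "!!x. Y x = 0 ==> x = 0"
  and nondeg: "!!n. T n = 0 ==> (!!k. T k = 0 ==> ip (J n) k = 0) ==> n = 0"
begin

lemma JJ [simp]: "J (J x) = x" using J2 by (metis lapp_mult lapp_one)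

lemma nrm_J [simp]: "nrm (J x) = nrm x"
proof -
 have "(nrm (J x))\<^sup>2 = (nrm x)\<^sup>2" using Jsym by (simp add: nrm_sq symD)
 thus ?thesis by simp
qed

lemma Jb [simp]: "bnd J" by (rule bndI[of _ 1]) simp

lemma ksymD: "sym (J * X) ==> ip (J (X x)) y = ip (J x) (X y)"
 using Jsym by (metis lapp_mult symD)

lemma ksymI: "(!!x y. ip (J (lapp X x)) y = ip (J x) (X y)) ==> sym (J * X)"
 using Jsym by (simp add: sym_def)

definition "D = (SOME D. pos D \<and> bnd D \<and> D * D = J * T)"

lemma D: "pos D" "bnd D" "D * D = J * T"
proof -
 have "\<exists>D. pos D \<and> bnd D \<and> D * D = J * T"
  using pos_sqrt[OF Tpos] Tb by (metis bnd_mult Jb)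
 hence "pos D \<and> bnd D \<and> D * D = J * T" unfolding D_def by (rule someI_ex)
 thus "pos D" "bnd D" "D * D = J * T" by auto
qed

lemma Dsym: "sym D" using D by simp

lemma JJ_mult [simp]: "J * (J * X) = X" using J2 by (metis mult.assoc mult_1_left)

lemma T_D: "J * (D * D) = T" by (simp add: D(3))

lemma D_ip: "ip (D x) (D y) = ip (J (T x)) y"
 using D(3) Dsym by (metis lapp_mult symD)

lemma nrm_D: "(nrm (D x))\<^sup>2 = Re (ip (J (T x)) x)"
 by (simp add: nrm_sq D_ip)

lemma D_ker: "T n = 0 ==> D n = 0"
 using nrm_D[of n] by simp

lemma Y_ker: "T n = 0 ==> Y n = n"
proof -
 assume n: "T n = 0"
 have "T (T n) + Y (Y n) = Y n" using circle by (metis lapp_add lapp_mult)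
 hence "Y (Y n - n) = 0" using n by simp
 thus ?thesis using Yinj[of "Y n - n"] by (simp only: right_minus_eq)
qed

text \<open>T = J D^2 gives D T = (D J D) D: passing through D replaces T, symmetric in the Krein
  space, by an operator symmetric in the Hilbert space.\<close>

definition "Tt = D * J * D"

lemma Tt_sym: "sym Tt"
 unfolding sym_def Tt_def using Dsym Jsym by (simp add: symD)

lemma Tt_bnd [simp]: "bnd Tt" using D by (simp add: Tt_def)

lemma Tt_D: "Tt * D = D * T"
 by (simp add: Tt_def mult.assoc D(3))

text \<open>In the semidefinite inner product [T x, y] the operator Y is symmetric and Y - Y^2 = T^2
  is nonnegative, so Y is a contraction for it. This is what \<open>douglas\<close> needs to produce
  the counterpart of Y in the model.\<close>

lemma DY_bound: "nrm (D (Y x)) <= nrm (D x)"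
proof (cases "nrm (D (Y x)) = 0")
 case False
 have "ip (D (Y x)) (D (Y x)) = ip (J (T (Y x))) (Y x)" by (simp add: D_ip)
 also have "... = ip (J (Y (T (Y x)))) x" using ksymD[OF Yk] by simp
 also have "Y (T (Y x)) = T (Y (Y x))" using TY by (metis lapp_mult)
 also have "Y (Y x) = Y x - T (T x)" using circle by (metis lapp_add lapp_mult add_diff_cancel_left')
 also have "ip (J (T (Y x - T (T x)))) x = ip (J (T (Y x))) x - ip (J (T (T (T x)))) x" by simp
 also have "ip (J (T (T (T x)))) x = ip (J (T (T x))) (T x)"
  using ksymD[of T "T (T x)" x] Tpos by simp
 also have "... = ip (D (T x)) (D (T x))" by (simp add: D_ip)
 also have "ip (J (T (Y x))) x = ip (D (Y x)) (D x)" by (simp add: D_ip)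
 finally have "(nrm (D (Y x)))\<^sup>2 = Re (ip (D (Y x)) (D x)) - (nrm (D (T x)))\<^sup>2"
  by (simp add: nrm_sq)
 hence "(nrm (D (Y x)))\<^sup>2 <= Re (ip (D (Y x)) (D x))" using zero_le_power2[of "nrm (D (T x))"] by linarith
 hence "nrm (D (Y x)) * nrm (D (Y x)) <= nrm (D (Y x)) * nrm (D x)"
  using Re_le[of "D (Y x)" "D x"] by (simp add: power2_eq_square)
 moreover have "0 < nrm (D (Y x))" using False nrm_nonneg[of "D (Y x)"] by (simp add: order_less_le)
 ultimately show ?thesis by (simp only: mult_le_cancel_left_pos)
qed simp

definition "Yt = (SOME h. sym h \<and> bnd h \<and> h * D = D * Y \<and> (\<forall>x. D x = 0 --> h x = 0))"

lemma Yt: "sym Yt" "bnd Yt" "Yt * D = D * Y" "D x = 0 ==> Yt x = 0"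
proof -
 have "\<exists>h. sym h \<and> bnd h \<and> h * D = D * Y \<and> (\<forall>x. D x = 0 --> h x = 0)"
 proof (rule douglas[of D "D * Y" 1])
  fix x y
  have "ip (D (Y y)) (D x) = ip (J (Y (T y))) x" using TY by (metis D_ip lapp_mult)
  also have "... = ip (D y) (D (Y x))" using ksymD[OF Yk] by (simp add: D_ip)
  finally show "ip ((D * Y) y) (D x) = ip (D y) ((D * Y) x)" by simp
  show "clr D ((D * Y) x)" by (simp add: clrI)
 qed (use Dsym DY_bound in auto)
 hence "sym Yt \<and> bnd Yt \<and> Yt * D = D * Y \<and> (\<forall>x. D x = 0 --> Yt x = 0)" unfolding Yt_def by (rule someI_ex)
 thus "sym Yt" "bnd Yt" "Yt * D = D * Y" "D x = 0 ==> Yt x = 0" by auto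
qed

lemma Yt_bnd [simp]: "bnd Yt" by (rule Yt)

lemma Tt_ker: "D x = 0 ==> Tt x = 0" by (simp add: Tt_def)

lemma TtYt: "Tt * Yt = Yt * Tt"
proof (rule lop_eq_clr[OF Dsym])
 show "Tt * Yt * D = Yt * Tt * D" using Yt(3) Tt_D TY by (metis mult.assoc)
qed (simp_all add: Tt_ker Yt)

lemma circle_t: "Tt * Tt + Yt * Yt = Yt"
proof (rule lop_eq_clr[OF Dsym])
 have "Tt * Tt * D = D * (T * T)" "Yt * Yt * D = D * (Y * Y)" using Yt(3) Tt_D by (metis mult.assoc)+
 hence "(Tt * Tt + Yt * Yt) * D = D * (T * T + Y * Y)" by (simp add: distrib_left distrib_right)
 thus "(Tt * Tt + Yt * Yt) * D = Yt * D" by (simp add: circle Yt)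
qed (simp_all add: Tt_ker Yt)

lemma TtTt: "Tt * Tt = Yt - Yt * Yt" using circle_t by (simp add: eq_diff_eq)

lemma nrm_Tt: "(nrm (Tt z))\<^sup>2 = Re (ip (Yt z) z) - (nrm (Yt z))\<^sup>2"
proof -
 have "Tt (Tt z) = Yt z - Yt (Yt z)" using TtTt by (metis lapp_mult lapp_diff)
 hence "ip (Tt z) (Tt z) = ip (Yt z) z - ip (Yt z) (Yt z)"
  using Tt_sym Yt(1) by (metis UNIV_I diff_right symD)
 thus ?thesis by (simp add: nrm_sq)
qed

lemma Yt_form: "(nrm (Yt z))\<^sup>2 <= Re (ip (Yt z) z)"
 using nrm_Tt[of z] zero_le_power2[of "nrm (Tt z)"] by linarith

lemma Yt_pos: "pos Yt"
proof -
 have "0 <= Re (ip (Yt z) z)" for z using Yt_form[of z] zero_le_power2[of "nrm (Yt z)"] by linarith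
 thus ?thesis using Yt by (simp add: pos_def)
qed

lemma Yt_contr: "nrm (Yt z) <= nrm z"
proof (cases "nrm (Yt z) = 0")
 case False
 hence "0 < nrm (Yt z)" using nrm_nonneg[of "Yt z"] by (simp add: order_less_le)
 moreover have "nrm (Yt z) * nrm (Yt z) <= nrm (Yt z) * nrm z"
  using Yt_form[of z] Re_le[of "Yt z" z] by (simp add: power2_eq_square)
 ultimately show ?thesis by (simp only: mult_le_cancel_left_pos)
qed simp

text \<open>Transport from the model back to the Krein space. It multiplies by T:
  \<open>Th 1\<close> is T, and if X corresponds to s, that is D X = s D, then \<open>Th s\<close>
  is T X by \<open>T_mult\<close>.\<close>

definition Th :: "'a lop => 'a lop" where "Th h = J * D * h * D"

lemma Th_app: "Th h x = J (D (h (D x)))" by (simp add: Th_def)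

lemma Th_bnd [simp]: "bnd h ==> bnd (Th h)" using D by (simp add: Th_def)

lemma Th_ksym: "sym h ==> sym (J * Th h)"
proof -
 assume h: "sym h"
 have "J * Th h = D * h * D" using J2 by (simp add: Th_def mult.assoc[symmetric])
 thus ?thesis using h Dsym by (simp add: sym_def)
qed

lemma Th_ip: "ip (J (Th h x)) y = ip (h (D x)) (D y)"
 using Dsym by (simp add: Th_app symD)

lemma Th_add: "Th (h + g) = Th h + Th g" by (simp add: Th_def algebra_simps)
lemma Th_diff: "Th (h - g) = Th h - Th g" by (simp add: Th_def algebra_simps)
lemma Th_scale: "Th (c *\<^sub>C h) = c *\<^sub>C Th h" by (simp add: Th_def)

lemma D_Th: "D * Th h = Tt * h * D" by (simp add: Th_def Tt_def mult.assoc)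

lemma T_mult: "D * X = s * D ==> T * X = Th s"
proof -
 assume a: "D * X = s * D"
 have "T * X = J * (D * (D * X))" using T_D by (metis mult.assoc)
 thus ?thesis unfolding a by (simp add: Th_def mult.assoc)
qed

lemma Th_mult: "D * X = s * D ==> Th h * X = Th (h * s)"
 by (simp add: Th_def mult.assoc)

lemma T_Th: "T * Th h = Th (Tt * h)" by (rule T_mult) (rule D_Th)

text \<open>The Hilbert space adjoint of \<open>Yt * D = D * Y\<close>, since the adjoint of Y is J
  Y J.\<close>

lemma Y_JD: "Y * (J * D) = J * D * Yt"
proof (rule sym_lopI)
 fix x y
 have "ip (Y (J (D x))) y = ip (J (J (Y (J (D x))))) y" by simp
 also have "... = ip (J (Y (J (D x)))) (J y)" using Jsym symD by blast
 also have "... = ip (J (J (D x))) (Y (J y))" by (rule ksymD[OF Yk])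
 also have "... = ip x (D (Y (J y)))" using Dsym by (simp add: symD)
 also have "D (Y (J y)) = Yt (D (J y))" using Yt(3) by (metis lapp_mult)
 also have "ip x (Yt (D (J y))) = ip (J (D (Yt x))) y" using Yt(1) Dsym Jsym by (simp add: symD)
 finally show "ip ((Y * (J * D)) x) y = ip ((J * D * Yt) x) y" by simp
qed

lemma Y_Th: "Y * Th h = Th (Yt * h)"
proof -
 have "Y * Th h = Y * (J * D) * (h * D)" by (simp add: Th_def mult.assoc)
 thus ?thesis unfolding Y_JD by (simp add: Th_def mult.assoc)
qed

lemma Th_Y: "Th h * Y = Th (h * Yt)" by (rule Th_mult) (simp add: Yt)
lemma Th_T: "Th h * T = Th (h * Tt)" by (rule Th_mult) (simp add: Tt_D)

text \<open>The way to prove identities in the Krein space: multiply them by T, where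
  \<open>Th\<close> computes, and check the adjoint side on ker(T). The hypotheses place ran(Z)
  inside ker(T) and orthogonal to it, so \<open>nondeg\<close> applies.\<close>

lemma zero_op:
 assumes adj: "!!x y. ip (J (lapp Z x)) y = ip (J x) (lapp Z' y)" and TZ: "T * Z = 0"
  and ker: "!!n. T n = 0 ==> Z' n = 0"
 shows "Z = 0"
proof (rule lop_eqI)
 fix x
 have "T (Z x) = 0" using TZ by (metis lapp_mult lapp_zero)
 moreover have "ip (J (Z x)) k = 0" if "T k = 0" for k using adj ker[OF that] by simp
 ultimately have "Z x = 0" by (rule nondeg)
 thus "Z x = lapp 0 x" by simp
qed

subsection \<open>Lifting functions of the model to the Krein space\<close>

text \<open>X is the function of the operator which s represents in the model. The intertwining with
  D does not reach ker(T), so the value a of the function at 0 is part of the data.\<close>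

definition lifts :: "'a lop => real => 'a lop => bool" where
 "lifts s a X \<longleftrightarrow> bnd X \<and> sym (J * X) \<and> D * X = s * D \<and> (\<forall>n. T n = 0 --> X n = of_real a *\<^sub>C n)"

text \<open>The function is written as a / (1 + \<lambda>^2) + h \<lambda> / (1 + \<lambda>^2); the
  first term lifts to a Y and the second to \<open>Th h\<close>. The factor h comes from Douglas
  factorisation once s - a Yt is dominated by Tt, a condition on the behaviour at 0 and at
  infinity.\<close>

lemma lift_exists:
 assumes s: "sym s" "bnd s" "s * Tt = Tt * s" "s * Yt = Yt * s"
  and M: "!!x. nrm (lapp (s - of_real a *\<^sub>C Yt) x) <= M * nrm (lapp Tt x)" "0 <= M"
 obtains X h where "lifts s a X" "X = of_real a *\<^sub>C Y + Th h" "sym h" "bnd h"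
  "h * Tt = s - of_real a *\<^sub>C Yt" "!!x. Tt x = 0 ==> h x = 0"
  "!!V. bnd V ==> V * Tt = Tt * V ==> V * Yt = Yt * V ==> V * s = s * V ==> V * h = h * V"
proof -
 have ss: "sym (s - of_real a *\<^sub>C Yt)" using s Yt by simp
 have cc: "Tt * (s - of_real a *\<^sub>C Yt) = (s - of_real a *\<^sub>C Yt) * Tt"
  using s TtYt by (simp add: algebra_simps)
 obtain h where h: "sym h" "bnd h" "h * Tt = s - of_real a *\<^sub>C Yt" "!!x. Tt x = 0 ==> h x = 0"
  "!!V. bnd V ==> V * Tt = Tt * V ==> V * (s - of_real a *\<^sub>C Yt) = (s - of_real a *\<^sub>C Yt) * V ==> V * h = h * V"
  by (rule douglas_commuting[OF Tt_sym ss cc M]) blast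
 have hT: "Tt * h = h * Tt" by (rule h(5)) (use cc in auto)
 define X where "X = of_real a *\<^sub>C Y + Th h"
 have "D * X = of_real a *\<^sub>C (Yt * D) + (s - of_real a *\<^sub>C Yt) * D"
  by (simp add: X_def distrib_left D_Th hT h(3) Yt)
 hence DX: "D * X = s * D" by (simp add: left_diff_distrib)
 have "sym (J * X)" using Yk Th_ksym[OF h(1)] by (simp add: X_def distrib_left)
 moreover have "X n = of_real a *\<^sub>C n" if "T n = 0" for n
  using that by (simp add: X_def Th_app D_ker Y_ker)
 ultimately have "lifts s a X" using DX Yb h by (simp add: lifts_def X_def)
 moreover have "V * h = h * V" if "bnd V" "V * Tt = Tt * V" "V * Yt = Yt * V" "V * s = s * V" for V
  by (rule h(5)) (use that in \<open>auto simp: algebra_simps\<close>)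
 ultimately show thesis using that h X_def by blast
qed

lemma liftsD:
 assumes "lifts s a X"
 shows "bnd X" "sym (J * X)" "D * X = s * D" "T * X = Th s" "T n = 0 ==> X n = of_real a *\<^sub>C n"
  "ip (J (X x)) y = ip (J x) (X y)"
 using assms T_mult ksymD by (auto simp: lifts_def)

lemma lifts_unique: "lifts s a X ==> lifts s a X' ==> X = X'"
 using zero_op[of "X - X'" "X - X'"] liftsD[of s a X] liftsD[of s a X'] by (simp add: right_diff_distrib)

lemma lifts_mult:
 assumes X: "lifts s a X" and Z: "lifts r b Z" and W: "lifts (s * r) (a * b) W" and c: "s * r = r * s"
 shows "X * Z = W"
proof -
 have "X * Z - W = 0"
 proof (rule zero_op)
  show "ip (J ((X * Z - W) x)) y = ip (J x) ((Z * X - W) y)" for x y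
   using liftsD(6)[OF X] liftsD(6)[OF Z] liftsD(6)[OF W] by simp
  show "T * (X * Z - W) = 0"
   using liftsD(4)[OF X] liftsD(4)[OF W] Th_mult[OF liftsD(3)[OF Z]]
   by (simp add: right_diff_distrib mult.assoc[symmetric])
  show "(Z * X - W) n = 0" if "T n = 0" for n
   using that liftsD(5)[OF X, of n] liftsD(5)[OF Z, of n] liftsD(5)[OF W, of n]
   by (simp add: mult.commute)
 qed
 thus ?thesis by simp
qed

lemma lifts_add: "lifts s a X ==> lifts r b Z ==> lifts (s + r) (a + b) (X + Z)"
 by (auto simp: lifts_def distrib_left distrib_right complex_vector.scale_left_distrib)

lemma lifts_commute:
 assumes X: "lifts s a X" and V: "bnd V" "V * T = T * V" and VT: "V * Th s = Th s * V"
 shows "V * X = X * V"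
proof -
 obtain V' where V': "bnd V'" "!!x y. ip (V x) y = ip x (V' y)" using adjoint_exists[OF V(1)] by blast
 \<comment> \<open>The adjoint of V in the Krein space form. It too commutes with T and so preserves
   ker(T), on which X is the scalar a.\<close>
 define W where "W = J * V' * J"
 have adj: "ip (J (V x)) y = ip (J x) (W y)" for x y
  using V'(2)[of x "J y"] Jsym by (simp add: W_def symD)
 have WT: "T (W n) = W (T n)" for n
 proof -
  have "ip (J x) (T (W n)) = ip (J x) (W (T n))" for x
  proof -
   have "ip (J x) (T (W n)) = ip (J (V (T x))) n" using ksymD[of T x "W n"] Tpos adj by simp
   also have "V (T x) = T (V x)" using V(2) by (metis lapp_mult)
   also have "ip (J (T (V x))) n = ip (J x) (W (T n))" using ksymD[of T "V x" n] Tpos adj by simp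
   finally show ?thesis .
  qed
  hence "ip (J (J (T (W n) - W (T n)))) (T (W n) - W (T n)) = 0"
   by (metis UNIV_I diff_right diff_self)
  thus ?thesis using self_eq[of "T (W n) - W (T n)"] by simp
 qed
 have "V * X - X * V = 0"
 proof (rule zero_op)
  show "ip (J ((V * X - X * V) x)) y = ip (J x) ((X * W - W * X) y)" for x y
   using liftsD(6)[OF X] adj by simp
  show "T * (V * X - X * V) = 0"
   using liftsD(4)[OF X] V(2) VT by (simp add: right_diff_distrib) (metis mult.assoc right_minus_eq)
  show "(X * W - W * X) n = 0" if "T n = 0" for n
   using that liftsD(5)[OF X, of n] liftsD(5)[OF X, of "W n"] WT[of n] by simp
 qed
 thus ?thesis by simp
qed

end

section \<open>Spectral projections of the model and their lifts\<close>

context krein_model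
begin

text \<open>Symmetric elements of the bicommutant of \<open>{Tt, Yt}\<close>; they all commute with each other.\<close>

definition bic :: "'a lop => bool" where
 "bic X \<longleftrightarrow> sym X \<and> bnd X \<and> (\<forall>V. bnd V --> V * Tt = Tt * V --> V * Yt = Yt * V --> V * X = X * V)"

lemma bic_sym [simp]: "bic X ==> sym X" and bic_bnd [simp]: "bic X ==> bnd X"
 by (simp_all add: bic_def)

lemma bicD: "bic X ==> bnd V ==> V * Tt = Tt * V ==> V * Yt = Yt * V ==> V * X = X * V"
 unfolding bic_def by blast

lemma bic_Tt [simp]: "bic Tt" and bic_Yt [simp]: "bic Yt" and bic_1 [simp]: "bic 1" and bic_0 [simp]: "bic 0"
 unfolding bic_def using Tt_sym Yt(1) by (auto simp del: not_all)

lemma bic_commute: assumes "bic X" "bic Z" shows "X * Z = Z * X"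
proof -
 have "X * Tt = Tt * X" using bicD[OF assms(1), of Tt] TtYt by simp
 moreover have "X * Yt = Yt * X" using bicD[OF assms(1), of Yt] TtYt by simp
 ultimately show ?thesis using bicD[OF assms(2), of X] assms(1) by simp
qed

lemma bic_app: "bic X ==> bic Z ==> X (Z x) = Z (X x)"
 using bic_commute by (metis lapp_mult)

lemma bic_add [simp]: "bic X ==> bic Z ==> bic (X + Z)"
 and bic_diff [simp]: "bic X ==> bic Z ==> bic (X - Z)"
 and bic_scale [simp]: "bic X ==> bic (of_real r *\<^sub>C X)"
 unfolding bic_def by (simp_all add: algebra_simps)

lemma bic_mult [simp]: assumes "bic X" "bic Z" shows "bic (X * Z)"
 unfolding bic_def
proof (intro conjI allI impI)
 show "sym (X * Z)" using assms bic_commute by (intro sym_mult) auto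
 show "bnd (X * Z)" using assms by simp
 fix V assume "bnd V" "V * Tt = Tt * V" "V * Yt = Yt * V"
 hence "V * X = X * V" "V * Z = Z * V" using assms bicD by blast+
 thus "V * (X * Z) = X * Z * V" by (metis mult.assoc)
qed

lemma bic_pos_mult:
 assumes "bic p" "p * p = p" "bic P" "bic Q"
  "!!z. p z = z ==> 0 <= Re (ip (P z) z)" "!!z. p z = z ==> 0 <= Re (ip (Q z) z)" "p z = z"
 shows "0 <= Re (ip (P (Q z)) z)"
 by (rule pos_mult_on[of p]) (use assms in \<open>blast intro: bic_commute bic_sym bic_bnd\<close>)+

lemma bic_douglas:
 assumes S: "bic S" and F: "bic F" "!!y. nrm (lapp F y) <= M * nrm (lapp S y)" and M: "0 <= M"
 obtains h where "bic h" "h * S = F" "!!x. S x = 0 ==> h x = 0"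
proof -
 obtain h where h: "sym h" "bnd h" "h * S = F" "!!x. S x = 0 ==> h x = 0"
  "!!V. bnd V ==> V * S = S * V ==> V * F = F * V ==> V * h = h * V"
  by (rule douglas_commuting[of S F M]) (use assms bic_commute in auto)
 have "bic h" unfolding bic_def using h(1,2) h(5) bicD[OF S] bicD[OF F(1)] by blast
 thus thesis using that h by blast
qed

lemma bic_eq: "bic S ==> bic P ==> bic Q ==> P * S = Q * S ==> (!!k. S k = 0 ==> P k = Q k) ==> P = Q"
 by (rule lop_eq_clr[of S]) auto

text \<open>The forms of \<lambda> / (1 + \<lambda>^2) and 1 / (1 + \<lambda>^2). An inequality
  between \<open>Qf z\<close> and \<open>t * Yf z\<close> compares \<lambda> with t on z.\<close>

definition Qf :: "'a => real" where "Qf z = Re (ip (Tt z) z)"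
definition Yf :: "'a => real" where "Yf z = Re (ip (Yt z) z)"

lemma Yf_nonneg: "0 <= Yf z" using Yt_pos posD by (simp add: Yf_def)

lemma Yf_le: "Yf z <= (nrm z)\<^sup>2"
proof -
 have "Yf z <= nrm (Yt z) * nrm z" using Re_le[of "Yt z" z] by (simp add: Yf_def)
 also have "... <= nrm z * nrm z" using Yt_contr by (intro mult_right_mono) auto
 finally show ?thesis by (simp add: power2_eq_square)
qed

lemma Yf_sq: "(nrm (Yt z))\<^sup>2 <= Yf z" using Yt_form by (simp add: Yf_def)

lemma Tt_sq: "(nrm (Tt z))\<^sup>2 = Yf z - (nrm (Yt z))\<^sup>2" using nrm_Tt by (simp add: Yf_def)

lemma TtYt_app: "Yt (Tt z) = Tt (Yt z)" by (simp add: bic_app)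

lemma Yt2_form: "ip (Yt (Yt z)) z = ip (Yt z) (Yt z)" using Yt(1) symD by blast
lemma Tt2_form: "ip (Tt (Tt z)) z = ip (Tt z) (Tt z)" using Tt_sym symD by blast

definition Bt :: "real => 'a lop" where "Bt t = Tt - of_real t *\<^sub>C Yt"

lemma Bt_bic [simp]: "bic (Bt t)" by (simp add: Bt_def)

lemma Bt_form: "Re (ip (Bt t z) z) = Qf z - t * Yf z"
 by (simp add: Bt_def Qf_def Yf_def)

text \<open>\<open>Bt t\<close> is (\<lambda> - t) / (1 + \<lambda>^2), so \<open>N t\<close> is the
  spectral projection of the model for \<lambda> < t. It vanishes on ker(Bt t), which leaves out the
  eigenvalue t and the common kernel of Tt and Yt; accordingly \<open>P s t\<close> below belongs to
  [s, t). The polynomials F are kept for \<open>Th_N_commute\<close>.\<close>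

definition "N t = (SOME N. \<exists>F. sym N \<and> N * N = N \<and> pos (- (Bt t * N)) \<and> pos (Bt t * (1 - N)) \<and>
  (\<forall>x. Bt t x = 0 --> N x = 0) \<and> (\<forall>n. polyfun (F n)) \<and> slim (\<lambda>n. F n (Bt t)) N \<and>
  (\<forall>V. bnd V --> V * Bt t = Bt t * V --> V * N = N * V))"

lemma N_props: "\<exists>F. sym (N t) \<and> N t * N t = N t \<and> pos (- (Bt t * N t)) \<and> pos (Bt t * (1 - N t)) \<and>
  (\<forall>x. Bt t x = 0 --> N t x = 0) \<and> (\<forall>n. polyfun (F n)) \<and> slim (\<lambda>n. F n (Bt t)) (N t) \<and>
  (\<forall>V. bnd V --> V * Bt t = Bt t * V --> V * N t = N t * V)"
 unfolding N_def by (rule someI_ex) (rule negative_projection_ex; simp)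

lemma N_sym [simp]: "sym (N t)" and N_idem [simp]: "N t * N t = N t" and N_kill: "Bt t x = 0 ==> N t x = 0"
 using N_props by blast+

lemma N_bic [simp]: "bic (N t)"
 unfolding bic_def
proof (intro conjI allI impI)
 fix V assume V: "bnd V" "V * Tt = Tt * V" "V * Yt = Yt * V"
 have "V * Bt t = Bt t * V" using bicD[OF Bt_bic] V by blast
 thus "V * N t = N t * V" using N_props V(1) by blast
qed (auto intro: proj_bnd)

lemma N_app [simp]: "N t (N t x) = N t x" using N_idem by (metis lapp_mult)

lemma N_neg: "N t z = z ==> Qf z <= t * Yf z"
 using N_props[of t] posD[of "- (Bt t * N t)" z] Bt_form[of t z] by auto

lemma N_pos: "N t z = 0 ==> t * Yf z <= Qf z"
 using N_props[of t] posD[of "Bt t * (1 - N t)" z] Bt_form[of t z] by auto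

lemma N_null: "N t z = z ==> Qf z = t * Yf z ==> z = 0"
 using N_props[of t] pos_null[of "- (Bt t * N t)" z] Bt_form[of t z] N_kill[of t z] by auto

text \<open>A vector fixed by \<open>N s\<close> and annihilated by \<open>N t\<close> satisfies t
  Yf \<le> Qf \<le> s Yf, which for s < t leaves only 0.\<close>

lemma N_mono: assumes "s <= t" shows "N s * N t = N s"
proof -
 have "N s x - N s (N t x) = 0" for x
 proof (cases "s = t")
  case False
  define z where "z = N s x - N s (N t x)"
  have 1: "N s z = z" by (simp add: z_def)
  have 2: "N t z = 0" using bic_app[of "N t" "N s"] by (simp add: z_def)
  have "t * Yf z <= s * Yf z" "Qf z <= s * Yf z" "t * Yf z <= Qf z"
   using N_neg[OF 1] N_pos[OF 2] by linarith+
  moreover from this have "Yf z = 0" using False assms Yf_nonneg[of z]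
   by (metis antisym_conv2 dual_order.antisym mult_le_cancel_right not_less order_le_less)
  ultimately have "z = 0" using N_null[OF 1] by simp
  thus ?thesis by (simp add: z_def)
 qed simp
 thus ?thesis by (intro lop_eqI) simp
qed

lemma N_mult: "N s * N t = N (min s t)"
 using N_mono[of s t] N_mono[of t s] bic_commute[of "N s" "N t"] by (cases "s <= t") (auto simp: min_def)

lemma N_mult_app: "N s (N t x) = N (min s t) x" using N_mult by (metis lapp_mult)

definition P :: "real => real => 'a lop" where "P s t = (if s < t then N t - N s else 0)"

lemma P_bic [simp]: "bic (P s t)" by (simp add: P_def)

lemma P_mult: "P s t * P u v = P (max s u) (min t v)"
 by (auto simp: P_def algebra_simps N_mult min_def max_def)

lemma P_idem [simp]: "P s t * P s t = P s t" by (simp add: P_mult)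

lemma P_app [simp]: "P s t (P s t x) = P s t x" using P_idem by (metis lapp_mult)

lemma P_contr: "nrm (P s t x) <= nrm x" by (rule proj_contraction) auto

lemma P_mem: assumes "s < t" "P s t z = z" shows "N t z = z" "N s z = 0"
proof -
 have z: "z = N t z - N s z" using assms by (simp add: P_def)
 have "N t z = N t (N t z - N s z)" using z by simp
 also have "... = N t z - N s z" using assms(1) by (simp add: N_mult_app)
 finally show "N t z = z" using z by simp
 have "N s z = N s (N t z - N s z)" using z by simp
 also have "... = 0" using assms(1) by (simp add: N_mult_app)
 finally show "N s z = 0" .
qed

lemma P_forms: assumes "s < t" "P s t z = z" shows "s * Yf z <= Qf z" "Qf z <= t * Yf z"
 using P_mem[OF assms] N_neg[of t z] N_pos[of s z] by auto

text \<open>On ran(P s t) both r Y - T and r Y + T are nonnegative, because \<bar>\<lambda>\<bar>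
  \<le> r there; the claim is nonnegativity of their product.\<close>

lemma Tt_le_Yt:
 assumes st: "s < t" "P s t z = z" and r: "\<bar>s\<bar> <= r" "\<bar>t\<bar> <= r"
 shows "(nrm (Tt z))\<^sup>2 <= r\<^sup>2 * (nrm (Yt z))\<^sup>2"
proof -
 have b: "0 <= r * Yf w - Qf w" "0 <= r * Yf w + Qf w" if w: "P s t w = w" for w
 proof -
  have "t * Yf w <= r * Yf w" "- r * Yf w <= s * Yf w" using r Yf_nonneg[of w] by (intro mult_right_mono; simp)+
  thus "0 <= r * Yf w - Qf w" "0 <= r * Yf w + Qf w" using P_forms[OF st(1) w] by auto
 qed
 have "0 <= Re (ip ((of_real r *\<^sub>C Yt - Tt) ((of_real r *\<^sub>C Yt + Tt) z)) z)"
 proof (rule bic_pos_mult[of "P s t"])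
  show "0 <= Re (ip ((of_real r *\<^sub>C Yt - Tt) w) w)" if "P s t w = w" for w
   using b(1)[OF that] by (simp add: Yf_def Qf_def)
  show "0 <= Re (ip ((of_real r *\<^sub>C Yt + Tt) w) w)" if "P s t w = w" for w
   using b(2)[OF that] by (simp add: Yf_def Qf_def)
 qed (use st in auto)
 thus ?thesis unfolding nrm_sq[OF UNIV_I]
  by (simp add: TtYt_app Yt2_form Tt2_form power2_eq_square algebra_simps)
qed

text \<open>\<open>Tt_le_Yt\<close> and Y - Y^2 = T^2 give G Y \<ge> 0 on ran(P s t) for G = (1 +
  r^2) Y - 1, and the factor Y has to be cancelled. On the negative part w of z with respect to G,
  the product G Y has both signs, so it vanishes; this gives Y w = 0, then T w = 0, and such vectors
  are excluded from ran(P s t).\<close>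

lemma Yf_lower:
 assumes st: "s < t" "P s t z = z" and r: "\<bar>s\<bar> <= r" "\<bar>t\<bar> <= r"
 shows "(nrm z)\<^sup>2 <= (1 + r\<^sup>2) * Yf z"
proof -
 define k where "k = 1 + r\<^sup>2"
 define G where "G = of_real k *\<^sub>C Yt - 1"
 have Gb: "bic G" by (simp add: G_def)
 obtain N' F where N': "sym N'" "N' * N' = N'" "pos (- (G * N'))" "pos (G * (1 - N'))"
  "!!x. G x = 0 ==> N' x = 0" "!!V. bnd V ==> V * G = G * V ==> V * N' = N' * V"
  using negative_projection_ex[of G] Gb bic_sym bic_bnd by blast
 have N'b: "bic N'" unfolding bic_def using N'(1,2,6) bicD[OF Gb] proj_bnd by blast
 define w where "w = N' z"
 have N'w: "N' w = w" using N'(2) by (metis w_def lapp_mult)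
 have Pw: "P s t w = w" using st(2) bic_app[OF P_bic N'b] by (simp add: w_def)
 have "(nrm (Tt w))\<^sup>2 <= r\<^sup>2 * (nrm (Yt w))\<^sup>2" by (rule Tt_le_Yt[OF st(1) Pw r])
 hence a: "0 <= k * (nrm (Yt w))\<^sup>2 - Yf w" using Tt_sq[of w] by (simp add: k_def algebra_simps)
 have pp: "pos (- (G * N') * Yt)"
 proof (rule pos_mult[OF N'(3) _ Yt_pos])
  have "bic (G * N')" by (rule bic_mult[OF Gb N'b])
  thus "bnd (- (G * N'))" "- (G * N') * Yt = Yt * - (G * N')"
   using bic_commute[of "G * N'" Yt] by simp_all
 qed
 have "N' (Yt w) = Yt w" using bic_app[OF N'b bic_Yt, of w] N'w by simp
 hence e: "(- (G * N') * Yt) w = - G (Yt w)" by simp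
 have "Re (ip (G (Yt w)) w) = k * (nrm (Yt w))\<^sup>2 - Yf w"
  by (simp add: G_def Yt2_form nrm_sq Yf_def)
 hence "Re (ip ((- (G * N') * Yt) w) w) = 0" using posD[OF pp, of w] a e by simp
 hence "G (Yt w) = 0" using pos_null[OF pp, of w] e by simp
 hence "Yt w = 0" using N'(5)[of "Yt w"] \<open>N' (Yt w) = Yt w\<close> by simp
 moreover from this have "(nrm (Tt w))\<^sup>2 = 0" using Tt_sq[of w] by (simp add: Yf_def)
 ultimately have "Bt t w = 0" by (simp add: Bt_def)
 hence "w = 0" using N_kill P_mem[OF st(1) Pw] by simp
 hence "N' z = 0" by (simp add: w_def)
 hence "0 <= Re (ip (G z) z)" using posD[OF N'(4), of z] by simp
 thus ?thesis by (simp add: G_def k_def Yf_def nrm_sq)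
qed

lemma Yt_lower:
 assumes st: "s < t" "P s t z = z" and r: "\<bar>s\<bar> <= r" "\<bar>t\<bar> <= r"
 shows "nrm z <= (1 + r\<^sup>2) * nrm (Yt z)"
proof (cases "nrm z = 0")
 case False
 hence n: "0 < nrm z" by (simp add: order_less_le)
 have "nrm z * nrm z <= (1 + r\<^sup>2) * (nrm (Yt z) * nrm z)"
  using Yf_lower[OF assms] mult_left_mono[OF Re_le[of "Yt z" z], of "1 + r\<^sup>2"]
  by (simp add: Yf_def power2_eq_square)
 thus ?thesis using n by (simp add: mult.assoc[symmetric] mult_le_cancel_right)
qed simp

definition Vt :: "real => 'a lop" where
 "Vt c = 1 - Yt - of_real (2 * c) *\<^sub>C Tt + of_real (c\<^sup>2) *\<^sub>C Yt"

lemma Vt_bic [simp]: "bic (Vt c)"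
 unfolding Vt_def by (intro bic_add bic_diff bic_scale bic_1 bic_Tt bic_Yt)

lemma Vt_form: "Re (ip (Vt c z) z) = (nrm z)\<^sup>2 - Yf z - 2 * c * Qf z + c\<^sup>2 * Yf z"
 by (simp add: Vt_def Yf_def Qf_def nrm_sq)

text \<open>\<open>Vt c\<close> is the function \<open>(\<lambda> - c)\<^sup>2 / (1 + \<lambda>\<^sup>2) = \<bar>1 - (c + i) / (\<lambda> + i)\<bar>\<^sup>2\<close>.\<close>

lemma Vt_pos: "0 <= (nrm z)\<^sup>2 - Yf z - 2 * c * Qf z + c\<^sup>2 * Yf z"
proof -
 define w where "w = Tt z - \<i> *\<^sub>C Yt z"
 define a where "a = complex_of_real c + \<i>"
 have r: "ip (Tt z) (Yt z) = ip (Yt z) (Tt z)"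
  using Tt_sym Yt(1) TtYt by (metis lapp_mult symD)
 have "ip w w = ip (Tt z) (Tt z) + ip (Yt z) (Yt z)"
  by (simp add: w_def r algebra_simps)
 hence ww: "(nrm w)\<^sup>2 = Yf z" using Tt_sq[of z] by (simp add: nrm_sq)
 have zt: "ip z (Tt z) = ip (Tt z) z" "ip z (Yt z) = ip (Yt z) z" using Tt_sym Yt(1) symD by metis+
 have Im: "Im (ip (Tt z) z) = 0" "Im (ip (Yt z) z) = 0" using sym_Im Tt_sym Yt(1) by auto
 have zw: "ip z (a *\<^sub>C w) = cnj a * (ip (Tt z) z + \<i> * ip (Yt z) z)"
  by (simp add: w_def zt)
 have "Re (ip z (a *\<^sub>C w)) = c * Qf z + Yf z"
  unfolding zw by (simp add: a_def Qf_def Yf_def Im)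
 moreover have "(nrm (a *\<^sub>C w))\<^sup>2 = (c\<^sup>2 + 1) * Yf z"
  by (simp add: nrm_scale power_mult_distrib ww a_def cmod_power2)
 ultimately have "(nrm (z - a *\<^sub>C w))\<^sup>2 = (nrm z)\<^sup>2 - 2 * (c * Qf z + Yf z) + (c\<^sup>2 + 1) * Yf z"
  by (simp only: nrm_sq_diff UNIV_I)
 hence "0 <= (nrm z)\<^sup>2 - 2 * (c * Qf z + Yf z) + (c\<^sup>2 + 1) * Yf z" by (metis zero_le_power2)
 thus ?thesis by (simp add: algebra_simps)
qed

text \<open>The lower bound must persist for large \<lambda>, where Yf degenerates.
  \<open>w1\<close>, from \<open>Vt_pos\<close> at z0 - \<epsilon> or z0 + \<epsilon>, bounds the
  form of \<open>Vt z0\<close> below by \<epsilon>^2 Yf. \<open>w2\<close>, from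
  \<open>Vt_pos\<close> at 2 z0, bounds half the squared norm by that form up to a multiple of Yf.
  Together they eliminate Yf.\<close>

lemma Vt_lower_half:
 assumes e: "\<epsilon> > 0" and z: "N (z0 - \<epsilon>) z = z \<or> N (z0 + \<epsilon>) z = 0"
 shows "(nrm z)\<^sup>2 / (2 * (1 + (1/2 + z0\<^sup>2) / \<epsilon>\<^sup>2)) <= Re (ip (Vt z0 z) z)"
proof -
 define w where "w = Re (ip (Vt z0 z) z)"
 have w: "w = (nrm z)\<^sup>2 - Yf z - 2 * z0 * Qf z + z0\<^sup>2 * Yf z" by (simp add: w_def Vt_form)
 have w1: "\<epsilon>\<^sup>2 * Yf z <= w"
 proof (cases "N (z0 - \<epsilon>) z = z")
  case True
  have "0 <= 2 * \<epsilon> * ((z0 - \<epsilon>) * Yf z - Qf z)" using N_neg[OF True] e by simp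
  thus ?thesis using Vt_pos[of z "z0 - \<epsilon>"] by (simp add: w power2_eq_square algebra_simps)
 next
  case False
  hence "N (z0 + \<epsilon>) z = 0" using z by simp
  hence "0 <= 2 * \<epsilon> * (Qf z - (z0 + \<epsilon>) * Yf z)" using N_pos[of "z0 + \<epsilon>" z] e by simp
  thus ?thesis using Vt_pos[of z "z0 + \<epsilon>"] by (simp add: w power2_eq_square algebra_simps)
 qed
 have w2: "(nrm z)\<^sup>2 / 2 <= w + (1/2 + z0\<^sup>2) * Yf z"
  using Vt_pos[of z "2 * z0"] by (simp add: w power2_eq_square algebra_simps)
 have "Yf z <= w / \<epsilon>\<^sup>2" using w1 e by (simp add: field_simps)
 hence "(1/2 + z0\<^sup>2) * Yf z <= (1/2 + z0\<^sup>2) * (w / \<epsilon>\<^sup>2)" by (intro mult_left_mono) (auto intro: add_nonneg_nonneg)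
 moreover have "(1/2 + z0\<^sup>2) * (w / \<epsilon>\<^sup>2) = w * ((1/2 + z0\<^sup>2) / \<epsilon>\<^sup>2)" by simp
 ultimately have "(nrm z)\<^sup>2 / 2 <= w + w * ((1/2 + z0\<^sup>2) / \<epsilon>\<^sup>2)" using w2 by linarith
 hence 1: "(nrm z)\<^sup>2 / 2 <= w * (1 + (1/2 + z0\<^sup>2) / \<epsilon>\<^sup>2)" by (simp only: distrib_left mult_1_right)
 have 2: "0 < 1 + (1/2 + z0\<^sup>2) / \<epsilon>\<^sup>2" by (intro add_pos_nonneg divide_nonneg_nonneg) auto
 have "a / (2 * K) <= w" if "a / 2 <= w * K" "0 < K" for a K :: real using that by (simp add: field_simps)
 from this[OF 1 2] show ?thesis unfolding w_def .
qed

text \<open>A vector annihilated by \<open>P s t\<close> splits orthogonally into a part below s and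
  a part above t, and each is at distance at least \<epsilon> from z0.\<close>

lemma Vt_lower:
 assumes s: "s < z0" "z0 < t"
 shows "\<exists>\<delta>>0. \<forall>w. P s t w = 0 --> \<delta> * (nrm w)\<^sup>2 <= Re (ip (Vt z0 w) w)"
proof -
 define \<epsilon> where "\<epsilon> = min (z0 - s) (t - z0)"
 define \<delta> where "\<delta> = 1 / (2 * (1 + (1/2 + z0\<^sup>2) / \<epsilon>\<^sup>2))"
 have e: "\<epsilon> > 0" using s by (simp add: \<epsilon>_def)
 have "0 < 1 + (1/2 + z0\<^sup>2) / \<epsilon>\<^sup>2" by (intro add_pos_nonneg divide_nonneg_nonneg) auto
 hence d: "\<delta> > 0" unfolding \<delta>_def by (intro divide_pos_pos mult_pos_pos) auto
 have half: "\<delta> * (nrm z)\<^sup>2 <= Re (ip (Vt z0 z) z)" if "N (z0 - \<epsilon>) z = z \<or> N (z0 + \<epsilon>) z = 0" for z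
  using Vt_lower_half[OF e that] by (simp add: \<delta>_def)
 have "\<delta> * (nrm w)\<^sup>2 <= Re (ip (Vt z0 w) w)" if w: "P s t w = 0" for w
 proof -
  define w1 w2 where "w1 = N s w" and "w2 = w - N t w"
  have ww: "w = w1 + w2" using w s by (simp add: w1_def w2_def P_def)
  have m: "min (z0 - \<epsilon>) s = s" "min (z0 + \<epsilon>) t = z0 + \<epsilon>" "min s t = s" using s by (auto simp: \<epsilon>_def)
  have 1: "N (z0 - \<epsilon>) w1 = w1" unfolding w1_def N_mult_app m ..
  have 2: "N (z0 + \<epsilon>) w2 = 0" by (simp add: w2_def N_mult_app m)
  have 3: "N s w2 = 0" "N s w1 = w1" by (simp_all add: w2_def w1_def N_mult_app m)
  have orth: "ip (X w1) w2 = 0" if X: "bic X" for X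
  proof -
   have "ip (X w1) w2 = ip (N s (X w1)) w2" using 3 bic_app[OF X N_bic] by metis
   also have "... = ip (X w1) (N s w2)" using symD[OF N_sym] by blast
   finally show ?thesis using 3 by simp
  qed
  have add: "Re (ip (X w) w) = Re (ip (X w1) w1) + Re (ip (X w2) w2)" if X: "bic X" for X
  proof -
   have "ip (X w2) w1 = ip w2 (X w1)" using symD X by simp
   also have "... = cnj (ip (X w1) w2)" by (rule herm) auto
   finally have "ip (X w2) w1 = 0" using orth[OF X] by simp
   thus ?thesis using orth[OF X] by (simp add: ww)
  qed
  have "(nrm w)\<^sup>2 = (nrm w1)\<^sup>2 + (nrm w2)\<^sup>2" using add[OF bic_1] by (simp add: nrm_sq)
  thus ?thesis using half[of w1] half[of w2] 1 2 add[of "Vt z0"] by (simp add: distrib_left)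
 qed
 thus ?thesis using d by blast
qed

lemma form_lower_norm:
 assumes "0 < c" "c * (nrm z)\<^sup>2 <= \<bar>Re (ip w z)\<bar>" shows "nrm z <= (1 / c) * nrm w"
proof (cases "nrm z = 0")
 case False
 hence n: "0 < nrm z" by (simp add: order_less_le)
 have "\<bar>Re (ip w z)\<bar> <= nrm w * nrm z"
  using cauchy_schwarz[of w z] abs_Re_le_cmod[of "ip w z"] by (meson UNIV_I order_trans)
 hence "(c * nrm z) * nrm z <= nrm w * nrm z" using assms by (simp add: power2_eq_square)
 hence "c * nrm z <= nrm w" using n by (simp add: mult_le_cancel_right)
 thus ?thesis using assms(1) by (simp add: field_simps)
qed (use assms in simp)

text \<open>On an interval off 0 the modulus of \<lambda> / (1 + \<lambda>^2) is at least m / (1 +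
  r^2).\<close>

lemma P_Tt_bound_away:
 assumes st: "s < t" "0 < s \<or> t < 0"
 shows "\<exists>M\<ge>0. \<forall>x. nrm (P s t x) <= M * nrm (Tt x)"
proof -
 define r m where "r = max \<bar>s\<bar> \<bar>t\<bar>" and "m = min \<bar>s\<bar> \<bar>t\<bar>"
 define c where "c = m / (1 + r\<^sup>2)"
 have r: "\<bar>s\<bar> <= r" "\<bar>t\<bar> <= r" by (auto simp: r_def)
 have m: "m > 0" using st by (auto simp: m_def)
 have k: "0 < 1 + r\<^sup>2" by (simp add: add_pos_nonneg)
 have c: "c > 0" using m k by (simp add: c_def)
 have "nrm (P s t x) <= (1 / c) * nrm (Tt x)" for x
 proof -
  define z where "z = P s t x"
  have z: "P s t z = z" by (simp add: z_def)
  have "m * Yf z <= \<bar>Qf z\<bar>"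
  proof (cases "0 < s")
   case True
   have "m * Yf z <= s * Yf z" using True Yf_nonneg[of z] by (intro mult_right_mono) (auto simp: m_def)
   thus ?thesis using P_forms(1)[OF st(1) z] by linarith
  next
   case False
   hence "t < 0" using st by simp
   hence "m * Yf z <= (- t) * Yf z" using Yf_nonneg[of z] by (intro mult_right_mono) (auto simp: m_def)
   thus ?thesis using P_forms(2)[OF st(1) z] by linarith
  qed
  moreover have "(nrm z)\<^sup>2 / (1 + r\<^sup>2) <= Yf z" using Yf_lower[OF st(1) z r] k by (simp add: field_simps)
  hence "m * ((nrm z)\<^sup>2 / (1 + r\<^sup>2)) <= m * Yf z" using m by (intro mult_left_mono) auto
  ultimately have "c * (nrm z)\<^sup>2 <= \<bar>Re (ip (Tt z) z)\<bar>" by (simp add: c_def Qf_def)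
  from form_lower_norm[OF c this] have "nrm z <= (1 / c) * nrm (Tt z)" .
  also have "Tt z = P s t (Tt x)" by (simp add: z_def bic_app)
  also have "(1 / c) * nrm (P s t (Tt x)) <= (1 / c) * nrm (Tt x)"
   using c P_contr by (intro mult_left_mono) auto
  finally show ?thesis by (simp add: z_def)
 qed
 thus ?thesis using c by (intro exI[of _ "1 / c"]) auto
qed

text \<open>Around 0 the projection is not dominated by T, since it is 1 at 0; subtracting Y, also 1
  at 0, leaves P (1 - Y) and Y (1 - P). On ran(P) one has c (1 - Y)^2 \<le> c (1 - Y) \<le> Y (1 -
  Y) = T^2. On its complement \<delta> \<le> \<open>Vt 0\<close> = 1 - Y, so that \<delta> Y^2 \<le>
  \<delta> Y \<le> T^2.\<close>

lemma P_Tt_bound_zero: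
 assumes st: "s < 0" "0 < t"
 shows "\<exists>M\<ge>0. \<forall>x. nrm (P s t x - Yt (P s t x)) <= M * nrm (Tt x) \<and> nrm (Yt (x - P s t x)) <= M * nrm (Tt x)"
proof -
 define r where "r = max \<bar>s\<bar> \<bar>t\<bar>"
 define c where "c = 1 / (1 + r\<^sup>2)"
 have r: "\<bar>s\<bar> <= r" "\<bar>t\<bar> <= r" by (auto simp: r_def)
 have k: "0 < 1 + r\<^sup>2" by (simp add: add_pos_nonneg)
 have c: "c > 0" using k by (simp add: c_def)
 have s_t: "s < t" using st by simp
 obtain \<delta> where d: "\<delta> > 0" "!!w. P s t w = 0 ==> \<delta> * (nrm w)\<^sup>2 <= Re (ip (Vt 0 w) w)"
  using Vt_lower[OF st] by blast
 have sqrt_bound: "u <= (1 / sqrt e) * v" if "e * u\<^sup>2 <= v\<^sup>2" "e > 0" "0 <= u" "0 <= v" for e u v :: real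
 proof -
  have "(sqrt e * u)\<^sup>2 <= v\<^sup>2" using that by (simp add: power_mult_distrib)
  hence "sqrt e * u <= v" by (rule power2_le_imp_le) (use that in simp)
  thus ?thesis using that by (simp add: field_simps)
 qed
 define M where "M = 1 / sqrt c + 1 / sqrt \<delta>"
 have "nrm (P s t x - Yt (P s t x)) <= M * nrm (Tt x) \<and> nrm (Yt (x - P s t x)) <= M * nrm (Tt x)" for x
 proof
  define z where "z = P s t x"
  have z: "P s t z = z" by (simp add: z_def)
  have "0 <= Re (ip ((Yt - of_real c *\<^sub>C 1) ((1 - Yt) z)) z)"
  proof (rule bic_pos_mult[of "P s t"])
   show "0 <= Re (ip ((Yt - of_real c *\<^sub>C 1) w) w)" if "P s t w = w" for w
    using Yf_lower[OF s_t that r] k by (simp add: Yf_def nrm_sq c_def field_simps)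
   show "0 <= Re (ip ((1 - Yt) w) w)" for w
    using Yf_le[of w] by (simp add: Yf_def nrm_sq)
  qed (use z in auto)
  hence "c * ((nrm z)\<^sup>2 - Yf z) <= Yf z - (nrm (Yt z))\<^sup>2"
   by (simp add: Yf_def nrm_sq Yt2_form algebra_simps)
  moreover have "(nrm (z - Yt z))\<^sup>2 <= (nrm z)\<^sup>2 - Yf z"
   using Yf_sq[of z] Re_swap[of "Yt z" z] by (simp add: nrm_sq_diff Yf_def)
  hence "c * (nrm (z - Yt z))\<^sup>2 <= c * ((nrm z)\<^sup>2 - Yf z)" using c by (intro mult_left_mono) auto
  ultimately have "c * (nrm (z - Yt z))\<^sup>2 <= (nrm (Tt z))\<^sup>2" using Tt_sq[of z] by linarith
  hence "nrm (z - Yt z) <= (1 / sqrt c) * nrm (Tt z)" using c by (intro sqrt_bound) auto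
  also have "Tt z = P s t (Tt x)" by (simp add: z_def bic_app)
  also have "(1 / sqrt c) * nrm (P s t (Tt x)) <= M * nrm (Tt x)"
   using c d P_contr by (intro mult_mono) (auto simp: M_def)
  finally show "nrm (P s t x - Yt (P s t x)) <= M * nrm (Tt x)" by (simp add: z_def)
 next
  define w where "w = x - P s t x"
  have w: "P s t w = 0" by (simp add: w_def)
  have "0 <= Re (ip ((1 - Yt - of_real \<delta> *\<^sub>C 1) (Yt w)) w)"
  proof (rule bic_pos_mult[of "1 - P s t"])
   show "0 <= Re (ip ((1 - Yt - of_real \<delta> *\<^sub>C 1) v) v)" if "(1 - P s t) v = v" for v
    using d(2)[of v] that by (simp add: Vt_form Yf_def nrm_sq)
   show "0 <= Re (ip (Yt v) v)" for v using Yf_nonneg[of v] by (simp add: Yf_def)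
  qed (use w in \<open>auto simp: algebra_simps\<close>)
  hence "\<delta> * Yf w <= Yf w - (nrm (Yt w))\<^sup>2"
   by (simp add: Yf_def nrm_sq Yt2_form)
  moreover have "\<delta> * (nrm (Yt w))\<^sup>2 <= \<delta> * Yf w" using d Yf_sq[of w] by (intro mult_left_mono) auto
  ultimately have "\<delta> * (nrm (Yt w))\<^sup>2 <= (nrm (Tt w))\<^sup>2" using Tt_sq[of w] by linarith
  hence "nrm (Yt w) <= (1 / sqrt \<delta>) * nrm (Tt w)" using d by (intro sqrt_bound) auto
  also have "Tt w = (1 - P s t) (Tt x)" by (simp add: w_def bic_app)
  also have "(1 / sqrt \<delta>) * nrm ((1 - P s t) (Tt x)) <= M * nrm (Tt x)"
   using c d proj_contraction[of "1 - P s t" "Tt x"]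
   by (intro mult_mono) (auto simp: M_def algebra_simps)
  finally show "nrm (Yt (x - P s t x)) <= M * nrm (Tt x)" by (simp add: w_def)
 qed
 moreover have "M \<ge> 0" using c d by (simp add: M_def)
 ultimately show ?thesis by blast
qed

lemma bic_lift:
 assumes s: "bic s" and M: "!!x. nrm (lapp (s - of_real a *\<^sub>C Yt) x) <= M * nrm (lapp Tt x)" "0 <= M"
 shows "\<exists>X h. lifts s a X \<and> X = of_real a *\<^sub>C Y + Th h \<and> bic h \<and> h * Tt = s - of_real a *\<^sub>C Yt \<and>
  (\<forall>x. Tt x = 0 --> h x = 0)"
proof -
 have c: "s * Tt = Tt * s" "s * Yt = Yt * s" using s bic_commute[of s Tt] bic_commute[of s Yt] by auto
 obtain X h where *: "lifts s a X" "X = of_real a *\<^sub>C Y + Th h" "sym h" "bnd h"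
  "h * Tt = s - of_real a *\<^sub>C Yt" "!!x. Tt x = 0 ==> h x = 0"
  "!!V. bnd V ==> V * Tt = Tt * V ==> V * Yt = Yt * V ==> V * s = s * V ==> V * h = h * V"
  using lift_exists[OF bic_sym[OF s] bic_bnd[OF s] c M] by blast
 have "bic h" unfolding bic_def using * bicD[OF s] by blast
 thus ?thesis using * by blast
qed

text \<open>The value at 0 of the indicator function of the interval, to be used on ker(T);
  endpoints are nonzero wherever it is applied.\<close>

definition al :: "real => real => real" where "al s t = (if s < 0 \<and> 0 < t then 1 else 0)"

lemma P_bound:
 assumes "s ~= 0" "t ~= 0"
 shows "\<exists>M\<ge>0. \<forall>x. nrm ((P s t - of_real (al s t) *\<^sub>C Yt) x) <= M * nrm (Tt x)"
proof (cases "s < t")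
 case True
 show ?thesis
 proof (cases "s < 0 \<and> 0 < t")
  case st: True
  then obtain M where M: "M \<ge> 0" "!!x. nrm (P s t x - Yt (P s t x)) <= M * nrm (Tt x)"
   "!!x. nrm (Yt (x - P s t x)) <= M * nrm (Tt x)" using P_Tt_bound_zero[of s t] by blast
  have "nrm ((P s t - Yt) x) <= (2 * M) * nrm (Tt x)" for x
  proof -
   have "(P s t - Yt) x = (P s t x - Yt (P s t x)) - Yt (x - P s t x)" by simp
   hence "nrm ((P s t - Yt) x) <= nrm (P s t x - Yt (P s t x)) + nrm (Yt (x - P s t x))"
    using nrm_triangle_diff by (metis UNIV_I)
   thus ?thesis using M(2,3)[of x] by simp
  qed
  thus ?thesis using st M(1) by (intro exI[of _ "2 * M"]) (auto simp: al_def)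
 next
  case False
  hence "0 < s \<or> t < 0" using assms True by auto
  thus ?thesis using P_Tt_bound_away[OF True] False by (auto simp: al_def)
 qed
next
 case False
 thus ?thesis by (intro exI[of _ 0]) (auto simp: P_def al_def)
qed

text \<open>The spectral projection in the Krein space for the interval with endpoints s and t, as
  the lift of \<open>P s t\<close>.\<close>

definition E :: "real => real => 'a lop" where "E s t = (SOME X. lifts (P s t) (al s t) X)"

lemma E_h:
 assumes "s ~= 0" "t ~= 0"
 shows "\<exists>h. lifts (P s t) (al s t) (E s t) \<and> E s t = of_real (al s t) *\<^sub>C Y + Th h \<and> bic h \<and>
  h * Tt = P s t - of_real (al s t) *\<^sub>C Yt \<and> (\<forall>x. Tt x = 0 --> h x = 0)"
proof -
 obtain M where M: "M \<ge> 0" "!!x. nrm ((P s t - of_real (al s t) *\<^sub>C Yt) x) <= M * nrm (Tt x)"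
  using P_bound[OF assms] by blast
 obtain X h where X: "lifts (P s t) (al s t) X" "X = of_real (al s t) *\<^sub>C Y + Th h" "bic h"
  "h * Tt = P s t - of_real (al s t) *\<^sub>C Yt" "\<forall>x. Tt x = 0 --> h x = 0"
  using bic_lift[OF P_bic M(2) M(1)] by blast
 have E: "lifts (P s t) (al s t) (E s t)" unfolding E_def by (rule someI[of "\<lambda>X. lifts (P s t) (al s t) X", OF X(1)])
 have "E s t = X" using lifts_unique[OF E X(1)] .
 thus ?thesis using E X by blast
qed

lemma E_lifts: "s ~= 0 ==> t ~= 0 ==> lifts (P s t) (al s t) (E s t)"
 using E_h by blast

lemma E_mult:
 assumes "s ~= 0" "t ~= 0" "u ~= 0" "v ~= 0"
 shows "E s t * E u v = E (max s u) (min t v)"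
proof (rule lifts_mult[OF E_lifts E_lifts])
 have "al s t * al u v = al (max s u) (min t v)" by (simp add: al_def)
 thus "lifts (P s t * P u v) (al s t * al u v) (E (max s u) (min t v))"
  using E_lifts[of "max s u" "min t v"] assms by (simp add: P_mult max_def min_def)
 show "P s t * P u v = P u v * P s t" by (rule bic_commute) auto
qed (use assms in auto)

lemma E_empty: "s ~= 0 ==> t ~= 0 ==> t <= s ==> E s t = 0"
proof -
 assume a: "s ~= 0" "t ~= 0" "t <= s"
 have "lifts (P s t) (al s t) 0" using a by (auto simp: lifts_def P_def al_def)
 thus ?thesis using lifts_unique E_lifts a by blast
qed

lemma E_split:
 assumes "s ~= 0" "t ~= 0" "u ~= 0" "s <= t" "t <= u"
 shows "E s u = E s t + E t u"
proof -
 consider "s = t" | "t = u" | "s < t" "t < u" "s < u" using assms by linarith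
 hence "P s u = P s t + P t u" by cases (simp_all add: P_def)
 moreover have "al s u = al s t + al t u" unfolding al_def using assms by (smt (verit))
 ultimately show ?thesis
  using lifts_unique[OF E_lifts[of s u]] lifts_add[OF E_lifts[of s t] E_lifts[of t u]] assms by simp
qed

text \<open>When 0 is outside the interval, E s t = \<open>Th h\<close> with h Tt = P s t. The
  vector z = h (D x) then lies in ran(P s t), and [E s t x, x] = Qf z has the sign of the
  interval.\<close>

lemma
 shows E_nonneg: "0 < s ==> t ~= 0 ==> 0 <= Re (ip (J (E s t x)) x)"
  and E_nonpos: "s ~= 0 ==> t < 0 ==> Re (ip (J (E s t x)) x) <= 0"
proof -
 have *: "\<exists>z. P s t z = z \<and> Re (ip (J (E s t x)) x) = Qf z" if st: "s ~= 0" "t ~= 0" "al s t = 0" for s t x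
 proof -
  obtain h where h: "E s t = of_real (al s t) *\<^sub>C Y + Th h" "bic h" "h * Tt = P s t - of_real (al s t) *\<^sub>C Yt"
   "!!x. Tt x = 0 ==> h x = 0" using E_h[OF st(1,2)] by blast
  have hT: "h * Tt = P s t" using h(3) st(3) by simp
  have "P s t * h = h"
  proof (rule bic_eq[OF bic_Tt])
   show "P s t * h * Tt = h * Tt" by (simp add: mult.assoc hT)
  qed (use h in auto)
  hence Ph: "P s t (h y) = h y" for y by (metis lapp_mult)
  define z where "z = h (D x)"
  have "P s t z = h (Tt z)" using hT by (metis lapp_mult)
  hence hz: "h (Tt z) = z" using Ph by (simp add: z_def)
  have "ip (J (E s t x)) x = ip z (D x)" using h(1) st(3) by (simp add: Th_ip z_def)
  also have "... = ip (h (Tt z)) (D x)" by (simp add: hz)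
  also have "... = ip (Tt z) z" unfolding z_def using h(2) symD bic_sym by blast
  finally show ?thesis using Ph[of "D x"] by (intro exI[of _ z]) (simp add: z_def Qf_def)
 qed
 show "0 <= Re (ip (J (E s t x)) x)" if st: "0 < s" "t ~= 0"
 proof (cases "s < t")
  case True
  obtain z where z: "P s t z = z" "Re (ip (J (E s t x)) x) = Qf z"
   using *[of s t x] st by (auto simp: al_def)
  have "0 <= s * Yf z" using st Yf_nonneg[of z] by simp
  thus ?thesis using P_forms(1)[OF True z(1)] z(2) by simp
 qed (use E_empty[of s t] st in simp)
 show "Re (ip (J (E s t x)) x) <= 0" if st: "s ~= 0" "t < 0"
 proof (cases "s < t")
  case True
  obtain z where z: "P s t z = z" "Re (ip (J (E s t x)) x) = Qf z"
   using *[of s t x] st by (auto simp: al_def)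
  have "t * Yf z <= 0" using st Yf_nonneg[of z] by (simp add: mult_nonpos_nonneg)
  thus ?thesis using P_forms(2)[OF True z(1)] z(2) by simp
 qed (use E_empty[of s t] st in simp)
qed

end

section \<open>Commutation, factorisation and local inverses of the lifted projections\<close>

context krein_model
begin

lemma Th_slim:
 assumes "slim X Z" shows "slim (\<lambda>n. Th (X n)) (Th Z)"
 unfolding Th_def
 by (intro slim_mult_right slim_mult_left assms) (use D in auto)

text \<open>V need not be transportable through D. But Th (F (Bt t)) = T F (T - t Y) for polynomials
  F, which lies in the algebra generated by T and Y, and \<open>N t\<close> is a strong limit of
  such polynomials.\<close>

lemma Th_N_commute:
 assumes V: "bnd V" "V * T = T * V" "V * Y = Y * V"
 shows "V * Th (N t) = Th (N t) * V"
proof -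
 obtain F where F: "!!n. polyfun (F n)" "slim (\<lambda>n. F n (Bt t)) (N t)" using N_props by blast
 define B where "B = T - of_real t *\<^sub>C Y"
 have DB: "D * B = Bt t * D" by (simp add: B_def Bt_def right_diff_distrib left_diff_distrib Tt_D Yt)
 have VB: "V * B = B * V" using V by (simp add: B_def right_diff_distrib left_diff_distrib)
 have "Th (F n (Bt t)) = T * F n B" for n
  by (rule T_mult[symmetric]) (rule polyfun_intertwine[OF F(1) DB])
 moreover have "V * (T * F n B) = T * F n B * V" for n
  using polyfun_commute[OF F(1)[of n] VB] V(2) by (metis mult.assoc)
 ultimately show ?thesis by (intro slim_commute[OF Th_slim[OF F(2)] V(1)]) simp
qed

lemma E_commute:
 assumes st: "s ~= 0" "t ~= 0" and V: "bnd V" "V * T = T * V" "V * Y = Y * V"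
 shows "V * E s t = E s t * V"
proof (rule lifts_commute[OF E_lifts[OF st] V(1,2)])
 show "V * Th (P s t) = Th (P s t) * V"
  using Th_N_commute[OF V, of s] Th_N_commute[OF V, of t]
  by (simp add: P_def Th_diff right_diff_distrib left_diff_distrib Th_def)
qed

lemma lifts_TY_commute:
 assumes X: "lifts s a X" and s: "bic s"
 shows "T * X = X * T" "Y * X = X * Y"
proof -
 have "T * Th s = Th s * T" using bic_commute[OF s bic_Tt] by (simp add: T_Th Th_T)
 thus "T * X = X * T" by (intro lifts_commute[OF X Tb]) simp_all
 have "Y * Th s = Th s * Y" using bic_commute[OF s bic_Yt] by (simp add: Y_Th Th_Y)
 thus "Y * X = X * Y" using TY by (intro lifts_commute[OF X Yb]) simp_all
qed

lemma lifts_lifts_commute: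
 assumes X: "lifts s a X" "bic s" and Z: "lifts r b Z" "bic r"
 shows "Z * X = X * Z"
proof -
 have "Z * Th s = Th s * Z"
 proof -
  have "T * (Z * X) = Th r * X" using liftsD(4)[OF Z(1)] by (simp add: mult.assoc[symmetric])
  have 1: "Th s * Z = Th (s * r)" by (rule Th_mult) (rule liftsD(3)[OF Z(1)])
  have "Z * Th s = Z * (T * X)" using liftsD(4)[OF X(1)] by simp
  also have "... = T * Z * X" using lifts_TY_commute[OF Z] by (simp add: mult.assoc[symmetric])
  also have "... = Th (r * s)" using liftsD(4)[OF Z(1)] Th_mult[OF liftsD(3)[OF X(1)]] by simp
  finally show ?thesis using 1 bic_commute[OF X(2) Z(2)] by simp
 qed
 thus ?thesis using lifts_TY_commute[OF Z] by (intro lifts_commute[OF X(1) liftsD(1)[OF Z(1)]]) simp_all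
qed

lemma Y_lifts: "lifts Yt 1 Y"
 using Yb Yk Yt Y_ker by (simp add: lifts_def)

text \<open>m is the function 1 + \<lambda>^2 on the interval and 0 elsewhere, and X is its lift.
  For the T and Y of an operator A, where (Y x, T x) is in the graph of A, this factorisation puts
  ran(E s t) into dom(A) and shows A E s t = T X to be bounded.\<close>

lemma E_factor:
 assumes st: "s ~= 0" "t ~= 0"
 obtains m X where "bic m" "lifts m (al s t) X" "E s t = Y * X"
proof (cases "s < t")
 case True
 define r where "r = max \<bar>s\<bar> \<bar>t\<bar>"
 have r: "\<bar>s\<bar> <= r" "\<bar>t\<bar> <= r" by (auto simp: r_def)
 define c where "c = 1 + r\<^sup>2"
 have c: "0 <= c" by (simp add: c_def)
 have b: "nrm (P s t x) <= c * nrm (Yt x)" for x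
 proof -
  have "nrm (P s t x) <= c * nrm (Yt (P s t x))" unfolding c_def by (rule Yt_lower[OF True _ r]) simp
  also have "Yt (P s t x) = P s t (Yt x)" by (rule bic_app) auto
  also have "c * nrm (P s t (Yt x)) <= c * nrm (Yt x)" using c P_contr by (intro mult_left_mono) auto
  finally show ?thesis .
 qed
 obtain m where m: "bic m" "m * Yt = P s t" "!!x. Yt x = 0 ==> m x = 0"
  using bic_douglas[OF bic_Yt P_bic b c] by blast
 have mP: "m * P s t = m"
 proof (rule bic_eq[OF bic_Yt])
  show "m * P s t * Yt = m * Yt" using m(2) bic_commute[OF P_bic bic_Yt] P_idem by (metis mult.assoc)
  fix k assume k: "Yt k = 0"
  have "m (P s t k) = P s t (m k)" by (rule bic_app) (use m in auto)
  thus "lapp (m * P s t) k = m k" using m(3)[OF k] by simp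
 qed (use m in auto)
 hence mP': "m x = m (P s t x)" for x by (metis lapp_mult)
 obtain K where K: "K > 0" "!!x. nrm (m x) <= K * nrm x" using bic_bnd[OF m(1)] by (meson bndE)
 have "\<exists>M\<ge>0. \<forall>x. nrm ((m - of_real (al s t) *\<^sub>C Yt) x) <= M * nrm (Tt x)"
 proof (cases "s < 0 \<and> 0 < t")
  case False
  hence "0 < s \<or> t < 0" using st True by auto
  then obtain M where M: "M \<ge> 0" "!!x. nrm (P s t x) <= M * nrm (Tt x)" using P_Tt_bound_away[OF True] by blast
  have "nrm (m x) <= (K * M) * nrm (Tt x)" for x
  proof -
   have "K * nrm (P s t x) <= K * (M * nrm (Tt x))" using K(1) M(2)[of x] by (intro mult_left_mono) auto
   thus ?thesis using K(2)[of "P s t x"] unfolding mP'[symmetric] by (simp only: mult.assoc)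
  qed
  thus ?thesis using False M(1) K(1) by (intro exI[of _ "K * M"]) (auto simp: al_def)
 next
  case st': True
  then obtain M where M: "M \<ge> 0" "!!x. nrm (P s t x - Yt (P s t x)) <= M * nrm (Tt x)"
   "!!x. nrm (Yt (x - P s t x)) <= M * nrm (Tt x)" using P_Tt_bound_zero[of s t] by blast
  have "nrm ((m - Yt) x) <= (2 * K * M + M) * nrm (Tt x)" for x
  proof -
   define z where "z = P s t x"
   have zz: "P s t z = z" by (simp add: z_def)
   define u where "u = z - Yt z"
   \<comment> \<open>On ran(P s t) one has m Y = 1, hence m - Y = m (1 - Y^2) = m (1 + Y) (1 - Y),
     and 1 - Y is dominated by T there.\<close>
   have "m (Yt (Yt z)) = P s t (Yt z)" using m(2) by (metis lapp_mult)
   also have "P s t (Yt z) = Yt z" using zz bic_app[of "P s t" Yt z] by simp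
   finally have "m (u + Yt u) = m z - Yt z" by (simp add: u_def)
   moreover have "(m - Yt) x = m z - Yt z - Yt (x - z)" using mP'[of x] by (simp add: z_def)
   ultimately have e: "(m - Yt) x = m (u + Yt u) - Yt (x - z)" by simp
   have "nrm (m (u + Yt u)) <= K * nrm (u + Yt u)" by (rule K)
   also have "... <= K * (2 * nrm u)"
    using nrm_triangle[of u "Yt u"] Yt_contr[of u] K(1) by (intro mult_left_mono) auto
   also have "... <= K * (2 * (M * nrm (Tt x)))"
    using M(2)[of x] K(1) by (intro mult_left_mono) (auto simp: u_def z_def)
   finally show ?thesis using nrm_triangle_diff[of "m (u + Yt u)" "Yt (x - z)"] M(3)[of x]
    unfolding e by (simp add: z_def algebra_simps)
  qed
  moreover have "0 <= 2 * K * M + M" using K(1) M(1) by simp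
  ultimately show ?thesis using st' by (intro exI[of _ "2 * K * M + M"]) (auto simp: al_def)
 qed
 then obtain M where M: "M \<ge> 0" "!!x. nrm ((m - of_real (al s t) *\<^sub>C Yt) x) <= M * nrm (Tt x)" by blast
 obtain X where X: "lifts m (al s t) X" using bic_lift[OF m(1) M(2) M(1)] by blast
 have "Yt * m = P s t" using m(2) bic_commute[OF m(1) bic_Yt] by simp
 hence "lifts (Yt * m) (1 * al s t) (E s t)" using E_lifts[OF st] by simp
 from lifts_mult[OF Y_lifts X this] have "Y * X = E s t" using bic_commute[OF bic_Yt m(1)] by simp
 thus thesis using that m X by metis
next
 case False
 have "lifts 0 (al s t) 0" using False by (auto simp: lifts_def al_def)
 thus thesis using that[of 0 0] E_empty[of s t] False st by simp
qed

text \<open>W is the inverse of \<lambda> - z0 off the interval, (1 - P) / (\<lambda> - z0). In the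
  model it is k \<open>Bt z0\<close>, where k divides 1 - P by \<open>Vt z0\<close> = (\<lambda> -
  z0)^2 / (1 + \<lambda>^2). The displayed equation is the resolvent identity at i, since T + i Y is
  the resolvent there.\<close>

lemma inverse_lift:
 assumes st: "s ~= 0" "t ~= 0" and z0: "s < z0" "z0 < t" "z0 = 0 \<or> 0 < s \<or> t < 0"
 obtains W where "bnd W" "W = (T + \<i> *\<^sub>C Y) * ((1 - E s t) + (of_real z0 - \<i>) *\<^sub>C W)"
  "W * T = T * W" "W * Y = Y * W" "!!u v. u ~= 0 ==> v ~= 0 ==> W * E u v = E u v * W"
proof -
 have stt: "s < t" using z0 by simp
 obtain \<delta> where d: "\<delta> > 0" "!!w. P s t w = 0 ==> \<delta> * (nrm w)\<^sup>2 <= Re (ip (Vt z0 w) w)"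
  using Vt_lower[OF z0(1,2)] by blast
 have "nrm ((1 - P s t) x) <= (1 / \<delta>) * nrm (Vt z0 x)" for x
 proof -
  define w where "w = x - P s t x"
  have "P s t w = 0" by (simp add: w_def)
  hence "\<delta> * (nrm w)\<^sup>2 <= \<bar>Re (ip (Vt z0 w) w)\<bar>" using d(2)[of w] by linarith
  from form_lower_norm[OF d(1) this] have "nrm w <= (1 / \<delta>) * nrm (Vt z0 w)" .
  also have "Vt z0 w = (1 - P s t) (Vt z0 x)"
   using bic_app[of "Vt z0" "P s t" x] by (simp add: w_def)
  also have "(1 / \<delta>) * nrm ((1 - P s t) (Vt z0 x)) <= (1 / \<delta>) * nrm (Vt z0 x)"
   using d(1) proj_contraction[of "1 - P s t"] by (intro mult_left_mono) (auto simp: algebra_simps)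
  finally show ?thesis by (simp add: w_def)
 qed
 then obtain k where k: "bic k" "k * Vt z0 = 1 - P s t" "!!x. Vt z0 x = 0 ==> k x = 0"
  using bic_douglas[of "Vt z0" "1 - P s t" "1 / \<delta>"] d(1) by auto
 have kP: "k * P s t = 0"
 proof (rule bic_eq[of "Vt z0"])
  have "k * P s t * Vt z0 = k * Vt z0 * P s t" using bic_commute[of "P s t" "Vt z0"] by (simp add: mult.assoc)
  thus "k * P s t * Vt z0 = 0 * Vt z0" by (simp add: k(2) left_diff_distrib)
  fix x assume x: "Vt z0 x = 0"
  have "k (P s t x) = P s t (k x)" by (rule bic_app) (use k in auto)
  thus "lapp (k * P s t) x = lapp 0 x" using k(3)[OF x] by simp
 qed (use k in auto)
 have kP': "k (P s t x) = 0" for x using kP by (metis lapp_mult lapp_zero)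
 have kV': "k (Vt z0 x) = x - P s t x" for x using k(2) by (metis lapp_mult lapp_diff lapp_one)
 obtain K where K: "K > 0" "!!x. nrm (k x) <= K * nrm x" using bic_bnd[OF k(1)] by (meson bndE)
 \<comment> \<open>The value of (1 - P) / (\<lambda> - z0) at \<lambda> = 0: zero if z0 = 0, because
   then P is 1 there, and otherwise - 1 / z0, because 0 is outside the interval.\<close>
 define a where "a = (if z0 = 0 then 0 else - 1 / z0)"
 have "\<exists>M\<ge>0. \<forall>x. nrm ((k * Bt z0 - of_real a *\<^sub>C Yt) x) <= M * nrm (Tt x)"
 proof (cases "z0 = 0")
  case True
  thus ?thesis using K by (intro exI[of _ K]) (auto simp: a_def Bt_def)
 next
  case False
  hence "0 < s \<or> t < 0" using z0 by simp
  then obtain M where M: "M \<ge> 0" "!!x. nrm (P s t x) <= M * nrm (Tt x)" using P_Tt_bound_away[OF stt] by blast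
  \<comment> \<open>G is chosen such that T G = z0 \<open>Bt z0\<close> + \<open>Vt z0\<close> Y.
    With k \<open>Vt z0\<close> = 1 - P this gives z0 (k \<open>Bt z0\<close> - a Y) = k G T + P Y,
    and both terms are dominated by T.\<close>
  define G where "G = of_real z0 *\<^sub>C 1 + Tt - of_real (2 * z0) *\<^sub>C Yt - of_real (z0\<^sup>2) *\<^sub>C Tt"
  have Gb: "bic G" unfolding G_def by (intro bic_add bic_diff bic_scale bic_1 bic_Tt bic_Yt)
  obtain L where L: "L > 0" "!!x. nrm (G x) <= L * nrm x" using bic_bnd[OF Gb] by (meson bndE)
  have "nrm ((k * Bt z0 - of_real a *\<^sub>C Yt) x) <= (\<bar>1 / z0\<bar> * (M + K * L)) * nrm (Tt x)" for x
  proof -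
   have YY: "Yt (Yt x) = Yt x - Tt (Tt x)" using TtTt by (metis lapp_diff lapp_mult diff_diff_eq2 add_diff_cancel_left')
   have sym1: "G (Tt x) = of_real z0 *\<^sub>C Bt z0 x + Vt z0 (Yt x)"
    by (simp add: G_def Bt_def Vt_def YY TtYt_app algebra_simps power2_eq_square)
   have "k (Vt z0 (Yt x)) = Yt x - Yt (P s t x)" using kV' bic_app[of "P s t" Yt] by simp
   hence sc: "of_real z0 *\<^sub>C ((k * Bt z0 - of_real a *\<^sub>C Yt) x) = k (G (Tt x)) + Yt (P s t x)"
    using False by (simp add: sym1 a_def complex_vector.scale_right_diff_distrib complex_vector.scale_right_distrib)
   have "v = of_real (1 / z0) *\<^sub>C (of_real z0 *\<^sub>C v)" for v :: 'a using False by simp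
   hence e: "(k * Bt z0 - of_real a *\<^sub>C Yt) x = of_real (1 / z0) *\<^sub>C (k (G (Tt x)) + Yt (P s t x))"
    unfolding sc[symmetric] .
   have "nrm (k (G (Tt x)) + Yt (P s t x)) <= nrm (k (G (Tt x))) + nrm (Yt (P s t x))" by (rule nrm_triangle) auto
   also have "nrm (k (G (Tt x))) <= K * (L * nrm (Tt x))"
    using K(2)[of "G (Tt x)"] mult_left_mono[OF L(2)[of "Tt x"], of K] K(1) by linarith
   also have "nrm (Yt (P s t x)) <= M * nrm (Tt x)" using Yt_contr[of "P s t x"] M(2)[of x] by linarith
   finally have "nrm (k (G (Tt x)) + Yt (P s t x)) <= (M + K * L) * nrm (Tt x)" by (simp add: algebra_simps)
   thus ?thesis unfolding e by (simp only: nrm_scale UNIV_I norm_of_real mult.assoc) (intro mult_left_mono; simp)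
  qed
  moreover have "0 <= \<bar>1 / z0\<bar> * (M + K * L)" using M(1) K(1) L(1) by simp
  ultimately show ?thesis by blast
 qed
 then obtain M where M: "M \<ge> 0" "!!x. nrm ((k * Bt z0 - of_real a *\<^sub>C Yt) x) <= M * nrm (Tt x)" by blast
 have sb: "bic (k * Bt z0)" using k(1) by simp
 obtain W where W: "lifts (k * Bt z0) a W" using bic_lift[OF sb M(2) M(1)] by blast
 have EL: "lifts (P s t) (al s t) (E s t)" by (rule E_lifts[OF st])
 have al: "1 - al s t + z0 * a = 0" using z0 by (auto simp: al_def a_def)
 define R where "R = T + \<i> *\<^sub>C Y"
 define c where "c = of_real z0 - \<i>"
 have DW: "D * ((1 - E s t) + c *\<^sub>C W) = ((1 - P s t) + c *\<^sub>C (k * Bt z0)) * D"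
  using liftsD(3)[OF W] liftsD(3)[OF EL] by (simp add: distrib_left distrib_right right_diff_distrib left_diff_distrib mult.assoc)
 have TR: "T * R = Th (Tt + \<i> *\<^sub>C Yt)"
  by (rule T_mult) (simp add: R_def distrib_left distrib_right Tt_D Yt)
 have symb: "(Tt + \<i> *\<^sub>C Yt) * ((1 - P s t) + c *\<^sub>C (k * Bt z0)) = k * Bt z0"
 proof (rule lop_eqI)
  fix x
  have YY: "Yt (Yt x) = Yt x - Tt (Tt x)" using TtTt by (metis lapp_diff lapp_mult diff_diff_eq2 add_diff_cancel_left')
  have tw: "(e * 2) *\<^sub>C v = e *\<^sub>C v + e *\<^sub>C v" "(\<i> * (e * 2)) *\<^sub>C v = (\<i> * e) *\<^sub>C v + (\<i> * e) *\<^sub>C v"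
   for e and v :: 'a
   by (simp_all add: complex_vector.scale_left_distrib[symmetric])
  define y where "y = Vt z0 x + c *\<^sub>C Bt z0 x"
  have 1: "((1 - P s t) + c *\<^sub>C (k * Bt z0)) x = k y" by (simp add: y_def kV')
  have "Tt (k y) + \<i> *\<^sub>C Yt (k y) = k (Tt y + \<i> *\<^sub>C Yt y)" using bic_app[OF k(1)] by simp
  also have "Tt y + \<i> *\<^sub>C Yt y = Bt z0 x"
   by (simp add: y_def Vt_def Bt_def c_def YY TtYt_app algebra_simps power2_eq_square
     complex_vector.scale_left_diff_distrib)
    (simp only: tw add_ac)
  finally show "lapp ((Tt + \<i> *\<^sub>C Yt) * ((1 - P s t) + c *\<^sub>C (k * Bt z0))) x = lapp (k * Bt z0) x"
   using 1 by simp
 qed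
 have "W - R * ((1 - E s t) + c *\<^sub>C W) = 0"
 proof (rule zero_op)
  have Radj: "ip (J (R x)) y = ip (J x) ((T - \<i> *\<^sub>C Y) y)" for x y
   using ksymD[of T x y] ksymD[OF Yk, of x y] Tpos by (simp add: R_def)
  show "ip (J ((W - R * ((1 - E s t) + c *\<^sub>C W)) x)) y =
   ip (J x) ((W - ((1 - E s t) + cnj c *\<^sub>C W) * (T - \<i> *\<^sub>C Y)) y)" for x y
  proof -
   define v where "v = (T - \<i> *\<^sub>C Y) y"
   have "ip (J (R (((1 - E s t) + c *\<^sub>C W) x))) y = ip (J (((1 - E s t) + c *\<^sub>C W) x)) v"
    unfolding v_def by (rule Radj)
   also have "... = ip (J x) (((1 - E s t) + cnj c *\<^sub>C W) v)"
    using liftsD(6)[OF W, of x v] liftsD(6)[OF EL, of x v] by simp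
   finally show ?thesis using liftsD(6)[OF W, of x y] unfolding v_def
    by (simp only: lapp_diff lapp_mult diff_left diff_right lop_diff UNIV_I)
  qed
  show "T * (W - R * ((1 - E s t) + c *\<^sub>C W)) = 0"
   using liftsD(4)[OF W] TR Th_mult[OF DW, of "Tt + \<i> *\<^sub>C Yt"] symb
   by (simp add: right_diff_distrib mult.assoc[symmetric])
  show "(W - ((1 - E s t) + cnj c *\<^sub>C W) * (T - \<i> *\<^sub>C Y)) n = 0" if n: "T n = 0" for n
  proof -
   have Wn: "W n = of_real a *\<^sub>C n" and En: "E s t n = of_real (al s t) *\<^sub>C n"
    using liftsD(5)[OF W n] liftsD(5)[OF EL n] by auto
   have "(W - ((1 - E s t) + cnj c *\<^sub>C W) * (T - \<i> *\<^sub>C Y)) n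
     = (of_real a + \<i> * (1 - of_real (al s t) + (of_real z0 + \<i>) * of_real a)) *\<^sub>C n"
    using n Y_ker[OF n] Wn En
    by (simp add: c_def algebra_simps complex_vector.scale_left_diff_distrib complex_vector.scale_left_distrib)
   also have "of_real a + \<i> * (1 - of_real (al s t) + (of_real z0 + \<i>) * of_real a)
     = \<i> * of_real (1 - al s t + z0 * a)" by (simp add: algebra_simps)
   finally show ?thesis by (simp only: al) simp
  qed
 qed
 hence "W = (T + \<i> *\<^sub>C Y) * ((1 - E s t) + (of_real z0 - \<i>) *\<^sub>C W)" by (simp add: R_def c_def)
 moreover have "W * E u v = E u v * W" if "u ~= 0" "v ~= 0" for u v
  by (rule lifts_lifts_commute[OF E_lifts[OF that] P_bic W sb])
 ultimately show thesis using that liftsD(1)[OF W] lifts_TY_commute[OF W sb] by simp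
qed

text \<open>On the spectral subspaces of shrinking neighbourhoods of 0 the operator tends to 0: the
 limit lies in the isotropic part of its kernel.\<close>

lemma E_shrink:
 assumes X: "lifts m a X" "bic m"
 shows "(\<lambda>n. nrm (T (X (E (- 1 / real (Suc n)) (1 / real (Suc n)) x)))) \<longlonglongrightarrow> 0"
proof -
 define p where "p n = P (- 1 / real (Suc n)) (1 / real (Suc n))" for n
 have neg: "- 1 / real (Suc n) < 1 / real (Suc n)" for n
  by (rule less_trans[of _ 0]) auto
 have pp: "p n * p k = p k" if "n <= k" for n k
 proof -
  have "1 / real (Suc k) <= 1 / real (Suc n)" using that by (intro divide_left_mono) auto
  thus ?thesis unfolding p_def P_mult by (simp add: max_def min_def)
 qed
 have psq: "(nrm (p n z))\<^sup>2 = Re (ip (p n z) z)" for n z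
 proof -
  have "ip (p n z) (p n z) = ip (p n (p n z)) z" unfolding p_def using symD[OF bic_sym[OF P_bic]] by metis
  thus ?thesis by (simp add: nrm_sq p_def)
 qed
 obtain p0 where p0: "slim p p0"
 proof (rule slim_mono[of p "\<lambda>z n. - (nrm (p n z))\<^sup>2" "\<lambda>_. 0"])
  fix z k n assume nk: "n <= (k :: nat)"
  have "ip (p k z) (p n z) = ip (p n (p k z)) z" unfolding p_def using symD[OF bic_sym[OF P_bic]] by metis
  also have "p n (p k z) = p k z" using pp[OF nk] by (metis lapp_mult)
  finally have "Re (ip (p k z) (p n z)) = (nrm (p k z))\<^sup>2" by (simp add: psq)
  thus "(nrm (p k z - p n z))\<^sup>2 <= - (nrm (p k z))\<^sup>2 - - (nrm (p n z))\<^sup>2" by (simp add: nrm_sq_diff)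
 qed auto
 have Tp: "Tt * p0 = 0"
 proof (rule lop_eqI)
  fix z
  have "(\<lambda>n. nrm (Tt (p n z) - Tt (p0 z))) \<longlonglongrightarrow> 0"
   using slimD[OF slim_mult_left[OF p0 Tt_bnd], of z] by simp
  hence "(\<lambda>n. nrm (Tt (p n z))) \<longlonglongrightarrow> nrm (Tt (p0 z))" by (intro nrm_tendsto) auto
  moreover have "(\<lambda>n. nrm (Tt (p n z))) \<longlonglongrightarrow> 0"
  proof (rule Lim_null_comparison)
   have "nrm (Tt (p n z)) <= nrm z * (1 / real (Suc n))" for n
   proof -
    define r where "r = 1 / real (Suc n)"
    have r: "0 < r" by (simp add: r_def)
    have "(nrm (Tt (p n z)))\<^sup>2 <= r\<^sup>2 * (nrm (Yt (p n z)))\<^sup>2"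
     by (rule Tt_le_Yt[of "- 1 / real (Suc n)" "1 / real (Suc n)"])
      (use neg r in \<open>auto simp: p_def r_def\<close>)
    also have "... <= r\<^sup>2 * (nrm z)\<^sup>2"
     using Yt_contr[of "p n z"] P_contr[of _ _ z] by (intro mult_left_mono power_mono) (auto simp: p_def intro: order_trans)
    finally have "(nrm (Tt (p n z)))\<^sup>2 <= (r * nrm z)\<^sup>2" by (simp add: power_mult_distrib)
    hence "nrm (Tt (p n z)) <= r * nrm z" by (rule power2_le_imp_le) (use r in simp)
    thus ?thesis by (simp add: r_def)
   qed
   thus "\<forall>\<^sub>F n in sequentially. norm (nrm (Tt (p n z))) <= nrm z * (1 / real (Suc n))" by simp
   show "(\<lambda>n. nrm z * (1 / real (Suc n))) \<longlonglongrightarrow> 0"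
    by (rule tendsto_mult_right_zero) (rule LIMSEQ_Suc[OF lim_1_over_n])
  qed
  ultimately have "nrm (Tt (p0 z)) = 0" using LIMSEQ_unique by blast
  thus "(Tt * p0) z = lapp 0 z" by simp
 qed
 \<comment> \<open>J D u lies in ker(T) and is orthogonal to ker(T) in the Krein space form, so
   \<open>nondeg\<close> makes it vanish. Without this the limit could survive on an isotropic part
   of the kernel.\<close>
 have Dzero: "D u = 0" if u: "Tt u = 0" for u
 proof -
  define n where "n = J (D u)"
  have "D n = 0" using u by (simp add: Tt_def n_def)
  hence "T n = 0" using T_D by (metis lapp_mult lop_zero)
  moreover have "ip (J n) k = 0" if k: "T k = 0" for k
   using D_ker[OF k] Dsym by (simp add: n_def symD)
  ultimately have "n = 0" by (rule nondeg)
  thus ?thesis by (metis JJ n_def lop_zero)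
 qed
 have lim: "slim (\<lambda>n. J * D * m * p n * D) (J * D * m * p0 * D)"
  using X(2) D by (intro slim_mult_right slim_mult_left[OF p0]) auto
 have "Tt (m (p0 z)) = 0" for z using Tp bic_app[OF bic_Tt X(2)] by (metis lapp_mult lapp_zero lop_zero)
 hence "J * D * m * p0 * D = 0" by (intro lop_eqI) (simp add: Dzero)
 hence "(\<lambda>n. nrm ((J * D * m * p n * D) x)) \<longlonglongrightarrow> 0" using slimD[OF lim, of x] by simp
 moreover have "J * D * m * p n * D = T * X * E (- 1 / real (Suc n)) (1 / real (Suc n))" for n
  using Th_mult[OF liftsD(3)[OF E_lifts], of "- 1 / real (Suc n)" "1 / real (Suc n)" m] liftsD(4)[OF X(1)]
  by (simp add: Th_def mult.assoc p_def)
 ultimately show ?thesis by simp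
qed

end

section \<open>The spectral function of a nonnegative operator\<close>

text \<open>The setting in which a spectral function is constructed. \<open>ker_nondeg\<close>
  becomes the assumption \<open>nondeg\<close> of \<open>krein_model\<close>, because ker(T) =
  ker(A) by \<open>T_ker\<close>.\<close>

locale nonneg_krein = hilbert_ops ip for ip :: "'a::complex_vector => 'a => complex" +
 fixes J :: "'a lop" and form :: "'a => 'a => complex" and A :: "('a \<times> 'a) set"
 assumes J2: "J * J = 1" and Jsym: "sym J" and form_ip: "form x y = ip (J x) y"
  and A_op: "operator_in UNIV A" and A_sa: "A = adjoint_in UNIV form A"
  and A_nonneg: "krein_nonnegative form A"
  and A_res: "Im z ~= 0 ==> z \<in> resolvent_set_in ip UNIV A"
  and ker_nondeg: "!!n. (n, 0) \<in> A ==> (!!k. (k, 0) \<in> A ==> form n k = 0) ==> n = 0"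
begin

lemma A_unique: "(f, g) \<in> A ==> (f, h) \<in> A ==> g = h"
 using A_op by (auto simp: operator_in_def single_valued_def)
lemma A_zero: "(0, 0) \<in> A" using A_op by (simp add: operator_in_def)
lemma A_add: "(f, f') \<in> A ==> (g, g') \<in> A ==> (f + g, f' + g') \<in> A"
 using A_op by (simp add: operator_in_def)
lemma A_scale: "(f, f') \<in> A ==> (c *\<^sub>C f, c *\<^sub>C f') \<in> A"
 using A_op by (simp add: operator_in_def)
lemma A_diff: "(f, f') \<in> A ==> (g, g') \<in> A ==> (f - g, f' - g') \<in> A"
 using A_add[of f f' "(-1) *\<^sub>C g" "(-1) *\<^sub>C g'"] A_scale[of g g' "-1"] by simp
lemma A_sym: "(f, f') \<in> A ==> (g, g') \<in> A ==> form f' g = form f g'"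
proof -
 assume a: "(f, f') \<in> A" "(g, g') \<in> A"
 have "(g, g') \<in> adjoint_in UNIV form A" using a(2) A_sa by blast
 thus ?thesis using a(1) by (auto simp: adjoint_in_def)
qed

lemma form_add: "form (x + y) z = form x z + form y z" "form z (x + y) = form z x + form z y"
 and form_scale: "form (c *\<^sub>C x) z = c * form x z" "form z (c *\<^sub>C x) = cnj c * form z x"
 and form_diff: "form (x - y) z = form x z - form y z" "form z (x - y) = form z x - form z y"
 and form_0 [simp]: "form 0 z = 0" "form z 0 = 0"
 and form_minus: "form (- x) z = - form x z" "form z (- x) = - form z x"
 by (simp_all add: form_ip)

lemma form_herm: "form y x = cnj (form x y)"
proof -
 have "ip (J y) x = ip y (J x)" using Jsym symD by blast
 thus ?thesis using herm[of "J x" y] by (simp add: form_ip)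
qed

lemma form_Im [simp]: "Im (form x x) = 0"
 using form_herm[of x x] by (metis cnj.simps(2) neg_equal_zero)

lemma A_nonneg': "(f, f') \<in> A ==> 0 <= Re (form f' f)" "(f, f') \<in> A ==> Im (form f' f) = 0"
 using A_nonneg by (auto simp: krein_nonnegative_def complex_nonneg_Reals_iff)

definition R :: "complex => 'a lop" where "R z = Lop (resolvent A z)"

lemma res_ex: "Im z ~= 0 ==> \<exists>!f. (f, h + z *\<^sub>C f) \<in> A"
 using A_res[of z] by (simp add: resolvent_set_in_def)

lemma res_mem: "Im z ~= 0 ==> (resolvent A z h, h + z *\<^sub>C resolvent A z h) \<in> A"
 unfolding resolvent_def by (rule theI') (rule res_ex)

lemma res_unique: "Im z ~= 0 ==> (f, h + z *\<^sub>C f) \<in> A ==> resolvent A z h = f"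
 using res_ex[of z h] res_mem[of z h] by blast

lemma R_app: assumes z: "Im z ~= 0" shows "lapp (R z) = resolvent A z"
 unfolding R_def
proof (rule lapp_Lop)
 fix x y
 show "resolvent A z (x + y) = resolvent A z x + resolvent A z y"
  using A_add[OF res_mem[OF z, of x] res_mem[OF z, of y]]
  by (intro res_unique[OF z]) (simp add: algebra_simps)
next
 fix c x
 show "resolvent A z (c *\<^sub>C x) = c *\<^sub>C resolvent A z x"
  using A_scale[OF res_mem[OF z, of x], of c]
  by (intro res_unique[OF z]) (simp add: complex_vector.scale_right_distrib mult.commute)
qed

lemma R_mem: "Im z ~= 0 ==> (R z x, x + z *\<^sub>C R z x) \<in> A"
 using res_mem by (simp add: R_app)

lemma R_unique: "Im z ~= 0 ==> (f, f') \<in> A ==> R z (f' - z *\<^sub>C f) = f"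
 using res_unique[of z f "f' - z *\<^sub>C f"] by (simp add: R_app)

lemma R_bnd: assumes z: "Im z ~= 0" shows "bnd (R z)"
proof -
 obtain C where C: "\<forall>(f, f')\<in>A. nrm f <= C * nrm (f' - z *\<^sub>C f)"
  using A_res[OF z] unfolding resolvent_set_in_def by blast
 have "nrm (R z x) <= C * nrm x" for x using bspec[OF C R_mem[OF z, of x]] by simp
 thus ?thesis by (rule bndI)
qed

lemma R_adj: assumes z: "Im z ~= 0" shows "form (R z x) y = form x (R (cnj z) y)"
proof -
 define u v where "u = R z x" and "v = R (cnj z) y"
 have u: "(u, x + z *\<^sub>C u) \<in> A" and v: "(v, y + cnj z *\<^sub>C v) \<in> A"
  using R_mem[of z x] R_mem[of "cnj z" y] z by (simp_all add: u_def v_def)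
 have "form (x + z *\<^sub>C u) v = form u (y + cnj z *\<^sub>C v)" by (rule A_sym[OF u v])
 thus ?thesis by (simp add: u_def[symmetric] v_def[symmetric] form_add form_scale)
qed

lemma R_identity: assumes "Im z ~= 0" "Im w ~= 0" shows "R z - R w = (z - w) *\<^sub>C (R z * R w)"
proof (rule lop_eqI)
 fix x
 define f where "f = R w x"
 have "R z (x + w *\<^sub>C f - z *\<^sub>C f) = f" using R_unique[OF assms(1) R_mem[OF assms(2), of x]] by (simp add: f_def)
 hence "R z x + w *\<^sub>C R z f - z *\<^sub>C R z f = f" by simp
 thus "(R z - R w) x = ((z - w) *\<^sub>C (R z * R w)) x"
  by (simp add: f_def[symmetric] complex_vector.scale_left_diff_distrib algebra_simps)
qed

lemma R_commute: assumes "Im z ~= 0" "Im w ~= 0" shows "R z * R w = R w * R z"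
proof (cases "z = w")
 case False
 have "(z - w) *\<^sub>C (R z * R w) = (z - w) *\<^sub>C (R w * R z)"
  using R_identity[OF assms] R_identity[OF assms(2,1)]
  by (metis complex_vector.scale_minus_left minus_diff_eq)
 thus ?thesis using False by simp
qed simp

definition "T = (1/2::complex) *\<^sub>C (R \<i> + R (- \<i>))"
definition "Y = (1 / (2 * \<i>)) *\<^sub>C (R \<i> - R (- \<i>))"

lemma TY_R: "T + \<i> *\<^sub>C Y = R \<i>" "T - \<i> *\<^sub>C Y = R (- \<i>)"
proof -
 have h: "(1/2::complex) *\<^sub>C X + (1/2::complex) *\<^sub>C X = X" for X :: "'a lop"
  using complex_vector.scale_left_distrib[of "1/2" "1/2" X] by simp
 have iY: "\<i> *\<^sub>C Y = (1/2::complex) *\<^sub>C (R \<i> - R (- \<i>))" by (simp add: Y_def)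
 show "T + \<i> *\<^sub>C Y = R \<i>" "T - \<i> *\<^sub>C Y = R (- \<i>)" unfolding iY T_def
  using h[of "R \<i>"] h[of "R (- \<i>)"]
  by (simp_all add: complex_vector.scale_right_distrib complex_vector.scale_right_diff_distrib algebra_simps)
qed

lemma Y_prod: "R \<i> * R (- \<i>) = Y"
 using R_identity[of \<i> "- \<i>"] by (simp add: Y_def)

lemma AY: "(Y x, T x) \<in> A"
proof -
 have "(R \<i> x - R (- \<i>) x, (x + \<i> *\<^sub>C R \<i> x) - (x + (- \<i>) *\<^sub>C R (- \<i>) x)) \<in> A"
  by (intro A_diff R_mem) auto
 from A_scale[OF this, of "1 / (2 * \<i>)"] show ?thesis
  by (simp add: Y_def T_def complex_vector.scale_right_distrib complex_vector.scale_right_diff_distrib)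
qed

lemma T_commute: "V * R \<i> = R \<i> * V ==> V * R (- \<i>) = R (- \<i>) * V ==> V * T = T * V"
 and Y_commute: "V * R \<i> = R \<i> * V ==> V * R (- \<i>) = R (- \<i>) * V ==> V * Y = Y * V"
 by (simp_all add: T_def Y_def distrib_left distrib_right right_diff_distrib left_diff_distrib)

lemma R_TY: "Im z ~= 0 ==> R z * T = T * R z" "Im z ~= 0 ==> R z * Y = Y * R z"
 by (rule T_commute Y_commute; rule R_commute; simp)+

lemma T_form: "form (T x) y = form x (T y)" and Y_form: "form (Y x) y = form x (Y y)"
 using R_adj[of \<i> x y] R_adj[of "- \<i>" x y]
 by (simp_all add: T_def Y_def form_scale form_add form_diff form_minus right_diff_distrib)

lemma TY: "T * Y = Y * T"
proof (rule Y_commute)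
 show "T * R \<i> = R \<i> * T" "T * R (- \<i>) = R (- \<i>) * T" using R_TY[of \<i>] R_TY[of "- \<i>"] by simp_all
qed

lemma circle: "T * T + Y * Y = Y"
proof -
 have "R \<i> * R (- \<i>) = T * T + Y * Y"
  unfolding TY_R[symmetric] using TY
  by (simp add: distrib_left distrib_right right_diff_distrib left_diff_distrib
    complex_vector.scale_right_distrib complex_vector.scale_right_diff_distrib)
 thus ?thesis by (simp add: Y_prod)
qed

lemma R_inj: "Im z ~= 0 ==> R z x = 0 ==> x = 0"
 using R_mem[of z x] A_unique[OF _ A_zero] by simp

lemma Y_inj: "Y x = 0 ==> x = 0"
 using Y_prod R_inj[of \<i> "R (- \<i>) x"] R_inj[of "- \<i>" x] by (metis complex_i_not_zero imaginary_unit.simps(2)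
   lapp_mult neg_equal_0_iff_equal one_neq_zero uminus_complex.simps(2))

lemma T_ker: "T n = 0 \<longleftrightarrow> (n, 0) \<in> A"
proof
 assume n: "T n = 0"
 have "T (T n) + Y (Y n) = Y n" using circle by (metis lapp_add lapp_mult)
 hence "Y (Y n - n) = 0" using n by simp
 hence "Y n = n" using Y_inj[of "Y n - n"] by simp
 thus "(n, 0) \<in> A" using AY[of n] n by simp
next
 assume n: "(n, 0) \<in> A"
 have 1: "R z (z *\<^sub>C n) = - n" if "Im z ~= 0" for z using R_unique[OF that n] by (simp add: minus_equation_iff)
 have "R \<i> (\<i> *\<^sub>C n) - R (- \<i>) ((- \<i>) *\<^sub>C n) = 0" using 1[of \<i>] 1[of "- \<i>"] by simp
 hence "(2 * \<i>) *\<^sub>C T n = 0"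
  by (simp add: T_def complex_vector.scale_right_distrib)
 thus "T n = 0" by simp
qed

text \<open>With u = R(i) x, the real part of [T x, x] equals [A u, u].\<close>

lemma T_nonneg: "0 <= Re (form (T x) x)"
proof -
 define u where "u = R \<i> x"
 have u: "(u, x + \<i> *\<^sub>C u) \<in> A" using R_mem[of \<i> x] by (simp add: u_def)
 have "form (R (- \<i>) x) x = form x u" using R_adj[of "- \<i>" x x] by (simp add: u_def)
 hence "form (T x) x = (1/2) * (form u x + form x u)" by (simp add: T_def form_scale form_add u_def)
 hence "Re (form (T x) x) = Re ((1/2) * (form u x + form x u))" by (rule arg_cong)
 also have "... = (Re (form u x) + Re (form x u)) / 2" by simp
 also have "Re (form u x) = Re (form x u)" using form_herm[of u x] by simp
 finally have "Re (form (T x) x) = Re (form x u)" by simp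
 also have "... = Re (form (x + \<i> *\<^sub>C u) u)" by (simp add: form_add form_scale)
 finally show ?thesis using A_nonneg'(1)[OF u] by simp
qed

sublocale krein_model ip J T Y
proof
 show "J * J = 1" "sym J" by (rule J2 Jsym)+
 show "bnd T" "bnd Y" using R_bnd[of \<i>] R_bnd[of "- \<i>"] by (simp_all add: T_def Y_def)
 have s: "ip (J (X x)) y = ip x (J (X y))" if "!!x y. form (lapp X x) y = form x (X y)" for X x y
  using that[of x y] Jsym by (simp add: form_ip symD)
 show "sym (J * Y)" using s[of Y] Y_form by (simp add: sym_def)
 show "pos (J * T)" unfolding pos_def sym_def lapp_mult using s[OF T_form] T_nonneg[unfolded form_ip] by blast
 show "T * Y = Y * T" "T * T + Y * Y = Y" by (rule TY circle)+
 show "!!x. Y x = 0 ==> x = 0" by (rule Y_inj)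
 show "n = 0" if "T n = 0" "!!k. T k = 0 ==> ip (J n) k = 0" for n
  using that by (intro ker_nondeg) (auto simp: T_ker form_ip)
qed

subsection \<open>From intervals to the ring\<close>

definition iv :: "real set => real => real => bool" where
 "iv I a b \<longleftrightarrow> a ~= 0 \<and> b ~= 0 \<and> {a<..<b} \<subseteq> I \<and> I \<subseteq> {a..b}"

text \<open>\<open>repr \<Delta> X\<close> says that \<open>X\<close> is the spectral projection of \<open>\<Delta>\<close>. The projection of an
 interval does not depend on whether the endpoints belong to it.\<close>

inductive repr :: "real option set => 'a lop => bool" where
 base: "iv I a b ==> repr (Some ` I) (E a b)"
| compl: "repr \<Delta> X ==> repr (- \<Delta>) (1 - X)"
| inter: "repr \<Delta> X ==> repr \<Delta>' X' ==> repr (\<Delta> \<inter> \<Delta>') (X * X')"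

lemma repr_bnd: "repr \<Delta> X ==> bnd X"
proof (induction rule: repr.induct)
 case (base I a b)
 thus ?case unfolding iv_def using liftsD(1)[OF E_lifts] by blast
qed auto

lemma repr_commute:
 assumes "repr \<Delta> X" and V: "!!a b. a ~= 0 ==> b ~= 0 ==> V * E a b = E a b * V"
 shows "V * X = X * V"
 using assms(1)
proof (induction rule: repr.induct)
 case (base I a b)
 thus ?case using V by (auto simp: iv_def)
next
 case (inter \<Delta> X \<Delta>' X')
 thus ?case by (metis mult.assoc)
qed (simp add: algebra_simps)

lemma E_E_commute: "a ~= 0 ==> b ~= 0 ==> c ~= 0 ==> d ~= 0 ==> E a b * E c d = E c d * E a b"
 by (simp add: E_mult max.commute min.commute)

lemma repr_repr_commute: assumes "repr \<Delta> X" "repr \<Delta>' X'" shows "X * X' = X' * X"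
proof (rule repr_commute[OF assms(2)])
 fix a b :: real assume ab: "a ~= 0" "b ~= 0"
 show "X * E a b = E a b * X"
  by (rule repr_commute[OF assms(1), symmetric]) (rule E_E_commute[OF ab])
qed

lemma repr_idem: "repr \<Delta> X ==> X * X = X"
proof (induction rule: repr.induct)
 case (base I a b)
 thus ?case by (simp add: iv_def E_mult)
next
 case (inter \<Delta> X \<Delta>' X')
 thus ?case using repr_repr_commute[OF inter(1,2)] by (metis mult.assoc)
qed (simp add: algebra_simps)

lemma E_form: "a ~= 0 ==> b ~= 0 ==> form (E a b x) y = form x (E a b y)"
 using liftsD(6)[OF E_lifts] by (simp add: form_ip)

lemma repr_form: "repr \<Delta> X ==> form (X x) y = form x (X y)"
proof (induction arbitrary: x y rule: repr.induct)
 case (base I a b)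
 thus ?case using E_form by (simp add: iv_def)
next
 case (inter \<Delta> X \<Delta>' X')
 have "X (X' y) = X' (X y)" using repr_repr_commute[OF inter(1,2)] by (metis lapp_mult)
 thus ?case using inter by simp
qed (simp add: form_diff)

text \<open>The representation of a set by unions and complements is not unique. What determines X
  is recorded here: off finitely many exceptional points the set is constant on cells and X acts as
  1 or 0 there accordingly, and on the complement of a large interval X is decided by whether
  infinity, \<open>None\<close>, belongs to the set.\<close>

lemma repr_cells:
 assumes "repr \<Delta> X"
 shows "\<exists>F. finite F \<and> 0 \<notin> F \<and>
  (\<forall>a b. a < b --> a ~= 0 --> b ~= 0 --> {a<..<b} \<inter> F = {} -->
   (Some ` {a<..<b} \<subseteq> \<Delta> \<and> X * E a b = E a b) \<or> (Some ` {a<..<b} \<inter> \<Delta> = {} \<and> X * E a b = 0)) \<and>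
  (\<forall>r>0. F \<subseteq> {- r<..<r} --> X * (1 - E (- r) r) = (if None \<in> \<Delta> then 1 - E (- r) r else 0))"
 using assms
proof (induction rule: repr.induct)
 case (base I c d)
 hence cd: "c ~= 0" "d ~= 0" and I: "{c<..<d} \<subseteq> I" "I \<subseteq> {c..d}" by (auto simp: iv_def)
 have "(Some ` {a<..<b} \<subseteq> Some ` I \<and> E c d * E a b = E a b) \<or>
   (Some ` {a<..<b} \<inter> Some ` I = {} \<and> E c d * E a b = 0)"
  if ab: "a < b" "a ~= 0" "b ~= 0" "{a<..<b} \<inter> {c, d} = {}" for a b
 proof -
  consider "c <= a" "b <= d" | "b <= c" | "d <= a" | "d < c"
   using ab(1,4) by (metis disjoint_insert(1) greaterThanLessThan_iff not_le not_less_iff_gr_or_eq order_le_less)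
  thus ?thesis
  proof cases
   case 1
   hence "{a<..<b} \<subseteq> I" using I by fastforce
   moreover have "E c d * E a b = E a b" using 1 ab cd by (simp add: E_mult max_absorb2 min_absorb2)
   ultimately show ?thesis by blast
  next
   case 2
   have "{a<..<b} \<inter> I = {}" using I 2 by fastforce
   moreover have "E c d * E a b = 0" using 2 ab cd
    by (simp add: E_mult) (rule E_empty; auto simp: max_def min_def)
   ultimately show ?thesis by blast
  next
   case 3
   have "{a<..<b} \<inter> I = {}" using I 3 by fastforce
   moreover have "E c d * E a b = 0" using 3 ab cd
    by (simp add: E_mult) (rule E_empty; auto simp: max_def min_def)
   ultimately show ?thesis by blast
  next
   case 4
   hence "I = {}" using I by force
   moreover have "E c d = 0" using 4 cd by (intro E_empty) auto
   ultimately show ?thesis by simp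
  qed
 qed
 moreover have "E c d * (1 - E (- r) r) = 0" if r: "r > 0" "{c, d} \<subseteq> {- r<..<r}" for r
 proof -
  have "max c (- r) = c" "min d r = d" using r by auto
  thus ?thesis using cd r by (simp add: right_diff_distrib E_mult)
 qed
 ultimately show ?case using cd by (intro exI[of _ "{c, d}"]) auto
next
 case (compl \<Delta> X)
 then obtain F where F: "finite F" "0 \<notin> F"
  "!!a b. a < b ==> a ~= 0 ==> b ~= 0 ==> {a<..<b} \<inter> F = {} ==>
   (Some ` {a<..<b} \<subseteq> \<Delta> \<and> X * E a b = E a b) \<or> (Some ` {a<..<b} \<inter> \<Delta> = {} \<and> X * E a b = 0)"
  "!!r. r > 0 ==> F \<subseteq> {- r<..<r} ==> X * (1 - E (- r) r) = (if None \<in> \<Delta> then 1 - E (- r) r else 0)" by metis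
 have "(Some ` {a<..<b} \<subseteq> - \<Delta> \<and> (1 - X) * E a b = E a b) \<or> (Some ` {a<..<b} \<inter> - \<Delta> = {} \<and> (1 - X) * E a b = 0)"
  if "a < b" "a ~= 0" "b ~= 0" "{a<..<b} \<inter> F = {}" for a b
  using F(3)[OF that] by (auto simp: left_diff_distrib)
 moreover have "(1 - X) * (1 - E (- r) r) = (if None \<in> - \<Delta> then 1 - E (- r) r else 0)"
  if "r > 0" "F \<subseteq> {- r<..<r}" for r
  using F(4)[OF that] unfolding left_diff_distrib[of 1 X] by simp
 ultimately show ?case using F(1,2) by (intro exI[of _ F]) blast
next
 case (inter \<Delta> X \<Delta>' X')
 then obtain F where F: "finite F" "0 \<notin> F"
  "!!a b. a < b ==> a ~= 0 ==> b ~= 0 ==> {a<..<b} \<inter> F = {} ==>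
   (Some ` {a<..<b} \<subseteq> \<Delta> \<and> X * E a b = E a b) \<or> (Some ` {a<..<b} \<inter> \<Delta> = {} \<and> X * E a b = 0)"
  "!!r. r > 0 ==> F \<subseteq> {- r<..<r} ==> X * (1 - E (- r) r) = (if None \<in> \<Delta> then 1 - E (- r) r else 0)" by metis
 from inter obtain G where G: "finite G" "0 \<notin> G"
  "!!a b. a < b ==> a ~= 0 ==> b ~= 0 ==> {a<..<b} \<inter> G = {} ==>
   (Some ` {a<..<b} \<subseteq> \<Delta>' \<and> X' * E a b = E a b) \<or> (Some ` {a<..<b} \<inter> \<Delta>' = {} \<and> X' * E a b = 0)"
  "!!r. r > 0 ==> G \<subseteq> {- r<..<r} ==> X' * (1 - E (- r) r) = (if None \<in> \<Delta>' then 1 - E (- r) r else 0)" by metis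
 have "(Some ` {a<..<b} \<subseteq> \<Delta> \<inter> \<Delta>' \<and> X * X' * E a b = E a b) \<or> (Some ` {a<..<b} \<inter> (\<Delta> \<inter> \<Delta>') = {} \<and> X * X' * E a b = 0)"
  if ab: "a < b" "a ~= 0" "b ~= 0" "{a<..<b} \<inter> (F \<union> G) = {}" for a b
 proof -
  have "{a<..<b} \<inter> F = {}" "{a<..<b} \<inter> G = {}" using ab(4) by auto
  note FG = F(3)[OF ab(1-3) this(1)] G(3)[OF ab(1-3) this(2)]
  have c: "X * X' * E a b = X' * (X * E a b)" "X * X' * E a b = X * (X' * E a b)"
   using repr_repr_commute[OF inter(1,2)] by (simp_all add: mult.assoc[symmetric])
  consider "Some ` {a<..<b} \<subseteq> \<Delta> \<inter> \<Delta>'" "X * E a b = E a b" "X' * E a b = E a b"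
   | "Some ` {a<..<b} \<inter> (\<Delta> \<inter> \<Delta>') = {}" "X * E a b = 0"
   | "Some ` {a<..<b} \<inter> (\<Delta> \<inter> \<Delta>') = {}" "X' * E a b = 0" using FG by blast
  thus ?thesis
  proof cases
   case 1
   hence "X * X' * E a b = E a b" unfolding c(2) by simp
   thus ?thesis using 1(1) by blast
  next
   case 2
   hence "X * X' * E a b = 0" unfolding c(1) by simp
   thus ?thesis using 2(1) by blast
  next
   case 3
   hence "X * X' * E a b = 0" unfolding c(2) by simp
   thus ?thesis using 3(1) by blast
  qed
 qed
 moreover have "X * X' * (1 - E (- r) r) = (if None \<in> \<Delta> \<inter> \<Delta>' then 1 - E (- r) r else 0)"
  if "r > 0" "F \<union> G \<subseteq> {- r<..<r}" for r
  using F(4)[of r] G(4)[of r] that by (simp add: mult.assoc)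
 ultimately show ?case using F(1,2) G(1,2) by (intro exI[of _ "F \<union> G"]) blast
qed

lemma repr_unique:
 assumes "repr \<Delta> X" "repr \<Delta> X'" shows "X = X'"
proof -
 obtain F where F: "finite F" "0 \<notin> F"
  "!!a b. a < b ==> a ~= 0 ==> b ~= 0 ==> {a<..<b} \<inter> F = {} ==>
   (Some ` {a<..<b} \<subseteq> \<Delta> \<and> X * E a b = E a b) \<or> (Some ` {a<..<b} \<inter> \<Delta> = {} \<and> X * E a b = 0)"
  "!!r. r > 0 ==> F \<subseteq> {- r<..<r} ==> X * (1 - E (- r) r) = (if None \<in> \<Delta> then 1 - E (- r) r else 0)"
  using repr_cells[OF assms(1)] by metis
 obtain G where G: "finite G" "0 \<notin> G"
  "!!a b. a < b ==> a ~= 0 ==> b ~= 0 ==> {a<..<b} \<inter> G = {} ==>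
   (Some ` {a<..<b} \<subseteq> \<Delta> \<and> X' * E a b = E a b) \<or> (Some ` {a<..<b} \<inter> \<Delta> = {} \<and> X' * E a b = 0)"
  "!!r. r > 0 ==> G \<subseteq> {- r<..<r} ==> X' * (1 - E (- r) r) = (if None \<in> \<Delta> then 1 - E (- r) r else 0)"
  using repr_cells[OF assms(2)] by metis
 define H where "H = F \<union> G"
 have H: "finite H" "0 \<notin> H" using F G by (auto simp: H_def)
 have cell: "X * E a b = X' * E a b" if ab: "a < b" "a ~= 0" "b ~= 0" "{a<..<b} \<inter> H = {}" for a b
 proof -
  have "{a<..<b} \<inter> F = {}" "{a<..<b} \<inter> G = {}" using ab(4) by (auto simp: H_def)
  moreover obtain t where "a < t" "t < b" using dense[OF ab(1)] by blast
  hence "Some t \<in> Some ` {a<..<b}" by simp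
  moreover note F(3)[OF ab(1-3)] G(3)[OF ab(1-3)]
  ultimately show ?thesis by (metis disjoint_iff subsetD)
 qed
 \<comment> \<open>Induction on the number of exceptional points inside the interval, cutting at one
   of them.\<close>
 have all: "X * E a b = X' * E a b" if "a < b" "a ~= 0" "b ~= 0" for a b
  using that
 proof (induction "card ({a<..<b} \<inter> H)" arbitrary: a b rule: less_induct)
  case less
  show ?case
  proof (cases "{a<..<b} \<inter> H = {}")
   case False
   then obtain t where t: "a < t" "t < b" "t \<in> H" by auto
   hence t0: "t ~= 0" using H by auto
   have "{a<..<t} \<inter> H \<subset> {a<..<b} \<inter> H" "{t<..<b} \<inter> H \<subset> {a<..<b} \<inter> H" using t by auto
   hence "card ({a<..<t} \<inter> H) < card ({a<..<b} \<inter> H)" "card ({t<..<b} \<inter> H) < card ({a<..<b} \<inter> H)"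
    using H by (auto intro: psubset_card_mono)
   hence "X * E a t = X' * E a t" "X * E t b = X' * E t b" using less t t0 by blast+
   moreover have "E a b = E a t + E t b" using t t0 less by (intro E_split) auto
   ultimately show ?thesis by (simp add: distrib_left)
  qed (use cell less in blast)
 qed
 obtain r where r: "r > 0" "H \<subseteq> {- r<..<r}"
 proof -
  obtain m where m: "!!x. x \<in> H ==> \<bar>x\<bar> <= m" using finite_imp_bounded[OF H(1)] by (auto simp: bounded_iff)
  show thesis
  proof (rule that[of "\<bar>m\<bar> + 1"])
   show "H \<subseteq> {- (\<bar>m\<bar> + 1)<..<\<bar>m\<bar> + 1}" using m by (fastforce simp: abs_le_iff)
  qed auto
 qed
 have "X * (1 - E (- r) r) = X' * (1 - E (- r) r)" using F(4)[of r] G(4)[of r] r by (simp add: H_def)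
 moreover have "X * E (- r) r = X' * E (- r) r" using r by (intro all) auto
 ultimately show ?thesis by (simp add: right_diff_distrib)
qed

lemma repr_un:
 assumes "repr \<Delta> X" "repr \<Delta>' X'" shows "repr (\<Delta> \<union> \<Delta>') (X + X' - X * X')"
proof -
 have "repr (- (- \<Delta> \<inter> - \<Delta>')) (1 - (1 - X) * (1 - X'))" by (intro repr.compl repr.inter assms)
 moreover have "1 - (1 - X) * (1 - X') = X + X' - X * X'" by (simp add: algebra_simps)
 ultimately show ?thesis by simp
qed

lemma repr_empty: "repr {} 0"
 using repr.base[of "{}" 1 1] E_empty[of 1 1] by (simp add: iv_def)

lemma nonzero_iv: "nonzero_bounded_interval I ==> \<exists>a b. iv I a b"
proof -
 assume "nonzero_bounded_interval I"
 then obtain a b where ab: "a ~= 0" "b ~= 0"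
  "I = {a..b} \<or> I = {a..<b} \<or> I = {a<..b} \<or> I = {a<..<b}"
  unfolding nonzero_bounded_interval_def by blast
 have "{a<..<b} \<subseteq> I" "I \<subseteq> {a..b}" using ab(3) by auto
 thus ?thesis using ab unfolding iv_def by blast
qed

lemma repr_ring_Union:
 assumes "finite F" "\<forall>I\<in>F. nonzero_bounded_interval I"
 shows "\<exists>X. repr (Some ` \<Union>F) X"
 using assms
proof (induction F rule: finite_induct)
 case empty
 thus ?case using repr_empty by auto
next
 case (insert I F)
 then obtain X a b where "repr (Some ` \<Union>F) X" "iv I a b" using nonzero_iv by blast
 from repr_un[OF repr.base[OF this(2)] this(1)] show ?case by (auto simp: image_Un)
qed

lemma repr_ring: assumes "\<Delta> \<in> interval_ring" shows "\<exists>X. repr \<Delta> X"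
proof -
 obtain F where F: "finite F" "\<forall>I\<in>F. nonzero_bounded_interval I"
  "\<Delta> = Some ` \<Union>F \<or> \<Delta> = - (Some ` \<Union>F)" using assms by (auto simp: interval_ring_def)
 obtain X where "repr (Some ` \<Union>F) X" using repr_ring_Union[OF F(1,2)] by blast
 thus ?thesis using F(3) repr.compl by blast
qed

definition ES :: "real option set => 'a lop" where "ES \<Delta> = (THE X. repr \<Delta> X)"

lemma ES_eq: "repr \<Delta> X ==> ES \<Delta> = X"
 unfolding ES_def using repr_unique by blast

lemma ES: "\<Delta> \<in> interval_ring ==> repr \<Delta> (ES \<Delta>)"
 using repr_ring ES_eq by metis

lemma ES_interval: "a ~= 0 ==> b ~= 0 ==> ES (Some ` {a..b}) = E a b"
 by (intro ES_eq repr.base) (auto simp: iv_def)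

end

section \<open>Uniform boundedness of families of positive forms\<close>

context hilbert_ops
begin

lemma pos_form_bound:
 assumes P: "pos P" and b: "!!x. Re (ip (P x) x) <= M * (nrm x)\<^sup>2" and M: "0 <= M"
 shows "nrm (P x) <= M * nrm x"
proof (cases "nrm (P x) = 0")
 case False
 define n where "n = nrm (P x)"
 have n: "0 < n" using False by (simp add: n_def order_less_le)
 have "(n\<^sup>2)\<^sup>2 <= Re (ip (P x) x) * Re (ip (P (P x)) (P x))"
  using pos_cs[OF P, of x "P x"] by (simp add: self_eq n_def norm_power)
 also have "... <= (M * (nrm x)\<^sup>2) * (M * n\<^sup>2)"
  using b[of x] b[of "P x"] posD[OF P] M by (intro mult_mono) (auto simp: n_def)
 finally have "n\<^sup>2 * n\<^sup>2 <= (M * nrm x)\<^sup>2 * n\<^sup>2" by (simp add: power2_eq_square mult_ac)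
 hence "n\<^sup>2 <= (M * nrm x)\<^sup>2" by (rule mult_right_le_imp_le) (use n in simp)
 hence "n <= M * nrm x" by (rule power2_le_imp_le) (use M in simp)
 thus ?thesis by (simp add: n_def)
qed (use M in simp)

lemma pos_upper: assumes "pos P" "bnd P" obtains M where "0 <= M" "!!x. Re (ip (P x) x) <= M * (nrm x)\<^sup>2"
proof -
 obtain C where C: "C > 0" "\<forall>x. Re (ip (P x) x) <= C * Re (ip x x)" using symI_bnd assms pos_sym by blast
 show thesis using that[of C] C by (simp add: nrm_sq)
qed

text \<open>The uniform boundedness principle, by Baire category for the closed sets on which all
  seminorms f n, the square roots of the forms, are at most k.\<close>

lemma pos_uniform_bound:
 fixes X :: "nat => 'a lop"
 assumes X: "!!n. pos (X n)" "!!n. bnd (X n)" and b: "!!x. \<exists>B. \<forall>n. Re (ip (X n x) x) <= B"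
 obtains M where "0 <= M" "!!n x. Re (ip (X n x) x) <= M * (nrm x)\<^sup>2"
proof -
 interpret m: Metric_space UNIV "\<lambda>x y. nrm (x - y)"
 proof
  show "0 <= nrm (x - y)" "nrm (x - y) = nrm (y - x)" for x y
   using nrm_minus_commute[of x y] by simp_all
  show "(nrm (x - y) = 0) = (x = y)" for x y by simp
  show "nrm (x - z) <= nrm (x - y) + nrm (y - z)" for x y z by (rule nrm_diff_triangle) auto
 qed
 define f where "f n x = ip_norm (\<lambda>x y. ip (X n x) y) x" for n x
 have psd: "psd_space UNIV (\<lambda>x y. ip (X n x) y)" for n by (rule pos_psd[OF X(1)])
 have f_sq: "(f n x)\<^sup>2 = Re (ip (X n x) x)" and f0: "0 <= f n x" for n x
  unfolding f_def using psd_space.nrm_sq[OF psd] psd_space.nrm_nonneg[OF psd] by auto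
 have f_tri: "f n x <= f n y + f n (x - y)" for n x y
  unfolding f_def using psd_space.nrm_triangle[OF psd, of y "x - y" n] by simp
 have f_le: "\<exists>C>0. \<forall>x. f n x <= C * nrm x" for n
 proof -
  obtain C where C: "0 <= C" "!!x. Re (ip (X n x) x) <= C * (nrm x)\<^sup>2" using pos_upper X by blast
  have "f n x <= (sqrt C + 1) * nrm x" for x
  proof -
   have "(f n x)\<^sup>2 <= (sqrt C * nrm x)\<^sup>2" using C by (simp add: f_sq power_mult_distrib)
   hence "f n x <= sqrt C * nrm x" by (rule power2_le_imp_le) (use C in simp)
   thus ?thesis by (simp add: distrib_right add_increasing2)
  qed
  thus ?thesis using C by (intro exI[of _ "sqrt C + 1"]) (auto intro: add_nonneg_pos)
 qed
 define V where "V k = {x. \<forall>n. f n x <= real k}" for k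
 have closed: "closedin m.mtopology (V k)" for k
 proof -
  have "openin m.mtopology (- V k)"
   unfolding m.openin_mtopology
  proof (intro conjI allI impI)
   fix x assume "x \<in> - V k"
   then obtain n where n: "real k < f n x" by (auto simp: V_def not_le)
   obtain C where C: "C > 0" "!!x. f n x <= C * nrm x" using f_le[of n] by blast
   define r where "r = (f n x - k) / C"
   have "m.mball x r \<subseteq> - V k"
   proof
    fix y assume "y \<in> m.mball x r"
    hence "nrm (x - y) < r" by (simp add: m.mball_def)
    hence "C * nrm (x - y) < f n x - k" using C n by (simp add: r_def field_simps)
    hence "real k < f n y" using f_tri[of n x y] C(2)[of "x - y"] by linarith
    thus "y \<in> - V k" by (auto simp: V_def not_le)
   qed
   moreover have "r > 0" using n C by (simp add: r_def)
   ultimately show "\<exists>r>0. m.mball x r \<subseteq> - V k" by blast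
  qed simp
  thus ?thesis by (simp add: closedin_def Compl_eq_Diff_UNIV)
 qed
 have "m.mcomplete" unfolding m.mcomplete_def
 proof (intro allI impI)
  fix \<sigma> assume "m.MCauchy \<sigma>"
  hence c: "\<forall>\<epsilon>>0. \<exists>N. \<forall>n n'. N <= n --> N <= n' --> nrm (\<sigma> n - \<sigma> n') < \<epsilon>"
   unfolding m.MCauchy_def by blast
  have "\<exists>N. \<forall>m\<ge>N. \<forall>n\<ge>N. nrm (\<sigma> m - \<sigma> n) < \<epsilon>" if e: "\<epsilon> > 0" for \<epsilon>
  proof -
   obtain N where "\<forall>n n'. N <= n --> N <= n' --> nrm (\<sigma> n - \<sigma> n') < \<epsilon>" using c e by blast
   thus ?thesis by blast
  qed
  then obtain l where l: "(\<lambda>n. nrm (\<sigma> n - l)) \<longlonglongrightarrow> 0" using complete[of \<sigma>] by blast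
  have "limitin m.mtopology \<sigma> l sequentially"
   unfolding m.limitin_metric using l by (auto dest!: order_tendstoD(2))
  thus "\<exists>x. limitin m.mtopology \<sigma> x sequentially" by blast
 qed
 have "\<Union>(range V) = UNIV"
 proof -
  have "x \<in> \<Union>(range V)" for x
  proof -
   obtain B where B: "!!n. Re (ip (X n x) x) <= B" using b by blast
   obtain k :: nat where k: "max 1 B <= real k" using real_arch_simple by blast
   have "f n x <= real k" for n
   proof (rule power2_le_imp_le)
    have "real k * 1 <= real k * real k" using k by (intro mult_left_mono) auto
    moreover have "B <= real k" using k by simp
    ultimately show "(f n x)\<^sup>2 <= (real k)\<^sup>2" unfolding f_sq power2_eq_square[of "real k"]
     using B[of n] by linarith
   qed simp
   thus ?thesis by (auto simp: V_def)
  qed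
  thus ?thesis by blast
 qed
 moreover have "m.mtopology interior_of UNIV = UNIV"
  using interior_of_topspace[of m.mtopology] by simp
 ultimately have "m.mtopology interior_of \<Union>(range V) ~= {}" by simp
 then obtain k where "m.mtopology interior_of (V k) ~= {}"
  using m.metric_Baire_category_alt[OF \<open>m.mcomplete\<close>, of "range V"] closed by auto
 then obtain x0 where "x0 \<in> m.mtopology interior_of (V k)" by blast
 then obtain r where r: "r > 0" "m.mball x0 r \<subseteq> V k"
  unfolding interior_of_def m.openin_mtopology by (smt (verit) mem_Collect_eq subset_trans)
 have small: "f n z <= 2 * k" if z: "nrm z < r" for n z
 proof -
  have "x0 + z \<in> m.mball x0 r" "x0 \<in> m.mball x0 r"
   using z r by (simp_all add: m.mball_def)
  hence "x0 + z \<in> V k" "x0 \<in> V k" using r(2) by blast+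
  hence "f n (x0 + z) <= k" "f n x0 <= k" by (simp_all add: V_def)
  moreover have "f n z <= f n (x0 + z) + f n (- x0)" using f_tri[of n z "x0 + z"] by simp
  moreover have "f n (- x0) = f n x0" by (simp add: f_def ip_norm_def)
  ultimately show ?thesis by linarith
 qed
 \<comment> \<open>Scaling x to norm r / 2 makes f n at most 2 k, hence the form at most 4 k^2;
   undoing the scaling multiplies this by 4 / r^2 and the squared norm of x.\<close>
 have "Re (ip (X n x) x) <= (16 * (real k)\<^sup>2 / r\<^sup>2) * (nrm x)\<^sup>2" for n x
 proof (cases "x = 0")
  case False
  hence nx: "0 < nrm x" by (simp add: nrm_pos)
  define c where "c = r / (2 * nrm x)"
  have c: "0 < c" using r nx by (simp add: c_def)
  have "r / (2 * w) * w = r / 2" if "0 < w" for w using that by simp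
  from this[OF nx] have "c * nrm x = r / 2" unfolding c_def .
  hence "nrm (of_real c *\<^sub>C x) < r" using c r by (simp add: nrm_scale)
  from small[OF this, of n] have "(f n (of_real c *\<^sub>C x))\<^sup>2 <= (2 * real k)\<^sup>2" using f0 by (intro power_mono) auto
  moreover have "(f n (of_real c *\<^sub>C x))\<^sup>2 = c\<^sup>2 * Re (ip (X n x) x)" unfolding f_sq by (simp add: power2_eq_square)
  ultimately have "c\<^sup>2 * Re (ip (X n x) x) <= 4 * (real k)\<^sup>2" by (simp add: power_mult_distrib)
  hence "Re (ip (X n x) x) <= 4 * (real k)\<^sup>2 / c\<^sup>2" using c by (simp add: field_simps)
  also have "... = (16 * (real k)\<^sup>2 / r\<^sup>2) * (nrm x)\<^sup>2" unfolding c_def using nx r by (simp only: power_divide power_mult_distrib) (simp add: field_simps)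
  finally show ?thesis .
 qed simp
 thus thesis using that[of "16 * (real k)\<^sup>2 / r\<^sup>2"] by simp
qed

end

section \<open>The axioms of a spectral function for the constructed projections\<close>

context nonneg_krein
begin

lemma form_le: "cmod (form x y) <= nrm x * nrm y"
 using cauchy_schwarz[of "J x" y] by (simp add: form_ip)

lemma ksym_of_form: "(!!x y. form (lapp X x) y = form x (X y)) ==> sym (J * X)"
 by (rule ksymI) (simp add: form_ip[symmetric])

text \<open>\<open>pos_bound\<close> for s J X shows that on ran(X) the norm of the definite form is
  equivalent to the Hilbert norm, and ran(X) is closed as the range of a bounded projection.\<close>

lemma hilbert_range:
 assumes X: "bnd X" "X * X = X" "!!x y. form (X x) y = form x (X y)" and s: "s = 1 \<or> s = - 1"
  and pos: "!!x. 0 <= s * Re (form (X x) x)"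
 shows "hilbert_on (range X) (\<lambda>x y. of_real s * form x y)"
proof -
 define P where "P = of_real s *\<^sub>C (J * X)"
 have XX: "X (X x) = X x" for x using X(2) by (metis lapp_mult)
 have Pp: "pos P" using ksym_of_form[OF X(3)] pos by (simp add: P_def pos_def form_ip)
 have Pn: "nrm (P x) = nrm (X x)" for x using s by (auto simp: P_def nrm_scale)
 have Pf: "Re (ip (P x) x) = s * Re (form (X x) x)" for x by (simp add: P_def form_ip)
 obtain C where C: "C > 0" "!!x. nrm (P x) <= C * nrm x" using bndE[of P] X by (auto simp: P_def)
 have low: "(nrm x)\<^sup>2 <= C * (s * Re (form x x))" if x: "x \<in> range X" for x
  using pos_bound[OF Pp C(2), of x] x XX by (auto simp: Pn Pf)
 have pp: "0 <= s * Re (form x x)" if "x \<in> range X" for x using low[OF that] C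
  by (smt (verit) zero_le_mult_iff zero_le_power2)
 have sub: "csubspace (range X)"
 proof (rule complex_vector.subspaceI)
  show "0 \<in> range X" using lop_zero[of X] by (metis rangeI)
  show "x + y \<in> range X" if "x \<in> range X" "y \<in> range X" for x y
   using that by (force simp flip: lop_add)
  show "c *\<^sub>C x \<in> range X" if "x \<in> range X" for c x
   using that by (force simp flip: lop_scale)
 qed
 define g where "g = (\<lambda>x y. of_real s * form x y)"
 have gn: "ip_norm g x = sqrt (s * Re (form x x))" for x by (simp add: g_def ip_norm_def)
 have ng: "nrm x <= sqrt C * ip_norm g x" if "x \<in> range X" for x
 proof -
  have "sqrt ((nrm x)\<^sup>2) <= sqrt (C * (s * Re (form x x)))" using low[OF that] by (rule real_sqrt_le_mono)
  thus ?thesis by (simp add: gn real_sqrt_mult)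
 qed
 have gle: "ip_norm g x <= nrm x" for x
 proof -
  have "s * Re (form x x) <= (nrm x)\<^sup>2"
   using form_le[of x x] abs_Re_le_cmod[of "form x x"] s by (auto simp: power2_eq_square)
  hence "ip_norm g x <= sqrt ((nrm x)\<^sup>2)" unfolding gn by (rule real_sqrt_le_mono)
  thus ?thesis by simp
 qed
 have "hilbert_on (range X) g"
  unfolding hilbert_on_def
 proof (intro conjI allI impI ballI)
  show "hermitian_form_on (range X) g"
   unfolding hermitian_form_on_def g_def
  proof (intro conjI allI ballI)
   show "of_real s * form y x = cnj (of_real s * form x y)" for x y
    by (subst form_herm) simp
  qed (simp_all add: form_add form_scale distrib_left)
  show "0 < Re (g x x)" if "x \<in> range X" "x ~= 0" for x
  proof -
   have "0 < nrm x" using that by (simp add: nrm_pos)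
   hence "0 < C * (s * Re (form x x))" using low[OF that(1)] by (smt (verit) zero_less_power2)
   thus ?thesis using C by (simp add: g_def zero_less_mult_iff)
  qed
  fix \<sigma> :: "nat => 'a"
  assume r: "range \<sigma> \<subseteq> range X" and c: "\<forall>\<epsilon>>0. \<exists>N. \<forall>m\<ge>N. \<forall>n\<ge>N. ip_norm g (\<sigma> m - \<sigma> n) < \<epsilon>"
  have sr: "\<sigma> n \<in> range X" for n using r by auto
  have "\<exists>N. \<forall>m\<ge>N. \<forall>n\<ge>N. nrm (\<sigma> m - \<sigma> n) < \<epsilon>" if e: "\<epsilon> > 0" for \<epsilon>
  proof -
   obtain N where N: "\<forall>m\<ge>N. \<forall>n\<ge>N. ip_norm g (\<sigma> m - \<sigma> n) < \<epsilon> / sqrt C" using c e C by (meson divide_pos_pos real_sqrt_gt_zero)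
   have "nrm (\<sigma> m - \<sigma> n) < \<epsilon>" if "m \<ge> N" "n \<ge> N" for m n
   proof -
    have "nrm (\<sigma> m - \<sigma> n) <= sqrt C * ip_norm g (\<sigma> m - \<sigma> n)"
     by (rule ng) (use sr sub complex_vector.subspace_diff in blast)
    also have "... < \<epsilon>" using N that C by (simp add: field_simps)
    finally show ?thesis .
   qed
   thus ?thesis by blast
  qed
  then obtain l where l: "(\<lambda>n. nrm (\<sigma> n - l)) \<longlonglongrightarrow> 0" using complete[of \<sigma>] by blast
  have "X (\<sigma> n) = \<sigma> n" for n using sr[of n] XX by auto
  moreover have "(\<lambda>n. nrm (X (\<sigma> n) - X l)) \<longlonglongrightarrow> 0"
  proof -
   obtain K where K: "!!x. nrm (X x) <= K * nrm x" using bndE[OF X(1)] by blast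
   have "(\<lambda>n. K * nrm (\<sigma> n - l)) \<longlonglongrightarrow> 0" using tendsto_mult_right_zero[OF l] by simp
   moreover have "nrm (X (\<sigma> n) - X l) <= K * nrm (\<sigma> n - l)" for n using K[of "\<sigma> n - l"] by simp
   ultimately show ?thesis
    using Lim_null_comparison[of "\<lambda>n. nrm (X (\<sigma> n) - X l)" "\<lambda>n. K * nrm (\<sigma> n - l)"] by simp
  qed
  ultimately have "X l = l" using limit_unique[of \<sigma> l "X l"] l by simp
  hence "l \<in> range X" by (metis rangeI)
  moreover have "(\<lambda>n. ip_norm g (\<sigma> n - l)) \<longlonglongrightarrow> 0"
  proof (rule Lim_null_comparison[OF _ l])
   have "0 <= ip_norm g (\<sigma> n - l)" for n using pp sub sr \<open>l \<in> range X\<close> complex_vector.subspace_diff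
    by (simp add: gn) blast
   thus "\<forall>\<^sub>F n in sequentially. norm (ip_norm g (\<sigma> n - l)) <= nrm (\<sigma> n - l)" using gle by simp
  qed
  ultimately show "\<exists>l\<in>range X. (\<lambda>n. ip_norm g (\<sigma> n - l)) \<longlonglongrightarrow> 0" by blast
 qed (use sub in simp)
 thus ?thesis by (simp add: g_def)
qed

lemma ES_pos:
 assumes "finite F" "\<forall>I\<in>F. nonzero_bounded_interval I" "(\<Union>F) \<subseteq> S" and S: "(S = {0<..} \<and> s = 1) \<or> (S = {..<0} \<and> s = - 1)"
 shows "\<exists>X. repr (Some ` \<Union>F) X \<and> (\<forall>x. 0 <= s * Re (form (X x) x))"
 using assms(1-3)
proof (induction F rule: finite_induct)
 case empty
 thus ?case using repr_empty by (intro exI[of _ 0]) simp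
next
 case (insert I F)
 then obtain X where X: "repr (Some ` \<Union>F) X" "!!x. 0 <= s * Re (form (X x) x)" by auto
 obtain a b where ab: "iv I a b" using insert nonzero_iv by blast
 have nz: "a ~= 0" "b ~= 0" and I: "{a<..<b} \<subseteq> S" using ab insert by (auto simp: iv_def)
 have Epos: "0 <= s * Re (form (E a b x) x)" for x
 proof (cases "a < b")
  case True
  obtain t where t: "a < t" "t < b" using dense[OF True] by blast
  show ?thesis using S
  proof
   assume S1: "S = {0<..} \<and> s = 1"
   have "0 <= a"
   proof (rule ccontr)
    assume "\<not> 0 <= a"
    then obtain t where "a < t" "t < min 0 b" using dense[of a "min 0 b"] True by auto
    thus False using I S1 by fastforce
   qed
   hence "0 < a" using nz by simp
   hence "0 <= Re (ip (J (E a b x)) x)" using E_nonneg nz by blast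
   thus ?thesis using S1 by (simp add: form_ip)
  next
   assume S2: "S = {..<0} \<and> s = - 1"
   have "b <= 0"
   proof (rule ccontr)
    assume "\<not> b <= 0"
    then obtain t where "max 0 a < t" "t < b" using dense[of "max 0 a" b] True by auto
    thus False using I S2 by fastforce
   qed
   hence "b < 0" using nz by simp
   hence "Re (ip (J (E a b x)) x) <= 0" using E_nonpos nz by blast
   thus ?thesis using S2 by (simp add: form_ip)
  qed
 next
  case False
  thus ?thesis using E_empty[of a b] nz by simp
 qed
 define Z where "Z = E a b + X - E a b * X"
 have r: "repr (Some ` I) (E a b)" by (rule repr.base[OF ab])
 have "repr (Some ` I \<union> Some ` \<Union>F) Z" unfolding Z_def by (rule repr_un[OF r X(1)])
 moreover have "0 <= s * Re (form (Z x) x)" for x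
 proof -
  \<comment> \<open>Splitting x into X x and w makes the form of the union a sum of two nonnegative
    terms: that of X at x and that of E a b at w.\<close>
  define w where "w = x - X x"
  have c: "E a b (X v) = X (E a b v)" for v using repr_repr_commute[OF r X(1)] by (metis lapp_mult)
  have XX: "X (X v) = X v" for v using repr_idem[OF X(1)] by (metis lapp_mult)
  have "form (E a b w) w = form (E a b w) x - form (X (E a b w)) x"
   using repr_form[OF X(1), of "E a b w" x] by (simp add: w_def form_diff)
  also have "X (E a b w) = 0" by (simp add: w_def c[symmetric] XX)
  finally have "form (E a b w) w = form (E a b x - E a b (X x)) x" by (simp add: w_def)
  hence "form (Z x) x = form (X x) x + form (E a b w) w" by (simp add: Z_def form_add form_diff)
  thus ?thesis using X(2)[of x] Epos[of w] by (simp add: distrib_left)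
 qed
 ultimately show ?case by (auto simp: image_Un)
qed

lemma ring_bounded:
 assumes "\<Delta> \<in> interval_ring" "None \<notin> \<Delta>"
 obtains F where "finite F" "\<forall>I\<in>F. nonzero_bounded_interval I" "\<Delta> = Some ` \<Union>F"
 using assms by (auto simp: interval_ring_def)

lemma ES_hilbert:
 assumes D: "\<Delta> \<in> interval_ring" and S: "\<Delta> \<subseteq> Some ` S" "(S = {0<..} \<and> s = 1) \<or> (S = {..<0} \<and> s = - 1)"
 shows "hilbert_on (range (ES \<Delta>)) (\<lambda>x y. of_real s * form x y)"
proof -
 obtain F where F: "finite F" "\<forall>I\<in>F. nonzero_bounded_interval I" "\<Delta> = Some ` \<Union>F"
  using ring_bounded[OF D] S by blast
 have "\<Union>F \<subseteq> S" using F(3) S(1) by blast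
 then obtain X where X: "repr \<Delta> X" "!!x. 0 <= s * Re (form (X x) x)"
  using ES_pos[OF F(1,2) _ S(2)] F(3) by blast
 show ?thesis unfolding ES_eq[OF X(1)]
  by (rule hilbert_range) (use X S repr_bnd[OF X(1)] repr_idem[OF X(1)] repr_form[OF X(1)] in auto)
qed

text \<open>A bounded set of the ring lies in some [- r, r], so its projection inherits the factor Y
  from \<open>E (- r) r\<close>, and ran(Y) is contained in dom(A).\<close>

lemma ES_factor:
 assumes D: "\<Delta> \<in> interval_ring" "None \<notin> \<Delta>"
 obtains W where "bnd W" "ES \<Delta> = Y * W"
proof -
 obtain F where F: "finite F" "\<forall>I\<in>F. nonzero_bounded_interval I" "\<Delta> = Some ` \<Union>F"
  using ring_bounded[OF D] by blast
 have "bounded (\<Union>F)"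
 proof (rule bounded_Union[OF F(1)], rule ballI)
  fix I assume "I \<in> F"
  then obtain a b where "I \<subseteq> {a..b}" using F(2) nonzero_iv by (force simp: iv_def)
  thus "bounded I" using bounded_closed_interval bounded_subset by blast
 qed
 then obtain m where m: "!!x. x \<in> \<Union>F ==> \<bar>x\<bar> <= m" by (auto simp: bounded_iff)
 define r where "r = \<bar>m\<bar> + 1"
 have r: "r > 0" by (simp add: r_def)
 have "\<Union>F \<subseteq> {- r..r}" using m by (fastforce simp: r_def abs_le_iff)
 hence "\<Delta> = Some ` {- r..r} \<inter> \<Delta>" using F(3) by blast
 moreover have "repr (Some ` {- r..r} \<inter> \<Delta>) (E (- r) r * ES \<Delta>)"
  by (intro repr.inter repr.base ES D) (use r in \<open>auto simp: iv_def\<close>)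
 ultimately have e: "ES \<Delta> = E (- r) r * ES \<Delta>" using ES_eq by metis
 have nz: "- r ~= 0" "r ~= 0" using r by auto
 obtain m X where X: "lifts m (al (- r) r) X" "E (- r) r = Y * X" using E_factor[OF nz] by blast
 have "ES \<Delta> = Y * (X * ES \<Delta>)" using e X(2) by (simp add: mult.assoc)
 moreover have "bnd (X * ES \<Delta>)" using liftsD(1)[OF X(1)] repr_bnd[OF ES[OF D(1)]] by simp
 ultimately show thesis using that by blast
qed

lemma V_E_commute:
 assumes "bnd V" "V * R \<i> = R \<i> * V" "V * R (- \<i>) = R (- \<i>) * V" "a ~= 0" "b ~= 0"
 shows "V * E a b = E a b * V"
 using assms T_commute Y_commute by (intro E_commute) auto

lemma V_ES_commute:
 assumes "bnd V" "V * R \<i> = R \<i> * V" "V * R (- \<i>) = R (- \<i>) * V" "\<Delta> \<in> interval_ring"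
 shows "V * ES \<Delta> = ES \<Delta> * V"
 by (rule repr_commute[OF ES[OF assms(4)]]) (use V_E_commute assms in blast)

lemma R_ES_commute: "Im z ~= 0 ==> \<Delta> \<in> interval_ring ==> R z * ES \<Delta> = ES \<Delta> * R z"
 by (rule V_ES_commute) (auto intro: R_bnd R_commute)

lemma R_E_commute: "Im z ~= 0 ==> a ~= 0 ==> b ~= 0 ==> R z * E a b = E a b * R z"
 by (rule V_E_commute) (auto intro: R_bnd R_commute)

text \<open>\<open>inverse_lift\<close> read through R(i) = T + i Y: on the range of 1 - E s t, the
  operator W inverts A - z0.\<close>

lemma local_inverse:
 assumes st: "s ~= 0" "t ~= 0" "s < z0" "z0 < t" "z0 = 0 \<or> 0 < s \<or> t < 0"
 obtains W where "bnd W" "!!a b. a ~= 0 ==> b ~= 0 ==> W * E a b = E a b * W"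
  "!!f f'. (f, f') \<in> A ==> W (f' - of_real z0 *\<^sub>C f) = f - E s t f"
  "!!x. (W x, x - E s t x + of_real z0 *\<^sub>C W x) \<in> A"
proof -
 obtain W where W: "bnd W" "W = (T + \<i> *\<^sub>C Y) * ((1 - E s t) + (of_real z0 - \<i>) *\<^sub>C W)"
  "W * T = T * W" "W * Y = Y * W" "!!u v. u ~= 0 ==> v ~= 0 ==> W * E u v = E u v * W"
  using inverse_lift[OF st] by metis
 define c where "c = of_real z0 - \<i>"
 have WR: "W * R \<i> = R \<i> * W" unfolding TY_R[symmetric] using W by (simp add: distrib_left distrib_right)
 have Wx: "W x = R \<i> (x - E s t x + c *\<^sub>C W x)" for x
 proof -
  have "W x = lapp ((T + \<i> *\<^sub>C Y) * ((1 - E s t) + (of_real z0 - \<i>) *\<^sub>C W)) x" using W(2) by metis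
  thus ?thesis unfolding TY_R c_def by simp
 qed
 have a: "W (f' - of_real z0 *\<^sub>C f) = f - E s t f" if ff: "(f, f') \<in> A" for f f'
 proof -
  define g where "g = f' - \<i> *\<^sub>C f"
  have f: "R \<i> g = f" using R_unique[OF _ ff, of \<i>] by (simp add: g_def)
  have "W g = R \<i> (g - E s t g) + c *\<^sub>C R \<i> (W g)" using Wx[of g] by simp
  also have "R \<i> (W g) = W f" using WR f by (metis lapp_mult)
  also have "R \<i> (g - E s t g) = f - E s t f"
   using R_E_commute[of \<i> s t] st f by (metis imaginary_unit.simps(2) lapp_mult lop_diff zero_neq_one)
  finally have "W g = f - E s t f + c *\<^sub>C W f" .
  moreover have "f' - of_real z0 *\<^sub>C f = g - c *\<^sub>C f"
   by (simp add: g_def c_def complex_vector.scale_left_diff_distrib)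
  ultimately show ?thesis by simp
 qed
 have b: "(W x, x - E s t x + of_real z0 *\<^sub>C W x) \<in> A" for x
  using R_mem[of \<i> "x - E s t x + c *\<^sub>C W x"] Wx[of x]
  by (simp add: c_def complex_vector.scale_left_diff_distrib)
 show thesis using that[OF W(1) W(5) a b] by blast
qed

lemma ES_spectrum:
 assumes D: "\<Delta> \<in> interval_ring"
 shows "spectrum_in ip (range (ES \<Delta>)) (A \<inter> range (ES \<Delta>) \<times> range (ES \<Delta>)) \<subseteq> of_real ` closure {t. Some t \<in> \<Delta>}"
proof
 define X where "X = ES \<Delta>"
 have r: "repr \<Delta> X" unfolding X_def by (rule ES[OF D])
 have XX: "X (X v) = X v" for v using repr_idem[OF r] by (metis lapp_mult)
 have rX: "x \<in> range X \<longleftrightarrow> X x = x" for x using XX by (metis rangeE rangeI)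
 fix z assume z: "z \<in> spectrum_in ip (range (ES \<Delta>)) (A \<inter> range (ES \<Delta>) \<times> range (ES \<Delta>))"
 show "z \<in> of_real ` closure {t. Some t \<in> \<Delta>}"
 proof (rule ccontr)
  assume nz: "z \<notin> of_real ` closure {t. Some t \<in> \<Delta>}"
  have "\<exists>W. bnd W \<and> (\<forall>h. X h = h --> X (W h) = W h \<and> (W h, h + z *\<^sub>C W h) \<in> A) \<and>
   (\<forall>f f'. (f, f') \<in> A --> X f = f --> W (f' - z *\<^sub>C f) = f)"
  proof (cases "Im z = 0")
   case False
   have c: "X (R z h) = R z (X h)" for h using R_ES_commute[OF False D] by (metis X_def lapp_mult)
   show ?thesis using R_bnd[OF False] R_mem[OF False] R_unique[OF False] c
    by (intro exI[of _ "R z"]) auto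
  next
   case True
   define z0 where "z0 = Re z"
   have zz: "z = of_real z0" using True by (simp add: z0_def complex_eq_iff)
   have "z0 \<notin> closure {t. Some t \<in> \<Delta>}" using nz zz by blast
   then obtain e where e: "e > 0" "!!t. \<bar>t - z0\<bar> < e ==> Some t \<notin> \<Delta>"
    unfolding closure_approachable dist_real_def by (auto simp: not_less) (metis linorder_not_less)
   \<comment> \<open>The interval [s, t] must avoid the set and have nonzero endpoints. For z0
     \<noteq> 0 it is kept away from 0, for z0 = 0 it is centred there, as
     \<open>local_inverse\<close> requires.\<close>
   define d where "d = (if z0 = 0 then e / 2 else min (e / 2) (\<bar>z0\<bar> / 2))"
   have d: "d > 0" "d < e" "z0 ~= 0 ==> d < \<bar>z0\<bar>" using e by (auto simp: d_def)
   define s t where "s = z0 - d" and "t = z0 + d"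
   have st: "s ~= 0" "t ~= 0" "s < z0" "z0 < t" "z0 = 0 \<or> 0 < s \<or> t < 0"
    using d by (auto simp: s_def t_def abs_if split: if_splits)
   obtain W where W: "bnd W" "!!a b. a ~= 0 ==> b ~= 0 ==> W * E a b = E a b * W"
    "!!f f'. (f, f') \<in> A ==> W (f' - of_real z0 *\<^sub>C f) = f - E s t f"
    "!!x. (W x, x - E s t x + of_real z0 *\<^sub>C W x) \<in> A"
    using local_inverse[OF st] by metis
   have "W * X = X * W" by (rule repr_commute[OF r W(2)])
   hence WX: "X (W h) = W (X h)" for h by (metis lapp_mult)
   have "Some ` {s..t} \<inter> \<Delta> = {}"
   proof -
    have "Some x \<notin> \<Delta>" if "x \<in> {s..t}" for x
     using that d by (intro e(2)) (auto simp: s_def t_def abs_if)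
    thus ?thesis by blast
   qed
   moreover have "repr (Some ` {s..t} \<inter> \<Delta>) (E s t * X)"
    by (intro repr.inter repr.base r) (use st in \<open>auto simp: iv_def\<close>)
   ultimately have "E s t * X = 0" using repr_unique repr_empty by metis
   hence EX: "E s t f = 0" if "X f = f" for f using that by (metis lapp_mult lapp_zero)
   show ?thesis using W(1) WX W(3) W(4) EX zz by (intro exI[of _ W] conjI allI impI) (simp, metis diff_zero, metis diff_zero, metis diff_zero)
  qed
  then obtain W where W: "bnd W" "!!h. X h = h ==> X (W h) = W h" "!!h. X h = h ==> (W h, h + z *\<^sub>C W h) \<in> A"
   "!!f f'. (f, f') \<in> A ==> X f = f ==> W (f' - z *\<^sub>C f) = f" by blast
  obtain C where C: "!!x. nrm (W x) <= C * nrm x" using bndE[OF W(1)] by blast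
  have "z \<in> resolvent_set_in ip (range X) (A \<inter> range X \<times> range X)"
   unfolding resolvent_set_in_def
  proof (intro CollectI conjI ballI)
   fix h assume "h \<in> range X"
   hence h: "X h = h" by (simp add: rX)
   show "\<exists>!f. (f, h + z *\<^sub>C f) \<in> A \<inter> range X \<times> range X"
   proof (rule ex1I[of _ "W h"])
    show "(W h, h + z *\<^sub>C W h) \<in> A \<inter> range X \<times> range X"
     using W(2,3)[OF h] h by (simp add: rX)
    show "f = W h" if "(f, h + z *\<^sub>C f) \<in> A \<inter> range X \<times> range X" for f
     using W(4)[of f "h + z *\<^sub>C f"] that by (simp add: rX)
   qed
  next
   show "\<exists>C. \<forall>(f, f')\<in>A \<inter> range X \<times> range X. nrm f <= C * nrm (f' - z *\<^sub>C f)"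
   proof (intro exI[of _ C] ballI)
    fix p assume "p \<in> A \<inter> range X \<times> range X"
    then obtain f f' where p': "p = (f, f')" "(f, f') \<in> A" "f \<in> range X" by blast
    hence p: "p = (f, f')" "(f, f') \<in> A" "X f = f" by (simp_all add: rX)
    show "case p of (f, f') => nrm f <= C * nrm (f' - z *\<^sub>C f)"
     using C[of "f' - z *\<^sub>C f"] W(4)[OF p(2,3)] by (simp add: p(1))
   qed
  qed
  thus False using z by (simp add: spectrum_in_def X_def)
 qed
qed

theorem ES_spectral: "spectral_function form ip A (\<lambda>\<Delta>. lapp (ES \<Delta>))"
 unfolding spectral_function_def
proof (intro conjI ballI impI)
 show "lapp (ES {}) = (\<lambda>x. 0)" using ES_eq[OF repr_empty] by auto
 show "lapp (ES UNIV) = id" using ES_eq[OF repr.compl[OF repr_empty]] by auto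
next
 fix \<Delta> assume D: "\<Delta> \<in> interval_ring"
 show "bounded_operator ip (lapp (ES \<Delta>))"
  using repr_bnd[OF ES[OF D]] by (simp add: bounded_operator_def clinear_on_def bnd_def)
 show "\<forall>x y. form (ES \<Delta> x) y = form x (ES \<Delta> y)" using repr_form[OF ES[OF D]] by blast
 show "hilbert_on (range (ES \<Delta>)) form" if "\<Delta> \<subseteq> Some ` {0<..}"
  using ES_hilbert[OF D that, of 1] by simp
 show "hilbert_on (range (ES \<Delta>)) (\<lambda>x y. - form x y)" if "\<Delta> \<subseteq> Some ` {..<0}"
  using ES_hilbert[OF D that, of "-1"] by simp
 show "in_double_commutant ip A (lapp (ES \<Delta>))"
  unfolding in_double_commutant_def
 proof (intro allI impI)
  fix V assume V: "bounded_operator ip V" "\<forall>z\<in>resolvent_set_in ip UNIV A. V \<circ> resolvent A z = resolvent A z \<circ> V"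
  define W where "W = Lop V"
  have WV: "lapp W = V" unfolding W_def using V(1) by (intro lapp_Lop) (auto simp: bounded_operator_def clinear_on_def)
  have "bnd W" using V(1) by (auto simp: bnd_def WV bounded_operator_def)
  moreover have "W * R z = R z * W" if "Im z ~= 0" for z
  proof (rule lop_eqI)
   fix x
   have "V \<circ> resolvent A z = resolvent A z \<circ> V" using V(2) A_res[OF that] by blast
   from fun_cong[OF this, of x] show "(W * R z) x = (R z * W) x" using that by (simp add: WV R_app)
  qed
  ultimately have "W * ES \<Delta> = ES \<Delta> * W" by (intro V_ES_commute D) auto
  thus "V \<circ> lapp (ES \<Delta>) = lapp (ES \<Delta>) \<circ> V" unfolding WV[symmetric] by (auto simp: fun_eq_iff) (metis lapp_mult)
 qed
 show "spectrum_in ip (range (ES \<Delta>)) (A \<inter> range (ES \<Delta>) \<times> range (ES \<Delta>)) \<subseteq> complex_of_real ` closure {t. Some t \<in> \<Delta>}"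
  by (rule ES_spectrum[OF D])
 have idem: "ES \<Delta> (ES \<Delta> x) = ES \<Delta> x" for x using repr_idem[OF ES[OF D]] by (metis lapp_mult)
 show "range (ES \<Delta>) \<subseteq> Domain A" if N: "None \<notin> \<Delta>"
 proof
  fix x assume "x \<in> range (ES \<Delta>)"
  obtain W where "ES \<Delta> = Y * W" using ES_factor[OF D N] by blast
  thus "x \<in> Domain A" using \<open>x \<in> range (ES \<Delta>)\<close> AY by fastforce
 qed
 show "\<exists>C. \<forall>(f, f')\<in>A. f \<in> range (ES \<Delta>) --> nrm f' <= C * nrm f" if N: "None \<notin> \<Delta>"
 proof -
  obtain W where W: "bnd W" "ES \<Delta> = Y * W" using ES_factor[OF D N] by blast
  obtain C where C: "!!x. nrm ((T * W) x) <= C * nrm x" using bndE[of "T * W"] Tb W(1) by auto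
  have "nrm f' <= C * nrm f" if f: "(f, f') \<in> A" "f \<in> range (ES \<Delta>)" for f f'
  proof -
   have "f = Y (W f)" using f(2) idem W(2) by (metis imageE lapp_mult)
   hence "f' = T (W f)" using AY[of "W f"] f(1) A_unique by metis
   thus ?thesis using C[of f] by simp
  qed
  thus ?thesis by blast
 qed
next
 fix \<Delta>1 \<Delta>2 assume D: "\<Delta>1 \<in> interval_ring" "\<Delta>2 \<in> interval_ring"
 have i: "ES (\<Delta>1 \<inter> \<Delta>2) = ES \<Delta>1 * ES \<Delta>2" by (rule ES_eq[OF repr.inter[OF ES[OF D(1)] ES[OF D(2)]]])
 thus "lapp (ES (\<Delta>1 \<inter> \<Delta>2)) = lapp (ES \<Delta>1) \<circ> lapp (ES \<Delta>2)" by auto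
 assume "\<Delta>1 \<inter> \<Delta>2 = {}"
 hence "ES \<Delta>1 * ES \<Delta>2 = 0" using i ES_eq[OF repr_empty] by simp
 hence "ES (\<Delta>1 \<union> \<Delta>2) = ES \<Delta>1 + ES \<Delta>2"
  using ES_eq[OF repr_un[OF ES[OF D(1)] ES[OF D(2)]]] by simp
 thus "lapp (ES (\<Delta>1 \<union> \<Delta>2)) = (\<lambda>x. ES \<Delta>1 x + ES \<Delta>2 x)" by auto
qed

end

section \<open>Regularity at zero and the growth of the resolvent\<close>

context nonneg_krein
begin

lemma TA: assumes f: "(f, f') \<in> A" shows "T f' = f - Y f" "T f = Y f'"
proof -
 have z: "R z f' = f + z *\<^sub>C R z f" if "Im z ~= 0" for z
  using R_unique[OF that f] by (simp add: algebra_simps)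
 have 1: "R \<i> f' = f + \<i> *\<^sub>C R \<i> f" "R (- \<i>) f' = f - \<i> *\<^sub>C R (- \<i>) f"
  using z[of \<i>] z[of "- \<i>"] by simp_all
 have h: "(1/2::complex) *\<^sub>C x + (1/2::complex) *\<^sub>C x = x" for x :: 'a
  using complex_vector.scale_left_distrib[of "1/2" "1/2" x] by simp
 have Yi: "Y f = (1 / (2 * \<i>)) *\<^sub>C (R \<i> f - R (- \<i>) f)" by (simp add: Y_def)
 have "T f' = (1/2::complex) *\<^sub>C f + (1/2::complex) *\<^sub>C f + (\<i>/2) *\<^sub>C (R \<i> f - R (- \<i>) f)"
  by (simp add: T_def 1 complex_vector.scale_right_distrib complex_vector.scale_right_diff_distrib)
 thus "T f' = f - Y f" by (simp add: h Yi)
 have "R \<i> f' - R (- \<i>) f' = \<i> *\<^sub>C (R \<i> f + R (- \<i>) f)"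
  by (simp add: 1 complex_vector.scale_right_distrib)
 thus "T f = Y f'" by (simp add: T_def Y_def)
qed

text \<open>An a priori bound of order 1 / y^2. In the seminorm of D the resolvent obeys the
  self-adjoint bound 1 / y; returning from this seminorm to the norm costs the second factor 1 /
  y.\<close>

lemma R_growth: "\<exists>C\<ge>0. \<forall>y x. 0 < y --> y <= 1 --> nrm (R (\<i> * of_real y) x) <= C / y\<^sup>2 * nrm x"
proof -
 obtain d where d: "d > 0" "!!x. nrm (D x) <= d * nrm x" using bndE[OF D(2)] by blast
 obtain c where c: "c > 0" "!!x. nrm (Y x) <= c * nrm x" using bndE[OF Yb] by blast
 have "nrm (R (\<i> * of_real y) x) <= (c + 2 * d\<^sup>2) / y\<^sup>2 * nrm x" if y: "0 < y" "y <= 1" for y x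
 proof -
  define z where "z = \<i> * complex_of_real y"
  have z: "Im z ~= 0" "cmod z = y" "z ~= 0" using y by (auto simp: z_def norm_mult)
  have z2: "z * z = - of_real (y\<^sup>2)" by (simp add: z_def power2_eq_square algebra_simps)
  define u where "u = R z x"
  have u: "(u, x + z *\<^sub>C u) \<in> A" using R_mem[OF z(1)] by (simp add: u_def)
  have Tu: "T (x + z *\<^sub>C u) = u - Y u" "T u = Y (x + z *\<^sub>C u)" using TA[OF u] by auto
  have Tx: "T x = u - Y u - z *\<^sub>C T u" using Tu(1) by (simp add: algebra_simps)
  \<comment> \<open>This is z / (\<lambda> - z) = \<lambda> / (1 + \<lambda>^2) (z + (1 + z^2) /
    (\<lambda> - z)) - 1 / (1 + \<lambda>^2). Up to Y x the vector z u is in ran(T), and T = J D^2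
    is controlled by D.\<close>
  have zu: "z *\<^sub>C u = T (z *\<^sub>C x + (1 + z * z) *\<^sub>C u) - Y x"
  proof -
   have "T (z *\<^sub>C x + (1 + z * z) *\<^sub>C u) = z *\<^sub>C T x + T u + (z * z) *\<^sub>C T u"
    by (simp add: complex_vector.scale_left_distrib)
   also have "... = z *\<^sub>C u - z *\<^sub>C Y u + T u"
    by (simp add: Tx complex_vector.scale_right_diff_distrib)
   also have "... = z *\<^sub>C u + Y x" using Tu(2) by simp
   finally show ?thesis by simp
  qed
  have Du: "nrm (D u) <= nrm (D x) / y"
  proof (cases "nrm (D u) = 0")
   case False
   have "ip (D x) (D u) = form (T x) u" by (simp add: D_ip form_ip)
   also have "... = form u u - form (Y u) u - z * form (T u) u"
    by (simp add: Tx form_diff form_scale)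
   finally have e: "ip (D x) (D u) = form u u - form (Y u) u - z * form (T u) u" .
   have "Im (form (Y u) u) = 0" using Y_form[of u u] form_herm[of u "Y u"] by (metis cnj.simps(2) neg_equal_zero)
   moreover have "form (T u) u = of_real ((nrm (D u))\<^sup>2)" by (simp add: D_ip[symmetric] form_ip self_eq)
   ultimately have "Im (ip (D x) (D u)) = - y * (nrm (D u))\<^sup>2" unfolding e by (simp add: z_def)
   hence "y * (nrm (D u))\<^sup>2 <= nrm (D x) * nrm (D u)"
    using cauchy_schwarz[of "D x" "D u"] abs_Im_le_cmod[of "ip (D x) (D u)"] y by simp
   hence "(y * nrm (D u)) * nrm (D u) <= nrm (D x) * nrm (D u)" by (simp add: power2_eq_square)
   moreover have "0 < nrm (D u)" using False by (simp add: order_less_le)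
   ultimately show ?thesis using y by (simp add: mult_le_cancel_right field_simps)
  qed (use y in simp)
  define w where "w = z *\<^sub>C x + (1 + z * z) *\<^sub>C u"
  have "nrm (D w) <= y * nrm (D x) + (1 - y\<^sup>2) * nrm (D u)"
  proof -
   have "nrm (D w) <= nrm (z *\<^sub>C D x) + nrm ((1 + z * z) *\<^sub>C D u)"
    unfolding w_def by (simp only: lop_add lop_scale) (rule nrm_triangle; simp)
   moreover have "cmod (1 + z * z) = 1 - y\<^sup>2"
   proof -
    have "1 + z * z = of_real (1 - y\<^sup>2)" by (simp add: z2)
    thus ?thesis using y by (simp only: norm_of_real) (simp add: power_le_one)
   qed
   ultimately show ?thesis by (simp add: nrm_scale z)
  qed
  also have "... <= y * nrm (D x) + 1 * (nrm (D x) / y)"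
   using Du y by (intro add_mono mult_mono) (auto simp: power_le_one)
  also have "y * nrm (D x) <= nrm (D x) / y"
  proof -
   have "y * y <= 1" using y mult_le_one[of y y] by simp
   hence "y * y * nrm (D x) <= 1 * nrm (D x)" by (intro mult_right_mono) auto
   thus ?thesis using y by (simp add: field_simps)
  qed
  finally have Dw: "nrm (D w) <= 2 * (nrm (D x) / y)" by simp
  have "nrm (T w) <= d * nrm (D w)"
  proof -
   have "T w = J (D (D w))" using T_D by (metis lapp_mult)
   thus ?thesis using d(2)[of "D w"] by simp
  qed
  also have "... <= d * (2 * (d * nrm x / y))"
  proof (intro mult_left_mono)
   have "nrm (D x) / y <= d * nrm x / y" using d(2)[of x] y by (intro divide_right_mono) auto
   thus "nrm (D w) <= 2 * (d * nrm x / y)" using Dw by simp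
  qed (use d in simp)
  finally have Tw: "nrm (T w) <= 2 * d\<^sup>2 * nrm x / y" by (simp add: power2_eq_square mult_ac)
  have "y * nrm u = nrm (z *\<^sub>C u)" by (simp add: nrm_scale z)
  also have "... <= nrm (T w) + nrm (Y x)" unfolding zu w_def[symmetric] by (rule nrm_triangle_diff) auto
  also have "... <= 2 * d\<^sup>2 * nrm x / y + c * nrm x / y"
  proof -
   have "c * nrm x * y <= c * nrm x" using y c by (intro mult_left_le) auto
   hence "c * nrm x <= c * nrm x / y" using y by (simp add: pos_le_divide_eq)
   thus ?thesis using Tw c(2)[of x] by linarith
  qed
  finally have "y * nrm u <= (c + 2 * d\<^sup>2) * nrm x / y" by (simp add: add_divide_distrib[symmetric] algebra_simps)
  hence "nrm u <= (c + 2 * d\<^sup>2) / y\<^sup>2 * nrm x" using y by (simp add: field_simps power2_eq_square)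
  thus ?thesis by (simp add: u_def z_def)
 qed
 thus ?thesis using c d by (intro exI[of _ "c + 2 * d\<^sup>2"]) auto
qed

text \<open>On ran(X) the operator A is self-adjoint for the definite form s [x, y], which gives the
  bound 1 / y in the norm of that form. The constant M pays for the passage between the two norms,
  once a square root of M in each direction.\<close>

lemma res_bound_definite:
 assumes X: "bnd X" "X * X = X" "!!x y. form (lapp X x) y = form x (X y)" and s: "s = 1 \<or> s = - 1"
  and pos: "!!x. 0 <= s * Re (form (X x) x)" and le: "!!x. s * Re (form (X x) x) <= M * (nrm x)\<^sup>2" and M: "0 <= M"
  and y: "y > 0" and c: "R (\<i> * of_real y) * X = X * R (\<i> * of_real y)"
 shows "nrm (R (\<i> * of_real y) (X x)) <= M / y * nrm x"
proof -
 define P where "P = of_real s *\<^sub>C (J * X)"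
 define z where "z = \<i> * complex_of_real y"
 have z: "Im z ~= 0" using y by (simp add: z_def)
 have XX: "X (X v) = X v" for v using X(2) by (metis lapp_mult)
 have Pp: "pos P" using ksym_of_form[OF X(3)] pos by (simp add: P_def pos_def form_ip)
 have Pn: "nrm (P v) = nrm (X v)" for v using s by (auto simp: P_def nrm_scale)
 have Pf: "ip (P v) w = of_real s * form (X v) w" for v w by (simp add: P_def form_ip)
 have Pb: "nrm (P v) <= M * nrm v" for v by (rule pos_form_bound[OF Pp _ M]) (use le in \<open>simp add: Pf\<close>)
 define u where "u = R z (X x)"
 have Xu: "X u = u" using c XX by (metis lapp_mult u_def z_def)
 have uA: "(u, X x + z *\<^sub>C u) \<in> A" using R_mem[OF z, of "X x"] by (simp add: u_def)
 define g where "g v = Re (ip (P v) v)" for v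
 have gX: "g (X v) = g v" for v unfolding g_def Pf using X(3)[of "X v" v] XX by simp
 have gu: "ip (P u) u = of_real s * form u u" by (simp add: Pf Xu)
 have "form (X x + z *\<^sub>C u) u = form (X x) u + z * form u u" by (simp add: form_add form_scale)
 moreover have "Im (z * form u u) = y * Re (form u u)" by (simp add: z_def)
 moreover have "Im (form (X x + z *\<^sub>C u) u) = 0" using A_nonneg'(2)[OF uA] .
 ultimately have "Im (form (X x) u) = - y * Re (form u u)"
  by (metis add_eq_0_iff2 minus_mult_left plus_complex.simps(2))
 hence "\<bar>y * g u\<bar> = \<bar>Im (form (X x) u)\<bar>" using s unfolding g_def gu by auto
 also have "... <= cmod (ip (P (X x)) u)" unfolding Pf XX using abs_Im_le_cmod[of "form (X x) u"] s by (auto simp: norm_mult)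
 finally have "(y * g u)\<^sup>2 <= (cmod (ip (P (X x)) u))\<^sup>2" by (metis abs_le_square_iff abs_norm_cancel)
 also have "... <= g x * g u" using pos_cs[OF Pp, of "X x" u] gX[of x] by (simp add: g_def)
 finally have 1: "y\<^sup>2 * g u * g u <= g x * g u" by (simp add: power2_eq_square mult_ac)
 have g0: "0 <= g v" for v using posD[OF Pp] by (simp add: g_def)
 have 2: "y\<^sup>2 * g u <= g x"
 proof (cases "g u = 0")
  case False
  hence "0 < g u" using g0[of u] by simp
  thus ?thesis using 1 by (simp add: mult_le_cancel_right)
 qed (use g0[of x] in simp)
 have "(nrm u)\<^sup>2 <= M * g u" using pos_bound[OF Pp Pb, of u] by (simp add: Pn Xu g_def)
 also have "... <= M * (g x / y\<^sup>2)" using 2 y M by (intro mult_left_mono) (auto simp: field_simps)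
 also have "... <= M * (M * (nrm x)\<^sup>2 / y\<^sup>2)"
  using le[of x] M by (intro mult_left_mono divide_right_mono) (auto simp: g_def Pf)
 also have "... = (M / y * nrm x)\<^sup>2" by (simp add: power2_eq_square)
 finally have "nrm u <= M / y * nrm x" by (rule power2_le_imp_le) (use M y in simp)
 thus ?thesis by (simp add: u_def z_def)
qed

text \<open>Both conditions express that the spectral projections stay bounded near 0; the
 spectral subspaces over shrinking neighbourhoods of 0 contribute at most \<open>C / y\<close>
 because the operator tends to 0 on them.\<close>

definition bounded_near_0 :: "real => real => bool" where
 "bounded_near_0 l M \<longleftrightarrow> (\<forall>t x. 0 < t --> t < l -->
   Re (form (E t l x) x) <= M * (nrm x)\<^sup>2 \<and> - Re (form (E (- l) (- t) x) x) <= M * (nrm x)\<^sup>2)"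

theorem resolvent_bound:
 assumes l: "0 < l" and M: "0 <= M" and b: "bounded_near_0 l M"
 shows "\<exists>C. \<forall>y x. 0 < y --> y < 1 --> nrm (R (\<i> * of_real y) x) <= C / y * nrm x"
proof -
 obtain G where G: "G \<ge> 0" "!!y x. 0 < y ==> y <= 1 ==> nrm (R (\<i> * of_real y) x) <= G / y\<^sup>2 * nrm x"
  using R_growth by blast
 have l0: "- l ~= 0" "l ~= 0" "- l < 0" "0 < l" using l by auto
 obtain W where W: "bnd W" "!!f f'. (f, f') \<in> A ==> W (f' - of_real 0 *\<^sub>C f) = f - E (- l) l f"
  using local_inverse[OF l0(1,2,3,4)] by metis
 obtain w where w: "w > 0" "!!x. nrm (W x) <= w * nrm x" using bndE[OF W(1)] by blast
 obtain e where e: "e > 0" "!!x. nrm (E (- l) l x) <= e * nrm x" using bndE[OF liftsD(1)[OF E_lifts[OF l0(1,2)]]] by blast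
 obtain m X where X: "bic m" "lifts m (al (- l) l) X" "E (- l) l = Y * X" using E_factor[OF l0(1,2)] by blast
 define K where "K = (2 * w + 2 * w * G) * (1 + e)"
 define C where "C = K + 2 * M + (e + 2 * M)"
 have "nrm (R (\<i> * of_real y) x) <= C / y * nrm x" if y: "0 < y" "y < 1" for y x
 proof -
  define z where "z = \<i> * complex_of_real y"
  have z: "Im z ~= 0" "cmod z = y" "z ~= 0" using y by (auto simp: z_def norm_mult)
  \<comment> \<open>W inverts A on the complementary spectral subspace, hence u = W (A u) = W (xe +
    z u).\<close>
  have ext: "nrm (R z (x - E (- l) l x)) <= K / y * nrm x"
  proof -
   define xe where "xe = x - E (- l) l x"
   have xe: "nrm xe <= (1 + e) * nrm x"
    using nrm_triangle_diff[of x "E (- l) l x"] e(2)[of x] by (simp add: xe_def algebra_simps)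
   have EE: "E (- l) l (E (- l) l v) = E (- l) l v" for v
    using E_mult[of "- l" l "- l" l] l by (metis lapp_mult less_irrefl max.idem min.idem neg_equal_0_iff_equal)
   define u where "u = R z xe"
   have "E (- l) l u = R z (E (- l) l xe)"
    using R_E_commute[OF z(1) l0(1,2)] by (metis lapp_mult u_def)
   hence Eu: "E (- l) l u = 0" by (simp add: xe_def EE)
   have "W (xe + z *\<^sub>C u) = u" using W(2)[OF R_mem[OF z(1), of xe]] Eu by (simp add: u_def)
   hence u1: "nrm u <= w * (nrm xe + y * nrm u)"
    using w(2)[of "xe + z *\<^sub>C u"] nrm_triangle[of xe "z *\<^sub>C u"] w(1)
    by (simp add: nrm_scale z) (smt (verit) mult_left_mono)
   have "nrm u <= (2 * w + 2 * w * G) / y * nrm xe"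
   \<comment> \<open>For small y the term w y |u| is absorbed on the left. Otherwise 1 / y \<le> 2
     w, and one of the two factors 1 / y in the a priori bound is harmless.\<close>
   proof (cases "w * y <= 1 / 2")
    case True
    have "w * (y * nrm u) <= 1 / 2 * nrm u" using mult_right_mono[OF True, of "nrm u"] by (simp add: mult.assoc)
    hence "nrm u <= 2 * w * nrm xe" using u1 by (simp add: distrib_left)
    also have "... <= (2 * w + 2 * w * G) * nrm xe" using w G by (intro mult_right_mono) auto
    also have "... <= (2 * w + 2 * w * G) / y * nrm xe"
    proof (intro mult_right_mono)
     have "(2 * w + 2 * w * G) * y <= 2 * w + 2 * w * G" using y w G by (intro mult_left_le) auto
     thus "2 * w + 2 * w * G <= (2 * w + 2 * w * G) / y" using y by (simp add: pos_le_divide_eq)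
    qed simp
    finally show ?thesis .
   next
    case False
    hence "1 / y <= 2 * w" using y by (simp add: field_simps)
    hence "G / y * (1 / y) <= G / y * (2 * w)" using y G by (intro mult_left_mono) auto
    hence "G / y\<^sup>2 <= 2 * w * G / y" by (simp add: power2_eq_square mult_ac)
    also have "... <= (2 * w + 2 * w * G) / y" using y w by (intro divide_right_mono) auto
    finally have "G / y\<^sup>2 * nrm xe <= (2 * w + 2 * w * G) / y * nrm xe" by (intro mult_right_mono) auto
    thus ?thesis using G(2)[of y xe] y by (simp add: u_def z_def)
   qed
   also have "... <= (2 * w + 2 * w * G) / y * ((1 + e) * nrm x)"
    using xe y w G by (intro mult_left_mono) auto
   finally show ?thesis by (simp add: u_def xe_def K_def)
  qed
  have tail: "nrm (R z x) <= K / y * nrm x + 2 * (M / y * nrm x)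
    + (1 / y) * ((e + 2 * M) * nrm x + G / y\<^sup>2 * nrm (T (X (E (- 1 / real (Suc n)) (1 / real (Suc n)) x))))"
   if n: "1 / real (Suc n) < l" for n
  proof -
   define t where "t = 1 / real (Suc n)"
   have t: "0 < t" "t < l" "t ~= 0" "- t ~= 0" using n by (auto simp: t_def)
   have Xp: "bnd (E a b)" "E a b * E a b = E a b" "!!x y. form (E a b x) y = form x (E a b y)"
    if "a ~= 0" "b ~= 0" for a b
    using liftsD(1)[OF E_lifts[OF that]] E_mult[OF that that] E_form[OF that] by auto
   have Rc: "R (\<i> * complex_of_real y) * E a b = E a b * R (\<i> * complex_of_real y)" if "a ~= 0" "b ~= 0" for a b
    by (rule R_E_commute) (use that y in auto)
   have p: "nrm (R z (E t l x)) <= M / y * nrm x" unfolding z_def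
   proof (rule res_bound_definite[where s = 1])
    show "0 <= 1 * Re (form (E t l v) v)" for v using E_nonneg[of t l v] t l by (simp add: form_ip)
    show "1 * Re (form (E t l v) v) <= M * (nrm v)\<^sup>2" for v using b t by (simp add: bounded_near_0_def)
   qed (use t l M y Xp Rc in auto)
   have q: "nrm (R z (E (- l) (- t) x)) <= M / y * nrm x" unfolding z_def
   proof (rule res_bound_definite[where s = "- 1"])
    show "0 <= - 1 * Re (form (E (- l) (- t) v) v)" for v using E_nonpos[of "- l" "- t" v] t l by (simp add: form_ip)
    show "- 1 * Re (form (E (- l) (- t) v) v) <= M * (nrm v)\<^sup>2" for v using b t by (simp add: bounded_near_0_def)
   qed (use t l M y Xp Rc in auto)
   have "pos (J * E t l)" using E_nonneg[of t l] t l liftsD(2)[OF E_lifts] by (simp add: pos_def)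
   hence "nrm ((J * E t l) x) <= M * nrm x"
    by (rule pos_form_bound) (use b t M in \<open>auto simp: bounded_near_0_def form_ip\<close>)
   hence p1: "nrm (E t l x) <= M * nrm x" by simp
   have "pos (- (J * E (- l) (- t)))" using E_nonpos[of "- l" "- t"] t l liftsD(2)[OF E_lifts] by (simp add: pos_def)
   hence "nrm (lapp (- (J * E (- l) (- t))) x) <= M * nrm x"
    by (rule pos_form_bound) (use b t M in \<open>auto simp: bounded_near_0_def form_ip\<close>)
   hence q1: "nrm (E (- l) (- t) x) <= M * nrm x" by simp
   define v where "v = E (- t) t x"
   have sp: "E (- l) l x = E (- l) (- t) x + v + E t l x"
    using E_split[of "- l" "- t" l] E_split[of "- t" t l] t l by (simp add: v_def)
   have nv: "nrm v <= (e + 2 * M) * nrm x"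
   proof -
    have "v = E (- l) l x - E (- l) (- t) x - E t l x" using sp by simp
    hence "nrm v <= nrm (E (- l) l x) + nrm (E (- l) (- t) x) + nrm (E t l x)"
     using nrm_triangle_diff[of "E (- l) l x - E (- l) (- t) x" "E t l x"]
      nrm_triangle_diff[of "E (- l) l x" "E (- l) (- t) x"] by simp
    thus ?thesis using e(2)[of x] p1 q1 by (simp add: distrib_right)
   qed
   \<comment> \<open>Since v lies in ran(Y X), A v is T (X v), and z R(z) v = R(z) A v - v. With y
     fixed, the a priori bound suffices for the first term, because A v tends to 0 as t does by
     \<open>E_shrink\<close>.\<close>
   have "E (- l) l v = v" using E_mult[of "- l" l "- t" t] t l
    by (metis l0(1,2) lapp_mult less_eq_real_def max.absorb2 min.absorb2 neg_le_iff_le v_def)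
   hence "(v, T (X v)) \<in> A" using AY[of "X v"] X(3) by (metis lapp_mult)
   hence "R z (T (X v)) - z *\<^sub>C R z v = v" using R_unique[OF z(1)] by fastforce
   hence "z *\<^sub>C R z v = R z (T (X v)) - v" by (simp add: algebra_simps)
   hence "y * nrm (R z v) = nrm (R z (T (X v)) - v)" by (metis UNIV_I nrm_scale z(2))
   also have "... <= nrm (R z (T (X v))) + nrm v" by (rule nrm_triangle_diff) auto
   also have "... <= G / y\<^sup>2 * nrm (T (X v)) + (e + 2 * M) * nrm x"
    using G(2)[of y "T (X v)"] nv y by (simp add: z_def)
   finally have rv: "nrm (R z v) <= (1 / y) * ((e + 2 * M) * nrm x + G / y\<^sup>2 * nrm (T (X v)))"
    using y by (simp add: field_simps)
   have e4: "R z x = R z (x - E (- l) l x) + R z (E t l x) + R z (E (- l) (- t) x) + R z v"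
    by (simp add: sp)
   have "nrm (R z x) <= nrm (R z (x - E (- l) l x)) + nrm (R z (E t l x)) + nrm (R z (E (- l) (- t) x)) + nrm (R z v)"
    unfolding e4 using nrm_triangle[OF UNIV_I UNIV_I, of "R z (x - E (- l) l x) + R z (E t l x) + R z (E (- l) (- t) x)" "R z v"]
     nrm_triangle[OF UNIV_I UNIV_I, of "R z (x - E (- l) l x) + R z (E t l x)" "R z (E (- l) (- t) x)"]
     nrm_triangle[OF UNIV_I UNIV_I, of "R z (x - E (- l) l x)" "R z (E t l x)"] by linarith
   thus ?thesis using ext p q rv by (simp add: v_def t_def)
  qed
  define S where "S n = T (X (E (- 1 / real (Suc n)) (1 / real (Suc n)) x))" for n
  have lim: "(\<lambda>n. K / y * nrm x + 2 * (M / y * nrm x) + (1 / y) * ((e + 2 * M) * nrm x + G / y\<^sup>2 * nrm (S n)))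
    \<longlonglongrightarrow> K / y * nrm x + 2 * (M / y * nrm x) + (1 / y) * ((e + 2 * M) * nrm x + G / y\<^sup>2 * 0)"
   unfolding S_def by (intro tendsto_intros E_shrink[OF X(2,1)])
  have "\<forall>\<^sub>F n in sequentially. 1 / real (Suc n) < l"
   using order_tendstoD(2)[OF LIMSEQ_Suc[OF lim_1_over_n], of l] l by simp
  hence "\<forall>\<^sub>F n in sequentially. nrm (R z x) <= K / y * nrm x + 2 * (M / y * nrm x) + (1 / y) * ((e + 2 * M) * nrm x + G / y\<^sup>2 * nrm (S n))"
   by eventually_elim (use tail in \<open>simp add: S_def\<close>)
  from tendsto_lowerbound[OF lim this]
  have "nrm (R z x) <= K / y * nrm x + 2 * (M / y * nrm x) + (1 / y) * ((e + 2 * M) * nrm x)" by simp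
  also have "... = C / y * nrm x" using y by (simp add: C_def field_simps)
  finally show ?thesis by (simp add: z_def)
 qed
 thus ?thesis by blast
qed

lemma E_mono_form:
 assumes "0 < s" "s <= t" "t <= u" "u <= v"
 shows "Re (form (E t u x) x) <= Re (form (E s v x) x)"
  "- Re (form (E (- u) (- t) x) x) <= - Re (form (E (- v) (- s) x) x)"
proof -
 have "E s v = E s t + E t u + E u v"
  using E_split[of s t v] E_split[of t u v] assms by simp
 thus "Re (form (E t u x) x) <= Re (form (E s v x) x)"
  using E_nonneg[of s t x] E_nonneg[of u v x] assms by (simp add: form_add form_ip)
 have "E (- v) (- s) = E (- v) (- u) + E (- u) (- t) + E (- t) (- s)"
  using E_split[of "- v" "- u" "- s"] E_split[of "- u" "- t" "- s"] assms by simp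
 thus "- Re (form (E (- u) (- t) x) x) <= - Re (form (E (- v) (- s) x) x)"
  using E_nonpos[of "- v" "- u" x] E_nonpos[of "- t" "- s" x] assms by (simp add: form_add form_ip)
qed

text \<open>A strong limit makes the forms bounded at each x, and uniform boundedness along a
  sequence t n tending to 0 gives M; monotonicity in t extends the bound to all t.\<close>

lemma strong_limit_bound:
 fixes F :: "real => 'a lop"
 assumes lim: "strong_limit_exists ip (\<lambda>t. lapp (F t)) (at_right 0)"
  and P: "!!t. 0 < t ==> t < l ==> pos (F t)" "!!t. 0 < t ==> t < l ==> bnd (F t)"
  and mono: "!!s t x. 0 < s ==> s <= t ==> t < l ==> Re (ip (F t x) x) <= Re (ip (F s x) x)" and l: "0 < l"
 obtains M where "0 <= M" "!!t x. 0 < t ==> t < l ==> Re (ip (F t x) x) <= M * (nrm x)\<^sup>2"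
proof -
 define t where "t n = l / (real n + 2)" for n :: nat
 have t: "0 < t n" "t n < l" for n
  using l mult_nonneg_nonneg[of l "real n"] by (auto simp: t_def field_simps intro: add_pos_nonneg)
 have "\<exists>B. \<forall>n. Re (ip (F (t n) x) x) <= B" for x
 proof -
  obtain y where y: "((\<lambda>s. nrm (F s x - y)) \<longlongrightarrow> 0) (at_right 0)"
   using lim unfolding strong_limit_exists_def by blast
  have "\<forall>\<^sub>F s in at_right 0. nrm (F s x - y) < 1" by (rule order_tendstoD(2)[OF y]) simp
  then obtain d where d: "d > 0" "!!s. 0 < s ==> s < d ==> nrm (F s x - y) < 1"
   unfolding eventually_at_right_field by auto
  have "Re (ip (F (t n) x) x) <= (nrm y + 1) * nrm x" for n
  proof -
   define s where "s = min (t n) (d / 2)"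
   have s: "0 < s" "s <= t n" "s < d" using t[of n] d by (auto simp: s_def)
   have "Re (ip (F (t n) x) x) <= Re (ip (F s x) x)" by (rule mono) (use s t in auto)
   also have "... <= nrm (F s x) * nrm x" by (rule Re_le) auto
   also have "nrm (F s x) <= nrm y + 1"
    using nrm_triangle[of "F s x - y" y] d(2)[OF s(1,3)] by simp
   finally show ?thesis by (simp add: mult_right_mono)
  qed
  thus ?thesis by blast
 qed
 then obtain M where M: "0 <= M" "!!n x. Re (ip (F (t n) x) x) <= M * (nrm x)\<^sup>2"
  using pos_uniform_bound[of "\<lambda>n. F (t n)"] P t by blast
 have "Re (ip (F s x) x) <= M * (nrm x)\<^sup>2" if s: "0 < s" "s < l" for s x
 proof -
  obtain n :: nat where "l / s < real n" using reals_Archimedean2 by blast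
  hence "t n <= s" using s l by (simp add: t_def field_simps)
  hence "Re (ip (F s x) x) <= Re (ip (F (t n) x) x)" using t s by (intro mono) auto
  thus ?thesis using M(2)[of n x] by linarith
 qed
 thus thesis using that M by blast
qed

text \<open>Endpoints in the ring are nonzero, so membership in its sets is constant near 0.\<close>

lemma ring_nbhd:
 assumes D: "\<Delta> \<in> interval_ring" "Some 0 \<in> \<Delta>"
 obtains e where "e > 0" "Some ` {- e..e} \<subseteq> \<Delta>"
proof -
 obtain F where F: "finite F" "\<forall>I\<in>F. nonzero_bounded_interval I" "\<Delta> = Some ` \<Union>F \<or> \<Delta> = - (Some ` \<Union>F)"
  using D by (auto simp: interval_ring_def)
 have nb: "\<exists>e>0. {- e..e} \<subseteq> I \<or> {- e..e} \<inter> I = {}" if "I \<in> F" for I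
 proof -
  obtain a b where ab: "a ~= 0" "b ~= 0" "{a<..<b} \<subseteq> I" "I \<subseteq> {a..b}" using nonzero_iv[of I] F(2) \<open>I \<in> F\<close> unfolding iv_def by metis
  define e where "e = min \<bar>a\<bar> \<bar>b\<bar> / 2"
  have e: "e > 0" "e < \<bar>a\<bar>" "e < \<bar>b\<bar>" using ab by (auto simp: e_def min_def)
  show ?thesis
  proof (cases "a < 0 \<and> 0 < b")
   case True
   hence "{- e..e} \<subseteq> {a<..<b}" using e by auto
   thus ?thesis using e ab by blast
  next
   case False
   hence "{- e..e} \<inter> {a..b} = {}" using e ab by (auto simp: abs_if split: if_splits)
   thus ?thesis using e ab by blast
  qed
 qed
 have un: "\<exists>e>0. {- e..e} \<subseteq> \<Union>G \<or> {- e..e} \<inter> \<Union>G = {}" if "finite G" "G \<subseteq> F" for G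
  using that
 proof (induction G rule: finite_induct)
  case (insert I G)
  then obtain e f where e: "e > 0" "{- e..e} \<subseteq> \<Union>G \<or> {- e..e} \<inter> \<Union>G = {}"
   and f: "f > 0" "{- f..f} \<subseteq> I \<or> {- f..f} \<inter> I = {}" using nb[of I] by auto
  define S where "S = {- min e f..min e f}"
  have "S \<subseteq> {- e..e}" "S \<subseteq> {- f..f}" by (auto simp: S_def)
  hence "S \<subseteq> \<Union>G \<or> S \<inter> \<Union>G = {}" "S \<subseteq> I \<or> S \<inter> I = {}" using e(2) f(2) by blast+
  hence "S \<subseteq> \<Union>(insert I G) \<or> S \<inter> \<Union>(insert I G) = {}" unfolding Sup_insert by blast
  thus ?case using e(1) f(1) unfolding S_def by (intro exI[of _ "min e f"]) simp
 qed (auto intro: exI[of _ 1])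
 obtain e where e: "e > 0" "{- e..e} \<subseteq> \<Union>F \<or> {- e..e} \<inter> \<Union>F = {}" using un[OF F(1)] by blast
 have z: "(0::real) \<in> {- e..e}" using e by simp
 have "Some ` {- e..e} \<subseteq> \<Delta>"
 proof (cases "\<Delta> = Some ` \<Union>F")
  case True
  hence "0 \<in> \<Union>F" using D(2) by auto
  thus ?thesis using e(2) z True by blast
 next
  case False
  hence "\<Delta> = - (Some ` \<Union>F)" using F(3) by simp
  moreover from this have "0 \<notin> \<Union>F" using D(2) by auto
  ultimately show ?thesis using e(2) z by blast
 qed
 thus thesis using that e by blast
qed

text \<open>Applied to the constructed spectral function \<open>ES\<close>, the hypothesis leaves
  two cases. If 0 is regular, strong limits give boundedness by \<open>strong_limit_bound\<close>.
  If 0 is not critical, the form is semidefinite on the spectral subspace of a whole neighbourhood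
  of 0, and its bounded projection X dominates those of all smaller intervals on either
  side.\<close>

theorem not_singular_bounded:
 assumes "Some 0 \<notin> singular_critical_points form ip A"
 obtains l M where "0 < l" "0 <= M" "bounded_near_0 l M"
proof -
 define EE where "EE = (\<lambda>\<Delta>. lapp (ES \<Delta>))"
 have "\<not> critical_point form EE (Some 0) \<or> regular_at_zero ip EE"
  using assms ES_spectral unfolding singular_critical_points_def EE_def by blast
 thus thesis
 proof
  assume "regular_at_zero ip EE"
  then obtain l1 l2 where l: "l1 < 0" "0 < l2"
   and lim: "strong_limit_exists ip (\<lambda>t. EE (Some ` {l1..t})) (at_left 0)"
    "strong_limit_exists ip (\<lambda>t. EE (Some ` {t..l2})) (at_right 0)"
   unfolding regular_at_zero_def by blast
  have lim1: "strong_limit_exists ip (\<lambda>t. lapp (- (J * E l1 (- t)))) (at_right 0)"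
   unfolding strong_limit_exists_def
  proof
   fix x
   obtain y where "((\<lambda>t. nrm (EE (Some ` {l1..t}) x - y)) \<longlongrightarrow> 0) (at_left 0)"
    using lim(1) unfolding strong_limit_exists_def by blast
   hence "((\<lambda>t. nrm (EE (Some ` {l1..- t}) x - y)) \<longlongrightarrow> 0) (at_right 0)"
    unfolding filterlim_at_left_to_right by simp
   moreover have "\<forall>\<^sub>F t in at_right 0. nrm (EE (Some ` {l1..- t}) x - y) = nrm (lapp (- (J * E l1 (- t))) x - (- J y))"
    using eventually_at_right_less
   proof eventually_elim
    case (elim t)
    have "EE (Some ` {l1..- t}) = lapp (E l1 (- t))" unfolding EE_def using elim l by (subst ES_interval) auto
    moreover have "lapp (- (J * E l1 (- t))) x - (- J y) = - J (E l1 (- t) x - y)" by simp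
    ultimately show ?case by (metis UNIV_I nrm_J nrm_minus)
   qed
   ultimately have "((\<lambda>t. nrm (lapp (- (J * E l1 (- t))) x - (- J y))) \<longlongrightarrow> 0) (at_right 0)"
    using tendsto_cong by force
   thus "\<exists>y. ((\<lambda>t. nrm (lapp (- (J * E l1 (- t))) x - y)) \<longlongrightarrow> 0) (at_right 0)" by blast
  qed
  have lim2: "strong_limit_exists ip (\<lambda>t. lapp (J * E t l2)) (at_right 0)"
   unfolding strong_limit_exists_def
  proof
   fix x
   obtain y where "((\<lambda>t. nrm (EE (Some ` {t..l2}) x - y)) \<longlongrightarrow> 0) (at_right 0)"
    using lim(2) unfolding strong_limit_exists_def by blast
   moreover have "\<forall>\<^sub>F t in at_right 0. nrm (EE (Some ` {t..l2}) x - y) = nrm (lapp (J * E t l2) x - J y)"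
    using eventually_at_right_less
   proof eventually_elim
    case (elim t)
    have "EE (Some ` {t..l2}) = lapp (E t l2)" unfolding EE_def using elim l by (subst ES_interval) auto
    moreover have "lapp (J * E t l2) x - J y = J (E t l2 x - y)" by simp
    ultimately show ?case by (metis nrm_J)
   qed
   ultimately have "((\<lambda>t. nrm (lapp (J * E t l2) x - J y)) \<longlongrightarrow> 0) (at_right 0)"
    using tendsto_cong by force
   thus "\<exists>y. ((\<lambda>t. nrm (lapp (J * E t l2) x - y)) \<longlongrightarrow> 0) (at_right 0)" by blast
  qed
  define l where "l = min l2 (- l1)"
  have ll: "0 < l" "l <= l2" "l <= - l1" using l by (auto simp: l_def)
  obtain M2 where M2: "0 <= M2" "!!t x. 0 < t ==> t < l ==> Re (ip ((J * E t l2) x) x) <= M2 * (nrm x)\<^sup>2"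
  proof (rule strong_limit_bound[OF lim2 _ _ _ ll(1)])
   show "pos (J * E t l2)" if "0 < t" for t
    using E_nonneg[of t l2] that ll liftsD(2)[OF E_lifts] by (simp add: pos_def)
   show "bnd (J * E t l2)" if "0 < t" for t using liftsD(1)[OF E_lifts, of t l2] that ll by simp
   show "Re (ip ((J * E t l2) x) x) <= Re (ip ((J * E s l2) x) x)" if "0 < s" "s <= t" "t < l" for s t x
    using E_mono_form(1)[of s t l2 l2 x] that ll by (simp add: form_ip)
  qed blast
  obtain M1 where M1: "0 <= M1" "!!t x. 0 < t ==> t < l ==> Re (ip (lapp (- (J * E l1 (- t))) x) x) <= M1 * (nrm x)\<^sup>2"
  proof (rule strong_limit_bound[OF lim1 _ _ _ ll(1)])
   show "pos (- (J * E l1 (- t)))" if "0 < t" for t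
    using E_nonpos[of l1 "- t"] that ll l liftsD(2)[OF E_lifts, of l1 "- t"] by (simp add: pos_def)
   show "bnd (- (J * E l1 (- t)))" if "0 < t" for t using liftsD(1)[OF E_lifts, of l1 "- t"] that ll l by simp
   show "Re (ip (lapp (- (J * E l1 (- t))) x) x) <= Re (ip (lapp (- (J * E l1 (- s))) x) x)"
    if "0 < s" "s <= t" "t < l" for s t x
    using E_mono_form(2)[of s t "- l1" "- l1" x] that ll by (simp add: form_ip)
  qed blast
  have "bounded_near_0 l (max M1 M2)"
   unfolding bounded_near_0_def
  proof (intro allI impI conjI)
   fix t x assume t: "0 < t" "t < l"
   have "Re (form (E t l x) x) <= Re (form (E t l2 x) x)" using E_mono_form(1)[of t t l l2 x] t ll by simp
   also have "... <= M2 * (nrm x)\<^sup>2" using M2(2)[OF t] by (simp add: form_ip)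
   also have "... <= max M1 M2 * (nrm x)\<^sup>2" by (intro mult_right_mono) auto
   finally show "Re (form (E t l x) x) <= max M1 M2 * (nrm x)\<^sup>2" .
   have "- Re (form (E (- l) (- t) x) x) <= - Re (form (E l1 (- t) x) x)"
    using E_mono_form(2)[of t t l "- l1" x] t ll by simp
   also have "... <= M1 * (nrm x)\<^sup>2" using M1(2)[OF t] by (simp add: form_ip)
   also have "... <= max M1 M2 * (nrm x)\<^sup>2" by (intro mult_right_mono) auto
   finally show "- Re (form (E (- l) (- t) x) x) <= max M1 M2 * (nrm x)\<^sup>2" .
  qed
  thus thesis using that[of l "max M1 M2"] ll M1 by auto
 next
  assume "\<not> critical_point form EE (Some 0)"
  then obtain \<Delta> where D: "\<Delta> \<in> interval_ring" "Some 0 \<in> \<Delta>" "\<not> indefinite_on form (range (EE \<Delta>))"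
   unfolding critical_point_def by blast
  define X where "X = ES \<Delta>"
  have r: "repr \<Delta> X" unfolding X_def by (rule ES[OF D(1)])
  obtain l where l: "l > 0" "Some ` {- l..l} \<subseteq> \<Delta>" using ring_nbhd[OF D(1,2)] by blast
  obtain s :: real where s: "s = 1 \<or> s = - 1" "!!x. 0 <= s * Re (form (X x) (X x))"
  proof (cases "\<exists>x\<in>range (EE \<Delta>). 0 < Re (form x x)")
   case True
   hence "\<forall>x\<in>range (EE \<Delta>). 0 <= Re (form x x)" using D(3) unfolding indefinite_on_def by (meson not_le)
   thus thesis using that[of 1] by (auto simp: EE_def X_def)
  next
   case False
   thus thesis using that[of "- 1"] by (force simp: EE_def X_def not_less)
  qed
  have XX: "X (X v) = X v" for v using repr_idem[OF r] by (metis lapp_mult)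
  have Xf: "form (X x) y = form x (X y)" for x y by (rule repr_form[OF r])
  have fX: "form (X x) x = form (X x) (X x)" for x using Xf[of "X x" x] XX by simp
  have "pos (of_real s *\<^sub>C (J * X))" "bnd (of_real s *\<^sub>C (J * X))"
   using ksym_of_form[OF Xf] s(2) fX repr_bnd[OF r] by (simp_all add: pos_def form_ip[symmetric])
  then obtain M where M: "0 <= M" "!!x. Re (ip ((of_real s *\<^sub>C (J * X)) x) x) <= M * (nrm x)\<^sup>2"
   using pos_upper by blast
  have XM: "s * Re (form (X x) x) <= M * (nrm x)\<^sup>2" for x using M(2)[of x] by (simp add: form_ip)
  have sub: "0 <= s * Re (form (E a b x) x)" "s * Re (form (E a b x) x) <= M * (nrm x)\<^sup>2"
   if ab: "a ~= 0" "b ~= 0" "{a..b} \<subseteq> {- l..l}" for a b x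
  proof -
   have re: "repr (Some ` {a..b}) (E a b)" by (rule repr.base) (use ab in \<open>auto simp: iv_def\<close>)
   have "Some ` {a..b} = Some ` {a..b} \<inter> \<Delta>" using ab l by blast
   hence "repr (Some ` {a..b}) (E a b * X)" using repr.inter[OF re r] by metis
   hence e: "E a b * X = E a b" using repr_unique re by blast
   have e': "X (E a b v) = E a b v" "E a b (X v) = E a b v" for v
    using e repr_repr_commute[OF re r] by (metis lapp_mult)+
   have EE: "E a b (E a b v) = E a b v" for v using repr_idem[OF re] by (metis lapp_mult)
   have "form (E a b x) x = form (X (E a b x)) (X (E a b x))"
    using E_form[OF ab(1,2), of "E a b x" x] EE e' by simp
   thus "0 <= s * Re (form (E a b x) x)" using s(2) by simp
   \<comment> \<open>The difference of X and E a b maps into ran(X), where s times the form is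
     nonnegative; so the form of E a b is at most that of X.\<close>
   define v where "v = X x - E a b x"
   have "form v v = form (X x) (X x) - form (X x) (E a b x) - form (E a b x) (X x) + form (E a b x) (E a b x)"
    by (simp add: v_def form_diff)
   also have "form (X x) (E a b x) = form x (E a b x)" using Xf[of x "E a b x"] e' by simp
   also have "form x (E a b x) = form (E a b x) x" using E_form[OF ab(1,2)] by simp
   also have "form (E a b x) (X x) = form (E a b x) x" using Xf[of "E a b x" x] e' by simp
   also have "form (E a b x) (E a b x) = form (E a b x) x" using E_form[OF ab(1,2), of "E a b x" x] EE by simp
   finally have "form v v = form (X x) x - form (E a b x) x" using fX[of x] by simp
   moreover have "X v = v" by (simp add: v_def XX e')
   ultimately have "0 <= s * (Re (form (X x) x) - Re (form (E a b x) x))" using s(2)[of v] by simp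
   thus "s * Re (form (E a b x) x) <= M * (nrm x)\<^sup>2" using XM[of x] by (simp add: right_diff_distrib)
  qed
  have "bounded_near_0 l M"
   unfolding bounded_near_0_def
  proof (intro allI impI conjI)
   fix t x assume t: "0 < t" "t < l"
   have p: "0 <= Re (form (E t l x) x)" using E_nonneg[of t l x] t by (simp add: form_ip)
   have n: "Re (form (E (- l) (- t) x) x) <= 0" using E_nonpos[of "- l" "- t" x] t by (simp add: form_ip)
   have M0: "0 <= M * (nrm x)\<^sup>2" using M by simp
   have "{t..l} \<subseteq> {- l..l}" "{- l..- t} \<subseteq> {- l..l}" using t by auto
   note S = sub[OF _ _ this(1), of x] sub[OF _ _ this(2), of x]
   show "Re (form (E t l x) x) <= M * (nrm x)\<^sup>2" using S p t s(1) M0 by auto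
   show "- Re (form (E (- l) (- t) x) x) <= M * (nrm x)\<^sup>2" using S n t s(1) M0 by auto
  qed
  thus thesis using that l M by blast
 qed
qed

end

section \<open>A criterion for regularity at zero\<close>

text \<open>The set of m \<le> a for which m p \<le> k holds is closed, and by \<open>step\<close>
  its supremum cannot lie below a. In this way information on resolvent sets becomes an inequality
  between forms, with no functional calculus for the projection at hand.\<close>

lemma threshold:
 fixes p k :: "'b => real"
 assumes k: "!!x. 0 <= k x"
  and step: "!!m. 0 <= m ==> m < a ==> (!!x. m * p x <= k x) ==> \<exists>\<epsilon>>0. \<forall>x. (m + \<epsilon>) * p x <= k x"
  and p: "!!x. 0 <= p x"
 shows "a * p x <= k x"
proof (cases "0 <= a")
 case True
 define S where "S = {m. 0 <= m \<and> m <= a \<and> (\<forall>x. m * p x <= k x)}"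
 have S0: "0 \<in> S" using k True by (simp add: S_def)
 have bdd: "bdd_above S" by (rule bdd_aboveI[of _ a]) (simp add: S_def)
 define m where "m = Sup S"
 have "m <= a" unfolding m_def by (rule cSup_least) (use S0 in \<open>auto simp: S_def\<close>)
 hence m: "0 <= m" "m <= a" using cSup_upper[OF S0 bdd] by (simp_all add: m_def)
 have mS: "m * p x <= k x" for x
 proof (cases "p x = 0")
  case False
  hence px: "0 < p x" using p[of x] by simp
  have "m <= k x / p x" unfolding m_def
   by (rule cSup_least) (use S0 px in \<open>auto simp: S_def field_simps\<close>)
  thus ?thesis using px by (simp add: field_simps)
 qed (use k in simp)
 have "m = a"
 proof (rule ccontr)
  assume "m ~= a"
  hence "m < a" using m by simp
  then obtain \<epsilon> where e: "\<epsilon> > 0" "!!x. (m + \<epsilon>) * p x <= k x" using step[OF m(1) _ mS] by blast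
  define n where "n = min (m + \<epsilon>) a"
  have "n * p x <= k x" for x
   using e(2)[of x] mult_right_mono[of n "m + \<epsilon>" "p x"] p[of x] by (simp add: n_def)
  hence "n \<in> S" using e m True by (simp add: S_def n_def)
  hence "n <= m" unfolding m_def by (rule cSup_upper[OF _ bdd])
  thus False using e \<open>m < a\<close> by (simp add: n_def min_def split: if_splits)
 qed
 thus ?thesis using mS by simp
next
 case False
 have "a * p x <= 0 * p x" using False p[of x] by (intro mult_right_mono) auto
 thus ?thesis using k[of x] by simp
qed

text \<open>The principle of \<open>slim_mono\<close> for a continuous parameter tending to 0: a
  bounded monotone p controls the increments of f, so f satisfies the Cauchy condition.\<close>

lemma (in hilbert_ops) monotone_limit:
 fixes f :: "real => 'a" and p :: "real => real"
 assumes f: "!!s t. 0 < s ==> s <= t ==> t < l ==> (nrm (f s - f t))\<^sup>2 <= C * (p s - p t)"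
  and p: "!!s t. 0 < s ==> s <= t ==> t < l ==> p t <= p s" "!!t. 0 < t ==> t < l ==> p t <= B"
  and C: "0 < C" and l: "0 < l"
 shows "\<exists>y. ((\<lambda>t. nrm (f t - y)) \<longlongrightarrow> 0) (at_right 0)"
proof -
 define P where "P = Sup (p ` {0<..<l})"
 have bdd: "bdd_above (p ` {0<..<l})" using p(2) by (intro bdd_aboveI[of _ B]) auto
 have pP: "p t <= P" if "0 < t" "t < l" for t unfolding P_def using that bdd by (auto intro: cSup_upper)
 have near: "\<exists>d. 0 < d \<and> d < l \<and> (\<forall>t. 0 < t --> t <= d --> P - p t < e)" if e: "0 < e" for e
 proof -
  have "p ` {0<..<l} ~= {}" using l by (auto intro: exI[of _ "l / 2"])
  hence "\<exists>z\<in>p ` {0<..<l}. P - e < z" using less_cSupD[of "p ` {0<..<l}" "P - e"] e by (auto simp: P_def)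
  then obtain d where d: "0 < d" "d < l" "P - e < p d" by auto
  have "P - p t < e" if "0 < t" "t <= d" for t using p(1)[OF that d(2)] d(3) by simp
  thus ?thesis using d by blast
 qed
 have fP: "(nrm (f s - f t))\<^sup>2 <= C * (P - p t)" if "0 < s" "s <= t" "t < l" for s t
 proof -
  have "C * (p s - p t) <= C * (P - p t)" using pP[of s] that C by (intro mult_left_mono) auto
  thus ?thesis using f[OF that] by linarith
 qed
 define t where "t n = l / (real n + 2)" for n :: nat
 have t: "0 < t n" "t n < l" for n using l mult_nonneg_nonneg[of l "real n"]
  by (auto simp: t_def field_simps intro: add_pos_nonneg)
 have tmono: "t m <= t n" if "n <= m" for m n using that l by (simp add: t_def divide_left_mono)
 have tsmall: "\<exists>N. \<forall>n\<ge>N. t n <= d" if d: "0 < d" for d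
 proof -
  obtain N :: nat where "l / d < real N" using reals_Archimedean2 by blast
  hence "t N <= d" using d l by (simp add: t_def field_simps)
  thus ?thesis using tmono order_trans by blast
 qed
 have "\<exists>N. \<forall>m\<ge>N. \<forall>n\<ge>N. nrm (f (t m) - f (t n)) < e" if e: "0 < e" for e
 proof -
  obtain d where d: "0 < d" "d < l" "!!t. 0 < t ==> t <= d ==> P - p t < e\<^sup>2 / C"
   using near[of "e\<^sup>2 / C"] e C by auto
  obtain N where N: "!!n. n \<ge> N ==> t n <= d" using tsmall[OF d(1)] by blast
  have 1: "nrm (f (t m) - f (t n)) < e" if "N <= n" "n <= m" for m n
  proof -
   have "(nrm (f (t m) - f (t n)))\<^sup>2 <= C * (P - p (t n))" using fP t tmono that by blast
   also have "... < e\<^sup>2" using d(3)[OF t(1) N[OF that(1)]] C by (simp add: field_simps)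
   finally show ?thesis using e power2_less_imp_less by fastforce
  qed
  have "nrm (f (t m) - f (t n)) < e" if "N <= n" "N <= m" for m n
   using 1[of n m] 1[of m n] that nrm_minus_commute[of "f (t m)" "f (t n)"] by (cases "n <= m") auto
  thus ?thesis by blast
 qed
 then obtain y where y: "(\<lambda>n. nrm (f (t n) - y)) \<longlonglongrightarrow> 0" using complete[of "\<lambda>n. f (t n)"] by blast
 have bound: "(nrm (f s - y))\<^sup>2 <= C * (P - p s)" if s: "0 < s" "s < l" for s
 proof -
  obtain N where N: "!!n. n \<ge> N ==> t n <= s" using tsmall[OF s(1)] by blast
  have "(\<lambda>n. nrm ((f (t n) - f s) - (y - f s))) \<longlonglongrightarrow> 0" using y by simp
  hence "(\<lambda>n. nrm (f (t n) - f s)) \<longlonglongrightarrow> nrm (y - f s)"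
   using nrm_tendsto[of "\<lambda>n. f (t n) - f s" "y - f s"] by simp
  hence "(\<lambda>n. (nrm (f (t n) - f s))\<^sup>2) \<longlonglongrightarrow> (nrm (y - f s))\<^sup>2" by (rule tendsto_power)
  moreover have "\<forall>n\<ge>N. (nrm (f (t n) - f s))\<^sup>2 <= C * (P - p s)" using fP N t s by blast
  ultimately have "(nrm (y - f s))\<^sup>2 <= C * (P - p s)" by (meson LIMSEQ_le_const2)
  thus ?thesis using nrm_minus_commute[of y "f s"] by simp
 qed
 have "((\<lambda>s. nrm (f s - y)) \<longlongrightarrow> 0) (at_right 0)"
 proof (rule tendstoI)
  fix e :: real assume e: "0 < e"
  obtain d where d: "0 < d" "d < l" "!!t. 0 < t ==> t <= d ==> P - p t < e\<^sup>2 / C"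
   using near[of "e\<^sup>2 / C"] e C by auto
  have "dist (nrm (f s - y)) 0 < e" if "0 < s" "s < d" for s
  proof -
   have "(nrm (f s - y))\<^sup>2 <= C * (P - p s)" using bound[of s] that d by simp
   also have "... < e\<^sup>2" using d(3)[of s] that C by (simp add: field_simps)
   finally have "nrm (f s - y) < e" using e power2_less_imp_less by fastforce
   thus ?thesis by simp
  qed
  thus "\<forall>\<^sub>F s in at_right 0. dist (nrm (f s - y)) 0 < e"
   unfolding eventually_at_right_field using d(1) by blast
 qed
 thus ?thesis by blast
qed

text \<open>For each \<open>\<tau>\<close> in \<open>(1, 2]\<close> the terms with F telescope along the points \<open>2^(-k-2) \<tau>\<close>; averaging over
 \<open>\<tau>\<close> turns the remaining terms into the integral of r.\<close>

lemma dyadic_sum_bound: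
 fixes p :: "nat => real" and F r :: "real => real"
 assumes F: "!!y. 0 < y ==> \<bar>F y\<bar> <= B"
  and r: "set_integrable lborel {0<..<1} r" "!!y. 0 < y ==> y < 1 ==> 0 <= r y" "(LINT y:{0<..<1}|lborel. r y) <= B"
  and p: "!!k y. (1/2)^(k+2) < y ==> y <= (1/2)^(k+1) ==>
   p k <= 6 * (1/2)^(k+2) * (C / y * (F y - F (2 * y)) + r y)"
  and C: "0 <= C"
 shows "(\<Sum>k<n. p k) <= 12 * C * B + 6 * B"
proof -
 define b where "b k = (1/2::real)^(k+1)" for k
 have b: "0 < b k" "b k < 1" "b k = 2 * b (Suc k)" for k
  using power_Suc_less_one[of "1/2::real" k] by (simp_all add: b_def)
 have b0: "b 0 = 1/2" by (simp add: b_def)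
 have sub: "{b n<..b 0} \<subseteq> {0<..<1}" for n using b(1)[of n] b(2)[of 0] by auto
 have int: "set_integrable lborel {b n<..b 0} r" for n
  by (rule set_integrable_subset[OF r(1) _ sub]) simp
 have ble: "b n <= b 0" for n
 proof (induction n)
  case (Suc n)
  thus ?case using b(3)[of n] b(1)[of "Suc n"] by linarith
 qed simp
 have blk: "{b (Suc n)<..b n} \<subseteq> {0<..<1}" for n using b(2)[of n] b(1)[of "Suc n"] by auto
 have intb: "set_integrable lborel {b (Suc n)<..b n} r" for n
  by (rule set_integrable_subset[OF r(1) _ blk]) simp
 have sc: "indicator {1<..2} \<tau> *\<^sub>R (b (Suc k) * r (b (Suc k) * \<tau>))
   = b (Suc k) *\<^sub>R (indicator {b (Suc k)<..b k} (0 + b (Suc k) * \<tau>) *\<^sub>R r (0 + b (Suc k) * \<tau>))" for k \<tau>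
 proof -
  have "\<tau> \<in> {1<..2} \<longleftrightarrow> b (Suc k) * \<tau> \<in> {b (Suc k)<..b k}"
   using b(1)[of "Suc k"] unfolding b(3)[of k] by (simp add: mult.commute[of 2])
  thus ?thesis by (simp add: indicator_def)
 qed
 have sint: "set_integrable lborel {1<..2} (\<lambda>\<tau>. b (Suc k) * r (b (Suc k) * \<tau>))" for k
 proof -
  have "integrable lborel (\<lambda>\<tau>. indicator {b (Suc k)<..b k} (0 + b (Suc k) * \<tau>) *\<^sub>R r (0 + b (Suc k) * \<tau>))"
   using intb[of k] b(1)[of "Suc k"] unfolding set_integrable_def
   by (subst lborel_integrable_real_affine_iff) auto
  thus ?thesis unfolding set_integrable_def sc by (rule integrable_scaleR_right)
 qed
 have sval: "(LINT \<tau>:{1<..2}|lborel. b (Suc k) * r (b (Suc k) * \<tau>)) = (LINT y:{b (Suc k)<..b k}|lborel. r y)" for k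
  unfolding set_lebesgue_integral_def sc
  using lborel_integral_real_affine[of "b (Suc k)" "\<lambda>y. indicator {b (Suc k)<..b k} y *\<^sub>R r y" 0] b(1)[of "Suc k"]
  by simp
 have tel: "(\<Sum>k<n. LINT y:{b (Suc k)<..b k}|lborel. r y) = (LINT y:{b n<..b 0}|lborel. r y)" for n
 proof (induction n)
  case (Suc n)
  have "{b (Suc n)<..b 0} = {b (Suc n)<..b n} \<union> {b n<..b 0}"
   using b(3)[of n] b(1)[of "Suc n"] ble[of n] by auto
  thus ?case using set_integral_Un[OF _ intb[of n] int[of n]] Suc by auto
 qed (simp add: set_lebesgue_integral_def)
 \<comment> \<open>What remains of the sum after the telescoping part has been removed. It does not
   depend on \<tau>, so it equals its own mean over (1, 2], an interval of length 1.\<close>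
 define c where "c = (\<Sum>k<n. p k) / 6 - 2 * C * B"
 have low: "c <= (\<Sum>k<n. b (Suc k) * r (b (Suc k) * \<tau>))" if t: "\<tau> \<in> {1<..2}" for \<tau>
 proof -
  have B: "0 <= B" using F[of 1] by simp
  define g where "g k = F (b k * \<tau>)" for k
  have "p k <= 6 * (C / \<tau> * (g (Suc k) - g k)) + 6 * (b (Suc k) * r (b (Suc k) * \<tau>))" for k
  proof -
   have "p k <= 6 * b (Suc k) * (C / (b (Suc k) * \<tau>) * (F (b (Suc k) * \<tau>) - F (2 * (b (Suc k) * \<tau>))) + r (b (Suc k) * \<tau>))"
   proof -
    have "b (Suc k) * 1 < b (Suc k) * \<tau>" "b (Suc k) * \<tau> <= b (Suc k) * 2"
     using t b(1)[of "Suc k"] by (simp_all only: mult_less_cancel_left_pos mult_le_cancel_left_pos) auto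
    thus ?thesis using p[of k "b (Suc k) * \<tau>"] b(3)[of k] by (simp add: b_def)
   qed
   also have "2 * (b (Suc k) * \<tau>) = b k * \<tau>" using b(3)[of k] by simp
   also have "6 * b (Suc k) * (C / (b (Suc k) * \<tau>) * (F (b (Suc k) * \<tau>) - F (b k * \<tau>)) + r (b (Suc k) * \<tau>))
     = 6 * (C / \<tau> * (g (Suc k) - g k)) + 6 * (b (Suc k) * r (b (Suc k) * \<tau>))"
    using b(1)[of "Suc k"] t by (simp add: g_def field_simps)
   finally show ?thesis .
  qed
  hence "(\<Sum>k<n. p k) <= (\<Sum>k<n. 6 * (C / \<tau> * (g (Suc k) - g k)) + 6 * (b (Suc k) * r (b (Suc k) * \<tau>)))"
   by (rule sum_mono)
  also have "... = 6 * (C / \<tau> * (g n - g 0)) + 6 * (\<Sum>k<n. b (Suc k) * r (b (Suc k) * \<tau>))"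
   unfolding sum.distrib sum_distrib_left[symmetric] sum_lessThan_telescope ..
  \<comment> \<open>Consecutive points 2^(-k-2) \<tau> and 2^(-k-1) \<tau> share a value of F, so
    only the first and last values survive, each at most B.\<close>
  also have "C / \<tau> * (g n - g 0) <= C * (2 * B)"
  proof (rule order_trans[OF mult_left_mono mult_right_mono])
   have "\<bar>g m\<bar> <= B" for m unfolding g_def using b(1)[of m] t by (intro F) simp
   from this[of n] this[of 0] show "g n - g 0 <= 2 * B" by linarith
   show "C / \<tau> <= C" using C t by (simp add: divide_le_eq mult_le_cancel_left1)
  qed (use C t B in auto)
  finally show ?thesis by (simp add: c_def)
 qed
 have "(LINT \<tau>:{1<..2::real}|lborel. c) <= (LINT \<tau>:{1<..2}|lborel. (\<Sum>k<n. b (Suc k) * r (b (Suc k) * \<tau>)))"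
 proof (rule set_integral_mono[OF _ _ low])
  have "integrable lborel (indicat_real {1<..2::real})" by (intro integrable_real_indicator) auto
  thus "set_integrable lborel {1<..2::real} (\<lambda>y. c)" by (simp add: set_integrable_def)
  show "set_integrable lborel {1<..2} (\<lambda>\<tau>. \<Sum>k<n. b (Suc k) * r (b (Suc k) * \<tau>))"
   using sint unfolding set_integrable_def by (simp only: scaleR_sum_right) (intro Bochner_Integration.integrable_sum)
 qed
 also have "... = (\<Sum>k<n. LINT \<tau>:{1<..2}|lborel. b (Suc k) * r (b (Suc k) * \<tau>))"
  using sint unfolding set_integrable_def set_lebesgue_integral_def
  by (simp only: scaleR_sum_right) (intro Bochner_Integration.integral_sum)
 also have "... = (LINT y:{b n<..b 0}|lborel. r y)" unfolding sval tel ..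
 also have "... <= (LINT y:{0<..<1}|lborel. r y)"
  unfolding set_lebesgue_integral_def
 proof (rule integral_mono)
  show "integrable lborel (\<lambda>y. indicator {b n<..b 0} y *\<^sub>R r y)" "integrable lborel (\<lambda>y. indicator {0<..<1} y *\<^sub>R r y)"
   using int[of n] r(1) by (simp_all add: set_integrable_def)
  show "indicator {b n<..b 0} y *\<^sub>R r y <= indicator {0<..<1} y *\<^sub>R r y" for y
   using sub[of n] r(2)[of y] by (auto simp: indicator_def)
 qed
 finally have "(LINT \<tau>:{1<..2::real}|lborel. c) <= B" using r(3) by linarith
 moreover have "(LINT \<tau>:{1<..2::real}|lborel. c) = c" by (simp add: set_lebesgue_integral_def)
 ultimately show ?thesis by (simp add: c_def)
qed

context nonneg_krein
begin

lemma R_A: assumes z: "Im z ~= 0" and f: "(f, f') \<in> A" shows "(R z f, R z f') \<in> A"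
proof -
 have "R z f' - z *\<^sub>C R z f = f" using R_unique[OF z f] by simp
 hence "R z f' = f + z *\<^sub>C R z f" by (simp add: algebra_simps)
 thus ?thesis using R_mem[OF z, of f] by simp
qed

text \<open>\<open>in_double_commutant\<close> tests commutation with the resolvent at every point
  of the resolvent set, real points included.\<close>

lemma R_resolvent:
 assumes z: "Im z ~= 0" and w: "w \<in> resolvent_set_in ip UNIV A"
 shows "R z (resolvent A w h) = resolvent A w (R z h)"
proof -
 have ex: "\<exists>!f. (f, h + w *\<^sub>C f) \<in> A" for h using w by (simp add: resolvent_set_in_def)
 have m: "(resolvent A w h, h + w *\<^sub>C resolvent A w h) \<in> A" for h
  unfolding resolvent_def by (rule theI') (rule ex)
 have "(R z (resolvent A w h), R z h + w *\<^sub>C R z (resolvent A w h)) \<in> A"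
  using R_A[OF z m[of h]] by simp
 thus ?thesis using ex[of "R z h"] m[of "R z h"] by blast
qed

lemma form_R: assumes z: "Re z = 0" "Im z ~= 0" shows "Re (form (R z x) x) = Re (form (x + z *\<^sub>C R z x) (R z x))"
proof -
 define u where "u = R z x"
 have "form (x + z *\<^sub>C u) u = form x u + z * form u u" by (simp add: form_add form_scale)
 moreover have "Re (form x u) = Re (form u x)" using form_herm[of x u] by simp
 ultimately show ?thesis using z by (simp add: u_def)
qed

text \<open>On the spectral side, s \<lambda> / (\<lambda>^2 + y^2) \<ge> 1 / (6 a) whenever s
  \<lambda> and y lie in [a, 2 a]. As X is known only through properties of a spectral projection,
  the bounds a p \<le> k \<le> 2 a p for the forms of X and A X are derived from the resolvent set
  by \<open>threshold\<close>, and the rest is algebra with u = R(iy) X x.\<close>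

lemma compression_bounds:
 assumes X: "bnd X" "X * X = X" "!!x y. form (lapp X x) y = form x (X y)" and s: "s = 1 \<or> s = - 1"
  and pos: "!!x. 0 <= s * Re (form (X x) x)"
  and comm: "!!z. Im z ~= 0 ==> R z * X = X * R z"
  and dom: "range X \<subseteq> Domain A"
  and bdd: "!!f f'. (f, f') \<in> A ==> f \<in> range X ==> nrm f' <= Cb * nrm f"
  and spec: "!!c. c < a \<or> 2 * a < c ==> of_real (s * c) \<in> resolvent_set_in ip (range X) (A \<inter> range X \<times> range X)"
  and a: "0 < a" and y: "a <= y" "y <= 2 * a"
 shows "s * Re (form (X x) x) <= 6 * a * Re (form (R (\<i> * of_real y) x) x)"
proof -
 have XX: "X (X x) = X x" for x using X(2) by (metis lapp_mult)
 have AX: "(X f, X f') \<in> A" if f: "(f, f') \<in> A" for f f'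
 proof -
  have "X f = R \<i> (X f' - \<i> *\<^sub>C X f)"
   using R_unique[OF _ f, of \<i>] comm[of \<i>] by (metis imaginary_unit.simps(2) lapp_mult lop_diff lop_scale one_neq_zero)
  thus ?thesis using R_mem[of \<i> "X f' - \<i> *\<^sub>C X f"] by simp
 qed
 \<comment> \<open>\<open>b x\<close> is A (X x); as \<open>Lop b\<close> it becomes the bounded
   operator B = A X.\<close>
 define b where "b x = (SOME f'. (X x, f') \<in> A)" for x
 have bA: "(X x, b x) \<in> A" for x
 proof -
  have "\<exists>f'. (X x, f') \<in> A" using dom by (auto simp: Domain_iff)
  thus ?thesis unfolding b_def by (rule someI_ex)
 qed
 have "lapp (Lop b) = b"
 proof (rule lapp_Lop)
  show "b (x + y) = b x + b y" for x y using A_add[OF bA[of x] bA[of y]] bA[of "x + y"] A_unique by simp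
  show "b (c *\<^sub>C x) = c *\<^sub>C b x" for c x using A_scale[OF bA[of x], of c] bA[of "c *\<^sub>C x"] A_unique by simp
 qed
 define B where "B = Lop b"
 have B: "(X x, B x) \<in> A" for x using bA \<open>lapp (Lop b) = b\<close> by (simp add: B_def)
 have XB: "X (B x) = B x" for x using AX[OF B[of x]] B[of x] A_unique by (simp add: XX)
 have BX: "B (X x) = B x" for x using B[of x] B[of "X x"] A_unique by (simp add: XX)
 obtain cX where cX: "cX > 0" "!!x. nrm (X x) <= cX * nrm x" using bndE[OF X(1)] by blast
 have Bb: "nrm (B x) <= Cb * nrm (X x)" for x using bdd[OF B[of x]] by simp
 have bndB: "bnd B"
 proof (rule bndI)
  fix x
  have "Cb * nrm (X x) <= \<bar>Cb\<bar> * nrm (X x)" by (intro mult_right_mono) auto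
  also have "... <= \<bar>Cb\<bar> * (cX * nrm x)" using cX(2)[of x] by (intro mult_left_mono) auto
  finally show "nrm (B x) <= (\<bar>Cb\<bar> * cX) * nrm x" using Bb[of x] by simp
 qed
 have Bf: "form (B x) y = form x (B y)" for x y
 proof -
  have "form (B x) y = form (B x) (X y)" using X(3)[of "B x" y] XB by simp
  also have "... = form (X x) (B y)" by (rule A_sym[OF B B])
  also have "... = form x (B y)" using X(3)[of x "B y"] XB by simp
  finally show ?thesis .
 qed
 define P K where "P = of_real s *\<^sub>C (J * X)" and "K = J * B"
 define p k where "p x = s * Re (form (X x) x)" and "k x = Re (form (B x) x)" for x
 have Pp: "pos P" using ksym_of_form[OF X(3)] pos by (simp add: P_def pos_def form_ip)
 have k0: "0 <= k x" for x
 proof -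
  have "form (B x) x = form (B x) (X x)" using X(3)[of "B x" x] XB by simp
  thus ?thesis using A_nonneg'(1)[OF B[of x]] by (simp add: k_def)
 qed
 have Kp: "pos K" using ksym_of_form[OF Bf] k0 by (simp add: K_def pos_def k_def form_ip)
 have p_eq: "Re (ip (P x) x) = p x" and k_eq: "Re (ip (K x) x) = k x" for x
  by (simp_all add: P_def K_def p_def k_def form_ip)
 have p0: "0 <= p x" for x using pos by (simp add: p_def)
 have pn: "p x <= (nrm (X x))\<^sup>2" for x
 proof -
  have "form (X x) x = form (X x) (X x)" using X(3)[of "X x" x] XX by simp
  thus ?thesis using form_le[of "X x" "X x"] abs_Re_le_cmod[of "form (X x) (X x)"] s
   by (auto simp: p_def power2_eq_square)
 qed
 have PK: "bnd P" "bnd K" using X(1) bndB by (simp_all add: P_def K_def)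
 text \<open>Unless \<open>m\<close> is a spectral value, a nonnegative \<open>\<plusminus>(K - m P)\<close> is bounded below by a multiple of \<open>P\<close>.\<close>
 have gap: "\<exists>\<epsilon>>0. \<forall>x. \<epsilon> * p x <= \<sigma> * (k x - m * p x)"
  if m: "m < a \<or> 2 * a < m" and sg: "\<sigma> = 1 \<or> \<sigma> = - 1" and nn: "!!x. 0 <= \<sigma> * (k x - m * p x)" for m \<sigma>
 proof -
  define Q where "Q = of_real \<sigma> *\<^sub>C (K - of_real m *\<^sub>C P)"
  have Qe: "Re (ip (Q x) x) = \<sigma> * (k x - m * p x)" for x by (simp add: Q_def p_eq k_eq)
  have "sym Q" unfolding Q_def using Pp Kp by (intro sym_scale sym_diff) auto
  hence Qp: "pos Q" using nn by (simp add: pos_def Qe)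
  obtain c where c: "c > 0" "!!x. nrm (Q x) <= c * nrm x" using bndE[of Q] PK by (auto simp: Q_def)
  have "of_real (s * m) \<in> resolvent_set_in ip (range X) (A \<inter> range X \<times> range X)" by (rule spec[OF m])
  then obtain C where C: "\<forall>(f, f')\<in>A \<inter> range X \<times> range X. nrm f <= C * nrm (f' - of_real (s * m) *\<^sub>C f)"
   unfolding resolvent_set_in_def by blast
  have Q: "nrm (Q x) = nrm (B x - of_real (s * m) *\<^sub>C X x)" for x
  proof -
   have "Q x = of_real \<sigma> *\<^sub>C J (B x - of_real (s * m) *\<^sub>C X x)"
    by (simp add: Q_def K_def P_def complex_vector.scale_right_diff_distrib mult_ac)
   hence "nrm (Q x) = cmod (of_real \<sigma>) * nrm (B x - of_real (s * m) *\<^sub>C X x)"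
    by (simp only: nrm_scale UNIV_I nrm_J)
   thus ?thesis using sg by auto
  qed
  have "nrm (X x) <= \<bar>C\<bar> * nrm (Q x)" for x
  proof -
   have "(X x, B x) \<in> A \<inter> range X \<times> range X" using B XB by (metis IntI SigmaI rangeI)
   hence "nrm (X x) <= C * nrm (Q x)" using C unfolding Q by blast
   also have "... <= \<bar>C\<bar> * nrm (Q x)" by (intro mult_right_mono) auto
   finally show ?thesis .
  qed
  hence "(nrm (X x))\<^sup>2 <= C\<^sup>2 * (nrm (Q x))\<^sup>2" for x
   using power_mono[of "nrm (X x)" "\<bar>C\<bar> * nrm (Q x)" 2] by (simp add: power_mult_distrib)
  hence px: "p x <= C\<^sup>2 * (nrm (Q x))\<^sup>2" for x using pn order_trans by blast
  have "p x <= (C\<^sup>2 * c + 1) * (\<sigma> * (k x - m * p x))" for x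
  proof -
   have "C\<^sup>2 * (nrm (Q x))\<^sup>2 <= C\<^sup>2 * (c * (\<sigma> * (k x - m * p x)))"
    using pos_bound[OF Qp c(2), of x] unfolding Qe by (intro mult_left_mono) auto
   thus ?thesis using px[of x] nn[of x] by (simp add: distrib_right mult.assoc)
  qed
  moreover have "0 < C\<^sup>2 * c + 1" using c by (intro add_nonneg_pos) auto
  ultimately show ?thesis by (intro exI[of _ "1 / (C\<^sup>2 * c + 1)"]) (simp add: field_simps)
 qed
 have low: "a * p x <= k x" for x
 proof (rule threshold[OF k0 _ p0])
  fix m assume m: "0 <= m" "m < a" "!!x. m * p x <= k x"
  then obtain \<epsilon> where e: "\<epsilon> > 0" "\<forall>x. \<epsilon> * p x <= 1 * (k x - m * p x)" using gap[of m 1] by auto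
  have "(m + \<epsilon>) * p x <= k x" for x using e(2)[rule_format, of x] by (simp add: distrib_right)
  thus "\<exists>\<epsilon>>0. \<forall>x. (m + \<epsilon>) * p x <= k x" using e(1) by blast
 qed
 \<comment> \<open>Some upper bound of k by a multiple of p, from boundedness of A on ran(X). It is
   the starting value that \<open>threshold\<close> lowers to 2 a.\<close>
 obtain M where M: "0 <= M" "!!x. k x <= M * p x"
 proof -
  obtain cP where cP: "cP > 0" "!!x. nrm (P x) <= cP * nrm x" using bndE[OF PK(1)] by blast
  have Pn: "nrm (P x) = nrm (X x)" for x using s by (auto simp: P_def nrm_scale)
  have "k x <= (\<bar>Cb\<bar> * cP) * p x" for x
  proof -
   have "form (B x) x = form (B x) (X x)" using X(3)[of "B x" x] XB by simp
   hence "k x <= nrm (B x) * nrm (X x)" using form_le[of "B x" "X x"] complex_Re_le_cmod[of "form (B x) (X x)"]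
    by (simp add: k_def)
   also have "... <= (\<bar>Cb\<bar> * nrm (X x)) * nrm (X x)"
   proof (intro mult_right_mono)
    have "Cb * nrm (X x) <= \<bar>Cb\<bar> * nrm (X x)" by (intro mult_right_mono) auto
    thus "nrm (B x) <= \<bar>Cb\<bar> * nrm (X x)" using Bb[of x] by linarith
   qed simp
   also have "... = \<bar>Cb\<bar> * (nrm (P x))\<^sup>2" by (simp add: Pn power2_eq_square)
   also have "... <= \<bar>Cb\<bar> * (cP * p x)" using pos_bound[OF Pp cP(2), of x] unfolding p_eq by (intro mult_left_mono) auto
   finally show ?thesis by simp
  qed
  thus thesis using that[of "\<bar>Cb\<bar> * cP"] cP by simp
 qed
 have up: "k x <= 2 * a * p x" for x
 proof -
  have "(M - 2 * a) * p x <= M * p x - k x"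
  proof (rule threshold[where k = "\<lambda>x. M * p x - k x", OF _ _ p0])
   show "0 <= M * p x - k x" for x using M(2)[of x] by simp
  next
   fix m assume m: "0 <= m" "m < M - 2 * a" "!!x. m * p x <= M * p x - k x"
   have "0 <= - 1 * (k x - (M - m) * p x)" for x using m(3)[of x] by (simp add: left_diff_distrib)
   then obtain \<epsilon> where e: "\<epsilon> > 0" "\<forall>x. \<epsilon> * p x <= - 1 * (k x - (M - m) * p x)" using gap[of "M - m" "- 1"] m by auto
   have "(m + \<epsilon>) * p x <= M * p x - k x" for x using e(2)[rule_format, of x] by (simp add: distrib_right left_diff_distrib)
   thus "\<exists>\<epsilon>>0. \<forall>x. (m + \<epsilon>) * p x <= M * p x - k x" using e(1) by blast
  qed
  thus ?thesis by (simp add: left_diff_distrib)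
 qed
 text \<open>Hence \<open>s [B u, B u] <= 2 a [B u, u]\<close>, by the Cauchy-Schwarz inequality for the form \<open>[B u, v]\<close>.\<close>
 have BB: "p (B u) <= 2 * a * k u" for u
 proof (cases "p (B u) = 0")
  case False
  have "Re (form (B u) (B u)) = Re (ip (K u) (B u))" by (simp add: K_def form_ip)
  moreover have "p (B u) = s * Re (form (B u) (B u))" by (simp add: p_def XB)
  ultimately have "(p (B u))\<^sup>2 <= (cmod (ip (K u) (B u)))\<^sup>2"
   using s abs_Re_le_cmod[of "ip (K u) (B u)"] p0[of "B u"] by (intro power_mono) auto
  also have "... <= k u * k (B u)" using pos_cs[OF Kp, of u "B u"] by (simp add: k_eq)
  also have "... <= k u * (2 * a * p (B u))" by (rule mult_left_mono[OF up k0])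
  finally have "p (B u) * p (B u) <= (2 * a * k u) * p (B u)" by (simp add: power2_eq_square mult_ac)
  moreover have "0 < p (B u)" using False p0[of "B u"] by simp
  ultimately show ?thesis by (simp add: mult_le_cancel_right)
 qed (use k0 a in simp)
 define z where "z = \<i> * complex_of_real y"
 have z: "Re z = 0" "Im z = y" "Im z ~= 0" using y a by (simp_all add: z_def)
 define u where "u = R z (X x)"
 define f where "f = R z x"
 have uf: "u = X f" using comm[OF z(3)] by (metis u_def f_def lapp_mult)
 have Xu: "X u = u" by (simp add: uf XX)
 have fA: "(f, x + z *\<^sub>C f) \<in> A" using R_mem[OF z(3)] by (simp add: f_def)
 have Bu: "B u = X x + z *\<^sub>C u" using AX[OF fA] B[of u] A_unique unfolding Xu by (simp add: uf)
 \<comment> \<open>X x is (A - z) u. As z is imaginary, the mixed terms cancel and p x = p (B u) +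
   y^2 p u.\<close>
 have "p x = p (B u - z *\<^sub>C u)"
 proof -
  have "p x = p (X x)" unfolding p_def using X(3)[of "X x" x] XX by simp
  thus ?thesis by (simp add: Bu)
 qed
 also have "... = p (B u) + y\<^sup>2 * p u"
 proof -
  have "form (B u) u = of_real (Re (form (B u) u))" using Bf[of u u] form_herm[of u "B u"]
   by (simp add: complex_eq_iff)
  moreover have "form u (B u) = form (B u) u" using Bf[of u u] by simp
  ultimately have c: "Re (cnj z * form (B u) u) = 0" "Re (z * form u (B u)) = 0" using z
   by (metis Re_complex_of_real complex_cnj_cnj cnj.simps(1) mult.commute mult_zero_right times_complex.simps(1) Im_complex_of_real diff_zero mult_zero_left)+
  have "Re (form (B u - z *\<^sub>C u) (B u - z *\<^sub>C u))
    = Re (form (B u) (B u)) - Re (cnj z * form (B u) u) - Re (z * form u (B u)) + Re (z * cnj z * form u u)"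
   by (simp add: form_diff form_scale right_diff_distrib mult.assoc mult.left_commute[of "cnj z" z] del: times_complex.simps)
  also have "z * cnj z = of_real (y\<^sup>2)" by (simp add: z_def power2_eq_square algebra_simps)
  finally have "Re (form (B u - z *\<^sub>C u) (B u - z *\<^sub>C u)) = Re (form (B u) (B u)) + y\<^sup>2 * Re (form u u)"
   unfolding c by simp
  thus ?thesis by (simp add: p_def XB Xu distrib_left mult_ac)
 qed
 \<comment> \<open>The first term is \<open>BB\<close>; the second uses y \<le> 2 a and a p u \<le>
   k u. Their sum is the origin of the constant 6.\<close>
 also have "... <= 2 * a * k u + 4 * a * k u"
 proof (rule add_mono[OF BB])
  have "y\<^sup>2 * p u <= (2 * a)\<^sup>2 * p u" using y a p0[of u] by (intro mult_right_mono power_mono) auto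
  also have "... = 4 * a * (a * p u)" by (simp add: power2_eq_square)
  also have "... <= 4 * a * k u" using low[of u] a by (intro mult_left_mono) auto
  finally show "y\<^sup>2 * p u <= 4 * a * k u" .
 qed
 also have "... = 6 * a * k u" by simp
 \<comment> \<open>u = X f and g = f - u are orthogonal for the nonnegative form [A f, f], so
   omitting g does not increase it.\<close>
 also have "k u <= Re (form (x + z *\<^sub>C f) f)"
 proof -
  define g where "g = f - u"
  have "(g, (x + z *\<^sub>C f) - B u) \<in> A" unfolding g_def using A_diff[OF fA B[of u]] by (simp add: Xu)
  from A_nonneg'(1)[OF this]
  have "0 <= Re (form (x + z *\<^sub>C f) f) - Re (form (x + z *\<^sub>C f) u) - Re (form (B u) f) + Re (form (B u) u)"
   by (simp add: g_def form_diff)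
  moreover have "form (x + z *\<^sub>C f) u = form (B u) u"
  proof -
   have "form (X (x + z *\<^sub>C f)) u = form (x + z *\<^sub>C f) u" using X(3)[of "x + z *\<^sub>C f" u] Xu by simp
   thus ?thesis by (simp add: Bu uf[symmetric])
  qed
  moreover have "form (B u) f = form (B u) u" using X(3)[of "B u" f] XB uf by simp
  ultimately show ?thesis by (simp add: k_def)
 qed
 also have "Re (form (x + z *\<^sub>C f) f) = Re (form (R z x) x)" using form_R[OF z(1,3), of x] by (simp add: f_def)
 finally show ?thesis using a by (simp add: p_def z_def)
qed

text \<open>For s = - 1 the interval is reflected at 0, so one argument with the form s [x, y]
  covers both sides of 0.\<close>

definition ray :: "real => real set => real set" where
 "ray s I = (*) s ` I"

lemma nonzero_ray:
 assumes I: "nonzero_bounded_interval I" and s: "s = 1 \<or> s = - 1"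
 shows "nonzero_bounded_interval (ray s I)"
proof -
 have m: "(*) (- 1::real) = uminus" "(*) (1::real) = id" by (simp_all add: fun_eq_iff)
 obtain a b where ab: "a ~= 0" "b ~= 0" "I = {a..b} \<or> I = {a..<b} \<or> I = {a<..b} \<or> I = {a<..<b}"
  using I unfolding nonzero_bounded_interval_def by blast
 hence "uminus ` I = {- b..- a} \<or> uminus ` I = {- b<..- a} \<or> uminus ` I = {- b..<- a} \<or> uminus ` I = {- b<..<- a}"
  by (elim disjE) simp_all
 hence "nonzero_bounded_interval (uminus ` I)"
  unfolding nonzero_bounded_interval_def using ab(1,2) by (intro exI[of _ "- b"] exI[of _ "- a"]) auto
 thus ?thesis using s I by (auto simp: ray_def m)
qed

lemma interval_in_ring: "nonzero_bounded_interval I ==> Some ` I \<in> interval_ring"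
 unfolding interval_ring_def by (auto intro!: exI[of _ "{I}"])

text \<open>\<open>Es\<close> is arbitrary, because every spectral function counts in the definition
  of c_s(A). \<open>compression_bounds\<close> estimates its dyadic blocks by the resolvent and
  \<open>dyadic_sum_bound\<close> adds them up, which bounds the projections of [t, 1/2] and of the
  reflected intervals. Being monotone in t, they converge strongly.\<close>

theorem regular_of_resolvent_bound:
 assumes S: "spectral_function form ip A Es" and C: "0 <= C"
  and bound: "!!x. \<exists>F r. (\<forall>y>0. \<bar>F y\<bar> <= C * (nrm x)\<^sup>2) \<and>
   set_integrable lborel {0<..<1} r \<and> (\<forall>y. 0 < y --> y < 1 --> 0 <= r y) \<and> (LINT y:{0<..<1}|lborel. r y) <= C * (nrm x)\<^sup>2 \<and>
   (\<forall>y. 0 < y --> y < 1 --> Re (form (R (\<i> * of_real y) x) x) <= C / y * (F y - F (2 * y)) + r y)"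
 shows "regular_at_zero ip Es"
proof -
 note S' = S[unfolded spectral_function_def]
 note SD = bspec[OF S'[THEN conjunct2, THEN conjunct2, THEN conjunct1] interval_in_ring]
 define X where "X I = Lop (Es (Some ` I))" for I
 have X: "lapp (X I) = Es (Some ` I)" if "nonzero_bounded_interval I" for I
 proof -
  have "clinear_on UNIV (Es (Some ` I))"
   using S' interval_in_ring[OF that] by (simp add: bounded_operator_def)
  thus ?thesis unfolding X_def by (intro lapp_Lop) (simp_all add: clinear_on_def)
 qed
 have Xb: "bnd (X I)" if "nonzero_bounded_interval I" for I
  using S' interval_in_ring[OF that] X[OF that] unfolding bounded_operator_def bnd_def by metis
 have Xf: "form (X I x) y = form x (X I y)" if "nonzero_bounded_interval I" for I x y
  using S' interval_in_ring[OF that] X[OF that] by metis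
 have XX: "X I * X I = X I" if I: "nonzero_bounded_interval I" for I
 proof (rule lop_eqI)
  have "Es (Some ` I \<inter> Some ` I) = Es (Some ` I) \<circ> Es (Some ` I)" using S' interval_in_ring[OF I] by metis
  thus "(X I * X I) x = X I x" for x by (simp add: X[OF I] fun_eq_iff)
 qed
 have Xun: "X K x = X I x + X I' x"
  if I: "nonzero_bounded_interval I" "nonzero_bounded_interval I'" "nonzero_bounded_interval K"
   "I \<inter> I' = {}" "K = I \<union> I'" for I I' K x
 proof -
  have "Some ` I \<inter> Some ` I' = {}" using I(4) by auto
  hence "Es (Some ` I \<union> Some ` I') = (\<lambda>x. Es (Some ` I) x + Es (Some ` I') x)"
   using S' interval_in_ring[OF I(1)] interval_in_ring[OF I(2)] by metis
  hence "Es (Some ` K) = (\<lambda>x. Es (Some ` I) x + Es (Some ` I') x)" unfolding I(5) image_Un .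
  thus ?thesis by (simp add: X I(1-3))
 qed
 have Xcomm: "R z * X I = X I * R z" if I: "nonzero_bounded_interval I" and z: "Im z ~= 0" for z I
 proof -
  have "in_double_commutant ip A (Es (Some ` I))" using S' interval_in_ring[OF I] by metis
  moreover have "bounded_operator ip (lapp (R z))"
   using R_bnd[OF z] by (simp add: bounded_operator_def clinear_on_def bnd_def)
  moreover have "\<forall>w\<in>resolvent_set_in ip UNIV A. lapp (R z) \<circ> resolvent A w = resolvent A w \<circ> lapp (R z)"
   using R_resolvent[OF z] by (auto simp: fun_eq_iff)
  ultimately have "lapp (R z) \<circ> Es (Some ` I) = Es (Some ` I) \<circ> lapp (R z)"
   unfolding in_double_commutant_def by blast
  thus ?thesis by (intro lop_eqI) (simp add: X[OF I] fun_eq_iff)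
 qed
 have nzi: "nonzero_bounded_interval (ray s {u<..v})" "nonzero_bounded_interval (ray s {u..v})"
  "nonzero_bounded_interval (ray s {u..<v})" "nonzero_bounded_interval (ray s {u<..<v})"
  if "0 < u" "0 < v" "s = 1 \<or> s = - 1" for u v s
  by (rule nonzero_ray; use that in \<open>auto simp: nonzero_bounded_interval_def intro: exI[of _ u] exI[of _ v]\<close>)+
 have rayU: "X (ray s K) x = X (ray s I) x + X (ray s I') x"
  if I: "nonzero_bounded_interval (ray s I)" "nonzero_bounded_interval (ray s I')" "nonzero_bounded_interval (ray s K)"
   "I \<inter> I' = {}" "K = I \<union> I'" and s: "s = 1 \<or> s = - 1" for s I I' K x
 proof (rule Xun[OF I(1-3)])
  have "inj ((*) s)" using s by (auto intro: injI)
  thus "ray s I \<inter> ray s I' = {}" unfolding ray_def using I(4) by (metis image_Int image_empty)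
  show "ray s K = ray s I \<union> ray s I'" by (simp add: ray_def I(5) image_Un)
 qed
 have rp: "0 <= s * Re (form (X (ray s I) x) x)"
  if n: "nonzero_bounded_interval (ray s I)" and I: "I \<subseteq> {0<..}" and s: "s = 1 \<or> s = - 1" for s I x
 proof -
  have D: "Some ` ray s I \<in> interval_ring" using interval_in_ring[OF n] .
  have H: "hilbert_on (range (X (ray s I))) (\<lambda>x y. of_real s * form x y)"
   using s
  proof
   assume s1: "s = 1"
   hence "Some ` ray s I \<subseteq> Some ` {0<..}" using I by (auto simp: ray_def)
   hence "hilbert_on (range (Es (Some ` ray s I))) form" using S' D by blast
   thus ?thesis unfolding X[OF n] using s1 by simp
  next
   assume s1: "s = - 1"
   hence "Some ` ray s I \<subseteq> Some ` {..<0}" using I by (auto simp: ray_def)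
   hence "hilbert_on (range (Es (Some ` ray s I))) (\<lambda>x y. - form x y)" using S' D by blast
   thus ?thesis unfolding X[OF n] using s1 by simp
  qed
  interpret h: hilbert_space "range (X (ray s I))" "\<lambda>x y. of_real s * form x y"
   by standard (rule H)
  define e where "e = X (ray s I) x"
  have "0 <= Re (of_real s * form e e)" by (rule h.semidef) (simp add: e_def)
  moreover have "form e e = form e x"
   using Xf[OF n, of e x] XX[OF n] by (metis e_def lapp_mult)
  ultimately show ?thesis by (simp add: e_def)
 qed
 have blk: "s * Re (form (X (ray s {a<..2 * a}) x) x) <= 6 * a * Re (form (R (\<i> * of_real y) x) x)"
  if s: "s = 1 \<or> s = - 1" and a: "0 < a" and y: "a <= y" "y <= 2 * a" for s a y x
 proof -
  define I where "I = ray s {a<..2 * a}"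
  have n: "nonzero_bounded_interval I" using nzi(1)[of a "2 * a" s] a s by (simp add: I_def)
  have D: "Some ` I \<in> interval_ring" "None \<notin> Some ` I" using interval_in_ring[OF n] by auto
  obtain Cb where Cb: "\<forall>(f, f')\<in>A. f \<in> range (Es (Some ` I)) --> nrm f' <= Cb * nrm f"
   using SD[OF n] D(2) by blast
  have sp: "spectrum_in ip (range (X I)) (A \<inter> range (X I) \<times> range (X I)) \<subseteq> of_real ` closure I"
  proof -
   have "{t. Some t \<in> Some ` I} = I" by auto
   thus ?thesis using SD[OF n] unfolding X[OF n] by simp
  qed
  have cl: "closure I \<subseteq> {c. a <= s * c \<and> s * c <= 2 * a}"
   by (rule closure_minimal) (use s a in \<open>auto simp: I_def ray_def intro!: closed_Collect_conj closed_Collect_le continuous_intros\<close>)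
  show ?thesis unfolding I_def[symmetric]
  proof (rule compression_bounds[OF Xb[OF n] XX[OF n] Xf[OF n] s _ Xcomm[OF n] _ _ _ a y])
   show "0 <= s * Re (form (X I x) x)" for x
    unfolding I_def by (rule rp[OF n[unfolded I_def] _ s]) (use a in auto)
   show "range (X I) \<subseteq> Domain A" using SD[OF n] D(2) unfolding X[OF n] by blast
   show "nrm f' <= Cb * nrm f" if "(f, f') \<in> A" "f \<in> range (X I)" for f f' using Cb that unfolding X[OF n] by blast
   fix c assume c: "c < a \<or> 2 * a < c"
   have "s * c \<notin> closure I"
   proof
    assume "s * c \<in> closure I"
    hence "a <= s * (s * c) \<and> s * (s * c) <= 2 * a" using cl by blast
    thus False using c s by auto
   qed
   hence "of_real (s * c) \<notin> complex_of_real ` closure I" by (auto simp del: of_real_mult)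
   thus "of_real (s * c) \<in> resolvent_set_in ip (range (X I)) (A \<inter> range (X I) \<times> range (X I))"
    using sp unfolding spectrum_in_def by blast
  qed
 qed
 \<comment> \<open>The constant of \<open>dyadic_sum_bound\<close> with C |x|^2 as the bound for F
   and for the integral; the summand 1 makes B positive when C = 0.\<close>
 define B where "B = 12 * C * C + 6 * C + 1"
 have B0: "0 < B" using C by (simp add: B_def add_nonneg_pos)
 have bdd: "s * Re (form (X (ray s {t..1/2}) x) x) <= B * (nrm x)\<^sup>2"
  if s: "s = 1 \<or> s = - 1" and t: "0 < t" "t < 1/2" for s t x
 proof -
  obtain F r where F: "!!y. 0 < y ==> \<bar>F y\<bar> <= C * (nrm x)\<^sup>2"
   and r: "set_integrable lborel {0<..<1} r" "!!y. 0 < y ==> y < 1 ==> 0 <= r y" "(LINT y:{0<..<1}|lborel. r y) <= C * (nrm x)\<^sup>2"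
   and Fr: "!!y. 0 < y ==> y < 1 ==> Re (form (R (\<i> * of_real y) x) x) <= C / y * (F y - F (2 * y)) + r y"
   using bound[of x] by blast
  define b where "b k = (1/2::real)^(k+1)" for k
  have b: "0 < b k" "b k = 2 * b (Suc k)" "b k < 1" for k
   using power_Suc_less_one[of "1/2::real" k] by (simp_all add: b_def)
  have b': "b (Suc k) < b k" for k using b(1)[of "Suc k"] b(2)[of k] by linarith
  define p where "p k = s * Re (form (X (ray s {b (Suc k)<..b k}) x) x)" for k
  have "p k <= 6 * (1/2)^(k+2) * (C / y * (F y - F (2 * y)) + r y)"
   if y: "(1/2::real)^(k+2) < y" "y <= (1/2)^(k+1)" for k y
  proof -
   define a where "a = (1/2::real)^(k+2)"
   have a: "0 < a" "b (Suc k) = a" "b k = 2 * a" "(1/2)^(k+1) = 2 * a" by (simp_all add: a_def b_def)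
   have y': "a <= y" "y <= 2 * a" "y < 1" using y b(3)[of k] unfolding a a_def[symmetric] by simp_all
   have "p k <= 6 * a * Re (form (R (\<i> * of_real y) x) x)" unfolding p_def a by (rule blk[OF s a(1) y'(1,2)])
   also have "... <= 6 * a * (C / y * (F y - F (2 * y)) + r y)"
    using Fr[OF _ y'(3)] a(1) y' by (intro mult_left_mono) auto
   finally show ?thesis unfolding a_def .
  qed
  from dyadic_sum_bound[OF F r this C]
  have sum: "(\<Sum>k<n. p k) <= 12 * C * (C * (nrm x)\<^sup>2) + 6 * (C * (nrm x)\<^sup>2)" for n .
  \<comment> \<open>As b 0 = 1/2, the first n + 1 dyadic blocks fill (b (n + 1), 1/2].\<close>
  have tel: "b (Suc n) < 1/2 \<and> (\<Sum>k<Suc n. p k) = s * Re (form (X (ray s {b (Suc n)<..1/2}) x) x)" for n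
  proof (induction n)
   case (Suc n)
   have l: "b (Suc n) < 1/2" "b (Suc (Suc n)) < 1/2" using Suc b'[of "Suc n"] by auto
   have "X (ray s {b (Suc (Suc n))<..1/2}) x = X (ray s {b (Suc (Suc n))<..b (Suc n)}) x + X (ray s {b (Suc n)<..1/2}) x"
    by (rule rayU) (use nzi[OF _ _ s] b(1)[of "Suc n"] b(1)[of "Suc (Suc n)"] b'[of "Suc n"] l s in auto)
   thus ?case using Suc l by (simp add: p_def form_add distrib_left)
  qed (simp add: p_def b_def)
  obtain n where n: "b (Suc n) < t"
  proof -
   obtain n where "(1/2::real)^n < t" using real_arch_pow_inv[OF t(1), of "1/2"] by auto
   thus thesis using that[of n] t by (simp add: b_def)
  qed
  have "X (ray s {b (Suc n)<..1/2}) x = X (ray s {b (Suc n)<..<t}) x + X (ray s {t..1/2}) x"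
   by (rule rayU) (use nzi[OF _ _ s] b(1)[of "Suc n"] n t s in auto)
  moreover have "0 <= s * Re (form (X (ray s {b (Suc n)<..<t}) x) x)"
   by (rule rp) (use nzi[OF _ _ s] b(1)[of "Suc n"] t s in auto)
  ultimately have "s * Re (form (X (ray s {t..1/2}) x) x) <= (\<Sum>k<Suc n. p k)"
   using tel[of n] by (simp add: form_add distrib_left)
  also note sum[of "Suc n"]
  also have "12 * C * (C * (nrm x)\<^sup>2) + 6 * (C * (nrm x)\<^sup>2) <= B * (nrm x)\<^sup>2" by (simp add: B_def distrib_right)
  finally show ?thesis .
 qed
 have lim: "\<exists>y. ((\<lambda>t. nrm (X (ray s {t..1/2}) x - y)) \<longlongrightarrow> 0) (at_right 0)" if s: "s = 1 \<or> s = - 1" for s x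
 proof -
  define p where "p t x = s * Re (form (X (ray s {t..1/2}) x) x)" for t x
  have d: "X (ray s {u..1/2}) x = X (ray s {u..<v}) x + X (ray s {v..1/2}) x" if uv: "0 < u" "u <= v" "v < 1/2" for u v x
   by (rule rayU) (use nzi[OF _ _ s] uv s in auto)
  have pd: "s * Re (form (X (ray s {u..<v}) x) x) = p u x - p v x" if uv: "0 < u" "u <= v" "v < 1/2" for u v x
   unfolding p_def d[OF uv] by (simp add: form_add distrib_left)
  have n: "nonzero_bounded_interval (ray s {u..<v})" if "0 < u" "u <= v" for u v using nzi(3)[OF _ _ s] that by simp
  have rp': "0 <= s * Re (form (X (ray s {u..<v}) x) x)" if "0 < u" "u <= v" for u v x
   by (rule rp[OF n _ s]) (use that in auto)
  have p0: "0 <= p t x" if "0 < t" "t < 1/2" for t x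
   unfolding p_def by (rule rp[OF _ _ s]) (use nzi[OF _ _ s] that in auto)
  show ?thesis
  proof (rule monotone_limit[of "1/2" _ B "\<lambda>t. p t x"])
   show "(nrm (X (ray s {u..1/2}) x - X (ray s {v..1/2}) x))\<^sup>2 <= B * (p u x - p v x)"
    if uv: "0 < u" "u <= v" "v < 1/2" for u v
   proof -
    note n = n[OF uv(1,2)]
    \<comment> \<open>The form of the projection of [u, v) is bounded by B, so
      \<open>pos_bound\<close> estimates the squared increment of the vectors by the increment of
      p.\<close>
    define P where "P = of_real s *\<^sub>C (J * X (ray s {u..<v}))"
    have Pe: "Re (ip (P w) w) = s * Re (form (X (ray s {u..<v}) w) w)" for w by (simp add: P_def form_ip)
    have Pp: "pos P" using ksym_of_form[OF Xf[OF n]] rp'[OF uv(1,2)] by (simp add: P_def pos_def form_ip)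
    have "Re (ip (P w) w) <= B * (nrm w)\<^sup>2" for w
     unfolding Pe pd[OF uv] using bdd[OF s, of u w] p0[of v w] uv by (simp add: p_def)
    hence "nrm (P w) <= B * nrm w" for w using pos_form_bound[OF Pp] B0 by simp
    hence "(nrm (P x))\<^sup>2 <= B * Re (ip (P x) x)" by (rule pos_bound[OF Pp])
    moreover have "nrm (P x) = nrm (X (ray s {u..<v}) x)" using s by (auto simp: P_def nrm_scale)
    ultimately show ?thesis unfolding Pe pd[OF uv] d[OF uv] by simp
   qed
   show "p v x <= p u x" if uv: "0 < u" "u <= v" "v < 1/2" for u v
    using pd[OF uv, of x] rp'[OF uv(1,2), of x] by simp
   show "p t x <= B * (nrm x)\<^sup>2" if "0 < t" "t < 1/2" for t using bdd[OF s that] by (simp add: p_def)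
  qed (use B0 in auto)
 qed
 have r1: "ray 1 {t..1/2} = {t..1/2}" "ray (- 1) {t..1/2} = {- 1/2..- t}" for t
  by (auto simp: ray_def image_iff intro: bexI[of _ "- _"])
 show ?thesis unfolding regular_at_zero_def strong_limit_exists_def
 proof (rule exI[of _ "- 1/2"], rule exI[of _ "1/2"], intro conjI allI)
  fix x
  obtain y where y: "((\<lambda>t. nrm (X (ray (- 1) {t..1/2}) x - y)) \<longlongrightarrow> 0) (at_right 0)" using lim[of "- 1" x] by blast
  have "\<forall>\<^sub>F t in at_right 0. nrm (X (ray (- 1) {t..1/2}) x - y) = nrm (Es (Some ` {- 1/2..- t}) x - y)"
   using eventually_at_right_less
  proof eventually_elim
   case (elim t)
   show ?case using X[OF nzi(2)[of t "1/2" "- 1"]] elim by (simp add: r1)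
  qed
  hence "((\<lambda>t. nrm (Es (Some ` {- 1/2..- t}) x - y)) \<longlongrightarrow> 0) (at_right 0)" using y tendsto_cong by force
  thus "\<exists>y. ((\<lambda>t. nrm (Es (Some ` {- 1/2..t}) x - y)) \<longlongrightarrow> 0) (at_left 0)"
   unfolding filterlim_at_left_to_right by auto
  obtain y where y: "((\<lambda>t. nrm (X (ray 1 {t..1/2}) x - y)) \<longlongrightarrow> 0) (at_right 0)" using lim[of 1 x] by blast
  have "\<forall>\<^sub>F t in at_right 0. nrm (X (ray 1 {t..1/2}) x - y) = nrm (Es (Some ` {t..1/2}) x - y)"
   using eventually_at_right_less
  proof eventually_elim
   case (elim t)
   show ?case using X[OF nzi(2)[of t "1/2" 1]] elim by (simp add: r1)
  qed
  hence "((\<lambda>t. nrm (Es (Some ` {t..1/2}) x - y)) \<longlongrightarrow> 0) (at_right 0)" using y tendsto_cong by force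
  thus "\<exists>y. ((\<lambda>t. nrm (Es (Some ` {t..1/2}) x - y)) \<longlongrightarrow> 0) (at_right 0)" by blast
 qed auto
qed

end

section \<open>Self-adjoint operators and boundary triples in a Hilbert space\<close>

lemma op_unique: "operator_in H T ==> (f, g) \<in> T ==> (f, h) \<in> T ==> g = h"
 by (auto simp: operator_in_def single_valued_def)

lemma op_mem: "operator_in H T ==> (f, g) \<in> T ==> f \<in> H" "operator_in H T ==> (f, g) \<in> T ==> g \<in> H"
 by (auto simp: operator_in_def)

lemma op_zero: "operator_in H T ==> (0, 0) \<in> T"
 by (simp add: operator_in_def)

lemma op_add: "operator_in H T ==> (f, f') \<in> T ==> (g, g') \<in> T ==> (f + g, f' + g') \<in> T"
 by (simp add: operator_in_def)

lemma op_scale: "operator_in H T ==> (f, f') \<in> T ==> (c *\<^sub>C f, c *\<^sub>C f') \<in> T"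
 by (simp add: operator_in_def)

lemma op_diff: "operator_in H T ==> (f, f') \<in> T ==> (g, g') \<in> T ==> (f - g, f' - g') \<in> T"
 using op_add[of H T f f' "(-1) *\<^sub>C g" "(-1) *\<^sub>C g'"] op_scale[of H T g g' "-1"] by simp

locale selfadjoint_operator = hilbert_space +
 fixes L :: "('a \<times> 'a) set"
 assumes L_op: "operator_in H L" and L_sa: "L = adjoint_in H ip L"
begin

lemmas L_mem [simp] = op_mem[OF L_op]

lemma L_sym: "(f, f') \<in> L ==> (g, g') \<in> L ==> ip f' g = ip f g'"
proof -
 assume a: "(f, f') \<in> L" "(g, g') \<in> L"
 have "(g, g') \<in> adjoint_in H ip L" using a(2) L_sa by blast
 thus ?thesis using a(1) by (auto simp: adjoint_in_def)
qed

lemma L_below: assumes f: "(f, f') \<in> L" shows "\<bar>Im z\<bar> * nrm f <= nrm (f' - z *\<^sub>C f)"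
proof (cases "nrm f = 0")
 case False
 have H: "f \<in> H" "f' \<in> H" using f by auto
 have "ip f' f = cnj (ip f' f)" using L_sym[OF f f] herm[of f' f] H by simp
 hence "Im (ip f' f) = 0" by (metis cnj.simps(2) neg_equal_zero)
 hence "Im (ip (f' - z *\<^sub>C f) f) = - Im z * (nrm f)\<^sup>2" using H by (simp add: nrm_sq)
 hence "\<bar>Im z\<bar> * (nrm f)\<^sup>2 = \<bar>Im (ip (f' - z *\<^sub>C f) f)\<bar>" by (simp add: abs_mult)
 also have "... <= nrm (f' - z *\<^sub>C f) * nrm f"
  using abs_Im_le_cmod[of "ip (f' - z *\<^sub>C f) f"] cauchy_schwarz[of "f' - z *\<^sub>C f" f] H by simp
 finally have "(\<bar>Im z\<bar> * nrm f) * nrm f <= nrm (f' - z *\<^sub>C f) * nrm f" by (simp add: power2_eq_square)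
 moreover have "0 < nrm f" using False H by (simp add: order_less_le)
 ultimately show ?thesis by (simp add: mult_le_cancel_right)
qed (use f in simp)

text \<open>The solution f represents the functional (L - cnj z) g \<mapsto> <g, h>, which is
  bounded by \<open>L_below\<close>. That f solves the equation is the statement that it lies in the
  domain of the adjoint, which is L.\<close>

lemma L_resolvent:
 assumes z: "Im z ~= 0" and h: "h \<in> H"
 shows "\<exists>!f. (f, h + z *\<^sub>C f) \<in> L"
proof -
 define G where "G = {(g' - cnj z *\<^sub>C g, ip g h) | g g'. (g, g') \<in> L}"
 have below: "nrm g <= nrm (g' - cnj z *\<^sub>C g) / \<bar>Im z\<bar>" if "(g, g') \<in> L" for g g'
  using L_below[OF that, of "cnj z"] z by (simp add: field_simps)
 obtain f where f: "f \<in> H" "!!v s. (v, s) \<in> G ==> s = ip v f"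
 proof (rule riesz_graph[of G "nrm h / \<bar>Im z\<bar>"])
  show "v \<in> H" if "(v, s) \<in> G" for v s using that by (auto simp: G_def)
  show "(0, 0) \<in> G" unfolding G_def using op_zero[OF L_op] h
   by (intro CollectI exI[of _ 0]) simp
  show "(v + w, s + r) \<in> G" if "(v, s) \<in> G" "(w, r) \<in> G" for v s w r
  proof -
   obtain g g' k k' where "(g, g') \<in> L" "(k, k') \<in> L" "v = g' - cnj z *\<^sub>C g" "s = ip g h"
    "w = k' - cnj z *\<^sub>C k" "r = ip k h" using \<open>(v, s) \<in> G\<close> \<open>(w, r) \<in> G\<close> unfolding G_def by blast
   moreover from this have "(g + k, g' + k') \<in> L" using op_add[OF L_op] by blast
   ultimately show ?thesis unfolding G_def using h
    by (intro CollectI exI[of _ "g + k"] exI[of _ "g' + k'"]) (auto simp: complex_vector.scale_right_distrib)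
  qed
  show "(c *\<^sub>C v, c * s) \<in> G" if vs: "(v, s) \<in> G" for c v s
  proof -
   obtain g g' where "(g, g') \<in> L" "v = g' - cnj z *\<^sub>C g" "s = ip g h" using vs unfolding G_def by blast
   moreover from this have "(c *\<^sub>C g, c *\<^sub>C g') \<in> L" using op_scale[OF L_op] by blast
   ultimately show ?thesis unfolding G_def using h
    by (intro CollectI exI[of _ "c *\<^sub>C g"] exI[of _ "c *\<^sub>C g'"])
     (auto simp: complex_vector.scale_right_diff_distrib mult.commute)
  qed
  show "cmod s <= nrm h / \<bar>Im z\<bar> * nrm v" if vs: "(v, s) \<in> G" for v s
  proof -
   obtain g g' where g: "(g, g') \<in> L" "v = g' - cnj z *\<^sub>C g" "s = ip g h" using vs unfolding G_def by blast
   have "cmod s <= nrm g * nrm h" unfolding g(3) using g h by (intro cauchy_schwarz) auto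
   also have "... <= nrm v / \<bar>Im z\<bar> * nrm h" using below[OF g(1)] h by (intro mult_right_mono) (auto simp: g)
   finally show ?thesis by (simp add: mult.commute)
  qed
  show "0 <= nrm h / \<bar>Im z\<bar>" using h by simp
 qed (use that in blast)
 have "(f, h + z *\<^sub>C f) \<in> adjoint_in H ip L"
  unfolding adjoint_in_def
 proof (intro CollectI, clarify, intro conjI ballI)
  show "f \<in> H" "h + z *\<^sub>C f \<in> H" using f h by auto
  fix p assume "p \<in> L"
  then obtain g g' where p: "p = (g, g')" "(g, g') \<in> L" by (cases p) auto
  hence "(g' - cnj z *\<^sub>C g, ip g h) \<in> G" unfolding G_def by blast
  hence "ip g h = ip (g' - cnj z *\<^sub>C g) f" by (rule f(2))
  thus "case p of (g, g') => ip g' f = ip g (h + z *\<^sub>C f)" using p f h by simp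
 qed
 hence fL: "(f, h + z *\<^sub>C f) \<in> L" using L_sa by simp
 moreover have "k = f" if k: "(k, h + z *\<^sub>C k) \<in> L" for k
 proof -
  have H: "k \<in> H" "f \<in> H" using k fL by auto
  have "\<bar>Im z\<bar> * nrm (k - f) <= nrm ((h + z *\<^sub>C k - (h + z *\<^sub>C f)) - z *\<^sub>C (k - f))"
   by (rule L_below) (rule op_diff[OF L_op k fL])
  also have "(h + z *\<^sub>C k - (h + z *\<^sub>C f)) - z *\<^sub>C (k - f) = 0"
   by (simp add: complex_vector.scale_right_diff_distrib)
  finally have "nrm (k - f) <= 0" using z by (simp add: mult_le_0_iff)
  hence "nrm (k - f) = 0" using H nrm_nonneg[of "k - f"] by (intro antisym) auto
  thus ?thesis using H by simp
 qed
 ultimately show ?thesis by blast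
qed

lemma res_mem: "Im z ~= 0 ==> h \<in> H ==> (resolvent L z h, h + z *\<^sub>C resolvent L z h) \<in> L"
 unfolding resolvent_def by (rule theI') (rule L_resolvent)

lemma res_unique: "Im z ~= 0 ==> h \<in> H ==> (f, h + z *\<^sub>C f) \<in> L ==> resolvent L z h = f"
 using L_resolvent[of z h] res_mem[of z h] by blast

lemma res_H [simp]: "Im z ~= 0 ==> h \<in> H ==> resolvent L z h \<in> H"
 by (rule L_mem(1)[OF res_mem])

lemma res_bound: "Im z ~= 0 ==> h \<in> H ==> nrm (resolvent L z h) <= nrm h / \<bar>Im z\<bar>"
 using L_below[OF res_mem[of z h], of z] by (simp add: field_simps)

text \<open>w is (L^2 + y^2)^(-1) x and w1 is L w, according to 1 / (L - i y) = (L + i y) / (L^2 +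
  y^2).\<close>

lemma sq_resolvent:
 assumes y: "0 < y" and x: "x \<in> H"
 obtains w w1 where "(w, w1) \<in> L" "(w1, x - of_real (y\<^sup>2) *\<^sub>C w) \<in> L"
  "resolvent L (\<i> * of_real y) x = w1 + (\<i> * of_real y) *\<^sub>C w"
proof -
 define z where "z = \<i> * complex_of_real y"
 have z: "Im z ~= 0" "Im (- z) ~= 0" "z * z = - of_real (y\<^sup>2)"
  using y by (simp_all add: z_def power2_eq_square algebra_simps)
 define u w where "u = resolvent L z x" and "w = resolvent L (- z) u"
 have u: "(u, x + z *\<^sub>C u) \<in> L" using res_mem[OF z(1) x] by (simp add: u_def)
 have "(w, u + (- z) *\<^sub>C w) \<in> L" unfolding w_def by (rule res_mem) (use z x in \<open>auto simp: u_def\<close>)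
 hence w: "(w, u - z *\<^sub>C w) \<in> L" by simp
 have "(u - z *\<^sub>C w, (x + z *\<^sub>C u) - z *\<^sub>C (u - z *\<^sub>C w)) \<in> L" by (intro op_diff[OF L_op] op_scale[OF L_op] u w)
 hence "(u - z *\<^sub>C w, x - of_real (y\<^sup>2) *\<^sub>C w) \<in> L"
  by (simp add: complex_vector.scale_right_diff_distrib z(3) del: of_real_power)
 moreover have "resolvent L (\<i> * of_real y) x = (u - z *\<^sub>C w) + (\<i> * of_real y) *\<^sub>C w" unfolding u_def z_def by simp
 ultimately show thesis using that[OF w] by blast
qed

text \<open>On the spectral side the next theorem says that \<open>\<psi>(s) - \<psi>(s/2) \<ge> s/(s\<^sup>2 + 1)\<close> for the bounded function
 \<open>\<psi>(s) = 5 s\<^sup>2/(s\<^sup>2 + 1) + (2 s - s\<^sup>3)/(s\<^sup>2 + 1)\<^sup>2\<close> and \<open>s = L/y\<close>.\<close>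

theorem dilation_bound:
 assumes x: "x \<in> H"
 shows "\<exists>F. \<forall>y>0. \<bar>F y\<bar> <= 9 * (nrm x)\<^sup>2 \<and> y * Re (ip (resolvent L (\<i> * of_real y) x) x) <= F y - F (2 * y)"
proof -
 have "\<exists>w w1. (w, w1) \<in> L \<and> (w1, x - of_real (y\<^sup>2) *\<^sub>C w) \<in> L \<and>
   resolvent L (\<i> * of_real y) x = w1 + (\<i> * of_real y) *\<^sub>C w" if "0 < y" for y
  using sq_resolvent[OF that x] by metis
 then obtain w w1 where w: "!!y. 0 < y ==> (w y, w1 y) \<in> L" "!!y. 0 < y ==> (w1 y, x - of_real (y\<^sup>2) *\<^sub>C w y) \<in> L"
  "!!y. 0 < y ==> resolvent L (\<i> * of_real y) x = w1 y + (\<i> * of_real y) *\<^sub>C w y" by metis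
 \<comment> \<open>The three terms correspond to \<psi>(s) = 5 s^2/(s^2 + 1) - s/(s^2 + 1) + 3
   s/(s^2 + 1)^2. Each function next to a coefficient is bounded by 1 in modulus, whence 9 = 5 + 1 +
   3.\<close>
 define F where "F y = 5 * Re (ip x (x - of_real (y\<^sup>2) *\<^sub>C w y)) - y * Re (ip (w1 y) x) + 3 * y^3 * Re (ip (w1 y) (w y))" for y
 have wH: "w y \<in> H" "w1 y \<in> H" if "0 < y" for y using w[OF that] by auto
 have bound: "\<bar>F y\<bar> <= 9 * (nrm x)\<^sup>2" if y: "0 < y" for y
 proof -
  define w2 where "w2 = x - of_real (y\<^sup>2) *\<^sub>C w y"
  note H = wH[OF y]
  have w2: "w2 \<in> H" "x = w2 + of_real (y\<^sup>2) *\<^sub>C w y" using x H by (simp_all add: w2_def)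
  have "ip w2 (w y) = ip (w1 y) (w1 y)" unfolding w2_def by (rule L_sym[OF w(2,1)[OF y]])
  hence r: "Re (ip w2 (w y)) = (nrm (w1 y))\<^sup>2" using H by (simp add: nrm_sq)
  have e: "(nrm x)\<^sup>2 = (nrm w2)\<^sup>2 + 2 * (y\<^sup>2 * (nrm (w1 y))\<^sup>2) + (y\<^sup>2 * nrm (w y))\<^sup>2"
   unfolding w2(2) using nrm_sq_add[of w2 "of_real (y\<^sup>2) *\<^sub>C w y"] w2(1) H
   by (simp add: nrm_scale r norm_power del: of_real_power)
  have "(nrm w2)\<^sup>2 <= (nrm x)\<^sup>2" "(y\<^sup>2 * nrm (w y))\<^sup>2 <= (nrm x)\<^sup>2" "(y * nrm (w1 y))\<^sup>2 <= (nrm x)\<^sup>2"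
   using e zero_le_power2[of "nrm w2"] zero_le_power2[of "y * nrm (w1 y)"] zero_le_power2[of "y\<^sup>2 * nrm (w y)"]
   by (simp_all add: power_mult_distrib)
  hence b: "nrm w2 <= nrm x" "y\<^sup>2 * nrm (w y) <= nrm x" "y * nrm (w1 y) <= nrm x"
   using x power2_le_imp_le nrm_nonneg by metis+
  have cs: "\<bar>Re (ip u v)\<bar> <= nrm u * nrm v" if "u \<in> H" "v \<in> H" for u v
   using cauchy_schwarz[OF that] abs_Re_le_cmod[of "ip u v"] by linarith
  have "\<bar>Re (ip x w2)\<bar> <= nrm x * nrm x"
   using cs[OF x w2(1)] mult_left_mono[OF b(1), of "nrm x"] x by simp
  moreover have "\<bar>y * Re (ip (w1 y) x)\<bar> <= nrm x * nrm x"
  proof -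
   have "\<bar>y * Re (ip (w1 y) x)\<bar> <= y * (nrm (w1 y) * nrm x)"
    using cs[OF H(2) x] y by (simp add: abs_mult)
   also have "... <= nrm x * nrm x" using mult_right_mono[OF b(3), of "nrm x"] x by (simp add: mult.assoc)
   finally show ?thesis .
  qed
  moreover have "\<bar>y^3 * Re (ip (w1 y) (w y))\<bar> <= nrm x * nrm x"
  proof -
   have "\<bar>y^3 * Re (ip (w1 y) (w y))\<bar> <= y^3 * (nrm (w1 y) * nrm (w y))"
    using cs[OF H(2,1)] y by (simp add: abs_mult)
   also have "... = (y * nrm (w1 y)) * (y\<^sup>2 * nrm (w y))" by (simp add: power2_eq_square power3_eq_cube)
   also have "... <= nrm x * nrm x" using b x y H by (intro mult_mono) auto
   finally show ?thesis .
  qed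
  ultimately show ?thesis unfolding F_def w2_def[symmetric] power2_eq_square[of "nrm x"] by linarith
 qed
 have "y * Re (ip (resolvent L (\<i> * of_real y) x) x) <= F y - F (2 * y)" if y: "0 < y" for y
 proof -
  have y2: "0 < 2 * y" using y by simp
  \<comment> \<open>v is (L^2 + y^2)^(-1) (L^2 + 4 y^2)^(-1) x and v1, ..., v4 are its images under
    powers of L. Everything at y and at 2 y is expressed through them, and the claim becomes an
    inequality between the moments \<mu> n = <L^n v, v>.\<close>
  obtain v v1 where v: "(v, v1) \<in> L" "(v1, w y - of_real ((2*y)\<^sup>2) *\<^sub>C v) \<in> L"
   using sq_resolvent[OF y2 wH(1)[OF y]] by blast
  define v2 where "v2 = w y - of_real ((2*y)\<^sup>2) *\<^sub>C v"
  have H: "v \<in> H" "v1 \<in> H" "v2 \<in> H" using v wH[OF y] by (auto simp: v2_def)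
  have v2: "(v1, v2) \<in> L" using v(2) by (simp add: v2_def)
  define v3 where "v3 = w1 y - of_real ((2*y)\<^sup>2) *\<^sub>C v1"
  have v3: "(v2, v3) \<in> L" unfolding v2_def v3_def by (intro op_diff[OF L_op] op_scale[OF L_op] w y v)
  define v4 where "v4 = x - of_real (y\<^sup>2) *\<^sub>C w y - of_real ((2*y)\<^sup>2) *\<^sub>C v2"
  have v4: "(v3, v4) \<in> L" unfolding v3_def v4_def by (intro op_diff[OF L_op] op_scale[OF L_op] w y v2)
  have H': "v3 \<in> H" "v4 \<in> H" using v4 by auto
  have wy: "w y = v2 + of_real ((2*y)\<^sup>2) *\<^sub>C v" "w1 y = v3 + of_real ((2*y)\<^sup>2) *\<^sub>C v1" by (simp_all add: v2_def v3_def)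
  have xe: "x = v4 + of_real (y\<^sup>2) *\<^sub>C w y + of_real ((2*y)\<^sup>2) *\<^sub>C v2" by (simp add: v4_def)
  define k where "k = v2 + of_real (y\<^sup>2) *\<^sub>C v"
  define k1 where "k1 = v3 + of_real (y\<^sup>2) *\<^sub>C v1"
  have k: "(k, k1) \<in> L" "(k1, v4 + of_real (y\<^sup>2) *\<^sub>C v2) \<in> L"
   unfolding k_def k1_def by (intro op_add[OF L_op] op_scale[OF L_op] v v2 v3 v4)+
  have xk: "x - of_real ((2*y)\<^sup>2) *\<^sub>C k = v4 + of_real (y\<^sup>2) *\<^sub>C v2"
   unfolding xe wy k_def by (simp add: complex_vector.scale_right_distrib algebra_simps)
  \<comment> \<open>Both w (2 y) and k = (L^2 + y^2) v solve (L^2 + 4 y^2) w = x, and the solution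
    is unique because L^2 + 4 y^2 is strictly positive.\<close>
  have eq: "w (2 * y) = k \<and> w1 (2 * y) = k1"
  proof -
   define d d1 where "d = w (2 * y) - k" and "d1 = w1 (2 * y) - k1"
   have d: "(d, d1) \<in> L" unfolding d_def d1_def by (intro op_diff[OF L_op] w(1)[OF y2] k)
   have "(d1, (x - of_real ((2*y)\<^sup>2) *\<^sub>C w (2 * y)) - (x - of_real ((2*y)\<^sup>2) *\<^sub>C k)) \<in> L"
    unfolding d1_def xk by (intro op_diff[OF L_op] w(2)[OF y2] k)
   hence "(d1, - of_real ((2*y)\<^sup>2) *\<^sub>C d) \<in> L" by (simp add: d_def complex_vector.scale_right_diff_distrib)
   from L_sym[OF this d] d have "- of_real ((2*y)\<^sup>2) * ip d d = ip d1 d1" by simp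
   hence "Re (- of_real ((2*y)\<^sup>2) * ip d d) = Re (ip d1 d1)" by (rule arg_cong)
   hence "- ((2*y)\<^sup>2 * (nrm d)\<^sup>2) = (nrm d1)\<^sup>2" using d by (simp add: nrm_sq)
   moreover have "0 <= (2*y)\<^sup>2 * (nrm d)\<^sup>2" "0 <= (nrm d1)\<^sup>2" by simp_all
   ultimately have "(2*y)\<^sup>2 * (nrm d)\<^sup>2 = 0" "(nrm d1)\<^sup>2 = 0" by linarith+
   hence "nrm d = 0" "nrm d1 = 0" using y by simp_all
   hence "d = 0" "d1 = 0" using d by auto
   thus ?thesis by (simp add: d_def d1_def)
  qed
  define \<mu> where "\<mu> n = (if n = (1::nat) then ip v1 v else if n = 2 then ip v1 v1 else if n = 3 then ip v2 v1
   else if n = 4 then ip v2 v2 else if n = 5 then ip v3 v2 else ip v3 v3)" for n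
  have ms: "ip v v1 = \<mu> 1" "ip v1 v = \<mu> 1" "ip v v2 = \<mu> 2" "ip v1 v1 = \<mu> 2" "ip v2 v = \<mu> 2"
   "ip v v3 = \<mu> 3" "ip v1 v2 = \<mu> 3" "ip v2 v1 = \<mu> 3" "ip v3 v = \<mu> 3"
   "ip v v4 = \<mu> 4" "ip v1 v3 = \<mu> 4" "ip v2 v2 = \<mu> 4" "ip v3 v1 = \<mu> 4" "ip v4 v = \<mu> 4"
   "ip v1 v4 = \<mu> 5" "ip v2 v3 = \<mu> 5" "ip v3 v2 = \<mu> 5" "ip v4 v1 = \<mu> 5"
   "ip v2 v4 = \<mu> 6" "ip v3 v3 = \<mu> 6" "ip v4 v2 = \<mu> 6"
   using L_sym[OF v(1) v(1)] L_sym[OF v(1) v2] L_sym[OF v2 v(1)] L_sym[OF v(1) v3] L_sym[OF v2 v2] L_sym[OF v3 v(1)]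
    L_sym[OF v(1) v4] L_sym[OF v2 v3] L_sym[OF v3 v2] L_sym[OF v4 v(1)]
    L_sym[OF v2 v4] L_sym[OF v3 v3] L_sym[OF v4 v2] L_sym[OF v3 v4] L_sym[OF v4 v3]
   unfolding \<mu>_def by simp_all
  define m where "m n = Re (\<mu> n)" for n
  have x2: "x = v4 + of_real (5 * y\<^sup>2) *\<^sub>C v2 + of_real (4 * y^4) *\<^sub>C v"
  proof -
   have "x = v4 + (of_real (y\<^sup>2) *\<^sub>C v2 + of_real (4 * y\<^sup>2) *\<^sub>C v2) + of_real (y\<^sup>2 * (4 * y\<^sup>2)) *\<^sub>C v"
    unfolding xe wy by (simp add: complex_vector.scale_right_distrib algebra_simps power_mult_distrib)
   also have "of_real (y\<^sup>2) *\<^sub>C v2 + of_real (4 * y\<^sup>2) *\<^sub>C v2 = of_real (5 * y\<^sup>2) *\<^sub>C v2"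
    unfolding complex_vector.scale_left_distrib[symmetric] by (rule arg_cong[where f = "\<lambda>c. c *\<^sub>C v2"]) (simp add: algebra_simps)
   finally show ?thesis by (simp add: power2_eq_square power4_eq_xxxx)
  qed
  have xw: "x - of_real (y\<^sup>2) *\<^sub>C w y = v4 + of_real (4 * y\<^sup>2) *\<^sub>C v2" using xe by (simp add: v4_def power_mult_distrib)
  have Fy: "F y = 5 * Re (ip x (v4 + of_real (4 * y\<^sup>2) *\<^sub>C v2)) - y * Re (ip (w1 y) x)
    + 3 * y^3 * (m 5 + 8 * y\<^sup>2 * m 3 + 16 * y^4 * m 1)"
   unfolding F_def xw unfolding wy using H H'
   by (simp add: ms m_def power_mult_distrib algebra_simps flip: power_add)
  have F2: "F (2 * y) = 5 * Re (ip x (v4 + of_real (y\<^sup>2) *\<^sub>C v2)) - 2 * y * Re (ip k1 x)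
    + 24 * y^3 * (m 5 + 2 * y\<^sup>2 * m 3 + y^4 * m 1)"
   unfolding F_def eq[THEN conjunct1] eq[THEN conjunct2] xk unfolding k_def k1_def using H H'
   by (simp add: ms m_def power_mult_distrib algebra_simps flip: power_add)
  have d1: "Re (ip x (v4 + of_real (4 * y\<^sup>2) *\<^sub>C v2)) - Re (ip x (v4 + of_real (y\<^sup>2) *\<^sub>C v2))
    = 3 * y\<^sup>2 * (m 6 + 5 * y\<^sup>2 * m 4 + 4 * y^4 * m 2)"
  proof -
   have "Re (ip x (v4 + of_real c *\<^sub>C v2)) = Re (ip x v4) + c * Re (ip x v2)" for c using x H H' by simp
   hence "Re (ip x (v4 + of_real (4 * y\<^sup>2) *\<^sub>C v2)) - Re (ip x (v4 + of_real (y\<^sup>2) *\<^sub>C v2)) = 3 * y\<^sup>2 * Re (ip x v2)"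
    by (simp only:)
   also have "Re (ip x v2) = m 6 + 5 * y\<^sup>2 * m 4 + 4 * y^4 * m 2"
    unfolding x2 using H H' by (simp add: ms m_def)
   finally show ?thesis .
  qed
  have d2: "Re (ip (w1 y) x) - Re (ip k1 x) = 3 * y\<^sup>2 * (m 5 + 5 * y\<^sup>2 * m 3 + 4 * y^4 * m 1)"
  proof -
   have "Re (ip (v3 + of_real c *\<^sub>C v1) x) = Re (ip v3 x) + c * Re (ip v1 x)" for c using x H H' by simp
   hence "Re (ip (w1 y) x) - Re (ip k1 x) = ((2*y)\<^sup>2 - y\<^sup>2) * Re (ip v1 x)"
    unfolding wy k1_def by (simp only:) (simp add: left_diff_distrib)
   also have "Re (ip v1 x) = m 5 + 5 * y\<^sup>2 * m 3 + 4 * y^4 * m 1"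
    unfolding x2 using H H' by (simp add: ms m_def)
   finally show ?thesis by (simp add: power_mult_distrib)
  qed
  have Re_R: "Re (ip (resolvent L (\<i> * of_real y) x) x) = Re (ip (w1 y) x)"
  proof -
   have "ip (x - of_real (y\<^sup>2) *\<^sub>C w y) (w y) = ip (w1 y) (w1 y)" by (rule L_sym[OF w(2,1)[OF y]])
   hence "ip x (w y) = ip (w1 y) (w1 y) + of_real (y\<^sup>2) * ip (w y) (w y)" using x wH[OF y] by (simp add: diff_eq_eq)
   hence "Im (ip x (w y)) = 0" using wH[OF y] by (simp del: of_real_power)
   hence "Im (ip (w y) x) = 0" using herm[of x "w y"] x wH[OF y] by simp
   thus ?thesis using w(3)[OF y] x wH[OF y] by simp
  qed
  have D: "F y - F (2 * y) - y * Re (ip (w1 y) x)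
    = 15 * y\<^sup>2 * (m 6 + 5 * y\<^sup>2 * m 4 + 4 * y^4 * m 2) - 27 * y^3 * m 5 - 54 * y^5 * m 3"
  proof -
   have "F y - F (2 * y) - y * Re (ip (w1 y) x)
    = 5 * (Re (ip x (v4 + of_real (4 * y\<^sup>2) *\<^sub>C v2)) - Re (ip x (v4 + of_real (y\<^sup>2) *\<^sub>C v2)))
     - 2 * y * (Re (ip (w1 y) x) - Re (ip k1 x))
     + 3 * y^3 * (m 5 + 8 * y\<^sup>2 * m 3 + 16 * y^4 * m 1) - 24 * y^3 * (m 5 + 2 * y\<^sup>2 * m 3 + y^4 * m 1)"
    unfolding Fy F2 by (simp add: algebra_simps)
   thus ?thesis unfolding d1 d2 by (simp add: algebra_simps power2_eq_square power3_eq_cube power4_eq_xxxx numeral_eq_Suc)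
  qed
  have sq: "m 6 = (nrm v3)\<^sup>2" "m 4 = (nrm v2)\<^sup>2" "m 2 = (nrm v1)\<^sup>2" using H H' by (simp_all add: m_def nrm_sq ms)
  \<comment> \<open>Odd moments are bounded by their even neighbours. In D the even coefficients 15,
    75, 60 exceed the shares 27/2, 27/2 + 27, 27 claimed by the odd ones.\<close>
  have "2 * (y * m 5) <= (nrm v3)\<^sup>2 + y\<^sup>2 * (nrm v2)\<^sup>2"
  proof -
   have "0 <= (nrm (v3 - of_real y *\<^sub>C v2))\<^sup>2" by simp
   thus ?thesis using nrm_sq_diff[of v3 "of_real y *\<^sub>C v2"] H H' by (simp add: nrm_scale power_mult_distrib ms m_def)
  qed
  hence a5: "2 * (y^3 * m 5) <= y\<^sup>2 * (nrm v3)\<^sup>2 + y^4 * (nrm v2)\<^sup>2"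
   using mult_left_mono[of _ _ "y\<^sup>2"] by (fastforce simp: algebra_simps power2_eq_square power3_eq_cube power4_eq_xxxx)
  have "2 * (y * m 3) <= (nrm v2)\<^sup>2 + y\<^sup>2 * (nrm v1)\<^sup>2"
  proof -
   have "0 <= (nrm (v2 - of_real y *\<^sub>C v1))\<^sup>2" by simp
   thus ?thesis using nrm_sq_diff[of v2 "of_real y *\<^sub>C v1"] H H' by (simp add: nrm_scale power_mult_distrib ms m_def)
  qed
  hence "y^4 * (2 * (y * m 3)) <= y^4 * ((nrm v2)\<^sup>2 + y\<^sup>2 * (nrm v1)\<^sup>2)" by (intro mult_left_mono) auto
  hence a3: "2 * (y^5 * m 3) <= y^4 * (nrm v2)\<^sup>2 + y^6 * (nrm v1)\<^sup>2" by (simp add: algebra_simps numeral_eq_Suc)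
  have e: "15 * y\<^sup>2 * (m 6 + 5 * y\<^sup>2 * m 4 + 4 * y^4 * m 2)
    = 15 * (y\<^sup>2 * (nrm v3)\<^sup>2) + 75 * (y^4 * (nrm v2)\<^sup>2) + 60 * (y^6 * (nrm v1)\<^sup>2)"
   unfolding sq by (simp add: algebra_simps numeral_eq_Suc)
  have n: "0 <= y\<^sup>2 * (nrm v3)\<^sup>2" "0 <= y^4 * (nrm v2)\<^sup>2" "0 <= y^6 * (nrm v1)\<^sup>2" using y by simp_all
  have "0 <= F y - F (2 * y) - y * Re (ip (w1 y) x)"
   unfolding D e mult.assoc[of 27] mult.assoc[of 54] using a5 a3 n by linarith
  thus ?thesis unfolding Re_R by simp
 qed
 thus ?thesis using bound by blast
qed

end

lemma adjoint_in_add: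
 assumes "psd_space H ip" "T \<subseteq> H \<times> H" "(f, f') \<in> adjoint_in H ip T" "(g, g') \<in> adjoint_in H ip T"
 shows "(f + g, f' + g') \<in> adjoint_in H ip T"
proof -
 interpret psd_space H ip by fact
 show ?thesis using assms(2-4) by (fastforce simp: adjoint_in_def)
qed

lemma adjoint_in_scale:
 assumes "psd_space H ip" "T \<subseteq> H \<times> H" "(f, f') \<in> adjoint_in H ip T"
 shows "(c *\<^sub>C f, c *\<^sub>C f') \<in> adjoint_in H ip T"
proof -
 interpret psd_space H ip by fact
 show ?thesis using assms(2-3) by (fastforce simp: adjoint_in_def)
qed

lemma (in hilbert_space) adjoint_operator:
 assumes S: "symmetric_in H ip S"
 shows "operator_in H (adjoint_in H ip S)"
proof -
 have SH: "S \<subseteq> H \<times> H" and dense: "dense_in ip (Domain S) H" using S by (auto simp: symmetric_in_def operator_in_def)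
 have uniq: "g = 0" if g: "(0, g) \<in> adjoint_in H ip S" for g
 proof (rule ccontr)
  assume "g ~= 0"
  have gH: "g \<in> H" using g by (simp add: adjoint_in_def)
  hence n: "0 < nrm g" using \<open>g ~= 0\<close> by (simp add: nrm_pos)
  obtain f where f: "f \<in> Domain S" "nrm (g - f) < nrm g" using dense gH n unfolding dense_in_def by blast
  then obtain f' where ff: "(f, f') \<in> S" by blast
  have fH: "f \<in> H" "f' \<in> H" using ff SH by auto
  have "ip f' 0 = ip f g" using g ff by (auto simp: adjoint_in_def)
  hence "ip f g = 0" using fH by simp
  hence "ip (g - f) g = of_real ((nrm g)\<^sup>2)" using gH fH by (simp add: self_eq)
  hence "(nrm g)\<^sup>2 <= nrm (g - f) * nrm g" using cauchy_schwarz[of "g - f" g] gH fH by (simp add: norm_power)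
  hence "nrm g * nrm g <= nrm (g - f) * nrm g" by (simp add: power2_eq_square)
  hence "nrm g <= nrm (g - f)" using n by (simp add: mult_le_cancel_right)
  thus False using f by simp
 qed
 have ps: "psd_space H ip" by (rule psd_space_axioms)
 show ?thesis unfolding operator_in_def
 proof (intro conjI allI impI)
  show "adjoint_in H ip S \<subseteq> H \<times> H" by (auto simp: adjoint_in_def)
  show "single_valued (adjoint_in H ip S)"
  proof (rule single_valuedI)
   fix f g g' assume a: "(f, g) \<in> adjoint_in H ip S" "(f, g') \<in> adjoint_in H ip S"
   have "(f + (-1) *\<^sub>C f, g + (-1) *\<^sub>C g') \<in> adjoint_in H ip S"
    using a by (intro adjoint_in_add[OF ps SH] adjoint_in_scale[OF ps SH])
   hence "g - g' = 0" by (intro uniq) simp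
   thus "g = g'" by simp
  qed
  show "(0, 0) \<in> adjoint_in H ip S" using SH by (auto simp: adjoint_in_def)
 qed (use adjoint_in_add[OF ps SH] adjoint_in_scale[OF ps SH] in blast)+
qed

text \<open>Defect numbers (1,1) enter only through the assumption \<open>onto\<close>.\<close>

locale boundary = hilbert_space +
 fixes S T :: "('a \<times> 'a) set" and G0 G1 :: "'a => complex"
 assumes S_sym: "symmetric_in H ip S" and T_eq: "T = adjoint_in H ip S"
  and lin0: "clinear_on (Domain T) G0" and lin1: "clinear_on (Domain T) G1"
  and ker: "(f, f') \<in> T ==> G0 f = 0 ==> G1 f = 0 ==> (f, f') \<in> S"
  and ker': "(f, f') \<in> S ==> G0 f = 0 \<and> G1 f = 0"
  and green: "(f, f') \<in> T ==> (g, g') \<in> T ==>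
   ip f' g - ip f g' = cnj (G0 g) * G1 f - cnj (G1 g) * G0 f"
  and onto: "\<exists>f\<in>Domain T. G0 f = a \<and> G1 f = b"
begin

lemma T_op: "operator_in H T" unfolding T_eq by (rule adjoint_operator[OF S_sym])

lemmas T_mem [simp] = op_mem[OF T_op]

lemma S_sub: "S \<subseteq> T" using S_sym by (simp add: symmetric_in_def T_eq)

lemma G_add: "(f, f') \<in> T ==> (g, g') \<in> T ==> G0 (f + g) = G0 f + G0 g"
 "(f, f') \<in> T ==> (g, g') \<in> T ==> G1 (f + g) = G1 f + G1 g"
 using lin0 lin1 unfolding clinear_on_def by blast+

lemma G_scale: "(f, f') \<in> T ==> G0 (c *\<^sub>C f) = c * G0 f" "(f, f') \<in> T ==> G1 (c *\<^sub>C f) = c * G1 f"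
 using lin0 lin1 unfolding clinear_on_def scaleC_complex_def by blast+

lemma G_diff: "(f, f') \<in> T ==> (g, g') \<in> T ==> G0 (f - g) = G0 f - G0 g"
 "(f, f') \<in> T ==> (g, g') \<in> T ==> G1 (f - g) = G1 f - G1 g"
 using G_add[of f f' "(-1) *\<^sub>C g" "(-1) *\<^sub>C g'"] G_scale[of g g' "-1"] op_scale[OF T_op, of g g' "-1"] by simp_all

text \<open>The self-adjoint extension of S with domain ker(G0), the reference operator in Krein's
  formula.\<close>

definition A0 where "A0 = {(f, f'). (f, f') \<in> T \<and> G0 f = 0}"

lemma A0_selfadjoint: "selfadjoint_operator H ip A0"
proof
 show "operator_in H A0"
  unfolding operator_in_def
 proof (intro conjI allI impI)
  show "A0 \<subseteq> H \<times> H" by (auto simp: A0_def)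
  show "single_valued A0" using op_unique[OF T_op] by (auto simp: A0_def intro!: single_valuedI)
  show "(0, 0) \<in> A0" using op_zero[OF T_op] G_scale(1)[of 0 0 0] by (simp add: A0_def)
  show "(f + g, f' + g') \<in> A0" if "(f, f') \<in> A0" "(g, g') \<in> A0" for f f' g g'
   using that op_add[OF T_op, of f f' g g'] G_add(1)[of f f' g g'] by (simp add: A0_def)
  show "(c *\<^sub>C f, c *\<^sub>C f') \<in> A0" if "(f, f') \<in> A0" for c f f'
   using that op_scale[OF T_op, of f f' c] G_scale(1)[of f f' c] by (simp add: A0_def)
 qed
 show "A0 = adjoint_in H ip A0"
 proof (intro set_eqI iffI)
  fix p assume "p \<in> A0"
  then obtain g g' where p: "p = (g, g')" "(g, g') \<in> T" "G0 g = 0" by (auto simp: A0_def)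
  have "ip f' g = ip f g'" if "(f, f') \<in> A0" for f f'
   using green[of f f' g g'] that p by (simp add: A0_def)
  thus "p \<in> adjoint_in H ip A0" using p by (auto simp: adjoint_in_def)
 next
  fix p assume pa: "p \<in> adjoint_in H ip A0"
  then obtain g g' where p: "p = (g, g')" "g \<in> H" "g' \<in> H" "!!f f'. (f, f') \<in> A0 ==> ip f' g = ip f g'"
   unfolding adjoint_in_def by blast
  have "S \<subseteq> A0" using S_sub ker' by (auto simp: A0_def)
  hence gT: "(g, g') \<in> T" using p unfolding T_eq adjoint_in_def by blast
  \<comment> \<open>An element of \<open>A0\<close> with G1 f = 1 makes Green's identity return G0
    g.\<close>
  obtain f f' where f: "(f, f') \<in> T" "G0 f = 0" "G1 f = 1" using onto[of 0 1] by blast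
  have "ip f' g - ip f g' = 0" using p(4)[of f f'] f by (simp add: A0_def)
  hence "cnj (G0 g) = 0" using green[OF f(1) gT] f by simp
  thus "p \<in> A0" using gT p(1) by (simp add: A0_def)
 qed
qed

end

sublocale boundary \<subseteq> A0: selfadjoint_operator H ip A0 by (rule A0_selfadjoint)

context boundary
begin

text \<open>A vector e with G0 e = 1 becomes a Weyl solution after adding the element f of dom(A0)
  that cancels (T - z) e. Two Weyl solutions differ by an eigenvector of \<open>A0\<close> at a
  nonreal point.\<close>

lemma weyl_ex:
 assumes z: "Im z ~= 0"
 shows "\<exists>!\<psi>. \<psi> \<in> eigenspace T z \<and> G0 \<psi> = 1"
proof -
 obtain e e' where e: "(e, e') \<in> T" "G0 e = 1" using onto[of 1 0] by blast
 have H: "e \<in> H" "e' \<in> H" using e(1) by auto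
 define h where "h = - (e' - z *\<^sub>C e)"
 define f where "f = resolvent A0 z h"
 have "(f, h + z *\<^sub>C f) \<in> A0" unfolding f_def by (rule A0.res_mem[OF z]) (use H in \<open>simp add: h_def\<close>)
 hence f: "(f, h + z *\<^sub>C f) \<in> T" "G0 f = 0" by (auto simp: A0_def)
 have "(e + f, e' + (h + z *\<^sub>C f)) \<in> T" by (rule op_add[OF T_op e(1) f(1)])
 also have "e' + (h + z *\<^sub>C f) = z *\<^sub>C (e + f)" by (simp add: h_def complex_vector.scale_right_distrib)
 finally have ex: "e + f \<in> eigenspace T z" "G0 (e + f) = 1" using G_add[OF e(1) f(1)] e f by (simp_all add: eigenspace_def)
 moreover have "p = q" if p: "p \<in> eigenspace T z" "G0 p = 1" and q: "q \<in> eigenspace T z" "G0 q = 1" for p q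
 proof -
  have T: "(p, z *\<^sub>C p) \<in> T" "(q, z *\<^sub>C q) \<in> T" using p q by (simp_all add: eigenspace_def)
  have "(p - q, z *\<^sub>C p - z *\<^sub>C q) \<in> T" by (rule op_diff[OF T_op T])
  moreover have "G0 (p - q) = 0" using G_diff[OF T] p q by simp
  ultimately have "(p - q, 0 + z *\<^sub>C (p - q)) \<in> A0" by (simp add: A0_def complex_vector.scale_right_diff_distrib)
  moreover have "(0, 0 + z *\<^sub>C 0) \<in> A0" using op_zero[OF A0.L_op] by simp
  ultimately have "p - q = 0" using A0.L_resolvent[OF z zero_mem] by blast
  thus ?thesis by simp
 qed
 ultimately show ?thesis by blast
qed

definition "w z = weyl_solution T G0 z"
definition "m z = weyl_function T G0 G1 z"

lemma m_eq: "m z = G1 (w z)" by (simp add: m_def weyl_function_def w_def)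

lemma w: assumes "Im z ~= 0" shows "(w z, z *\<^sub>C w z) \<in> T" "G0 (w z) = 1"
 using theI'[OF weyl_ex[OF assms]] by (simp_all add: w_def weyl_solution_def eigenspace_def)

lemma w_H [simp]: "Im z ~= 0 ==> w z \<in> H" using w(1) T_mem(1) by blast

text \<open>Green's identity for two Weyl solutions. It identifies their Gram matrix with the kernel
  of H(m), which is how B_0 is carried over to H.\<close>

lemma w_gram: assumes "Im a ~= 0" "Im b ~= 0" shows "(a - cnj b) * ip (w a) (w b) = m a - cnj (m b)"
 using green[OF w(1)[OF assms(1)] w(1)[OF assms(2)]] assms w(2) by (simp add: m_eq left_diff_distrib)

lemma m_cnj: assumes "Im z ~= 0" shows "m (cnj z) = cnj (m z)"
 using w_gram[of z "cnj z"] assms by (metis cnj.simps(2) complex_cnj_cnj diff_self eq_iff_diff_eq_0 mult_zero_left neg_equal_0_iff_equal)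

lemma m_Im: assumes z: "Im z ~= 0" shows "Im (m z) = Im z * (nrm (w z))\<^sup>2"
proof -
 have "z - cnj z = of_real (2 * Im z) * \<i>" by (simp add: complex_eq_iff)
 hence "of_real (2 * Im z) * \<i> * of_real ((nrm (w z))\<^sup>2) = m z - cnj (m z)"
  using w_gram[OF z z] self_eq[OF w_H[OF z]] by metis
 hence "Im (of_real (2 * Im z) * \<i> * of_real ((nrm (w z))\<^sup>2)) = Im (m z - cnj (m z))" by (rule arg_cong)
 thus ?thesis by simp
qed

lemma w_pos: "Im z ~= 0 ==> 0 < nrm (w z)"
proof -
 assume z: "Im z ~= 0"
 have "G0 0 = 0" using G_scale(1)[OF op_zero[OF T_op], of 0] by simp
 hence "w z ~= 0" using w(2)[OF z] by auto
 thus ?thesis using z by (simp add: nrm_pos)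
qed

text \<open>Green's identity for (A0 - z)^(-1) h and \<open>w (cnj z)\<close>, on which G0 takes the
  values 0 and 1.\<close>

lemma G1_resolvent:
 assumes z: "Im z ~= 0" and h: "h \<in> H"
 shows "G1 (resolvent A0 z h) = ip h (w (cnj z))"
proof -
 define f where "f = resolvent A0 z h"
 have f: "(f, h + z *\<^sub>C f) \<in> T" "G0 f = 0" using A0.res_mem[OF z h] by (auto simp: f_def A0_def)
 have z': "Im (cnj z) ~= 0" using z by simp
 have "f \<in> H" using f by auto
 thus ?thesis using green[OF f(1) w(1)[OF z']] w(2)[OF z'] f(2) h z' by (simp add: f_def[symmetric])
qed

text \<open>If \<open>0\<close> were an eigenvalue of the adjoint T that is not one of S, then the Weyl solutions could be
 controlled by their inner products with the eigenvector.\<close>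

lemma weyl_below:
 assumes x: "(x, 0) \<in> T" "(x, 0) \<notin> S"
 shows "\<exists>C>0. \<forall>y. 0 < y --> y < 1 --> nrm (w (\<i> * of_real y)) <= C * cmod (ip (w (\<i> * of_real y)) x)"
proof -
 have xH: "x \<in> H" using x(1) by auto
 have ne: "G0 x ~= 0 \<or> G1 x ~= 0" using ker[OF x(1)] x(2) by blast
 define P where "P f = cnj (G0 x) * G1 f - cnj (G1 x) * G0 f" for f
 have P: "ip f' x = P f" if "(f, f') \<in> T" for f f'
  using green[OF that x(1)] that by (simp add: P_def)
 have xx: "cnj (G0 x) * G1 x = cnj (G1 x) * G0 x" using P[OF x(1)] xH by (simp add: P_def)
 \<comment> \<open>P f = 0 says that the boundary values of f are proportional to those of x, and by
   \<open>xx\<close> these have a real ratio; so T is symmetric on such vectors.\<close>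
 have sym: "Im (ip f' f) = 0" if f: "(f, f') \<in> T" "P f = 0" for f f'
 proof -
  have e: "cnj (G0 x) * G1 f = cnj (G1 x) * G0 f" using f(2) by (simp add: P_def)
  have "cnj (G0 f) * G1 f = cnj (G1 f) * G0 f"
  proof (cases "G0 x = 0")
   case True
   hence "G0 f = 0" using e ne by simp
   thus ?thesis by simp
  next
   case False
   define r where "r = G1 x / G0 x"
   have "cnj r = r" using xx False by (simp add: r_def field_simps)
   moreover have "G1 f = cnj r * G0 f" using e False by (simp add: r_def field_simps)
   ultimately show ?thesis by (simp add: mult_ac)
  qed
  moreover have "f \<in> H" "f' \<in> H" using f by auto
  ultimately have "ip f' f = cnj (ip f' f)" using green[OF f(1) f(1)] herm[of f' f] by simp
  thus ?thesis by (metis cnj.simps(2) neg_equal_zero)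
 qed
 have i: "Im \<i> ~= 0" by simp
 have wi: "(w \<i>, \<i> *\<^sub>C w \<i>) \<in> T" using w(1)[OF i] .
 define p where "p = ip (w \<i>) x"
 have Pi: "P (w \<i>) = \<i> * p" using P[OF wi] xH by (simp add: p_def)
 have p: "p ~= 0"
 proof
  assume "p = 0"
  hence "Im (ip (\<i> *\<^sub>C w \<i>) (w \<i>)) = 0" using sym[OF wi] Pi by simp
  thus False using w_pos[OF i] by (simp add: self_eq)
 qed
 define C where "C = 2 * nrm (w \<i>) / cmod p"
 have "nrm (w (\<i> * of_real y)) <= C * cmod (ip (w (\<i> * of_real y)) x)" if y: "0 < y" "y < 1" for y
 proof -
  define z where "z = \<i> * complex_of_real y"
  have z: "Im z ~= 0" "cmod z = y" using y by (simp_all add: z_def norm_mult)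
  have wz: "(w z, z *\<^sub>C w z) \<in> T" by (rule w(1)[OF z(1)])
  have H: "w z \<in> H" "w \<i> \<in> H" using z by auto
  define q where "q = ip (w z) x"
  \<comment> \<open>Chosen such that P (w z - \<kappa> w i) = 0, given P (w z) = i y q and P (w i) =
    i p.\<close>
  define \<kappa> where "\<kappa> = of_real y * q / p"
  have Pz: "P (w z) = \<i> * of_real y * q" using P[OF wz] xH H by (simp add: q_def z_def)
  define d where "d = w z - \<kappa> *\<^sub>C w \<i>"
  define d' where "d' = z *\<^sub>C w z - \<kappa> *\<^sub>C \<i> *\<^sub>C w \<i>"
  have dT: "(d, d') \<in> T" unfolding d_def d'_def by (intro op_diff[OF T_op] op_scale[OF T_op] wz wi)
  have dH: "d \<in> H" "d' \<in> H" using dT by auto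
  have "P d = P (w z) - \<kappa> * P (w \<i>)"
   by (simp add: P_def d_def G_diff[OF wz op_scale[OF T_op wi]] G_scale[OF wi] algebra_simps)
  hence Pd: "P d = 0" using p by (simp add: Pz Pi \<kappa>_def)
  have d': "d' = z *\<^sub>C d + (\<kappa> * (z - \<i>)) *\<^sub>C w \<i>"
   by (simp add: d_def d'_def complex_vector.scale_right_diff_distrib complex_vector.scale_left_diff_distrib right_diff_distrib mult.commute)
  define k where "k = \<kappa> * (z - \<i>)"
  have "ip d' d = z * ip d d + k * ip (w \<i>) d" unfolding d' k_def[symmetric] using dH H by simp
  moreover have "Im (z * ip d d) = y * (nrm d)\<^sup>2" using dH by (simp add: z_def nrm_sq)
  ultimately have "y * (nrm d)\<^sup>2 = - Im (k * ip (w \<i>) d)" using sym[OF dT Pd] by simp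
  also have "... <= cmod (k * ip (w \<i>) d)" using abs_Im_le_cmod[of "k * ip (w \<i>) d"] by linarith
  also have "... <= cmod k * (nrm (w \<i>) * nrm d)"
   unfolding norm_mult using cauchy_schwarz[of "w \<i>" d] dH H by (intro mult_left_mono) auto
  finally have "(y * nrm d) * nrm d <= (cmod k * nrm (w \<i>)) * nrm d" by (simp add: power2_eq_square mult_ac)
  hence yd: "y * nrm d <= cmod k * nrm (w \<i>)"
   using dH by (cases "nrm d = 0") (auto simp: mult_le_cancel_right order_less_le)
  have "z - \<i> = \<i> * of_real (y - 1)" by (simp add: z_def right_diff_distrib)
  hence "cmod (z - \<i>) = cmod \<i> * \<bar>y - 1\<bar>" by (metis norm_mult norm_of_real)
  hence "cmod k = cmod \<kappa> * (1 - y)" using y by (simp add: k_def norm_mult)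
  hence "y * nrm d <= cmod \<kappa> * nrm (w \<i>) * (1 - y)" using yd by (simp add: mult_ac)
  moreover have "nrm (w z) <= nrm d + cmod \<kappa> * nrm (w \<i>)"
   using nrm_triangle[of d "\<kappa> *\<^sub>C w \<i>"] dH H by (simp add: d_def nrm_scale)
  hence "y * nrm (w z) <= y * nrm d + y * (cmod \<kappa> * nrm (w \<i>))"
   using y by (simp add: distrib_left[symmetric])
  moreover have "cmod \<kappa> * nrm (w \<i>) * (1 - y) = cmod \<kappa> * nrm (w \<i>) - y * (cmod \<kappa> * nrm (w \<i>))"
   by (simp add: right_diff_distrib)
  ultimately have "y * nrm (w z) <= cmod \<kappa> * nrm (w \<i>)" by linarith
  also have "... = y * (cmod q / cmod p * nrm (w \<i>))" using y by (simp add: \<kappa>_def norm_mult norm_divide)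
  finally have "nrm (w z) <= cmod q / cmod p * nrm (w \<i>)" using y by (simp only: mult_le_cancel_left_pos)
  also have "... <= C * cmod q"
  proof -
   have "0 <= cmod q / cmod p * nrm (w \<i>)" using H by simp
   moreover have "C * cmod q = 2 * (cmod q / cmod p * nrm (w \<i>))" by (simp add: C_def)
   ultimately show ?thesis by linarith
  qed
  finally show ?thesis by (simp add: z_def q_def)
 qed
 moreover have "C > 0" using w_pos[OF i] p by (simp add: C_def)
 ultimately show ?thesis by blast
qed

end

section \<open>Property B0\<close>

text \<open>A vector with prescribed inner products against a family exists if the values obey the
  norm bound on finite combinations. These are lists of pairs: repeated indices do no harm, and
  concatenation is addition.\<close>

lemma (in hilbert_space) riesz_family:
 fixes k :: "'i => 'a" and t :: "'i => complex"
 assumes k: "!!i. i \<in> I ==> k i \<in> H"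
  and b: "!!xs. snd ` set xs \<subseteq> I ==> cmod (\<Sum>(c, i)\<leftarrow>xs. c * t i) <= M * nrm (\<Sum>(c, i)\<leftarrow>xs. c *\<^sub>C k i)" and M: "0 <= M"
 shows "\<exists>h\<in>H. nrm h <= M \<and> (\<forall>i\<in>I. ip h (k i) = cnj (t i))"
proof -
 define v where "v xs = (\<Sum>(c, i)\<leftarrow>xs. c *\<^sub>C k i)" for xs
 define s where "s xs = (\<Sum>(c, i)\<leftarrow>xs. c * t i)" for xs
 define G where "G = {(v xs, s xs) | xs. snd ` set xs \<subseteq> I}"
 have vH: "v xs \<in> H" if "snd ` set xs \<subseteq> I" for xs
  using that by (induction xs) (auto simp: v_def k)
 obtain u where u: "u \<in> H" "!!v s. (v, s) \<in> G ==> s = ip v u" "nrm u <= M"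
 proof (rule riesz_graph[of G M])
  show "v \<in> H" if "(v, s) \<in> G" for v s using that vH by (auto simp: G_def)
  show "(0, 0) \<in> G" unfolding G_def by (intro CollectI exI[of _ "[]"]) (simp add: v_def s_def)
  show "(a + b, p + q) \<in> G" if "(a, p) \<in> G" "(b, q) \<in> G" for a p b q
  proof -
   obtain xs ys where "a = v xs" "p = s xs" "b = v ys" "q = s ys" "snd ` set xs \<subseteq> I" "snd ` set ys \<subseteq> I"
    using \<open>(a, p) \<in> G\<close> \<open>(b, q) \<in> G\<close> unfolding G_def by blast
   thus ?thesis unfolding G_def by (intro CollectI exI[of _ "xs @ ys"]) (auto simp: v_def s_def)
  qed
  show "(c *\<^sub>C a, c * p) \<in> G" if ap: "(a, p) \<in> G" for c a p
  proof -
   obtain xs where xs: "a = v xs" "p = s xs" "snd ` set xs \<subseteq> I" using ap unfolding G_def by blast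
   define ys where "ys = map (\<lambda>(d, i). (c * d, i)) xs"
   have "v ys = c *\<^sub>C v xs" "s ys = c * s xs" unfolding ys_def v_def s_def
    by (induction xs) (auto simp: complex_vector.scale_right_distrib distrib_left)
   moreover have "snd ` set ys \<subseteq> I" using xs(3) by (force simp: ys_def)
   ultimately show ?thesis unfolding G_def using xs by (intro CollectI exI[of _ ys]) auto
  qed
  show "cmod s' <= M * nrm v'" if "(v', s') \<in> G" for v' s' using that b by (auto simp: G_def v_def s_def)
 qed (use M that in blast)+
 have "ip u (k i) = cnj (t i)" if i: "i \<in> I" for i
 proof -
  have "(v [(1, i)], s [(1, i)]) \<in> G" unfolding G_def using i by (intro CollectI exI[of _ "[(1, i)]"]) simp
  hence "t i = ip (k i) u" using u(2) by (force simp: v_def s_def)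
  thus ?thesis using herm[of "k i" u] k[OF i] u(1) by simp
 qed
 thus ?thesis using u by blast
qed

text \<open>Equal Gram matrices make the map between the spans isometric.\<close>

lemma gram_lists:
 fixes k :: "'i => 'a::complex_vector" and \<xi> :: "'i => 'b::complex_vector"
 assumes H: "hilbert_space H q" "hilbert_space H' p" and k: "!!i. i \<in> I ==> k i \<in> H" "!!i. i \<in> I ==> \<xi> i \<in> H'"
  and gram: "!!i j. i \<in> I ==> j \<in> I ==> q (k i) (k j) = p (\<xi> i) (\<xi> j)"
  and xs: "snd ` set xs \<subseteq> I"
 shows "ip_norm q (\<Sum>(c, i)\<leftarrow>xs. c *\<^sub>C k i) = ip_norm p (\<Sum>(c, i)\<leftarrow>xs. c *\<^sub>C \<xi> i)"
proof -
 interpret q: hilbert_space H q by fact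
 interpret p: hilbert_space H' p by fact
 have m: "(\<Sum>(c, i)\<leftarrow>xs. c *\<^sub>C k i) \<in> H" "(\<Sum>(c, i)\<leftarrow>xs. c *\<^sub>C \<xi> i) \<in> H'" if "snd ` set xs \<subseteq> I" for xs
  using that by (induction xs) (auto simp: k)
 have 1: "q (k i) (\<Sum>(c, i)\<leftarrow>ys. c *\<^sub>C k i) = p (\<xi> i) (\<Sum>(c, i)\<leftarrow>ys. c *\<^sub>C \<xi> i)"
  if "i \<in> I" "snd ` set ys \<subseteq> I" for i ys
  using that(2) by (induction ys) (auto simp: k m gram \<open>i \<in> I\<close>)
 have "q (\<Sum>(c, i)\<leftarrow>xs. c *\<^sub>C k i) (\<Sum>(c, i)\<leftarrow>ys. c *\<^sub>C k i) = p (\<Sum>(c, i)\<leftarrow>xs. c *\<^sub>C \<xi> i) (\<Sum>(c, i)\<leftarrow>ys. c *\<^sub>C \<xi> i)"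
  if "snd ` set xs \<subseteq> I" "snd ` set ys \<subseteq> I" for xs ys
  using that(1) by (induction xs) (auto simp: k m[OF that(2)] m 1[OF _ that(2)])
 thus ?thesis using xs by (simp add: ip_norm_def)
qed

text \<open>If the Gram matrices are transposes of each other, the map between the spans is a
  conjugate linear isometry, whence the conjugated coefficients.\<close>

lemma gram_lists_cnj:
 fixes k :: "'i => 'a::complex_vector" and \<xi> :: "'i => 'b::complex_vector"
 assumes H: "hilbert_space H q" "hilbert_space H' p" and k: "!!i. i \<in> I ==> k i \<in> H" "!!i. i \<in> I ==> \<xi> i \<in> H'"
  and gram: "!!i j. i \<in> I ==> j \<in> I ==> q (k i) (k j) = p (\<xi> j) (\<xi> i)"
  and xs: "snd ` set xs \<subseteq> I"
 shows "ip_norm q (\<Sum>(c, i)\<leftarrow>xs. c *\<^sub>C k i) = ip_norm p (\<Sum>(c, i)\<leftarrow>xs. cnj c *\<^sub>C \<xi> i)"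
proof -
 interpret q: hilbert_space H q by fact
 interpret p: hilbert_space H' p by fact
 have m: "(\<Sum>(c, i)\<leftarrow>xs. c *\<^sub>C k i) \<in> H" "(\<Sum>(c, i)\<leftarrow>xs. cnj c *\<^sub>C \<xi> i) \<in> H'" if "snd ` set xs \<subseteq> I" for xs
  using that by (induction xs) (auto simp: k)
 have 1: "q (k i) (\<Sum>(c, i)\<leftarrow>ys. c *\<^sub>C k i) = p (\<Sum>(c, i)\<leftarrow>ys. cnj c *\<^sub>C \<xi> i) (\<xi> i)"
  if "i \<in> I" "snd ` set ys \<subseteq> I" for i ys
  using that(2) by (induction ys) (auto simp: k m gram \<open>i \<in> I\<close>)
 have "q (\<Sum>(c, i)\<leftarrow>xs. c *\<^sub>C k i) (\<Sum>(c, i)\<leftarrow>ys. c *\<^sub>C k i) = p (\<Sum>(c, i)\<leftarrow>ys. cnj c *\<^sub>C \<xi> i) (\<Sum>(c, i)\<leftarrow>xs. cnj c *\<^sub>C \<xi> i)"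
  if "snd ` set xs \<subseteq> I" "snd ` set ys \<subseteq> I" for xs ys
  using that(1) by (induction xs) (auto simp: k m[OF that(2)] m 1[OF _ that(2)])
 thus ?thesis using xs by (simp add: ip_norm_def)
qed

context boundary
begin

text \<open>m (cnj z) = cnj (m z) turns \<open>w_gram\<close> at the conjugate points into the same
  kernel. The two realisations of it serve the two signs in \<open>B0_bound\<close>.\<close>

lemma kernel_gram:
 assumes "0 < Im a" "0 < Im b"
 shows "nevanlinna_kernel m a b = ip (w a) (w b)" "nevanlinna_kernel m a b = ip (w (cnj b)) (w (cnj a))"
proof -
 have ne: "a - cnj b ~= 0" "cnj b - a ~= 0" "a ~= cnj b" using assms by (auto simp: complex_eq_iff)
 show "nevanlinna_kernel m a b = ip (w a) (w b)"
  using w_gram[of a b] assms ne by (simp add: nevanlinna_kernel_def field_simps)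
 have "(cnj b - a) * ip (w (cnj b)) (w (cnj a)) = cnj (m b) - m a"
  using w_gram[of "cnj b" "cnj a"] m_cnj[of a] m_cnj[of b] assms by simp
 thus "nevanlinna_kernel m a b = ip (w (cnj b)) (w (cnj a))" using ne
  by (simp add: nevanlinna_kernel_def field_simps)
qed

text \<open>B_0 concerns functions in H(m), whereas Krein's formula contains <g, w(iy)> and <g,
  w(-iy)>. Applied to the kernels at the points iy, \<open>riesz_family\<close> gives h in H(m) of
  norm at most that of g with \<bar>h(iy)\<bar> equal to the modulus of either inner product. The
  case \<sigma> = 1 corresponds to the holomorphic function <w z, g> and uses the conjugate linear
  isometry, the case \<sigma> = -1 to <g, w (cnj z)>.\<close>

lemma B0_bound:
 assumes B: "B0_property m"
 shows "\<exists>C\<ge>0. \<forall>g\<in>H. \<forall>\<sigma>. \<sigma> = 1 \<or> \<sigma> = - 1 -->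
  set_integrable lborel {0<..<1} (\<lambda>y. (cmod (ip g (w (\<i> * of_real (\<sigma> * y)))))\<^sup>2 / Im (m (\<i> * of_real y))) \<and>
  (LINT y:{0<..<1}|lborel. (cmod (ip g (w (\<i> * of_real (\<sigma> * y)))))\<^sup>2 / Im (m (\<i> * of_real y))) <= C * (nrm g)\<^sup>2"
proof -
 obtain HH q C where rk: "is_rkhs m HH q" and C: "!!h. h \<in> HH ==>
   set_integrable lborel {0<..<1} (\<lambda>y. (cmod (h (\<i> * of_real y)))\<^sup>2 * B0_weight m y) \<and>
      sqrt (LINT y:{0<..<1}|lborel. (cmod (h (\<i> * of_real y)))\<^sup>2 * B0_weight m y) <= C * ip_norm q h"
  using B unfolding B0_property_def by blast
 interpret q: hilbert_space HH q using rk by unfold_locales (simp add: is_rkhs_def)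
 define I where "I = {y::real. 0 < y}"
 define K where "K y = (\<lambda>z. if z \<in> \<real> then 0 else nevanlinna_kernel m z (\<i> * complex_of_real y))" for y
 have iy: "\<i> * complex_of_real y \<in> - \<real>" if "y \<in> I" for y using that by (simp add: I_def complex_is_Real_iff)
 have K: "K y \<in> HH" "!!h. h \<in> HH ==> q h (K y) = h (\<i> * of_real y)" if "y \<in> I" for y
  using rk iy[OF that] unfolding is_rkhs_def K_def Let_def by blast+
 have gram: "q (K y) (K y') = ip (w (\<i> * of_real y')) (w (\<i> * of_real y))"
  "q (K y) (K y') = ip (w (\<i> * of_real (- y))) (w (\<i> * of_real (- y')))" if "y \<in> I" "y' \<in> I" for y y'
 proof -
  have "q (K y) (K y') = nevanlinna_kernel m (\<i> * of_real y') (\<i> * of_real y)"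
   using K(2)[OF that(2) K(1)[OF that(1)]] iy[OF that(2)] by (simp add: K_def)
  thus "q (K y) (K y') = ip (w (\<i> * of_real y')) (w (\<i> * of_real y))"
   "q (K y) (K y') = ip (w (\<i> * of_real (- y))) (w (\<i> * of_real (- y')))"
   using kernel_gram[of "\<i> * of_real y'" "\<i> * of_real y"] that by (simp_all add: I_def)
 qed
 have wI: "w (\<i> * of_real y) \<in> H" "w (\<i> * of_real (- y)) \<in> H" if "y \<in> I" for y
  using that by (auto simp: I_def intro!: w_H)
 have ex: "\<exists>h\<in>HH. q.nrm h <= nrm g \<and> (\<forall>y\<in>I. cmod (h (\<i> * of_real y)) = cmod (ip g (w (\<i> * of_real (\<sigma> * y)))))"
  if g: "g \<in> H" and s: "\<sigma> = 1 \<or> \<sigma> = - 1" for g \<sigma>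
  using s
 proof
  assume s: "\<sigma> = 1"
  have "\<exists>h\<in>HH. q.nrm h <= nrm g \<and> (\<forall>i\<in>I. q h (K i) = cnj (ip g (w (\<i> * of_real i))))"
  proof (rule q.riesz_family)
   show "cmod (\<Sum>(c, i)\<leftarrow>xs. c * ip g (w (\<i> * of_real i))) <= nrm g * q.nrm (\<Sum>(c, i)\<leftarrow>xs. c *\<^sub>C K i)"
    if xs: "snd ` set xs \<subseteq> I" for xs
   proof -
    define u where "u xs = (\<Sum>(c, i)\<leftarrow>xs. cnj c *\<^sub>C w (\<i> * complex_of_real i))" for xs
    have uC: "u [] = 0" "u ((c, i) # xs) = cnj c *\<^sub>C w (\<i> * of_real i) + u xs" for c i xs by (simp_all add: u_def)
    have uH: "u xs \<in> H" if "snd ` set xs \<subseteq> I" for xs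
     using that by (induction xs) (auto simp: uC wI)
    have "(\<Sum>(c, i)\<leftarrow>xs. c * ip g (w (\<i> * of_real i))) = ip g (u xs)"
     using xs by (induction xs) (auto simp: uC uH wI g)
    moreover have "q.nrm (\<Sum>(c, i)\<leftarrow>xs. c *\<^sub>C K i) = nrm (u xs)" unfolding u_def
     using gram_lists_cnj[where k = K and \<xi> = "\<lambda>i. w (\<i> * of_real i)" and I = I,
       OF q.hilbert_space_axioms hilbert_space_axioms K(1) wI(1) gram(1) xs] .
    ultimately show ?thesis using cauchy_schwarz[OF g uH[OF xs]] by simp
   qed
  qed (use K g in auto)
  thus ?thesis using K(2) s by (metis complex_mod_cnj mult_1)
 next
  assume s: "\<sigma> = - 1"
  have "\<exists>h\<in>HH. q.nrm h <= nrm g \<and> (\<forall>i\<in>I. q h (K i) = cnj (ip (w (\<i> * of_real (- i))) g))"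
  proof (rule q.riesz_family)
   show "cmod (\<Sum>(c, i)\<leftarrow>xs. c * ip (w (\<i> * of_real (- i))) g) <= nrm g * q.nrm (\<Sum>(c, i)\<leftarrow>xs. c *\<^sub>C K i)"
    if xs: "snd ` set xs \<subseteq> I" for xs
   proof -
    define u where "u xs = (\<Sum>(c, i)\<leftarrow>xs. c *\<^sub>C w (\<i> * complex_of_real (- i)))" for xs
    have uC: "u [] = 0" "u ((c, i) # xs) = c *\<^sub>C w (\<i> * of_real (- i)) + u xs" for c i xs by (simp_all add: u_def)
    have uH: "u xs \<in> H" if "snd ` set xs \<subseteq> I" for xs
     using that by (induction xs) (auto simp: uC wI simp del: of_real_minus)
    have "(\<Sum>(c, i)\<leftarrow>xs. c * ip (w (\<i> * of_real (- i))) g) = ip (u xs) g"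
     using xs by (induction xs) (auto simp: uC uH wI g simp del: of_real_minus)
    moreover have "q.nrm (\<Sum>(c, i)\<leftarrow>xs. c *\<^sub>C K i) = nrm (u xs)" unfolding u_def
     using gram_lists[where k = K and \<xi> = "\<lambda>i. w (\<i> * of_real (- i))" and I = I,
       OF q.hilbert_space_axioms hilbert_space_axioms K(1) wI(2) gram(2) xs] .
    ultimately show ?thesis using cauchy_schwarz[OF uH[OF xs] g] by (simp add: mult.commute)
   qed
  qed (use K g in auto)
  then obtain h where h: "h \<in> HH" "q.nrm h <= nrm g" "!!i. i \<in> I ==> q h (K i) = cnj (ip (w (\<i> * of_real (- i))) g)" by blast
  have "cmod (h (\<i> * of_real y)) = cmod (ip g (w (\<i> * of_real (\<sigma> * y))))" if y: "y \<in> I" for y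
   using h(3)[OF y] K(2)[OF y h(1)] herm[OF wI(2)[OF y] g] s by simp
  thus ?thesis using h by blast
 qed
 have "set_integrable lborel {0<..<1} (\<lambda>y. (cmod (ip g (w (\<i> * of_real (\<sigma> * y)))))\<^sup>2 / Im (m (\<i> * of_real y))) \<and>
  (LINT y:{0<..<1}|lborel. (cmod (ip g (w (\<i> * of_real (\<sigma> * y)))))\<^sup>2 / Im (m (\<i> * of_real y))) <= C\<^sup>2 * (nrm g)\<^sup>2"
  if g: "g \<in> H" and s: "\<sigma> = 1 \<or> \<sigma> = - 1" for g \<sigma>
 proof -
  define f where "f y = (cmod (ip g (w (\<i> * of_real (\<sigma> * y)))))\<^sup>2 / Im (m (\<i> * of_real y))" for y
  obtain h where h: "h \<in> HH" "q.nrm h <= nrm g"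
   "!!y. y \<in> I ==> cmod (h (\<i> * of_real y)) = cmod (ip g (w (\<i> * of_real (\<sigma> * y))))" using ex[OF g s] by blast
  define f' where "f' y = (cmod (h (\<i> * of_real y)))\<^sup>2 * B0_weight m y" for y
  have ff: "indicator {0<..<1} y *\<^sub>R f y = indicator {0<..<1} y *\<^sub>R f' y" for y
   using h(3)[of y] by (auto simp: indicator_def f_def f'_def I_def B0_weight_def)
  have Cf: "set_integrable lborel {0<..<1} f'" "sqrt (LINT y:{0<..<1}|lborel. f' y) <= C * q.nrm h"
   using C[OF h(1)] unfolding f'_def by blast+
  have pos: "0 <= (LINT y:{0<..<1}|lborel. f' y)"
   unfolding set_lebesgue_integral_def
  proof (rule Bochner_Integration.integral_nonneg)
   fix y
   have "0 <= Im (m (\<i> * of_real y))" if "0 < y" using m_Im[of "\<i> * of_real y"] that by simp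
   thus "0 <= indicator {0<..<1} y *\<^sub>R f' y" by (auto simp: indicator_def f'_def B0_weight_def)
  qed
  have "(LINT y:{0<..<1}|lborel. f' y) = (sqrt (LINT y:{0<..<1}|lborel. f' y))\<^sup>2" using pos by simp
  also have "... <= (C * q.nrm h)\<^sup>2" using Cf(2) pos by (intro power_mono) auto
  also have "... <= C\<^sup>2 * (nrm g)\<^sup>2" unfolding power_mult_distrib
   using h(1,2) by (intro mult_left_mono power_mono) auto
  finally have "(LINT y:{0<..<1}|lborel. f' y) <= C\<^sup>2 * (nrm g)\<^sup>2" .
  thus ?thesis using Cf(1) unfolding f_def[symmetric] set_integrable_def set_lebesgue_integral_def ff by blast
 qed
 thus ?thesis by (intro exI[of _ "C\<^sup>2"]) auto
qed

lemma not_integrable_inverse: "\<not> set_integrable lborel {0<..<1::real} (\<lambda>y. 1 / y)"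
proof
 assume i: "set_integrable lborel {0<..<1::real} (\<lambda>y. 1 / y)"
 define B where "B = (LINT y:{0<..<1::real}|lborel. 1 / y)"
 have "- ln e <= B" if e: "0 < e" "e < 1" for e
 proof -
  have "(LINT y:{e..<1}|lborel. 1 / y) <= B"
   unfolding B_def set_lebesgue_integral_def
  proof (rule integral_mono)
   show "integrable lborel (\<lambda>y. indicator {e..<1} y *\<^sub>R (1 / y))"
    using set_integrable_subset[OF i, of "{e..<1}"] e by (force simp: set_integrable_def)
   show "integrable lborel (\<lambda>y::real. indicator {0<..<1} y *\<^sub>R (1 / y))" using i by (simp add: set_integrable_def)
  qed (use e in \<open>auto simp: indicator_def\<close>)
  moreover have "(LINT y:{e..1}|lborel. 1 / y) = ln 1 - ln e"
   unfolding set_lebesgue_integral_def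
   using integral_FTC_Icc_nonneg[of "\<lambda>y. 1 / y" e 1 ln] DERIV_ln_divide e by (simp add: mult.commute)
  moreover have "(LINT y:{e..1}|lborel. 1 / y) = (LINT y:{e..<1}|lborel. 1 / y)"
   unfolding set_lebesgue_integral_def
   by (rule integral_cong_AE) (use AE_lborel_singleton[of 1] in \<open>auto simp: indicator_def elim!: eventually_mono\<close>)
  ultimately show ?thesis by simp
 qed
 moreover have "- (\<bar>B\<bar> + 1) < 0" by linarith
 ultimately have "\<bar>B\<bar> + 1 <= B" by (metis exp_gt_zero exp_less_one_iff ln_exp minus_minus)
 thus False by linarith
qed

text \<open>Otherwise \<open>weyl_below\<close>, together with Im m(iy) = y |w(iy)|^2, would make
  the integrand of \<open>B0_bound\<close> at x at least a positive multiple of 1 / y, which is not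
  integrable at 0.\<close>

lemma B0_kernel:
 assumes B: "B0_property m" and x: "(x, 0) \<in> T"
 shows "(x, 0) \<in> S"
proof (rule ccontr)
 assume "(x, 0) \<notin> S"
 then obtain C where C: "C > 0" "!!y. 0 < y ==> y < 1 ==> nrm (w (\<i> * of_real y)) <= C * cmod (ip (w (\<i> * of_real y)) x)"
  using weyl_below[OF x] by blast
 have xH: "x \<in> H" using x by auto
 define f where "f y = (cmod (ip x (w (\<i> * of_real (1 * y)))))\<^sup>2 / Im (m (\<i> * of_real y))" for y
 have fi: "set_integrable lborel {0<..<1} f" unfolding f_def using B0_bound[OF B] xH by blast
 have fb: "1 / y <= C\<^sup>2 * f y" if y: "0 < y" "y < 1" for y
 proof -
  define z where "z = \<i> * complex_of_real y"
  have z: "Im z ~= 0" "Im z = y" using y by (simp_all add: z_def)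
  have "(nrm (w z))\<^sup>2 <= (C * cmod (ip x (w z)))\<^sup>2"
   using C(2)[OF y] herm[of "w z" x] xH z by (intro power_mono) (auto simp: z_def)
  moreover have "0 < (nrm (w z))\<^sup>2" using w_pos[OF z(1)] by simp
  ultimately have "1 <= C\<^sup>2 * (cmod (ip x (w z)))\<^sup>2 / (nrm (w z))\<^sup>2" by (simp add: power_mult_distrib)
  hence "1 / y <= C\<^sup>2 * (cmod (ip x (w z)))\<^sup>2 / (nrm (w z))\<^sup>2 / y" using y by (intro divide_right_mono) auto
  thus ?thesis using m_Im[OF z(1)] by (simp add: f_def z_def[symmetric] z(2) mult.commute)
 qed
 have "set_integrable lborel {0<..<1::real} (\<lambda>y. 1 / y)"
  unfolding set_integrable_def
 proof (rule Bochner_Integration.integrable_bound)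
  show "integrable lborel (\<lambda>y. indicator {0<..<1} y *\<^sub>R (C\<^sup>2 * f y))"
   using fi integrable_mult_right[of "C\<^sup>2" lborel "\<lambda>y. indicator {0<..<1} y *\<^sub>R f y"]
   by (simp add: set_integrable_def mult.left_commute)
  show "(\<lambda>y::real. indicator {0<..<1} y *\<^sub>R (1 / y)) \<in> borel_measurable lborel" by simp
  have "norm (indicator {0<..<1} y *\<^sub>R (1 / y)) <= norm (indicator {0<..<1} y *\<^sub>R (C\<^sup>2 * f y))" for y
   using fb[of y] by (auto simp: indicator_def)
  thus "AE y in lborel. norm (indicator {0<..<1} y *\<^sub>R (1 / y)) <= norm (indicator {0<..<1} y *\<^sub>R (C\<^sup>2 * f y))" by simp
 qed
 thus False using not_integrable_inverse by blast
qed

end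

text \<open>Surjectivity of the boundary map: by Green's identity Im (cnj (G0 f) * G1 f) equals Im z
  times the squared norm of f for a defect vector f at z. It has opposite signs at i and -i, so the
  boundary values of the two defect vectors are linearly independent.\<close>

lemma (in hilbert_space) boundary_of_triple:
 assumes S: "symmetric_in H ip S" and defect: "defect_numbers_1_1 H ip S" and tri: "boundary_triple H ip S G0 G1"
 shows "boundary H ip S (adjoint_in H ip S) G0 G1"
proof -
 define T where "T = adjoint_in H ip S"
 have T_op: "operator_in H T" unfolding T_def by (rule adjoint_operator[OF S])
 have lin: "clinear_on (Domain T) G0" "clinear_on (Domain T) G1"
  and ker: "{f \<in> Domain T. G0 f = 0 \<and> G1 f = 0} = Domain S"
  and green: "!!f f' g g'. (f, f') \<in> T ==> (g, g') \<in> T ==>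
   ip f' g - ip f g' = cnj (G0 g) * G1 f - cnj (G1 g) * G0 f"
  using tri unfolding boundary_triple_def T_def[symmetric] Let_def by blast+
 have defv: "\<exists>v. (v, z *\<^sub>C v) \<in> T \<and> v ~= 0" if d: "cdim (eigenspace T z) = 1" for z
 proof (rule ccontr)
  assume "\<not> ?thesis"
  hence "eigenspace T z \<subseteq> cspan {}" by (auto simp: eigenspace_def)
  hence "cdim (eigenspace T z) <= card ({} :: 'a set)" by (rule complex_vector.dim_le_card) simp
  thus False using d by simp
 qed
 obtain p q where p: "(p, \<i> *\<^sub>C p) \<in> T" "p ~= 0" and q: "(q, (- \<i>) *\<^sub>C q) \<in> T" "q ~= 0"
  using defv[of \<i>] defv[of "- \<i>"] defect unfolding defect_numbers_1_1_def T_def[symmetric] by blast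
 have Im_eq: "Im (cnj (G0 f) * G1 f) = Im z * (nrm f)\<^sup>2" if f: "(f, z *\<^sub>C f) \<in> T" for f z
 proof -
  have fH: "f \<in> H" using op_mem(1)[OF T_op f] .
  have "(z - cnj z) * of_real ((nrm f)\<^sup>2) = cnj (G0 f) * G1 f - cnj (G1 f) * G0 f"
   using green[OF f f] fH by (simp add: self_eq left_diff_distrib)
  hence "Im ((z - cnj z) * of_real ((nrm f)\<^sup>2)) = Im (cnj (G0 f) * G1 f - cnj (G1 f) * G0 f)" by (rule arg_cong)
  thus ?thesis by (simp add: algebra_simps)
 qed
 define a0 a1 b0 b1 where "a0 = G0 p" and "a1 = G1 p" and "b0 = G0 q" and "b1 = G1 q"
 have "p \<in> H" "q \<in> H" using op_mem(1)[OF T_op] p q by blast+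
 hence a: "0 < Im (cnj a0 * a1)" and b: "Im (cnj b0 * b1) < 0"
  using Im_eq[OF p(1)] Im_eq[OF q(1)] p q by (simp_all add: a0_def a1_def b0_def b1_def)
 define D where "D = a0 * b1 - a1 * b0"
 have D: "D ~= 0"
 proof
  assume "D = 0"
  have n: "a0 ~= 0" "b0 ~= 0" using a b by auto
  define k where "k = a1 / a0"
  have k: "a1 = k * a0" "b1 = k * b0" using \<open>D = 0\<close> n by (simp_all add: k_def D_def field_simps)
  have *: "Im (cnj c * (k * c)) = (cmod c)\<^sup>2 * Im k" for c
  proof -
   have "cnj c * (k * c) = k * of_real ((cmod c)\<^sup>2)" using complex_norm_square[of c] by (simp add: mult_ac)
   hence "Im (cnj c * (k * c)) = Im (k * of_real ((cmod c)\<^sup>2))" by (rule arg_cong)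
   thus ?thesis by (simp only: times_complex.simps Im_complex_of_real Re_complex_of_real) simp
  qed
  have "0 < (cmod a0)\<^sup>2 * Im k" "(cmod b0)\<^sup>2 * Im k < 0" using a b unfolding k * by auto
  thus False by (simp add: zero_less_mult_iff mult_less_0_iff)
 qed
 have onto: "\<exists>f\<in>Domain T. G0 f = c \<and> G1 f = d" for c d
 proof -
  define \<alpha> \<beta> where "\<alpha> = (c * b1 - d * b0) / D" and "\<beta> = (d * a0 - c * a1) / D"
  have "(\<alpha> *\<^sub>C p + \<beta> *\<^sub>C q, \<alpha> *\<^sub>C \<i> *\<^sub>C p + \<beta> *\<^sub>C (- \<i>) *\<^sub>C q) \<in> T"
   by (intro op_add[OF T_op] op_scale[OF T_op] p q)
  moreover have dm: "p \<in> Domain T" "q \<in> Domain T" "\<alpha> *\<^sub>C p \<in> Domain T" "\<beta> *\<^sub>C q \<in> Domain T"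
   using p q op_scale[OF T_op] by blast+
  have "G0 (\<alpha> *\<^sub>C p + \<beta> *\<^sub>C q) = \<alpha> * a0 + \<beta> * b0" "G1 (\<alpha> *\<^sub>C p + \<beta> *\<^sub>C q) = \<alpha> * a1 + \<beta> * b1"
   using lin dm unfolding clinear_on_def scaleC_complex_def a0_def a1_def b0_def b1_def by metis+
  moreover have "\<alpha> * a0 + \<beta> * b0 = c" "\<alpha> * a1 + \<beta> * b1 = d"
  proof -
   have "(c * b1 - d * b0) * a0 + (d * a0 - c * a1) * b0 = c * D"
    "(c * b1 - d * b0) * a1 + (d * a0 - c * a1) * b1 = d * D" by (simp_all add: D_def algebra_simps)
   thus "\<alpha> * a0 + \<beta> * b0 = c" "\<alpha> * a1 + \<beta> * b1 = d" using D by (simp_all add: \<alpha>_def \<beta>_def field_simps)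
  qed
  ultimately show ?thesis by (metis DomainI)
 qed
 show ?thesis unfolding T_def[symmetric]
 proof
  show "symmetric_in H ip S" "T = adjoint_in H ip S" by (simp_all add: S T_def)
  have ST: "S \<subseteq> T" using S by (simp add: symmetric_in_def T_def)
  show "(f, f') \<in> S" if f: "(f, f') \<in> T" "G0 f = 0" "G1 f = 0" for f f'
  proof -
   have "f \<in> Domain S" using ker f by blast
   then obtain f'' where "(f, f'') \<in> S" by blast
   thus ?thesis using op_unique[OF T_op f(1)] ST by blast
  qed
  show "G0 f = 0 \<and> G1 f = 0" if "(f, f') \<in> S" for f f' using ker that by blast
  show "\<exists>f\<in>Domain T. G0 f = c \<and> G1 f = d" for c d by (rule onto)
 qed (use lin green in auto)
qed

section \<open>Partially fundamentally reducible operators\<close>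

locale krein_decomposition =
 fixes form :: "'a::complex_vector => 'a => complex" and Kp Km :: "'a set"
 assumes form_hermitian: "hermitian_form_on UNIV form" and decomposition: "fundamental_decomposition form Kp Km"
begin

definition nform :: "'a => 'a => complex" where "nform x y = - form x y"
abbreviation "P \<equiv> proj_along Kp Km"
abbreviation "Q \<equiv> proj_along Km Kp"
abbreviation "ip \<equiv> fundamental_ip form Kp Km"

lemma nform_eq: "(\<lambda>x y. - form x y) = nform" by (simp add: nform_def fun_eq_iff)

lemma form_add: "form (x + y) z = form x z + form y z" "form z (x + y) = form z x + form z y"
 and form_scale: "form (c *\<^sub>C x) z = c * form x z" "form z (c *\<^sub>C x) = cnj c * form z x"
 and form_herm: "form y x = cnj (form x y)"
proof -
 have h: "form (x + y) z = form x z + form y z" "form (c *\<^sub>C x) y = c * form x y" "form y x = cnj (form x y)" for x y z c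
  using form_hermitian unfolding hermitian_form_on_def by blast+
 show "form (x + y) z = form x z + form y z" "form (c *\<^sub>C x) z = c * form x z" "form y x = cnj (form x y)" by (rule h)+
 show "form z (x + y) = form z x + form z y" using h(1,3) by (metis complex_cnj_add)
 show "form z (c *\<^sub>C x) = cnj c * form z x" using h(2,3) by (metis complex_cnj_mult)
qed

lemma form_diff: "form (x - y) z = form x z - form y z" "form z (x - y) = form z x - form z y"
 and form_minus: "form (- x) z = - form x z" "form z (- x) = - form z x"
 and form_0 [simp]: "form 0 z = 0" "form z 0 = 0"
 using form_add(1)[of x "(-1) *\<^sub>C y" z] form_add(2)[of z x "(-1) *\<^sub>C y"] form_scale(1)[of "-1" y z] form_scale(1)[of "-1" x z]
  form_scale(2)[of z "-1" y] form_scale(2)[of z "-1" x] form_scale(1)[of 0 0 z] form_scale(2)[of z 0 0] by simp_all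

lemma hilbert_pm: "hilbert_space Kp form" "hilbert_space Km nform"
 using decomposition by (simp_all add: fundamental_decomposition_def hilbert_space_def nform_eq)

sublocale p: hilbert_space Kp form by (rule hilbert_pm)
sublocale n: hilbert_space Km nform by (rule hilbert_pm)

lemma orth: assumes "x \<in> Kp" "y \<in> Km" shows "form x y = 0" "form y x = 0"
proof -
 show "form x y = 0" using decomposition assms by (simp add: fundamental_decomposition_def)
 thus "form y x = 0" using form_herm[of y x] by simp
qed

lemma proj_unique: assumes "a \<in> Kp" "b \<in> Km" shows "P (a + b) = a" "Q (a + b) = b"
proof -
 have 0: "Kp \<inter> Km = {0}" using decomposition by (simp add: fundamental_decomposition_def)
 show "P (a + b) = a" unfolding proj_along_def
 proof (rule the_equality)
  fix c assume c: "c \<in> Kp \<and> a + b - c \<in> Km"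
  have "a - c = (a + b - c) - b" by simp
  hence "a - c \<in> Kp \<inter> Km" using c assms by (metis IntI n.diff_mem p.diff_mem)
  thus "c = a" using 0 by simp
 qed (use assms in simp)
 show "Q (a + b) = b" unfolding proj_along_def
 proof (rule the_equality)
  fix c assume c: "c \<in> Km \<and> a + b - c \<in> Kp"
  have "b - c = (a + b - c) - a" by simp
  hence "b - c \<in> Kp \<inter> Km" using c assms by (metis IntI n.diff_mem p.diff_mem)
  thus "c = b" using 0 by simp
 qed (use assms in simp)
qed

lemma proj_mem [simp]: "P x \<in> Kp" "Q x \<in> Km" and proj_sum: "x = P x + Q x"
proof -
 have "\<exists>a\<in>Kp. \<exists>b\<in>Km. x = a + b" using decomposition by (simp add: fundamental_decomposition_def)
 then obtain a b where "a \<in> Kp" "b \<in> Km" "x = a + b" by blast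
 thus "P x \<in> Kp" "Q x \<in> Km" "x = P x + Q x" using proj_unique by auto
qed

lemma proj_add: "P (x + y) = P x + P y" "Q (x + y) = Q x + Q y"
proof -
 have "(P x + P y) + (Q x + Q y) = (P x + Q x) + (P y + Q y)" by (simp add: algebra_simps)
 hence "x + y = (P x + P y) + (Q x + Q y)" unfolding proj_sum[symmetric] by simp
 thus "P (x + y) = P x + P y" "Q (x + y) = Q x + Q y"
  using proj_unique[of "P x + P y" "Q x + Q y"] by (metis n.add_mem p.add_mem proj_mem)+
qed

lemma proj_scale: "P (c *\<^sub>C x) = c *\<^sub>C P x" "Q (c *\<^sub>C x) = c *\<^sub>C Q x"
proof -
 have "c *\<^sub>C x = c *\<^sub>C P x + c *\<^sub>C Q x" using proj_sum[of x] by (metis complex_vector.scale_right_distrib)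
 thus "P (c *\<^sub>C x) = c *\<^sub>C P x" "Q (c *\<^sub>C x) = c *\<^sub>C Q x"
  using proj_unique[of "c *\<^sub>C P x" "c *\<^sub>C Q x"] by (metis n.scale_mem p.scale_mem proj_mem)+
qed

lemma proj_diff: "P (x - y) = P x - P y" "Q (x - y) = Q x - Q y"
 using proj_add[of x "(-1) *\<^sub>C y"] proj_scale[of "-1" y] by simp_all

lemma proj_on: "x \<in> Kp ==> P x = x" "x \<in> Kp ==> Q x = 0" "x \<in> Km ==> P x = 0" "x \<in> Km ==> Q x = x"
 using proj_unique[of x 0] proj_unique[of 0 x] by simp_all

lemma form_split: "form x y = form (P x) (P y) - nform (Q x) (Q y)"
proof -
 have "form x y = form (P x + Q x) (P y + Q y)" using proj_sum[of x] proj_sum[of y] by metis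
 thus ?thesis by (simp add: form_add orth nform_def)
qed

lemma ip_split: "ip x y = form (P x) (P y) + nform (Q x) (Q y)"
proof -
 have "ip x y = form (P x - Q x) (P y + Q y)"
  unfolding fundamental_ip_def fundamental_symmetry_def using proj_sum[of y] by metis
 thus ?thesis by (simp add: form_add form_diff orth nform_def)
qed

lemma nrm_split: "(ip_norm ip x)\<^sup>2 = (p.nrm (P x))\<^sup>2 + (n.nrm (Q x))\<^sup>2"
 and nrm_parts: "p.nrm (P x) <= ip_norm ip x" "n.nrm (Q x) <= ip_norm ip x"
proof -
 have r: "Re (ip x x) = (p.nrm (P x))\<^sup>2 + (n.nrm (Q x))\<^sup>2" by (simp add: ip_split p.nrm_sq n.nrm_sq)
 hence i: "ip_norm ip x = sqrt ((p.nrm (P x))\<^sup>2 + (n.nrm (Q x))\<^sup>2)" by (simp add: ip_norm_def[of ip])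
 thus "(ip_norm ip x)\<^sup>2 = (p.nrm (P x))\<^sup>2 + (n.nrm (Q x))\<^sup>2" by simp
 show "p.nrm (P x) <= ip_norm ip x" "n.nrm (Q x) <= ip_norm ip x"
  unfolding i by (simp_all add: real_le_rsqrt)
qed

lemma hilbert_ip: "hilbert_on UNIV ip"
 unfolding hilbert_on_def
proof (intro conjI allI impI ballI)
 show "hermitian_form_on UNIV ip"
  unfolding hermitian_form_on_def
 proof (intro conjI allI ballI)
  show "ip y x = cnj (ip x y)" for x y
   using p.herm[of "P x" "P y"] n.herm[of "Q x" "Q y"] by (simp add: ip_split)
 qed (simp_all add: ip_split proj_add proj_scale distrib_left)
 show "0 < Re (ip x x)" if x: "x ~= 0" for x
 proof -
  have "P x ~= 0 \<or> Q x ~= 0" using x proj_sum[of x] by auto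
  hence "0 < p.nrm (P x) \<or> 0 < n.nrm (Q x)" using p.nrm_pos n.nrm_pos by auto
  hence "0 < (p.nrm (P x))\<^sup>2 + (n.nrm (Q x))\<^sup>2" by (auto simp: sum_power2_gt_zero_iff)
  thus ?thesis by (simp add: ip_split p.nrm_sq n.nrm_sq)
 qed
 fix \<sigma> :: "nat => 'a" assume c: "\<forall>\<epsilon>>0. \<exists>N. \<forall>m\<ge>N. \<forall>n\<ge>N. ip_norm ip (\<sigma> m - \<sigma> n) < \<epsilon>"
 obtain a where a: "a \<in> Kp" "(\<lambda>n. p.nrm (P (\<sigma> n) - a)) \<longlonglongrightarrow> 0"
 proof (rule p.complete[of "\<lambda>n. P (\<sigma> n)"])
  show "\<exists>N. \<forall>m\<ge>N. \<forall>n\<ge>N. p.nrm (P (\<sigma> m) - P (\<sigma> n)) < \<epsilon>" if "\<epsilon> > 0" for \<epsilon>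
   using c that nrm_parts(1) unfolding proj_diff[symmetric] by (meson le_less_trans)
 qed auto
 obtain b where b: "b \<in> Km" "(\<lambda>n. n.nrm (Q (\<sigma> n) - b)) \<longlonglongrightarrow> 0"
 proof (rule n.complete[of "\<lambda>n. Q (\<sigma> n)"])
  show "\<exists>N. \<forall>m\<ge>N. \<forall>n\<ge>N. n.nrm (Q (\<sigma> m) - Q (\<sigma> n)) < \<epsilon>" if "\<epsilon> > 0" for \<epsilon>
   using c that nrm_parts(2) unfolding proj_diff[symmetric] by (meson le_less_trans)
 qed auto
 have "ip_norm ip (\<sigma> n - (a + b)) = sqrt ((p.nrm (P (\<sigma> n) - a))\<^sup>2 + (n.nrm (Q (\<sigma> n) - b))\<^sup>2)" for n
  by (simp add: ip_norm_def[of ip] ip_split p.nrm_sq n.nrm_sq proj_diff proj_unique a b del: p.diff_left p.diff_right n.diff_left n.diff_right)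
 moreover have "(\<lambda>n. sqrt ((p.nrm (P (\<sigma> n) - a))\<^sup>2 + (n.nrm (Q (\<sigma> n) - b))\<^sup>2)) \<longlonglongrightarrow> sqrt (0\<^sup>2 + 0\<^sup>2)"
  by (intro tendsto_intros a b)
 ultimately have "(\<lambda>n. ip_norm ip (\<sigma> n - (a + b))) \<longlonglongrightarrow> 0" by simp
 thus "\<exists>l\<in>UNIV. (\<lambda>n. ip_norm ip (\<sigma> n - l)) \<longlonglongrightarrow> 0" by blast
qed simp

definition J :: "'a lop" where "J = Lop (fundamental_symmetry Kp Km)"

lemma J_app: "lapp J x = P x - Q x"
proof -
 have "lapp J = fundamental_symmetry Kp Km" unfolding J_def
  by (rule lapp_Lop) (simp_all add: fundamental_symmetry_def proj_add proj_scale complex_vector.scale_right_diff_distrib)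
 thus ?thesis by (simp add: fundamental_symmetry_def)
qed

lemma J_J: "J * J = 1"
proof (rule lop_eqI)
 fix x
 have "P x - Q x = P x + (- Q x)" by simp
 hence "P (P x - Q x) = P x" "Q (P x - Q x) = - Q x" using proj_unique[of "P x" "- Q x"] by (metis n.minus_mem proj_mem)+
 moreover have "lapp (J * J) x = P (P x - Q x) - Q (P x - Q x)" by (simp only: lapp_mult J_app)
 ultimately have "lapp (J * J) x = P x + Q x" by simp
 thus "lapp (J * J) x = lapp 1 x" using proj_sum[of x] by simp
qed

lemma form_J: "form x y = ip (lapp J x) y"
proof -
 have "lapp J (lapp J x) = x" using J_J by (metis lapp_mult lapp_one)
 thus ?thesis by (simp add: fundamental_ip_def fundamental_symmetry_def J_app[symmetric])
qed

lemma J_sym: "ip (lapp J x) y = ip x (lapp J y)"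
proof -
 have "ip x (lapp J y) = form (lapp J x) (lapp J y)" by (simp add: fundamental_ip_def fundamental_symmetry_def J_app)
 also have "... = form (P x - Q x) (P y - Q y)" by (simp add: J_app)
 also have "... = form (P x) (P y) - nform (Q x) (Q y)" by (simp add: form_diff orth nform_def)
 also have "... = form x y" by (rule form_split[symmetric])
 also have "... = ip (lapp J x) y" by (rule form_J)
 finally show ?thesis by simp
qed

end

locale reducible_operator = krein_decomposition +
 fixes A :: "('a \<times> 'a) set" and \<Gamma>0p \<Gamma>1p \<Gamma>0m \<Gamma>1m :: "'a => complex"
 assumes red: "partially_fundamentally_reducible form Kp Km A"
  and nonneg: "krein_nonnegative form A"
  and triple_plus: "boundary_triple Kp form (part_plus Kp A) \<Gamma>0p \<Gamma>1p"
  and triple_minus: "induced_triple Kp Km A \<Gamma>0p \<Gamma>1p \<Gamma>0m \<Gamma>1m"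
begin

abbreviation "Sp \<equiv> part_plus Kp A"
abbreviation "Sm \<equiv> part_minus Km A"
abbreviation "Tp \<equiv> adjoint_in Kp form Sp"
abbreviation "Tm \<equiv> adjoint_in Km nform Sm"

lemma A_op: "operator_in UNIV A" and A_adj: "A = adjoint_in UNIV form A"
 and Sp_sym: "symmetric_in Kp form Sp" and Sm_sym: "symmetric_in Km nform Sm"
 using red by (simp_all add: partially_fundamentally_reducible_def krein_selfadjoint_def nform_eq)

sublocale bp: boundary Kp form Sp Tp \<Gamma>0p \<Gamma>1p
 using p.boundary_of_triple[OF Sp_sym _ triple_plus] red
 by (simp add: partially_fundamentally_reducible_def)

declare bp.T_mem [simp del] bp.A0.L_mem [simp del]

lemma A_sym: "(f, f') \<in> A ==> (g, g') \<in> A ==> form f' g = form f g'"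
proof -
 assume a: "(f, f') \<in> A" "(g, g') \<in> A"
 have "(g, g') \<in> adjoint_in UNIV form A" using a(2) A_adj by blast
 thus ?thesis using a(1) by (auto simp: adjoint_in_def)
qed

lemma A_I: assumes "!!f f'. (f, f') \<in> A ==> form f' g = form f g'" shows "(g, g') \<in> A"
proof -
 have "(g, g') \<in> adjoint_in UNIV form A" using assms by (auto simp: adjoint_in_def)
 thus ?thesis using A_adj by blast
qed

lemma Sp_iff: "(f, f') \<in> Sp \<longleftrightarrow> (f, f') \<in> A \<and> f \<in> Kp \<and> f' \<in> Kp" by (simp add: part_plus_def)

lemma Sm_iff: "(f, f') \<in> Sm \<longleftrightarrow> (f, - f') \<in> A \<and> f \<in> Km \<and> f' \<in> Km"
 unfolding part_minus_def by (force intro: exI[of _ "- f'"])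

lemma A_plus: assumes f: "(f, f') \<in> A" shows "(P f, P f') \<in> Tp"
proof -
 have "form g' (P f) = form g (P f')" if "(g, g') \<in> Sp" for g g'
 proof -
  have g: "(g, g') \<in> A" "g \<in> Kp" "g' \<in> Kp" using that by (simp_all add: Sp_iff)
  thus ?thesis using A_sym[OF g(1) f] by (simp add: form_split[of g' f] form_split[of g f'] proj_on)
 qed
 thus ?thesis by (auto simp: adjoint_in_def)
qed

lemma A_minus: assumes f: "(f, f') \<in> A" shows "(Q f, - Q f') \<in> Tm"
proof -
 have "nform g' (Q f) = nform g (- Q f')" if "(g, g') \<in> Sm" for g g'
 proof -
  have g: "(g, - g') \<in> A" "g \<in> Km" "g' \<in> Km" using that by (simp_all add: Sm_iff)
  have "form (- g') f = form g f'" by (rule A_sym[OF g(1) f])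
  thus ?thesis using g by (simp add: form_split[of "- g'" f] form_split[of g f'] proj_on)
 qed
 thus ?thesis by (auto simp: adjoint_in_def)
qed

lemma induced: "(f, f') \<in> A ==> \<Gamma>0m (Q f) = \<Gamma>0p (P f)" "(f, f') \<in> A ==> \<Gamma>1m (Q f) = - \<Gamma>1p (P f)"
 using triple_minus unfolding induced_triple_def by blast+

text \<open>A vector of \<open>dom(S\<^sub>+\<^sup>*)\<close> whose boundary values annihilate those of \<open>P\<^sub>+ dom(A)\<close> lies in \<open>dom(A\<^sup>*) = dom(A)\<close>.\<close>

lemma annihilator:
 assumes e: "(e, e') \<in> Tp" and g: "g \<in> Km" "g' \<in> Km"
  and an: "!!f f'. (f, f') \<in> A ==>
   form (P f') e - form (P f) e' = nform (Q f') g + nform (Q f) g'"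
 shows "(e + g, e' - g') \<in> A"
proof (rule A_I)
 fix f f' assume f: "(f, f') \<in> A"
 have H: "e \<in> Kp" "e' \<in> Kp" "- g' \<in> Km" using op_mem[OF bp.T_op e] g by auto
 have "P (e + g) = e" "Q (e + g) = g" "P (e' + - g') = e'" "Q (e' + - g') = - g'"
  using proj_unique[OF H(1) g(1)] proj_unique[OF H(2,3)] by auto
 hence "form f' (e + g) = form (P f') e - nform (Q f') g" "form f (e' - g') = form (P f) e' + nform (Q f) g'"
  using form_split[of f' "e + g"] form_split[of f "e' - g'"] g by simp_all
 thus "form f' (e + g) = form f (e' - g')" using an[OF f] by (simp add: algebra_simps)
qed

lemma green_A:
 assumes f: "(f, f') \<in> A" and e: "(e, e') \<in> Tp"
 shows "form (P f') e - form (P f) e' = cnj (\<Gamma>0p e) * \<Gamma>1p (P f) - cnj (\<Gamma>1p e) * \<Gamma>0p (P f)"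
 by (rule bp.green[OF A_plus[OF f] e])

lemma A_onto: "\<exists>f f'. (f, f') \<in> A \<and> \<Gamma>0p (P f) = a \<and> \<Gamma>1p (P f) = b"
proof -
 define V where "V = {(\<Gamma>0p (P f), \<Gamma>1p (P f)) | f f'. (f, f') \<in> A}"
 have add: "(a + c, b + d) \<in> V" if "(a, b) \<in> V" "(c, d) \<in> V" for a b c d
 proof -
  obtain f f' g g' where fg: "(f, f') \<in> A" "(g, g') \<in> A" "a = \<Gamma>0p (P f)" "b = \<Gamma>1p (P f)" "c = \<Gamma>0p (P g)" "d = \<Gamma>1p (P g)"
   using \<open>(a, b) \<in> V\<close> \<open>(c, d) \<in> V\<close> unfolding V_def by blast
  have "(f + g, f' + g') \<in> A" by (rule op_add[OF A_op fg(1,2)])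
  moreover have "\<Gamma>0p (P (f + g)) = a + c" "\<Gamma>1p (P (f + g)) = b + d"
   using bp.G_add[OF A_plus[OF fg(1)] A_plus[OF fg(2)]] fg by (simp_all add: proj_add)
  ultimately show ?thesis unfolding V_def by (intro CollectI exI[of _ "f + g"] exI[of _ "f' + g'"]) simp
 qed
 have scale: "(k * a, k * b) \<in> V" if "(a, b) \<in> V" for k a b
 proof -
  obtain f f' where f: "(f, f') \<in> A" "a = \<Gamma>0p (P f)" "b = \<Gamma>1p (P f)" using \<open>(a, b) \<in> V\<close> unfolding V_def by blast
  have "(k *\<^sub>C f, k *\<^sub>C f') \<in> A" by (rule op_scale[OF A_op f(1)])
  moreover have "\<Gamma>0p (P (k *\<^sub>C f)) = k * a" "\<Gamma>1p (P (k *\<^sub>C f)) = k * b"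
   using bp.G_scale[OF A_plus[OF f(1)]] f by (simp_all add: proj_scale)
  ultimately show ?thesis unfolding V_def by (intro CollectI exI[of _ "k *\<^sub>C f"] exI[of _ "k *\<^sub>C f'"]) simp
 qed
 have nz: "\<exists>a b. (a, b) \<in> V \<and> c * a + d * b ~= 0" if cd: "c ~= 0 \<or> d ~= 0" for c d
 proof (rule ccontr)
  assume "\<not> ?thesis"
  hence z: "!!a b. (a, b) \<in> V ==> c * a + d * b = 0" by blast
  obtain e e' where e: "(e, e') \<in> Tp" "\<Gamma>0p e = cnj d" "\<Gamma>1p e = - cnj c" using bp.onto[of "cnj d" "- cnj c"] by blast
  have "(e + 0, e' - 0) \<in> A"
  proof (rule annihilator[OF e(1)])
   fix f f' assume f: "(f, f') \<in> A"
   hence "(\<Gamma>0p (P f), \<Gamma>1p (P f)) \<in> V" unfolding V_def by blast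
   from z[OF this] show "form (P f') e - form (P f) e' = nform (Q f') 0 + nform (Q f) 0"
    using green_A[OF f e(1)] e by (simp add: add.commute)
  qed auto
  hence "(e, e') \<in> Sp" using op_mem[OF bp.T_op e(1)] by (simp add: Sp_iff)
  hence "\<Gamma>0p e = 0 \<and> \<Gamma>1p e = 0" by (rule bp.ker')
  thus False using e cd by auto
 qed
 obtain a1 b1 where v1: "(a1, b1) \<in> V" "a1 ~= 0" using nz[of 1 0] by auto
 obtain a2 b2 where v2: "(a2, b2) \<in> V" "- b1 * a2 + a1 * b2 ~= 0" using nz[of "- b1" a1] v1 by auto
 define D where "D = a1 * b2 - b1 * a2"
 have D: "D ~= 0" using v2 by (simp add: D_def)
 define k l where "k = (a * b2 - b * a2) / D" and "l = (b * a1 - a * b1) / D"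
 have "(k * a1 + l * a2, k * b1 + l * b2) \<in> V" by (intro add scale v1 v2)
 moreover have "k * a1 + l * a2 = a" "k * b1 + l * b2 = b"
 proof -
  have "(a * b2 - b * a2) * a1 + (b * a1 - a * b1) * a2 = a * D" "(a * b2 - b * a2) * b1 + (b * a1 - a * b1) * b2 = b * D"
   by (simp_all add: D_def algebra_simps)
  thus "k * a1 + l * a2 = a" "k * b1 + l * b2 = b" using D by (simp_all add: k_def l_def field_simps)
 qed
 ultimately have "(a, b) \<in> V" by simp
 thus ?thesis unfolding V_def by blast
qed

lemma Tm_ex: assumes g: "(g, g') \<in> Tm" shows "\<exists>f f'. (f, f') \<in> A \<and> Q f = g \<and> Q f' = - g'"
proof -
 have gK: "g \<in> Km" "g' \<in> Km" using g by (simp_all add: adjoint_in_def)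
 define om where "om f f' = nform (- Q f') g - nform (Q f) g'" for f f'
 have om_0: "om f f' = 0" if f: "(f, f') \<in> A" "\<Gamma>0p (P f) = 0" "\<Gamma>1p (P f) = 0" for f f'
 proof -
  have s: "(P f, P f') \<in> Sp" by (rule bp.ker[OF A_plus[OF f(1)] f(2,3)])
  hence "(f - P f, f' - P f') \<in> A" using op_diff[OF A_op f(1)] by (simp add: Sp_iff)
  moreover have "f - P f = Q f" "f' - P f' = Q f'" using proj_sum[of f] proj_sum[of f'] by (metis add_diff_cancel_left')+
  ultimately have "(Q f, - Q f') \<in> Sm" by (simp add: Sm_iff)
  thus ?thesis using g by (auto simp: adjoint_in_def om_def)
 qed
 obtain f0 f0' where f0: "(f0, f0') \<in> A" "\<Gamma>0p (P f0) = 1" "\<Gamma>1p (P f0) = 0" using A_onto by blast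
 obtain f1 f1' where f1: "(f1, f1') \<in> A" "\<Gamma>0p (P f1) = 0" "\<Gamma>1p (P f1) = 1" using A_onto by blast
 have om_lin: "om f f' = \<Gamma>0p (P f) * om f0 f0' + \<Gamma>1p (P f) * om f1 f1'" if f: "(f, f') \<in> A" for f f'
 proof -
  define a b where "a = \<Gamma>0p (P f)" and "b = \<Gamma>1p (P f)"
  have k: "(f - (a *\<^sub>C f0 + b *\<^sub>C f1), f' - (a *\<^sub>C f0' + b *\<^sub>C f1')) \<in> A"
   by (intro op_diff[OF A_op] op_add[OF A_op] op_scale[OF A_op] f f0 f1)
  have c: "(a *\<^sub>C P f0 + b *\<^sub>C P f1, a *\<^sub>C P f0' + b *\<^sub>C P f1') \<in> Tp"
   by (intro op_add[OF bp.T_op] op_scale[OF bp.T_op] A_plus f0 f1)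
  have c0: "(a *\<^sub>C P f0, a *\<^sub>C P f0') \<in> Tp" "(b *\<^sub>C P f1, b *\<^sub>C P f1') \<in> Tp"
   by (intro op_scale[OF bp.T_op] A_plus f0 f1)+
  have "\<Gamma>0p (P f - (a *\<^sub>C P f0 + b *\<^sub>C P f1)) = 0" "\<Gamma>1p (P f - (a *\<^sub>C P f0 + b *\<^sub>C P f1)) = 0"
   using bp.G_diff[OF A_plus[OF f] c] bp.G_add[OF c0] bp.G_scale[OF A_plus[OF f0(1)]] bp.G_scale[OF A_plus[OF f1(1)]] f0 f1
   by (simp_all add: a_def b_def)
  hence "om (f - (a *\<^sub>C f0 + b *\<^sub>C f1)) (f' - (a *\<^sub>C f0' + b *\<^sub>C f1')) = 0"
   by (intro om_0[OF k]) (simp_all add: proj_diff proj_add proj_scale)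
  thus ?thesis using gK by (simp add: om_def proj_diff proj_add proj_scale a_def b_def algebra_simps)
 qed
 obtain e e' where e: "(e, e') \<in> Tp" "\<Gamma>0p e = - cnj (om f1 f1')" "\<Gamma>1p e = cnj (om f0 f0')"
  using bp.onto[of "- cnj (om f1 f1')" "cnj (om f0 f0')"] by blast
 have "(e + g, e' - g') \<in> A"
 proof (rule annihilator[OF e(1) gK])
  fix f f' assume f: "(f, f') \<in> A"
  have "form (P f') e - form (P f) e' = - om f f'"
   unfolding om_lin[OF f] green_A[OF f e(1)] e by (simp add: algebra_simps)
  also have "... = nform (Q f') g + nform (Q f) g'" using gK by (simp add: om_def)
  finally show "form (P f') e - form (P f) e' = nform (Q f') g + nform (Q f) g'" .
 qed
 moreover have "Q (e + g) = g" "Q (e' + - g') = - g'"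
  using proj_unique(2)[of e g] proj_unique(2)[of e' "- g'"] op_mem[OF bp.T_op e(1)] gK by auto
 ultimately show ?thesis by (intro exI[of _ "e + g"] exI[of _ "e' - g'"]) simp
qed

text \<open>By \<open>Tm_ex\<close> every g in the domain of \<open>Tm\<close> is Q f with f in
  dom(A), so its boundary data are those of P f. Green's identity on K_- is the symmetry of A minus
  Green's identity on K_+.\<close>

sublocale bm: boundary Km nform Sm Tm \<Gamma>0m \<Gamma>1m
proof
 show "symmetric_in Km nform Sm" by (rule Sm_sym)
 have Tm_op: "operator_in Km Tm" by (rule n.adjoint_operator[OF Sm_sym])
 have ex: "\<exists>f f'. (f, f') \<in> A \<and> Q f = g \<and> Q f' = - g' \<and> \<Gamma>0m g = \<Gamma>0p (P f) \<and> \<Gamma>1m g = - \<Gamma>1p (P f)"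
  if g: "(g, g') \<in> Tm" for g g' using Tm_ex[OF g] induced by blast
 have lin: "\<Gamma>0m (g + h) = \<Gamma>0m g + \<Gamma>0m h \<and> \<Gamma>1m (g + h) = \<Gamma>1m g + \<Gamma>1m h"
  if gh: "g \<in> Domain Tm" "h \<in> Domain Tm" for g h
 proof -
  obtain g' h' where "(g, g') \<in> Tm" "(h, h') \<in> Tm" using gh by blast
  then obtain a a' b b' where a: "(a, a') \<in> A" "Q a = g" and b: "(b, b') \<in> A" "Q b = h" using Tm_ex by metis
  have s: "(a + b, a' + b') \<in> A" by (rule op_add[OF A_op a(1) b(1)])
  show ?thesis using induced[OF s] induced[OF a(1)] induced[OF b(1)] bp.G_add[OF A_plus[OF a(1)] A_plus[OF b(1)]] a b
   by (simp add: proj_add)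
 qed
 have sca: "\<Gamma>0m (c *\<^sub>C g) = c *\<^sub>C \<Gamma>0m g \<and> \<Gamma>1m (c *\<^sub>C g) = c *\<^sub>C \<Gamma>1m g" if gT: "g \<in> Domain Tm" for c g
 proof -
  obtain g' where "(g, g') \<in> Tm" using gT by blast
  then obtain a a' where a: "(a, a') \<in> A" "Q a = g" using Tm_ex by metis
  have s: "(c *\<^sub>C a, c *\<^sub>C a') \<in> A" by (rule op_scale[OF A_op a(1)])
  show ?thesis using induced[OF s] induced[OF a(1)] bp.G_scale[OF A_plus[OF a(1)]] a
   by (simp add: proj_scale scaleC_complex_def)
 qed
 show "clinear_on (Domain Tm) \<Gamma>0m" "clinear_on (Domain Tm) \<Gamma>1m"
  unfolding clinear_on_def using lin sca by blast+
 show "(g, g') \<in> Sm" if g: "(g, g') \<in> Tm" "\<Gamma>0m g = 0" "\<Gamma>1m g = 0" for g g'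
 proof -
  obtain f f' where f: "(f, f') \<in> A" "Q f = g" "Q f' = - g'" "\<Gamma>0p (P f) = 0" "\<Gamma>1p (P f) = 0"
   using ex[OF g(1)] g by auto
  have "(P f, P f') \<in> Sp" by (rule bp.ker[OF A_plus[OF f(1)] f(4,5)])
  hence "(f - P f, f' - P f') \<in> A" using op_diff[OF A_op f(1)] by (simp add: Sp_iff)
  moreover have "f - P f = g" "f' - P f' = - g'" using proj_sum[of f] proj_sum[of f'] f by (metis add_diff_cancel_left')+
  ultimately show ?thesis using op_mem[OF Tm_op g(1)] by (simp add: Sm_iff)
 qed
 show "\<Gamma>0m g = 0 \<and> \<Gamma>1m g = 0" if "(g, g') \<in> Sm" for g g'
 proof -
  have g: "(g, - g') \<in> A" "g \<in> Km" using that by (simp_all add: Sm_iff)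
  have "\<Gamma>0p 0 = 0" "\<Gamma>1p 0 = 0" using bp.G_scale[OF op_zero[OF bp.T_op], of 0] by simp_all
  thus ?thesis using induced[OF g(1)] g(2) by (simp add: proj_on)
 qed
 show "nform g' h - nform g h' = cnj (\<Gamma>0m h) * \<Gamma>1m g - cnj (\<Gamma>1m h) * \<Gamma>0m g"
  if g: "(g, g') \<in> Tm" and h: "(h, h') \<in> Tm" for g g' h h'
 proof -
  obtain a a' where a: "(a, a') \<in> A" "Q a = g" "Q a' = - g'" "\<Gamma>0m g = \<Gamma>0p (P a)" "\<Gamma>1m g = - \<Gamma>1p (P a)" using ex[OF g] by blast
  obtain b b' where b: "(b, b') \<in> A" "Q b = h" "Q b' = - h'" "\<Gamma>0m h = \<Gamma>0p (P b)" "\<Gamma>1m h = - \<Gamma>1p (P b)" using ex[OF h] by blast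
  have m: "g' \<in> Km" "h' \<in> Km" "g \<in> Km" "h \<in> Km" using op_mem[OF Tm_op g] op_mem[OF Tm_op h] by auto
  have "form a' b = form a b'" by (rule A_sym[OF a(1) b(1)])
  hence "form (P a') (P b) + nform g' h = form (P a) (P b') + nform g h'"
   using m by (simp add: form_split[of a' b] form_split[of a b'] a b)
  hence "nform g' h - nform g h' = - (form (P a') (P b) - form (P a) (P b'))" by (simp add: algebra_simps)
  also have "... = - (cnj (\<Gamma>0p (P b)) * \<Gamma>1p (P a) - cnj (\<Gamma>1p (P b)) * \<Gamma>0p (P a))"
   using green_A[OF a(1) A_plus[OF b(1)]] by simp
  finally show ?thesis by (simp add: a b)
 qed
 show "\<exists>g\<in>Domain Tm. \<Gamma>0m g = a \<and> \<Gamma>1m g = b" for a b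
 proof -
  obtain f f' where f: "(f, f') \<in> A" "\<Gamma>0p (P f) = a" "\<Gamma>1p (P f) = - b" using A_onto by blast
  have "Q f \<in> Domain Tm" using A_minus[OF f(1)] by blast
  thus ?thesis using induced[OF f(1)] f by (intro bexI[of _ "Q f"]) auto
 qed
qed simp

declare bm.T_mem [simp del] bm.A0.L_mem [simp del]

text \<open>Under the coupling conditions Green's identities on K_+ and K_- cancel against every
  element of A, so (f, f') belongs to the Krein space adjoint of A, which is A.\<close>

lemma A_iff:
 assumes p: "(P f, P f') \<in> Tp" and q: "(Q f, - Q f') \<in> Tm" and b: "\<Gamma>0m (Q f) = \<Gamma>0p (P f)" "\<Gamma>1m (Q f) = - \<Gamma>1p (P f)"
 shows "(f, f') \<in> A"
proof (rule A_I)
 fix g g' assume g: "(g, g') \<in> A"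
 have 1: "form (P g') (P f) - form (P g) (P f') = cnj (\<Gamma>0p (P f)) * \<Gamma>1p (P g) - cnj (\<Gamma>1p (P f)) * \<Gamma>0p (P g)"
  by (rule green_A[OF g p])
 have "nform (- Q g') (Q f) - nform (Q g) (- Q f') = cnj (\<Gamma>0m (Q f)) * \<Gamma>1m (Q g) - cnj (\<Gamma>1m (Q f)) * \<Gamma>0m (Q g)"
  by (rule bm.green[OF A_minus[OF g] q])
 hence 2: "nform (Q g) (Q f') - nform (Q g') (Q f) = - (cnj (\<Gamma>0p (P f)) * \<Gamma>1p (P g) - cnj (\<Gamma>1p (P f)) * \<Gamma>0p (P g))"
  using b induced[OF g] by simp
 have "form g' f - form g f' = (form (P g') (P f) - form (P g) (P f')) + (nform (Q g) (Q f') - nform (Q g') (Q f))"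
  by (simp add: form_split[of g' f] form_split[of g f'])
 thus "form g' f = form g f'" unfolding 1 2 by simp
qed

text \<open>Cauchy-Schwarz for the nonnegative form [A f, g]: a null vector is orthogonal to
  everything.\<close>

lemma A_semidef: assumes f: "(f, f') \<in> A" "form f' f = 0" and g: "(g, g') \<in> A" shows "form f' g = 0"
proof (rule ccontr)
 define c where "c = form f' g"
 assume "form f' g ~= 0"
 hence c: "c ~= 0" by (simp add: c_def)
 have "0 <= Re (form g' g) + 2 * t * (cmod c)\<^sup>2" for t :: real
 proof -
  define k where "k = of_real t * cnj c"
  have "(k *\<^sub>C f + g, k *\<^sub>C f' + g') \<in> A" by (intro op_add[OF A_op] op_scale[OF A_op] f g)
  hence "0 <= Re (form (k *\<^sub>C f' + g') (k *\<^sub>C f + g))"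
   using nonneg by (auto simp: krein_nonnegative_def complex_nonneg_Reals_iff)
  also have "form (k *\<^sub>C f' + g') (k *\<^sub>C f + g) = k * c + cnj k * form g' f + form g' g"
   using f(2) by (simp add: form_add form_scale c_def)
  also have "form g' f = cnj c" using A_sym[OF g f(1)] form_herm[of g f'] by (simp add: c_def)
  also have "k * c + cnj k * cnj c + form g' g = of_real (2 * t * (cmod c)\<^sup>2) + form g' g"
   using complex_norm_square[of c] by (simp add: k_def mult_ac)
  finally show ?thesis by simp
 qed
 from this[of "- (Re (form g' g) + 1) / (2 * (cmod c)\<^sup>2)"] show False using c by (simp add: field_simps)
qed

text \<open>For nonreal z nonnegativity forces [f, f] = 0. By \<open>A_semidef\<close> z f is then
  orthogonal to dom(A), so (0, z f) lies in A, and A is single valued.\<close>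

lemma no_eigenvector: assumes z: "Im z ~= 0" and f: "(f, z *\<^sub>C f) \<in> A" shows "f = 0"
proof -
 have "form (z *\<^sub>C f) f \<in> \<real>\<^sub>\<ge>\<^sub>0" using nonneg f by (auto simp: krein_nonnegative_def)
 hence "Im (z * form f f) = 0" by (simp add: form_scale complex_nonneg_Reals_iff)
 moreover have "Im (form f f) = 0" using form_herm[of f f] by (metis cnj.simps(2) neg_equal_zero)
 ultimately have "form f f = 0" using z by (simp add: complex_eq_iff)
 hence f0: "form (z *\<^sub>C f) f = 0" by (simp add: form_scale)
 have "(0, z *\<^sub>C f) \<in> A"
 proof (rule A_I)
  fix g g' assume g: "(g, g') \<in> A"
  show "form g' 0 = form g (z *\<^sub>C f)" using A_semidef[OF f f0 g] form_herm[of g "z *\<^sub>C f"] by simp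
 qed
 hence "z *\<^sub>C f = 0" using op_unique[OF A_op _ op_zero[OF A_op]] by blast
 thus ?thesis using z by auto
qed

text \<open>Ingredients of Krein's formula for the coupling of S_+ and - S_-; the minus sign
  accounts for the argument - z on K_-. \<open>W z\<close> is a defect vector whose two values of
  \<Gamma>0 agree, \<open>M z\<close> measures its failure to satisfy the condition on \<Gamma>1,
  and for nonreal z \<open>ell z h\<close> is [h, W (cnj z)].\<close>

definition "W z = bp.w z + bm.w (- z)"
definition "M z = bp.m z + bm.m (- z)"
definition "ell z h = form (P h) (bp.w (cnj z)) - nform (Q h) (bm.w (- cnj z))"

lemma W_proj: "Im z ~= 0 ==> P (W z) = bp.w z" "Im z ~= 0 ==> Q (W z) = bm.w (- z)"
 unfolding W_def by (rule proj_unique; simp)+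

text \<open>At a zero of M the vector W z satisfies both coupling conditions, so it would be an
  eigenvector of A at a nonreal point.\<close>

lemma M_nonzero: assumes z: "Im z ~= 0" shows "M z ~= 0"
proof
 assume "M z = 0"
 have z': "Im (- z) ~= 0" using z by simp
 have "(W z, z *\<^sub>C W z) \<in> A"
 proof (rule A_iff)
  show "(P (W z), P (z *\<^sub>C W z)) \<in> Tp" using bp.w(1)[OF z] z by (simp add: W_proj proj_scale)
  show "(Q (W z), - Q (z *\<^sub>C W z)) \<in> Tm" using bm.w(1)[OF z'] z by (simp add: W_proj proj_scale)
  show "\<Gamma>0m (Q (W z)) = \<Gamma>0p (P (W z))" using bp.w(2)[OF z] bm.w(2)[OF z'] z by (simp add: W_proj)
  have "bm.m (- z) = - bp.m z" using \<open>M z = 0\<close> by (simp add: M_def add_eq_0_iff2)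
  thus "\<Gamma>1m (Q (W z)) = - \<Gamma>1p (P (W z))" using z by (simp add: W_proj bp.m_eq bm.m_eq)
 qed
 hence "W z = 0" by (rule no_eigenvector[OF z])
 hence "bp.w z = 0" using W_proj(1)[OF z] proj_on(1)[of 0] by simp
 thus False using bp.w_pos[OF z] by simp
qed

text \<open>The resolvent at z of the uncoupled operator, \<open>bp.A0\<close> on K_+ and -
  \<open>bm.A0\<close> on K_-.\<close>

definition "R0 z h = resolvent bp.A0 z (P h) - resolvent bm.A0 (- z) (Q h)"

lemma R0_proj: assumes "Im z ~= 0"
 shows "P (R0 z h) = resolvent bp.A0 z (P h)" "Q (R0 z h) = - resolvent bm.A0 (- z) (Q h)"
proof -
 have "- resolvent bm.A0 (- z) (Q h) \<in> Km" "resolvent bp.A0 z (P h) \<in> Kp" using assms by simp_all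
 from proj_unique[OF this(2,1)] show "P (R0 z h) = resolvent bp.A0 z (P h)" "Q (R0 z h) = - resolvent bm.A0 (- z) (Q h)"
  by (simp_all add: R0_def)
qed

text \<open>\<open>R0 z h\<close> satisfies the coupling condition on \<Gamma>0, both values being
  0, but not the one on \<Gamma>1. Adding a multiple of \<open>W z\<close> preserves the former, and
  the coefficient is solved from the latter with the help of \<open>G1_resolvent\<close>.\<close>

theorem krein_formula:
 assumes z: "Im z ~= 0"
 shows "(f, h + z *\<^sub>C f) \<in> A \<longleftrightarrow> f = R0 z h - (ell z h / M z) *\<^sub>C W z"
proof -
 define c k where "c = ell z h / M z" and "k = R0 z h - c *\<^sub>C W z"
 have z': "Im (- z) ~= 0" using z by simp
 define a b where "a = resolvent bp.A0 z (P h)" and "b = resolvent bm.A0 (- z) (Q h)"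
 have a: "(a, P h + z *\<^sub>C a) \<in> Tp" "\<Gamma>0p a = 0" using bp.A0.res_mem[OF z, of "P h"] by (auto simp: bp.A0_def a_def)
 have b: "(b, Q h + (- z) *\<^sub>C b) \<in> Tm" "\<Gamma>0m b = 0" using bm.A0.res_mem[OF z', of "Q h"] by (auto simp: bm.A0_def b_def)
 have a1: "\<Gamma>1p a = form (P h) (bp.w (cnj z))" using bp.G1_resolvent[OF z, of "P h"] by (simp add: a_def)
 have b1: "\<Gamma>1m b = nform (Q h) (bm.w (- cnj z))" using bm.G1_resolvent[OF z', of "Q h"] by (simp add: b_def)
 have Pk: "P k = a - c *\<^sub>C bp.w z" using z by (simp add: k_def proj_diff proj_scale R0_proj W_proj a_def)
 have Qk: "Q k = - b - c *\<^sub>C bm.w (- z)" using z by (simp add: k_def proj_diff proj_scale R0_proj W_proj b_def)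
 have cw: "(c *\<^sub>C bp.w z, c *\<^sub>C z *\<^sub>C bp.w z) \<in> Tp" by (rule op_scale[OF bp.T_op bp.w(1)[OF z]])
 have cv: "((-1) *\<^sub>C b, (-1) *\<^sub>C (Q h + (- z) *\<^sub>C b)) \<in> Tm" "(c *\<^sub>C bm.w (- z), c *\<^sub>C (- z) *\<^sub>C bm.w (- z)) \<in> Tm"
  by (rule op_scale[OF bm.T_op b(1)], rule op_scale[OF bm.T_op bm.w(1)[OF z']])
 have kA: "(k, h + z *\<^sub>C k) \<in> A"
 proof (rule A_iff)
  have "(a - c *\<^sub>C bp.w z, (P h + z *\<^sub>C a) - c *\<^sub>C z *\<^sub>C bp.w z) \<in> Tp" by (rule op_diff[OF bp.T_op a(1) cw])
  thus "(P k, P (h + z *\<^sub>C k)) \<in> Tp"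
   by (simp add: proj_add proj_scale Pk complex_vector.scale_right_diff_distrib mult.commute add_diff_eq)
  have "((-1) *\<^sub>C b - c *\<^sub>C bm.w (- z), (-1) *\<^sub>C (Q h + (- z) *\<^sub>C b) - c *\<^sub>C (- z) *\<^sub>C bm.w (- z)) \<in> Tm"
   by (rule op_diff[OF bm.T_op cv])
  moreover have "(-1) *\<^sub>C (Q h + (- z) *\<^sub>C b) - c *\<^sub>C (- z) *\<^sub>C bm.w (- z) = - Q (h + z *\<^sub>C k)"
   by (simp add: proj_add proj_scale Qk complex_vector.scale_right_diff_distrib mult.commute)
  ultimately show "(Q k, - Q (h + z *\<^sub>C k)) \<in> Tm" by (simp add: Qk)
  show "\<Gamma>0m (Q k) = \<Gamma>0p (P k)"
   using bp.G_diff(1)[OF a(1) cw] bp.G_scale(1)[OF bp.w(1)[OF z], of c] bm.G_diff(1)[OF cv] bm.G_scale(1)[OF bm.w(1)[OF z'], of c]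
    bm.G_scale(1)[OF b(1), of "-1"] a(2) b(2) bp.w(2)[OF z] bm.w(2)[OF z'] by (simp add: Pk Qk)
  have "\<Gamma>1p (P k) = form (P h) (bp.w (cnj z)) - c * bp.m z"
   using bp.G_diff(2)[OF a(1) cw] bp.G_scale(2)[OF bp.w(1)[OF z], of c] by (simp add: Pk a1 bp.m_eq)
  moreover have "\<Gamma>1m (Q k) = - nform (Q h) (bm.w (- cnj z)) - c * bm.m (- z)"
   using bm.G_diff(2)[OF cv] bm.G_scale(2)[OF bm.w(1)[OF z'], of c] bm.G_scale(2)[OF b(1), of "-1"]
   by (simp add: Qk b1 bm.m_eq)
  moreover have "c * bp.m z + c * bm.m (- z) = form (P h) (bp.w (cnj z)) - nform (Q h) (bm.w (- cnj z))"
  proof -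
   have "c * M z = ell z h" using M_nonzero[OF z] by (simp add: c_def)
   thus ?thesis by (simp add: M_def ell_def distrib_left)
  qed
  ultimately show "\<Gamma>1m (Q k) = - \<Gamma>1p (P k)" by algebra
 qed
 have "f = k" if f: "(f, h + z *\<^sub>C f) \<in> A"
 proof -
  have "(f - k, (h + z *\<^sub>C f) - (h + z *\<^sub>C k)) \<in> A" by (rule op_diff[OF A_op f kA])
  hence "(f - k, z *\<^sub>C (f - k)) \<in> A" by (simp add: complex_vector.scale_right_diff_distrib)
  hence "f - k = 0" by (rule no_eigenvector[OF z])
  thus ?thesis by simp
 qed
 thus ?thesis using kA unfolding k_def c_def by blast
qed

end

section \<open>Resolvent set and kernel of A\<close>

sublocale krein_decomposition \<subseteq> h: hilbert_ops ip
 by (simp add: hilbert_ops_def hilbert_space_def hilbert_ip)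

context reducible_operator
begin

lemma nrm_le: "h.nrm x <= p.nrm (P x) + n.nrm (Q x)"
proof -
 have "(h.nrm x)\<^sup>2 <= (p.nrm (P x) + n.nrm (Q x))\<^sup>2" unfolding nrm_split power2_sum by simp
 thus ?thesis by (rule power2_le_imp_le) simp
qed

lemma R0_bound: assumes z: "Im z ~= 0" shows "h.nrm (R0 z h) <= 2 * (h.nrm h / \<bar>Im z\<bar>)"
proof -
 have "p.nrm (P (R0 z h)) <= h.nrm h / \<bar>Im z\<bar>"
  using bp.A0.res_bound[OF z, of "P h"] divide_right_mono[OF nrm_parts(1)[of h], of "\<bar>Im z\<bar>"] z
  by (simp add: R0_proj)
 moreover have "n.nrm (Q (R0 z h)) <= h.nrm h / \<bar>Im z\<bar>"
  using bm.A0.res_bound[of "- z" "Q h"] divide_right_mono[OF nrm_parts(2)[of h], of "\<bar>Im z\<bar>"] z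
  by (simp add: R0_proj)
 ultimately show ?thesis using nrm_le[of "R0 z h"] by linarith
qed

lemma A_resolvent: assumes z: "Im z ~= 0" shows "z \<in> resolvent_set_in ip UNIV A"
 unfolding resolvent_set_in_def
proof (intro CollectI conjI ballI)
 show "\<exists>!f. (f, h + z *\<^sub>C f) \<in> A" for h unfolding krein_formula[OF z] by blast
 define C where "C = 2 / \<bar>Im z\<bar> + (p.nrm (bp.w (cnj z)) + n.nrm (bm.w (- cnj z))) / cmod (M z) * h.nrm (W z)"
 have "h.nrm f <= C * h.nrm (f' - z *\<^sub>C f)" if f: "(f, f') \<in> A" for f f'
 proof -
  define h where "h = f' - z *\<^sub>C f"
  have w: "bp.w (cnj z) \<in> Kp" "bm.w (- cnj z) \<in> Km" using z by simp_all
  have "(f, h + z *\<^sub>C f) \<in> A" using f by (simp add: h_def)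
  hence fe: "f = R0 z h - (ell z h / M z) *\<^sub>C W z" unfolding krein_formula[OF z] .
  have "cmod (ell z h) <= cmod (form (P h) (bp.w (cnj z))) + cmod (nform (Q h) (bm.w (- cnj z)))"
   unfolding ell_def by (rule norm_triangle_ineq4)
  also have "... <= p.nrm (P h) * p.nrm (bp.w (cnj z)) + n.nrm (Q h) * n.nrm (bm.w (- cnj z))"
   using w by (intro add_mono p.cauchy_schwarz n.cauchy_schwarz) auto
  also have "... <= h.nrm h * p.nrm (bp.w (cnj z)) + h.nrm h * n.nrm (bm.w (- cnj z))"
   using w by (intro add_mono mult_right_mono nrm_parts) auto
  also have "... = (p.nrm (bp.w (cnj z)) + n.nrm (bm.w (- cnj z))) * h.nrm h" by (simp add: algebra_simps)
  finally have l: "cmod (ell z h) <= (p.nrm (bp.w (cnj z)) + n.nrm (bm.w (- cnj z))) * h.nrm h" .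
  have "h.nrm f <= h.nrm (R0 z h) + h.nrm ((ell z h / M z) *\<^sub>C W z)" unfolding fe by (rule h.nrm_triangle_diff) auto
  also have "h.nrm ((ell z h / M z) *\<^sub>C W z) = cmod (ell z h) / cmod (M z) * h.nrm (W z)" by (simp add: h.nrm_scale norm_divide)
  also have "... <= (p.nrm (bp.w (cnj z)) + n.nrm (bm.w (- cnj z))) * h.nrm h / cmod (M z) * h.nrm (W z)"
   using l by (intro mult_right_mono divide_right_mono) auto
  also have "h.nrm (R0 z h) <= 2 * (h.nrm h / \<bar>Im z\<bar>)" by (rule R0_bound[OF z])
  finally have "h.nrm f <= 2 * (h.nrm h / \<bar>Im z\<bar>) + (p.nrm (bp.w (cnj z)) + n.nrm (bm.w (- cnj z))) * h.nrm h / cmod (M z) * h.nrm (W z)" by simp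
  also have "... = C * h.nrm h" by (simp add: C_def distrib_right)
  finally show ?thesis by (simp add: h_def)
 qed
 thus "\<exists>C. \<forall>(f, f')\<in>A. h.nrm f <= C * h.nrm (f' - z *\<^sub>C f)" by blast
qed

text \<open>The components of a kernel vector are annihilated by the adjoints of S_+ and S_-;
  \<open>B0_kernel\<close> brings them back into S_+ and S_-, which are parts of A and - A.\<close>

lemma kernel_parts:
 assumes B: "B0_property bp.m" "B0_property bm.m" and n: "(n, 0) \<in> A"
 shows "(P n, 0) \<in> A" "(Q n, 0) \<in> A"
proof -
 have 0: "P 0 = 0" "Q 0 = 0" using proj_on[of 0] by simp_all
 have "(P n, 0) \<in> Sp" by (rule bp.B0_kernel[OF B(1)]) (use A_plus[OF n] 0 in simp)
 thus "(P n, 0) \<in> A" by (simp add: Sp_iff)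
 have "(Q n, 0) \<in> Sm" by (rule bm.B0_kernel[OF B(2)]) (use A_minus[OF n] 0 in simp)
 thus "(Q n, 0) \<in> A" by (simp add: Sm_iff)
qed

text \<open>Orthogonality is tested against the components P n and Q n, which belong to ker(A) and
  on which the form is definite.\<close>

lemma kernel_nondegenerate:
 assumes B: "B0_property bp.m" "B0_property bm.m" and n: "(n, 0) \<in> A" and o: "!!k. (k, 0) \<in> A ==> form n k = 0"
 shows "n = 0"
proof -
 have "form n (P n) = form (P n) (P n)" "form n (Q n) = - nform (Q n) (Q n)"
  using form_split[of n "P n"] form_split[of n "Q n"] by (simp_all add: proj_on)
 hence "form (P n) (P n) = 0" "nform (Q n) (Q n) = 0" using o[OF kernel_parts(1)[OF B n]] o[OF kernel_parts(2)[OF B n]] by simp_all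
 hence "P n = 0" "Q n = 0" using p.self_eq[of "P n"] n.self_eq[of "Q n"] by simp_all
 thus ?thesis using proj_sum[of n] by simp
qed

text \<open>For x in ker(A^2) the vector y = A x lies in ker(A) and is orthogonal to it, since
  [A x, k] = [x, A k] = 0; nondegeneracy gives y = 0.\<close>

lemma kernel_square:
 assumes B: "B0_property bp.m" "B0_property bm.m"
 shows "op_ker A = op_ker (A O A)"
proof
 show "op_ker A \<subseteq> op_ker (A O A)" using op_zero[OF A_op] by (auto simp: op_ker_def)
 show "op_ker (A O A) \<subseteq> op_ker A"
 proof
  fix x assume "x \<in> op_ker (A O A)"
  then obtain y where y: "(x, y) \<in> A" "(y, 0) \<in> A" by (auto simp: op_ker_def)
  have "y = 0"
  proof (rule kernel_nondegenerate[OF B y(2)])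
   fix k assume "(k, 0) \<in> A"
   thus "form y k = 0" using A_sym[OF y(1)] by fastforce
  qed
  thus "x \<in> op_ker A" using y by (simp add: op_ker_def)
 qed
qed

end

section \<open>D_0 and regularity at zero\<close>

lemma (in selfadjoint_operator) Re_resolvent_cnj:
 assumes z: "Im z ~= 0" and x: "x \<in> H"
 shows "Re (ip (resolvent L (cnj z) x) x) = Re (ip (resolvent L z x) x)"
proof -
 define u v where "u = resolvent L z x" and "v = resolvent L (cnj z) x"
 have z': "Im (cnj z) ~= 0" using z by simp
 have u: "(u, x + z *\<^sub>C u) \<in> L" "u \<in> H" using res_mem[OF z x] res_H[OF z x] by (simp_all add: u_def)
 have v: "(v, x + cnj z *\<^sub>C v) \<in> L" "v \<in> H" using res_mem[OF z' x] res_H[OF z' x] by (simp_all add: v_def)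
 have "ip (x + z *\<^sub>C u) v = ip u (x + cnj z *\<^sub>C v)" by (rule L_sym[OF u(1) v(1)])
 hence "ip x v = ip u x" using u(2) v(2) x by simp
 thus ?thesis using Re_swap[OF x v(2)] by (simp add: u_def[symmetric] v_def[symmetric])
qed

context reducible_operator
begin

lemma nonneg_krein_A:
 assumes B: "B0_property bp.m" "B0_property bm.m"
 shows "nonneg_krein ip J form A"
proof
 show "J * J = 1" by (rule J_J)
 show "h.sym J" by (simp add: h.sym_def J_sym)
 show "form x y = ip (lapp J x) y" for x y by (rule form_J)
 show "operator_in UNIV A" "A = adjoint_in UNIV form A" "krein_nonnegative form A" by (rule A_op A_adj nonneg)+
 show "z \<in> resolvent_set_in ip UNIV A" if "Im z ~= 0" for z using that by (rule A_resolvent)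
 show "n = 0" if "(n, 0) \<in> A" "!!k. (k, 0) \<in> A ==> form n k = 0" for n
  using kernel_nondegenerate[OF B] that by blast
qed

lemma weyl_values:
 assumes y: "0 < y"
 defines "z \<equiv> \<i> * complex_of_real y"
 shows "(p.nrm (bp.w z))\<^sup>2 = Im (bp.m z) / y" "(p.nrm (bp.w (cnj z)))\<^sup>2 = Im (bp.m z) / y"
  "(n.nrm (bm.w z))\<^sup>2 = Im (bm.m z) / y" "(n.nrm (bm.w (- z)))\<^sup>2 = Im (bm.m z) / y"
  "0 < Im (bp.m z)" "0 < Im (bm.m z)"
proof -
 have z: "Im z = y" "Im z ~= 0" "Im (cnj z) ~= 0" "- z = cnj z" using y by (simp_all add: z_def)
 show "(p.nrm (bp.w z))\<^sup>2 = Im (bp.m z) / y" "(n.nrm (bm.w z))\<^sup>2 = Im (bm.m z) / y"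
  using bp.m_Im[OF z(2)] bm.m_Im[OF z(2)] y by (simp_all add: z(1))
 show "(p.nrm (bp.w (cnj z)))\<^sup>2 = Im (bp.m z) / y" "(n.nrm (bm.w (- z)))\<^sup>2 = Im (bm.m z) / y"
  unfolding z(4) using bp.m_Im[OF z(3)] bm.m_Im[OF z(3)] bp.m_cnj[OF z(2)] bm.m_cnj[OF z(2)] y by (simp_all add: z(1))
 show "0 < Im (bp.m z)" "0 < Im (bm.m z)"
  unfolding bp.m_Im[OF z(2)] bm.m_Im[OF z(2)] z(1) using bp.w_pos[OF z(2)] bm.w_pos[OF z(2)] y
  by (auto intro!: mult_pos_pos zero_less_power)
qed

text \<open>The uncoupled resolvent is bounded by 2 / y, so a bound C / y for the resolvent of A
  bounds the rank-one term of Krein's formula by (C + 2) / y. At a vector where \<open>ell\<close>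
  attains its norm this is the quotient in D_0.\<close>

lemma D0_of_regular:
 assumes B: "B0_property bp.m" "B0_property bm.m" and reg: "Some 0 \<notin> singular_critical_points form ip A"
 shows "D0_property bp.m bm.m"
proof -
 interpret K: nonneg_krein ip J form A by (rule nonneg_krein_A[OF B])
 obtain l M' where "0 < l" "0 <= M'" "K.bounded_near_0 l M'" using K.not_singular_bounded[OF reg] by blast
 then obtain C where C: "!!y x. 0 < y ==> y < 1 ==> h.nrm (lapp (K.R (\<i> * of_real y)) x) <= C / y * h.nrm x"
  using K.resolvent_bound by blast
 have "(Im (bp.m (\<i> * of_real y)) + Im (bm.m (\<i> * of_real y))) / cmod (bp.m (\<i> * of_real y) + bm.m (- \<i> * of_real y)) <= C + 2"
  "bp.m (\<i> * of_real y) + bm.m (- \<i> * of_real y) ~= 0" if y: "0 < y" "y < 1" for y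
 proof -
  define z where "z = \<i> * complex_of_real y"
  note w = weyl_values[OF y(1), folded z_def]
  have z: "Im z = y" "Im z ~= 0" "Im (cnj z) ~= 0" "- cnj z = z" "Im (- z) ~= 0" using y by (simp_all add: z_def)
  have Mz: "M z = bp.m (\<i> * of_real y) + bm.m (- \<i> * of_real y)" by (simp add: M_def z_def)
  show "bp.m (\<i> * of_real y) + bm.m (- \<i> * of_real y) ~= 0" using M_nonzero[OF z(2)] unfolding Mz .
  define s where "s = Im (bp.m z) + Im (bm.m z)"
  have s: "0 < s" using w by (simp add: s_def)
  define N where "N = sqrt (s / y)"
  have N: "0 < N" "N\<^sup>2 = s / y" using s y by (simp_all add: N_def)
  \<comment> \<open>x is J (W (cnj z)), so \<open>ell z x\<close> is the squared norm of W (cnj z).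
    Both x and W z have norm N, because Weyl solutions at conjugate points have equal norms.\<close>
  define x where "x = bp.w (cnj z) + (- bm.w z)"
  have wH: "bp.w (cnj z) \<in> Kp" "- bm.w z \<in> Km" using z by simp_all
  have Px: "P x = bp.w (cnj z)" "Q x = - bm.w z" using proj_unique[OF wH] by (simp_all add: x_def)
  have nW: "h.nrm (W z) = N"
  proof -
   have "(h.nrm (W z))\<^sup>2 = N\<^sup>2" unfolding nrm_split W_proj[OF z(2)] w N(2) s_def by (simp add: add_divide_distrib)
   thus ?thesis by (rule power2_eq_imp_eq) (use N in simp_all)
  qed
  have nx: "h.nrm x = N"
  proof -
   have "(h.nrm x)\<^sup>2 = N\<^sup>2" unfolding nrm_split Px N(2) s_def using w z by (simp add: add_divide_distrib)
   thus ?thesis by (rule power2_eq_imp_eq) (use N in simp_all)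
  qed
  have "ell z x = of_real ((p.nrm (bp.w (cnj z)))\<^sup>2 + (n.nrm (bm.w z))\<^sup>2)"
   unfolding ell_def Px z(4) using p.self_eq[OF wH(1)] n.self_eq[of "bm.w z"] z by simp
  also have "(p.nrm (bp.w (cnj z)))\<^sup>2 + (n.nrm (bm.w z))\<^sup>2 = s / y" unfolding w s_def by (simp add: add_divide_distrib)
  finally have ell: "cmod (ell z x) = s / y" using s y by (simp del: of_real_divide)
  define c where "c = ell z x / M z"
  have R: "lapp (K.R z) x = R0 z x - c *\<^sub>C W z"
   using K.R_mem[OF z(2), of x] unfolding krein_formula[OF z(2)] c_def .
  hence "c *\<^sub>C W z = R0 z x - lapp (K.R z) x" by simp
  hence "cmod c * N = h.nrm (R0 z x - lapp (K.R z) x)" using h.nrm_scale[of "W z" c] nW by simp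
  also have "... <= h.nrm (R0 z x) + h.nrm (lapp (K.R z) x)" by (rule h.nrm_triangle_diff) auto
  also have "... <= 2 * (N / y) + C / y * N"
   using R0_bound[OF z(2), of x] C[OF y, of x] y unfolding nx z(1) z_def[symmetric] by simp
  also have "... = (C + 2) / y * N" by (simp add: add_divide_distrib distrib_right)
  finally have "cmod c <= (C + 2) / y" by (rule mult_right_le_imp_le) (rule N(1))
  moreover have "cmod c = s / y / cmod (M z)" by (simp add: c_def norm_divide ell)
  ultimately have "s / cmod (M z) / y <= (C + 2) / y" by (simp add: mult.commute)
  hence "s / cmod (M z) <= C + 2" unfolding divide_le_cancel using y by simp
  thus "(Im (bp.m (\<i> * of_real y)) + Im (bm.m (\<i> * of_real y))) / cmod (bp.m (\<i> * of_real y) + bm.m (- \<i> * of_real y)) <= C + 2"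
   unfolding s_def Mz by (simp add: z_def)
 qed
 note D = this
 show ?thesis unfolding D0_property_def
 proof (intro conjI ballI boundedI)
  show "bp.m (\<i> * of_real y) + bm.m (- \<i> * of_real y) ~= 0" if "y \<in> {0<..<1}" for y
   by (rule D(2)) (use that in auto)
  fix v assume "v \<in> (\<lambda>y::real. (Im (bp.m (\<i> * of_real y)) + Im (bm.m (\<i> * of_real y)))
        / cmod (bp.m (\<i> * of_real y) + bm.m (- \<i> * of_real y))) ` {0<..<1}"
  then obtain y where y: "0 < y" "y < 1" and v: "v = (Im (bp.m (\<i> * of_real y)) + Im (bm.m (\<i> * of_real y)))
        / cmod (bp.m (\<i> * of_real y) + bm.m (- \<i> * of_real y))" by auto
  have "0 <= v" unfolding v using weyl_values(5,6)[OF y(1)] by (intro divide_nonneg_nonneg) auto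
  moreover have "v <= C + 2" unfolding v by (rule D(1)[OF y])
  ultimately show "norm v <= C + 2" by simp
 qed
qed

text \<open>Krein's formula splits Re [R(iy) x, x] into two self-adjoint parts, which
  \<open>dilation_bound\<close> turns into differences of F, and a rank-one part. D_0 replaces 1 /
  \<bar>M\<bar> by a multiple of 1 / (Im m_+ + Im m_-), which supplies the weights whose integrals
  B_0 controls.\<close>

lemma regular_of_D0:
 assumes B: "B0_property bp.m" "B0_property bm.m" and D0: "D0_property bp.m bm.m"
 shows "Some 0 \<notin> singular_critical_points form ip A"
proof -
 interpret K: nonneg_krein ip J form A by (rule nonneg_krein_A[OF B])
 obtain K0 where K0: "!!y. 0 < y ==> y < 1 ==>
   (Im (bp.m (\<i> * of_real y)) + Im (bm.m (\<i> * of_real y))) / cmod (bp.m (\<i> * of_real y) + bm.m (- \<i> * of_real y)) <= K0"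
  and K0p: "0 < K0"
 proof -
  obtain K1 where K1: "0 < K1" "\<forall>v\<in>(\<lambda>y::real. (Im (bp.m (\<i> * of_real y)) + Im (bm.m (\<i> * of_real y)))
        / cmod (bp.m (\<i> * of_real y) + bm.m (- \<i> * of_real y))) ` {0<..<1}. norm v <= K1"
   using D0 unfolding D0_property_def bounded_pos by blast
  have "(Im (bp.m (\<i> * of_real y)) + Im (bm.m (\<i> * of_real y))) / cmod (bp.m (\<i> * of_real y) + bm.m (- \<i> * of_real y)) <= K1"
   if "0 < y" "y < 1" for y
  proof -
   have "y \<in> {0<..<1}" using that by simp
   from K1(2)[rule_format, OF imageI[OF this]] show ?thesis by (simp only: real_norm_def)
  qed
  thus thesis using that K1(1) by blast
 qed
 obtain Cp where Cp: "0 <= Cp" "!!g \<sigma>. g \<in> Kp ==> \<sigma> = 1 \<or> \<sigma> = - 1 ==>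
  set_integrable lborel {0<..<1} (\<lambda>y. (cmod (form g (bp.w (\<i> * of_real (\<sigma> * y)))))\<^sup>2 / Im (bp.m (\<i> * of_real y))) \<and>
  (LINT y:{0<..<1}|lborel. (cmod (form g (bp.w (\<i> * of_real (\<sigma> * y)))))\<^sup>2 / Im (bp.m (\<i> * of_real y))) <= Cp * (p.nrm g)\<^sup>2"
  using bp.B0_bound[OF B(1)] by blast
 obtain Cm where Cm: "0 <= Cm" "!!g \<sigma>. g \<in> Km ==> \<sigma> = 1 \<or> \<sigma> = - 1 ==>
  set_integrable lborel {0<..<1} (\<lambda>y. (cmod (nform g (bm.w (\<i> * of_real (\<sigma> * y)))))\<^sup>2 / Im (bm.m (\<i> * of_real y))) \<and>
  (LINT y:{0<..<1}|lborel. (cmod (nform g (bm.w (\<i> * of_real (\<sigma> * y)))))\<^sup>2 / Im (bm.m (\<i> * of_real y))) <= Cm * (n.nrm g)\<^sup>2"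
  using bm.B0_bound[OF B(2)] by blast
 \<comment> \<open>9 comes from \<open>dilation_bound\<close>; the four integrals in
   \<open>r\<close> contribute 2 K0 (Cp + Cm).\<close>
 define C where "C = 9 + 2 * K0 * (Cp + Cm)"
 have C: "9 <= C" using K0p Cp Cm by (simp add: C_def)
 have "regular_at_zero ip Es" if S: "spectral_function form ip A Es" for Es
 proof (rule K.regular_of_resolvent_bound[OF S])
  show "0 <= C" using C by simp
  fix x
  obtain Fp where Fp: "!!y. 0 < y ==> \<bar>Fp y\<bar> <= 9 * (p.nrm (P x))\<^sup>2"
   "!!y. 0 < y ==> y * Re (form (resolvent bp.A0 (\<i> * of_real y) (P x)) (P x)) <= Fp y - Fp (2 * y)"
   using bp.A0.dilation_bound[of "P x"] by auto
  obtain Fm where Fm: "!!y. 0 < y ==> \<bar>Fm y\<bar> <= 9 * (n.nrm (Q x))\<^sup>2"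
   "!!y. 0 < y ==> y * Re (nform (resolvent bm.A0 (\<i> * of_real y) (Q x)) (Q x)) <= Fm y - Fm (2 * y)"
   using bm.A0.dilation_bound[of "Q x"] by auto
  define gp where "gp \<sigma> y = (cmod (form (P x) (bp.w (\<i> * of_real (\<sigma> * y)))))\<^sup>2 / Im (bp.m (\<i> * of_real y))" for \<sigma> y
  define gm where "gm \<sigma> y = (cmod (nform (Q x) (bm.w (\<i> * of_real (\<sigma> * y)))))\<^sup>2 / Im (bm.m (\<i> * of_real y))" for \<sigma> y
  have gi: "set_integrable lborel {0<..<1} (gp 1)" "set_integrable lborel {0<..<1} (gp (- 1))"
   "set_integrable lborel {0<..<1} (gm 1)" "set_integrable lborel {0<..<1} (gm (- 1))"
   unfolding gp_def gm_def using Cp(2)[of "P x" 1] Cp(2)[of "P x" "- 1"] Cm(2)[of "Q x" 1] Cm(2)[of "Q x" "- 1"]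
   by simp_all
  have gb: "(LINT y:{0<..<1}|lborel. gp 1 y) <= Cp * (p.nrm (P x))\<^sup>2" "(LINT y:{0<..<1}|lborel. gp (- 1) y) <= Cp * (p.nrm (P x))\<^sup>2"
   "(LINT y:{0<..<1}|lborel. gm 1 y) <= Cm * (n.nrm (Q x))\<^sup>2" "(LINT y:{0<..<1}|lborel. gm (- 1) y) <= Cm * (n.nrm (Q x))\<^sup>2"
   unfolding gp_def gm_def using Cp(2)[of "P x" 1] Cp(2)[of "P x" "- 1"] Cm(2)[of "Q x" 1] Cm(2)[of "Q x" "- 1"]
   by simp_all
  define r where "r y = K0 * ((gp 1 y + gp (- 1) y) + (gm 1 y + gm (- 1) y))" for y
  \<comment> \<open>Division by C compensates for the factor C / y in the criterion.\<close>
  define F where "F y = (Fp y + Fm y) / C" for y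
  have nP: "(p.nrm (P x))\<^sup>2 <= (h.nrm x)\<^sup>2" "(n.nrm (Q x))\<^sup>2 <= (h.nrm x)\<^sup>2" unfolding nrm_split by simp_all
  have "\<bar>F y\<bar> <= C * (h.nrm x)\<^sup>2" if "0 < y" for y
  proof -
   have "\<bar>Fp y + Fm y\<bar> <= 9 * (h.nrm x)\<^sup>2" unfolding nrm_split distrib_left using Fp(1)[OF that] Fm(1)[OF that] by linarith
   also have "... <= C * (C * (h.nrm x)\<^sup>2)"
   proof (rule mult_mono)
    have "1 * (h.nrm x)\<^sup>2 <= C * (h.nrm x)\<^sup>2" using C by (intro mult_right_mono) auto
    thus "(h.nrm x)\<^sup>2 <= C * (h.nrm x)\<^sup>2" by simp
   qed (use C in auto)
   finally show ?thesis using C by (simp add: F_def abs_divide divide_le_eq mult.commute)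
  qed
  moreover have "set_integrable lborel {0<..<1} r"
   unfolding r_def by (intro set_integrable_mult_right set_integral_add(1) gi)
  moreover have "(LINT y:{0<..<1}|lborel. r y) <= C * (h.nrm x)\<^sup>2"
  proof -
   have "(LINT y:{0<..<1}|lborel. r y) = K0 * (((LINT y:{0<..<1}|lborel. gp 1 y) + (LINT y:{0<..<1}|lborel. gp (- 1) y))
     + ((LINT y:{0<..<1}|lborel. gm 1 y) + (LINT y:{0<..<1}|lborel. gm (- 1) y)))"
    unfolding r_def by (simp add: set_integral_add gi)
   also have "... <= K0 * ((Cp * (h.nrm x)\<^sup>2 + Cp * (h.nrm x)\<^sup>2) + (Cm * (h.nrm x)\<^sup>2 + Cm * (h.nrm x)\<^sup>2))"
    using gb mult_left_mono[OF nP(1) Cp(1)] mult_left_mono[OF nP(2) Cm(1)] K0p by (intro mult_left_mono add_mono) linarith+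
   also have "... <= C * (h.nrm x)\<^sup>2" by (simp add: C_def algebra_simps)
   finally show ?thesis .
  qed
  moreover have "0 <= r y" if "0 < y" for y
   using weyl_values(5,6)[OF that] K0p by (simp add: r_def gp_def gm_def)
  moreover have "Re (form (lapp (K.R (\<i> * of_real y)) x) x) <= C / y * (F y - F (2 * y)) + r y" if y: "0 < y" "y < 1" for y
  proof -
   define z where "z = \<i> * complex_of_real y"
   note w = weyl_values[OF y(1), folded z_def]
   have z: "Im z = y" "Im z ~= 0" "- cnj z = z" "Im (- z) ~= 0" "- z = cnj z" "Im (cnj z) ~= 0" using y by (simp_all add: z_def)
   have Mz: "M z = bp.m (\<i> * of_real y) + bm.m (- \<i> * of_real y)" by (simp add: M_def z_def)
   define a b where "a = Im (bp.m z)" and "b = Im (bm.m z)"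
   have ab: "0 < a" "0 < b" using w by (simp_all add: a_def b_def)
   define c where "c = ell z x / M z"
   define A1 A2 B1 B2 where "A1 = cmod (form (P x) (bp.w (cnj z)))" and "A2 = cmod (nform (Q x) (bm.w z))"
    and "B1 = cmod (form (P x) (bp.w z))" and "B2 = cmod (nform (Q x) (bm.w (cnj z)))"
   have ry: "r y = K0 * ((B1\<^sup>2 / a + A1\<^sup>2 / a) + (A2\<^sup>2 / b + B2\<^sup>2 / b))"
    by (simp add: r_def gp_def gm_def A1_def A2_def B1_def B2_def a_def b_def z_def)
   define t where "t = form (bp.w z) (P x) - nform (bm.w (- z)) (Q x)"
   have wH: "bp.w z \<in> Kp" "bm.w (cnj z) \<in> Km" using z by simp_all
   have R: "lapp (K.R z) x = R0 z x - c *\<^sub>C W z"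
    using K.R_mem[OF z(2), of x] unfolding krein_formula[OF z(2)] c_def .
   have mem: "resolvent bp.A0 z (P x) \<in> Kp" "resolvent bm.A0 (- z) (Q x) \<in> Km" "bm.w (- z) \<in> Km" using z by simp_all
   have "form (lapp (K.R z) x) x = form (resolvent bp.A0 z (P x)) (P x) + nform (resolvent bm.A0 (- z) (Q x)) (Q x) - c * t"
    unfolding R form_split[of "R0 z x - c *\<^sub>C W z" x] proj_diff proj_scale R0_proj[OF z(2)] W_proj[OF z(2)]
    using mem wH by (simp add: t_def right_diff_distrib)
   \<comment> \<open>The K_- part is evaluated at - z = cnj z; conjugating the point leaves the real
     part of the form unchanged, so \<open>Fm\<close> applies.\<close>
   moreover have "Re (nform (resolvent bm.A0 (- z) (Q x)) (Q x)) = Re (nform (resolvent bm.A0 z (Q x)) (Q x))"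
    unfolding z(5) by (rule bm.A0.Re_resolvent_cnj[OF z(2)]) simp
   moreover have "- Re (c * t) <= r y"
   proof -
    have "cmod (ell z x) <= A1 + A2" unfolding ell_def z(3) A1_def A2_def by (rule norm_triangle_ineq4)
    moreover have "cmod t <= B1 + B2"
    proof -
     have "cmod (form (bp.w z) (P x)) = B1" "cmod (nform (bm.w (- z)) (Q x)) = B2"
      unfolding B1_def B2_def z(5) using p.herm[of "P x" "bp.w z"] n.herm[of "Q x" "bm.w (cnj z)"] wH by simp_all
     thus ?thesis using norm_triangle_ineq4[of "form (bp.w z) (P x)" "nform (bm.w (- z)) (Q x)"] by (simp add: t_def)
    qed
    ultimately have "cmod (ell z x) * cmod t <= (A1 + A2) * (B1 + B2)" by (intro mult_mono) (auto simp: A1_def A2_def)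
    also have "... <= A1\<^sup>2 + A2\<^sup>2 + B1\<^sup>2 + B2\<^sup>2"
    proof -
     have "0 <= (A1 - B1)\<^sup>2 + (A1 - B2)\<^sup>2 + (A2 - B1)\<^sup>2 + (A2 - B2)\<^sup>2" by simp
     thus ?thesis by (simp add: power2_eq_square algebra_simps)
    qed
    finally have lt: "cmod (ell z x) * cmod t <= A1\<^sup>2 + A2\<^sup>2 + B1\<^sup>2 + B2\<^sup>2" .
    have "M z ~= 0" by (rule M_nonzero[OF z(2)])
    moreover have "(a + b) / cmod (M z) <= K0" using K0[OF y] unfolding Mz a_def b_def by (simp add: z_def)
    ultimately have "a + b <= K0 * cmod (M z)" by (simp add: divide_le_eq)
    hence "1 / cmod (M z) <= K0 / (a + b)" using ab \<open>M z ~= 0\<close> by (simp add: field_simps)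
    have "- Re (c * t) <= cmod (c * t)" using abs_Re_le_cmod[of "c * t"] by linarith
    also have "... = (cmod (ell z x) * cmod t) * (1 / cmod (M z))" by (simp add: c_def norm_mult norm_divide)
    also have "... <= (A1\<^sup>2 + A2\<^sup>2 + B1\<^sup>2 + B2\<^sup>2) * (K0 / (a + b))"
     using lt \<open>1 / cmod (M z) <= K0 / (a + b)\<close> by (intro mult_mono) auto
    also have "... = K0 * ((B1\<^sup>2 / (a + b) + A1\<^sup>2 / (a + b)) + (A2\<^sup>2 / (a + b) + B2\<^sup>2 / (a + b)))"
     by (simp add: add_divide_distrib algebra_simps)
    \<comment> \<open>Each 1 / (a + b) is estimated by 1 / a or 1 / b, according to the space in
      which the inner product is taken.\<close>
    also have "... <= r y" unfolding ry using ab K0p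
     by (intro mult_left_mono add_mono divide_left_mono) auto
    finally show ?thesis .
   qed
   moreover have "Re (form (resolvent bp.A0 z (P x)) (P x)) <= (Fp y - Fp (2 * y)) / y"
    "Re (nform (resolvent bm.A0 z (Q x)) (Q x)) <= (Fm y - Fm (2 * y)) / y"
    using Fp(2)[OF y(1)] Fm(2)[OF y(1)] y by (simp_all add: pos_le_divide_eq mult.commute z_def)
   moreover have "C / y * (F y - F (2 * y)) = (Fp y - Fp (2 * y)) / y + (Fm y - Fm (2 * y)) / y"
    using C y by (simp add: F_def field_simps)
   ultimately show ?thesis by (simp add: z_def[symmetric])
  qed
  ultimately show "\<exists>F r. (\<forall>y>0. \<bar>F y\<bar> <= C * (h.nrm x)\<^sup>2) \<and>
   set_integrable lborel {0<..<1} r \<and> (\<forall>y. 0 < y --> y < 1 --> 0 <= r y) \<and> (LINT y:{0<..<1}|lborel. r y) <= C * (h.nrm x)\<^sup>2 \<and>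
   (\<forall>y. 0 < y --> y < 1 --> Re (form (lapp (K.R (\<i> * of_real y)) x) x) <= C / y * (F y - F (2 * y)) + r y)"
   by (intro exI[of _ F] exI[of _ r]) auto
 qed
 thus ?thesis by (auto simp: singular_critical_points_def)
qed

end

theorem theorem5p8:
  fixes form :: "'a::complex_vector \<Rightarrow> 'a \<Rightarrow> complex"
    and Kp Km :: "'a set"
    and A :: "('a \<times> 'a) set"
    and \<Gamma>0p \<Gamma>1p \<Gamma>0m \<Gamma>1m :: "'a \<Rightarrow> complex"
    and mp mm :: "complex \<Rightarrow> complex"
  assumes krein: "krein_space form"
    and reducible: "partially_fundamentally_reducible form Kp Km A"
    and nonneg: "krein_nonnegative form A"
    and triple_plus: "boundary_triple Kp form (part_plus Kp A) \<Gamma>0p \<Gamma>1p"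
    and triple_minus: "induced_triple Kp Km A \<Gamma>0p \<Gamma>1p \<Gamma>0m \<Gamma>1m"
    and mp_def: "mp = weyl_function (adjoint_plus form Kp A) \<Gamma>0p \<Gamma>1p"
    and mm_def: "mm = weyl_function (adjoint_minus form Km A) \<Gamma>0m \<Gamma>1m"
    and B0_plus: "B0_property mp"
    and B0_minus: "B0_property mm"
  shows "Some 0 \<notin> singular_critical_points form (fundamental_ip form Kp Km) A \<longleftrightarrow>
           op_ker A = op_ker (A O A) \<and> D0_property mp mm"
proof -
  interpret reducible_operator form Kp Km A \<Gamma>0p \<Gamma>1p \<Gamma>0m \<Gamma>1m
  proof
    show "hermitian_form_on UNIV form" using krein by (simp add: krein_space_def)
    show "fundamental_decomposition form Kp Km" using reducible by (simp add: partially_fundamentally_reducible_def)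
  qed (rule reducible nonneg triple_plus triple_minus)+
  have m: "bp.m = mp" "bm.m = mm"
    by (simp_all add: fun_eq_iff bp.m_def bm.m_def mp_def mm_def adjoint_plus_def adjoint_minus_def nform_eq)
  show ?thesis using kernel_square D0_of_regular regular_of_D0 B0_plus B0_minus unfolding m by blast
qed

end
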